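(* For each $d\ge1$ let $r_1(d),\dots,r_d(d)\ge0$ be integers and let $F=F_d$ be equipped with the folded Wiener sheet measure $\mu=\mu_d$ with these smoothness parameters. Then multivariate function approximation $\mathrm{APP}=\{\mathrm{APP}_d\}$ is tractable in $\Lambda^{\rm std}$, its exponent is the same in $\Lambda^{\rm all}$ and $\Lambda^{\rm std}$, and $$p^*(\Lambda^{\rm std})=\Bigl(\tfrac12+\min\{r_j(d):\ j=1,\dots,d,\ d=1,2,\dots\}\Bigr)^{-1}\le 2 .$$ Moreover, any linear multivariate problem $\mathrm{LMP}=\{\mathrm{LMP}_d\}$ which is equipped with the folded Wiener sheet measure (the same $F_d,\mu_d$) and whose continuous linear operators $S=S_d:F_d\to G_d$ satisfy, for every $d$, $\|S(f)\|\le K_1\|f\|_{L_2(D)}$ for all $f\in F_d$ with some $K_1=K_1(d)$, is tractable and has exponent at most $p^*(\Lambda^{\rm std})\le2$.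
   Context: Space and measure. For each $d$, $D=[0,1]^d$; with $r_j=r_j(d)$, $F_d$ is the separable Banach space of functions $f:D\to\mathbb R$, $r_i$ times continuously differentiable with respect to $x_i$ (i.e. with continuous derivatives $f^{(i_1,\dots,i_d)}$, $0\le i_j\le r_j$), which vanish together with these derivatives at all points having at least one component equal to zero; its norm is the sup norm of $f^{(r_1,\dots,r_d)}$. The folded Wiener sheet measure $\mu_d$ is the zero mean Gaussian measure on $F_d$ with covariance kernel $R_\mu(t,x)=\prod_{j=1}^d\int_0^1\frac{(t_j-s)_+^{r_j}}{r_j!}\frac{(x_j-s)_+^{r_j}}{r_j!}\,ds$. Problems. A linear multivariate problem is a sequence $\mathrm{LMP}_d=(F_d,\mu_d,G_d,S_d,\Lambda)$ with $G_d$ a separable Hilbert space, $S_d:F_d\to G_d$ continuous linear, and $\Lambda$ either $\Lambda^{\rm all}=F_d^*$ or $\Lambda^{\rm std}=\{f\mapsto f(x):x\in D\}$. $\mathrm{APP}_d$ is the case $G_d=L_2(D)$, $S_d(f)=f$. Algorithms and complexity. An algorithm is $U(f)=\phi(N(f))$ with $N(f)=[L_1(f),\dots,L_n(f)]$, $L_i\in\Lambda$, where the $L_i$ and $n=n(f)$ may be chosen adaptively on the basis of already computed values, and $\phi:N(F_d)\to G_d$. Its average error is $e^{\rm avg}(U)=(\int_{F_d}\|S_d(f)-U(f)\|^2\mu_d(df))^{1/2}$. Each evaluation of a functional costs $c=c(d)>0$; arithmetic operations and comparisons on reals, additions in $G_d$ and multiplications of elements of $G_d$ by scalars have unit cost.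 The average cost is $\int_{F_d}(\mathrm{cost}(N,f)+n_1(f))\,\mu_d(df)$, where $\mathrm{cost}(N,f)\ge c\,n(f)$ is the cost of computing $N(f)$ and $n_1(f)$ is the number of operations needed to compute $\phi(N(f))$ from $N(f)$. The average case complexity $\mathrm{comp}^{\rm avg}(\varepsilon;d,\Lambda)$ is the infimum of the average costs of all $U$ using $\Lambda$ with $e^{\rm avg}(U)\le\varepsilon$. Tractability. The problem is tractable in $\Lambda$ if there is $p\ge0$ such that for all $d$, $\mathrm{comp}^{\rm avg}(\varepsilon;d,\Lambda)=O(c\,\varepsilon^{-p})$ as $\varepsilon\to0$, with a constant that may depend on $d$; the exponent $p^*(\Lambda)$ is the infimum of such $p$. *)

theory Defs
  imports "HOL-Probability.Probability"
begin

text \<open>Points of \<open>[0,1]^d\<close> are extensional functions on the coordinate set \<open>{1..d}\<close>, so that \<open>d\<close>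
  may range over the naturals inside one formula. The topology on \<open>nat \<Rightarrow> real\<close> is the product
  topology, which on \<open>cube d\<close> is the Euclidean one.\<close>

type_synonym point = "nat \<Rightarrow> real"
type_synonym func = "point \<Rightarrow> real"
type_synonym functional = "func \<Rightarrow> real"

definition cube :: "nat \<Rightarrow> point set" where
  "cube d = (\<Pi>\<^sub>E j\<in>{1..d}. {0..1})"

definition cube_measure :: "nat \<Rightarrow> point measure" where
  "cube_measure d = (\<Pi>\<^sub>M j\<in>{1..d}. restrict_space lborel {0..1})"

definition multi_indices :: "nat \<Rightarrow> (nat \<Rightarrow> nat) \<Rightarrow> (nat \<Rightarrow> nat) set" where
  "multi_indices d r = (\<Pi>\<^sub>E j\<in>{1..d}. {0..r j})"

text \<open>\<open>g a\<close> is the continuous mixed derivative \<open>f^(a)\<close> for every multi-index \<open>a \<le> r\<close>; at the faces of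
  the cube the partial derivatives are one-sided. On \<open>cube d\<close> the family \<open>g\<close> is determined by \<open>f\<close>.\<close>

definition has_mixed_derivs ::
    "nat \<Rightarrow> (nat \<Rightarrow> nat) \<Rightarrow> func \<Rightarrow> ((nat \<Rightarrow> nat) \<Rightarrow> func) \<Rightarrow> bool" where
  "has_mixed_derivs d r f g \<longleftrightarrow>
     (\<forall>x\<in>cube d. g (restrict (\<lambda>_. 0) {1..d}) x = f x) \<and>
     (\<forall>a\<in>multi_indices d r. continuous_on (cube d) (g a)) \<and>
     (\<forall>a\<in>multi_indices d r. \<forall>j\<in>{1..d}. a j < r j \<longrightarrow>
        (\<forall>x\<in>cube d. ((\<lambda>t. g a (x(j := t))) has_real_derivative g (a(j := Suc (a j))) x)
                       (at (x j) within {0..1})))"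

definition mixed_deriv :: "nat \<Rightarrow> (nat \<Rightarrow> nat) \<Rightarrow> func \<Rightarrow> (nat \<Rightarrow> nat) \<Rightarrow> func" where
  "mixed_deriv d r f = (SOME g. has_mixed_derivs d r f g)"

text \<open>A function on the cube is represented by its extension by zero.\<close>

definition F_space :: "nat \<Rightarrow> (nat \<Rightarrow> nat) \<Rightarrow> func set" where
  "F_space d r = {f. (\<forall>x. x \<notin> cube d \<longrightarrow> f x = 0) \<and>
     (\<exists>g. has_mixed_derivs d r f g) \<and>
     (\<forall>a\<in>multi_indices d r. \<forall>x\<in>cube d. (\<exists>j\<in>{1..d}. x j = 0) \<longrightarrow> mixed_deriv d r f a x = 0)}"

definition F_norm :: "nat \<Rightarrow> (nat \<Rightarrow> nat) \<Rightarrow> func \<Rightarrow> real" where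
  "F_norm d r f = (SUP x\<in>cube d. \<bar>mixed_deriv d r f (restrict r {1..d}) x\<bar>)"

definition F_borel :: "nat \<Rightarrow> (nat \<Rightarrow> nat) \<Rightarrow> func measure" where
  "F_borel d r = sigma (F_space d r)
     {U. openin (Metric_space.mtopology (F_space d r) (\<lambda>f g. F_norm d r (\<lambda>x. f x - g x))) U}"

definition F_dual :: "nat \<Rightarrow> (nat \<Rightarrow> nat) \<Rightarrow> functional set" where
  "F_dual d r = {L.
     (\<forall>f\<in>F_space d r. \<forall>g\<in>F_space d r. L (\<lambda>x. f x + g x) = L f + L g) \<and>
     (\<forall>a. \<forall>f\<in>F_space d r. L (\<lambda>x. a * f x) = a * L f) \<and>
     (\<exists>C. \<forall>f\<in>F_space d r. \<bar>L f\<bar> \<le> C * F_norm d r f)}"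

text \<open>\<open>u_+^k / k!\<close>. For \<open>k = 0\<close> this is the indicator of \<open>u > 0\<close>, not the constant \<open>1\<close> that
  \<open>max 0 u ^ 0\<close> would give.\<close>

definition trunc_pow :: "nat \<Rightarrow> real \<Rightarrow> real" where
  "trunc_pow k u = (if u > 0 then u ^ k / fact k else 0)"

definition wiener_kernel :: "nat \<Rightarrow> (nat \<Rightarrow> nat) \<Rightarrow> point \<Rightarrow> point \<Rightarrow> real" where
  "wiener_kernel d r t x =
     (\<Prod>j=1..d. (LINT s:{0..1}|lborel. trunc_pow (r j) (t j - s) * trunc_pow (r j) (x j - s)))"

text \<open>A continuous functional of variance zero is almost surely zero instead of having a density.\<close>

definition centered_gaussian :: "nat \<Rightarrow> (nat \<Rightarrow> nat) \<Rightarrow> func measure \<Rightarrow> bool" where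
  "centered_gaussian d r \<mu> \<longleftrightarrow>
     prob_space \<mu> \<and> space \<mu> = F_space d r \<and> sets \<mu> = sets (F_borel d r) \<and>
     (\<forall>L\<in>F_dual d r. (AE f in \<mu>. L f = 0) \<or>
        (\<exists>\<sigma>>0. distributed \<mu> lborel L (normal_density 0 \<sigma>)))"

definition folded_wiener_sheet :: "nat \<Rightarrow> (nat \<Rightarrow> nat) \<Rightarrow> func measure \<Rightarrow> bool" where
  "folded_wiener_sheet d r \<mu> \<longleftrightarrow>
     centered_gaussian d r \<mu> \<and>
     (\<forall>t\<in>cube d. \<forall>x\<in>cube d. (\<integral>f. f t * f x \<partial>\<mu>) = wiener_kernel d r t x)"

text \<open>The target spaces vary with \<open>d\<close>, hence they are given by a carrier and operations rather than
  by a type class.\<close>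

record 'g hilbert =
  hcarrier :: "'g set"
  hzero :: 'g
  hadd :: "'g \<Rightarrow> 'g \<Rightarrow> 'g"
  hscale :: "real \<Rightarrow> 'g \<Rightarrow> 'g"
  hinner :: "'g \<Rightarrow> 'g \<Rightarrow> real"

definition hnorm :: "'g hilbert \<Rightarrow> 'g \<Rightarrow> real" where
  "hnorm H u = sqrt (hinner H u u)"

definition hdist :: "'g hilbert \<Rightarrow> 'g \<Rightarrow> 'g \<Rightarrow> real" where
  "hdist H u v = hnorm H (hadd H u (hscale H (-1) v))"

locale separable_hilbert_space =
  fixes H :: "'g hilbert"
  assumes zero_closed: "hzero H \<in> hcarrier H"
    and add_closed: "u \<in> hcarrier H \<Longrightarrow> v \<in> hcarrier H \<Longrightarrow> hadd H u v \<in> hcarrier H"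
    and scale_closed: "u \<in> hcarrier H \<Longrightarrow> hscale H a u \<in> hcarrier H"
    and add_assoc: "u \<in> hcarrier H \<Longrightarrow> v \<in> hcarrier H \<Longrightarrow> w \<in> hcarrier H \<Longrightarrow>
      hadd H (hadd H u v) w = hadd H u (hadd H v w)"
    and add_commute: "u \<in> hcarrier H \<Longrightarrow> v \<in> hcarrier H \<Longrightarrow> hadd H u v = hadd H v u"
    and add_zero: "u \<in> hcarrier H \<Longrightarrow> hadd H u (hzero H) = u"
    and add_inverse: "u \<in> hcarrier H \<Longrightarrow> hadd H u (hscale H (-1) u) = hzero H"
    and scale_one: "u \<in> hcarrier H \<Longrightarrow> hscale H 1 u = u"
    and scale_scale: "u \<in> hcarrier H \<Longrightarrow> hscale H a (hscale H b u) = hscale H (a * b) u"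
    and scale_add_left: "u \<in> hcarrier H \<Longrightarrow>
      hscale H (a + b) u = hadd H (hscale H a u) (hscale H b u)"
    and scale_add_right: "u \<in> hcarrier H \<Longrightarrow> v \<in> hcarrier H \<Longrightarrow>
      hscale H a (hadd H u v) = hadd H (hscale H a u) (hscale H a v)"
    and inner_commute: "u \<in> hcarrier H \<Longrightarrow> v \<in> hcarrier H \<Longrightarrow> hinner H u v = hinner H v u"
    and inner_add: "u \<in> hcarrier H \<Longrightarrow> v \<in> hcarrier H \<Longrightarrow> w \<in> hcarrier H \<Longrightarrow>
      hinner H (hadd H u v) w = hinner H u w + hinner H v w"
    and inner_scale: "u \<in> hcarrier H \<Longrightarrow> v \<in> hcarrier H \<Longrightarrow>
      hinner H (hscale H a u) v = a * hinner H u v"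
    and inner_nonneg: "u \<in> hcarrier H \<Longrightarrow> 0 \<le> hinner H u u"
    and inner_eq_zero: "u \<in> hcarrier H \<Longrightarrow> hinner H u u = 0 \<Longrightarrow> u = hzero H"
    and complete: "Metric_space.mcomplete (hcarrier H) (hdist H)"
    and separable: "\<exists>A \<subseteq> hcarrier H. countable A \<and>
      (\<forall>u\<in>hcarrier H. \<forall>e>0. \<exists>v\<in>A. hdist H u v < e)"

definition L2_funs :: "nat \<Rightarrow> func set" where
  "L2_funs d = {f \<in> borel_measurable (cube_measure d). integrable (cube_measure d) (\<lambda>x. (f x)\<^sup>2)}"

definition L2_class :: "nat \<Rightarrow> func \<Rightarrow> func set" where
  "L2_class d f = {g \<in> L2_funs d. AE x in cube_measure d. g x = f x}"

definition L2_rep :: "func set \<Rightarrow> func" where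
  "L2_rep A = (SOME f. f \<in> A)"

definition L2 :: "nat \<Rightarrow> func set hilbert" where
  "L2 d = \<lparr>
     hcarrier = L2_class d ` L2_funs d,
     hzero = L2_class d (\<lambda>_. 0),
     hadd = (\<lambda>A B. L2_class d (\<lambda>x. L2_rep A x + L2_rep B x)),
     hscale = (\<lambda>a A. L2_class d (\<lambda>x. a * L2_rep A x)),
     hinner = (\<lambda>A B. \<integral>x. L2_rep A x * L2_rep B x \<partial>cube_measure d)\<rparr>"

text \<open>Adaptive information: after the values \<open>ys = [y1, ..., yi]\<close> have been computed, \<open>stop ys\<close>
  decides whether to terminate, and otherwise \<open>next_fun ys\<close> is the functional evaluated next.\<close>

record information =
  next_fun :: "real list \<Rightarrow> functional"
  stop :: "real list \<Rightarrow> bool"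

primrec info_values :: "information \<Rightarrow> func \<Rightarrow> nat \<Rightarrow> real list" where
  "info_values N f 0 = []"
| "info_values N f (Suc k) = info_values N f k @ [next_fun N (info_values N f k) f]"

definition terminates :: "information \<Rightarrow> func \<Rightarrow> bool" where
  "terminates N f \<longleftrightarrow> (\<exists>k. stop N (info_values N f k))"

definition cardinality :: "information \<Rightarrow> func \<Rightarrow> nat" where
  "cardinality N f = (LEAST k. stop N (info_values N f k))"

definition info :: "information \<Rightarrow> func \<Rightarrow> real list" where
  "info N f = info_values N f (cardinality N f)"

definition nonadaptive :: "information \<Rightarrow> bool" where
  "nonadaptive N \<longleftrightarrow>
     (\<forall>ys zs. length ys = length zs \<longrightarrow> next_fun N ys = next_fun N zs \<and> stop N ys = stop N zs)"

text \<open>\<open>\<kappa> N f\<close> is the cost of computing \<open>N(f)\<close>: one evaluation costs \<open>c\<close>, and an adaptive choice of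
  functionals may cost extra. How much extra is left open; for nonadaptive information nothing has
  to be chosen.\<close>

definition information_cost :: "func set \<Rightarrow> real \<Rightarrow> (information \<Rightarrow> func \<Rightarrow> real) \<Rightarrow> bool" where
  "information_cost F c \<kappa> \<longleftrightarrow>
     (\<forall>N. (\<forall>f\<in>F. terminates N f) \<longrightarrow>
        (\<forall>f\<in>F. c * real (cardinality N f) \<le> \<kappa> N f \<and>
                 (nonadaptive N \<longrightarrow> \<kappa> N f = c * real (cardinality N f))))"

text \<open>Computation trees over real registers and registers holding elements of the target space.
  Every operation stores its result in a new register. Constants are precomputed and free. The tree
  may be infinite, so unbounded loops are allowed.\<close>

datatype 'a operand = Const 'a | Reg nat

datatype arith_op = Add | Sub | Mult | Div

datatype cmp_op = Less | Leq | Equal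

codatatype 'g program =
    Return "'g operand"
  | Arith arith_op "real operand" "real operand" "'g program"
  | Branch cmp_op "real operand" "real operand" "'g program" "'g program"
  | VAdd "'g operand" "'g operand" "'g program"
  | VScale "real operand" "'g operand" "'g program"

fun fetch :: "'a list \<Rightarrow> 'a operand \<Rightarrow> 'a option" where
  "fetch xs (Const a) = Some a"
| "fetch xs (Reg i) = (if i < length xs then Some (xs ! i) else None)"

fun arith :: "arith_op \<Rightarrow> real \<Rightarrow> real \<Rightarrow> real" where
  "arith Add a b = a + b"
| "arith Sub a b = a - b"
| "arith Mult a b = a * b"
| "arith Div a b = a / b"

fun cmp :: "cmp_op \<Rightarrow> real \<Rightarrow> real \<Rightarrow> bool" where
  "cmp Less a b \<longleftrightarrow> a < b"
| "cmp Leq a b \<longleftrightarrow> a \<le> b"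
| "cmp Equal a b \<longleftrightarrow> a = b"

text \<open>\<open>runs H p xs us v k\<close>: started with registers \<open>xs\<close> and \<open>us\<close>, the program \<open>p\<close> stops after exactly
  \<open>k\<close> unit cost operations and returns \<open>v\<close>.\<close>

inductive runs ::
    "'g hilbert \<Rightarrow> 'g program \<Rightarrow> real list \<Rightarrow> 'g list \<Rightarrow> 'g \<Rightarrow> nat \<Rightarrow> bool" for H where
  run_Return: "fetch us x = Some v \<Longrightarrow> v \<in> hcarrier H \<Longrightarrow> runs H (Return x) xs us v 0"
| run_Arith: "fetch xs x = Some a \<Longrightarrow> fetch xs y = Some b \<Longrightarrow> (opr = Div \<longrightarrow> b \<noteq> 0) \<Longrightarrow>
    runs H p (xs @ [arith opr a b]) us v k \<Longrightarrow> runs H (Arith opr x y p) xs us v (Suc k)"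
| run_Branch: "fetch xs x = Some a \<Longrightarrow> fetch xs y = Some b \<Longrightarrow>
    runs H (if cmp opr a b then p else q) xs us v k \<Longrightarrow> runs H (Branch opr x y p q) xs us v (Suc k)"
| run_VAdd: "fetch us x = Some g \<Longrightarrow> fetch us y = Some h \<Longrightarrow> g \<in> hcarrier H \<Longrightarrow> h \<in> hcarrier H \<Longrightarrow>
    runs H p xs (us @ [hadd H g h]) v k \<Longrightarrow> runs H (VAdd x y p) xs us v (Suc k)"
| run_VScale: "fetch xs x = Some a \<Longrightarrow> fetch us y = Some g \<Longrightarrow> g \<in> hcarrier H \<Longrightarrow>
    runs H p xs (us @ [hscale H a g]) v k \<Longrightarrow> runs H (VScale x y p) xs us v (Suc k)"

text \<open>The problem for one fixed \<open>d\<close>; a linear multivariate problem is a sequence of these.\<close>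

record 'g problem =
  dimension :: nat
  smoothness :: "nat \<Rightarrow> nat"
  meas :: "func measure"
  target :: "'g hilbert"
  solution :: "func \<Rightarrow> 'g"
  eval_cost :: real
  info_cost :: "information \<Rightarrow> func \<Rightarrow> real"

datatype info_class = All | Std

fun class_functionals :: "info_class \<Rightarrow> nat \<Rightarrow> (nat \<Rightarrow> nat) \<Rightarrow> functional set" where
  "class_functionals All d r = F_dual d r"
| "class_functionals Std d r = (\<lambda>x f. f x) ` cube d"

definition continuous_linear_op ::
    "nat \<Rightarrow> (nat \<Rightarrow> nat) \<Rightarrow> 'g hilbert \<Rightarrow> (func \<Rightarrow> 'g) \<Rightarrow> bool" where
  "continuous_linear_op d r H S \<longleftrightarrow>
     (\<forall>f\<in>F_space d r. S f \<in> hcarrier H) \<and>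
     (\<forall>f\<in>F_space d r. \<forall>g\<in>F_space d r. S (\<lambda>x. f x + g x) = hadd H (S f) (S g)) \<and>
     (\<forall>a. \<forall>f\<in>F_space d r. S (\<lambda>x. a * f x) = hscale H a (S f)) \<and>
     (\<exists>C. \<forall>f\<in>F_space d r. hnorm H (S f) \<le> C * F_norm d r f)"

text \<open>An algorithm consists of information \<open>N\<close>, a map \<open>\<phi>\<close>, and a program for \<open>\<phi>\<close>, which may be chosen
  separately for each number of computed values. The same program has to serve for all data of that
  length. \<open>operations\<close> is \<open>\<infinity>\<close> at data at which the program does not compute \<open>\<phi>\<close>.\<close>

type_synonym 'g algorithm = "information \<times> (real list \<Rightarrow> 'g) \<times> (nat \<Rightarrow> 'g program)"

definition operations ::
    "'g hilbert \<Rightarrow> (real list \<Rightarrow> 'g) \<Rightarrow> (nat \<Rightarrow> 'g program) \<Rightarrow> real list \<Rightarrow> ennreal" where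
  "operations H \<phi> prg ys = (INF k\<in>{k. runs H (prg (length ys)) ys [] (\<phi> ys) k}. of_nat k)"

fun sq_error :: "'g problem \<Rightarrow> 'g algorithm \<Rightarrow> func \<Rightarrow> ennreal" where
  "sq_error P (N, \<phi>, prg) f = ennreal ((hdist (target P) (solution P f) (\<phi> (info N f)))\<^sup>2)"

fun total_cost :: "'g problem \<Rightarrow> 'g algorithm \<Rightarrow> func \<Rightarrow> ennreal" where
  "total_cost P (N, \<phi>, prg) f =
     ennreal (info_cost P N f) + operations (target P) \<phi> prg (info N f)"

text \<open>The two measurability conditions make the average error and the average cost meaningful: the
  library integral of a nonmeasurable function is only a lower integral.\<close>

fun is_algorithm :: "'g problem \<Rightarrow> info_class \<Rightarrow> 'g algorithm \<Rightarrow> bool" where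
  "is_algorithm P \<Lambda> (N, \<phi>, prg) \<longleftrightarrow>
     (\<forall>ys. next_fun N ys \<in> class_functionals \<Lambda> (dimension P) (smoothness P)) \<and>
     (\<forall>f\<in>F_space (dimension P) (smoothness P).
        terminates N f \<and> \<phi> (info N f) \<in> hcarrier (target P)) \<and>
     sq_error P (N, \<phi>, prg) \<in> borel_measurable (meas P) \<and>
     total_cost P (N, \<phi>, prg) \<in> borel_measurable (meas P)"

definition avg_error :: "'g problem \<Rightarrow> 'g algorithm \<Rightarrow> ennreal" where
  "avg_error P U = (let I = \<integral>\<^sup>+f. sq_error P U f \<partial>meas P in
     if I = \<infinity> then \<infinity> else ennreal (sqrt (enn2real I)))"

definition avg_cost :: "'g problem \<Rightarrow> 'g algorithm \<Rightarrow> ennreal" where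
  "avg_cost P U = (\<integral>\<^sup>+f. total_cost P U f \<partial>meas P)"

definition comp_avg :: "'g problem \<Rightarrow> info_class \<Rightarrow> real \<Rightarrow> ennreal" where
  "comp_avg P \<Lambda> \<epsilon> = (INF U\<in>{U. is_algorithm P \<Lambda> U \<and> avg_error P U \<le> ennreal \<epsilon>}. avg_cost P U)"

definition tractable_with :: "(nat \<Rightarrow> 'g problem) \<Rightarrow> info_class \<Rightarrow> real \<Rightarrow> bool" where
  "tractable_with P \<Lambda> p \<longleftrightarrow> p \<ge> 0 \<and>
     (\<forall>d\<ge>1. \<exists>C. \<forall>\<^sub>F \<epsilon> in at_right 0.
        comp_avg (P d) \<Lambda> \<epsilon> \<le> ennreal (C * eval_cost (P d) * \<epsilon> powr (- p)))"

definition tractable :: "(nat \<Rightarrow> 'g problem) \<Rightarrow> info_class \<Rightarrow> bool" where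
  "tractable P \<Lambda> \<longleftrightarrow> (\<exists>p. tractable_with P \<Lambda> p)"

definition exponent :: "(nat \<Rightarrow> 'g problem) \<Rightarrow> info_class \<Rightarrow> real" where
  "exponent P \<Lambda> = Inf {p. tractable_with P \<Lambda> p}"

definition LMP ::
    "(nat \<Rightarrow> nat \<Rightarrow> nat) \<Rightarrow> (nat \<Rightarrow> func measure) \<Rightarrow> (nat \<Rightarrow> real) \<Rightarrow>
     (nat \<Rightarrow> information \<Rightarrow> func \<Rightarrow> real) \<Rightarrow> (nat \<Rightarrow> 'g hilbert) \<Rightarrow> (nat \<Rightarrow> func \<Rightarrow> 'g) \<Rightarrow>
     nat \<Rightarrow> 'g problem" where
  "LMP r \<mu> c \<kappa> G S d = \<lparr>dimension = d, smoothness = r d, meas = \<mu> d, target = G d, solution = S d,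
     eval_cost = c d, info_cost = \<kappa> d\<rparr>"

definition APP ::
    "(nat \<Rightarrow> nat \<Rightarrow> nat) \<Rightarrow> (nat \<Rightarrow> func measure) \<Rightarrow> (nat \<Rightarrow> real) \<Rightarrow>
     (nat \<Rightarrow> information \<Rightarrow> func \<Rightarrow> real) \<Rightarrow> nat \<Rightarrow> func set problem" where
  "APP r \<mu> c \<kappa> = LMP r \<mu> c \<kappa> L2 L2_class"

end

theory Submission
  imports Defs
begin

text \<open>Upper bound: in one variable a function of smoothness \<open>m\<close> is sampled at about \<open>2^l\<close> points and
  recovered by piecewise polynomial interpolation, with the indicators of the cells replaced by polynomials
  vanishing to order \<open>m + 1\<close> at \<open>0\<close>, so that the result lies in the space; the mean square error is the
  \<open>L\<^sub>2\<close> error of the kernel sections. Smolyak's sparse grid combination of these approximations attains,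
  up to powers of \<open>q\<close>, error \<open>2^(-(m + 1/2) q)\<close> at cost \<open>2^q\<close>.

  Lower bound: the algorithm's information is ignored. A program that stops after \<open>k\<close> operations has
  at most \<open>2^k\<close> computation paths, and the output of each lies in the span of at most \<open>2 k + 1\<close>
  constants. For \<open>M\<close> much larger than \<open>k\<close>, spline bumps of width \<open>1 / M\<close> give \<open>M\<close> orthonormal functions
  on whose span the sheet is spread with standard deviation at least of order \<open>M^(-(m + 1))\<close> in every
  direction. A Gaussian small ball estimate in the orthogonal complement of each output space, and a
  union bound over the paths, force a mean square error of order \<open>M^(-(2 m + 1))\<close>. This replaces the
  study of conditional measures given adaptive information.\<close>
subsection \<open>Integration over the cube\<close>

text \<open>The two classes meet because the upper bound uses point values, which are continuous
  functionals, while the lower bound holds for arbitrary information. Such a bound is possible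
  because the model charges for producing the output: scalars may depend on the data in any way, but
  elements of the target space enter only as constants of the path taken. The budget
  \<open>A\<close> bounds linearly both the dimension of each output space and the logarithm of the
  number of pairs (number of values, path), whereas small balls have probability exponentially small
  in \<open>M\<close>; so \<open>M\<close> proportional to \<open>A\<close> suffices. With
  \<open>A\<close> of order epsilon^(-p) the resulting error bound reads p (2 m + 1) >= 2. The sheet
  is given only through the laws of single functionals and the covariance of point values. Hence the
  bumps are built as representers of divided differences of point values, and the small ball
  estimate for several functionals is reduced to characteristic functions of single ones. The powers
  of \<open>q\<close> are absorbed by any gap above the exponent, which is an infimum.\<close>

abbreviation unit_measure :: "real measure" where
  "unit_measure \<equiv> restrict_space lborel {0..1}"

lemma prob_space_unit_measure: "prob_space unit_measure"
  by (rule prob_spaceI) (simp add: emeasure_restrict_space space_restrict_space)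

interpretation unit: prob_space unit_measure
  by (rule prob_space_unit_measure)

interpretation units: product_prob_space "\<lambda>_::nat. unit_measure" I for I
  by unfold_locales

lemma prob_space_cube_measure: "prob_space (cube_measure d)"
  unfolding cube_measure_def by (rule prob_space_PiM) (rule prob_space_unit_measure)

interpretation cube: prob_space "cube_measure d" for d
  by (rule prob_space_cube_measure)

lemma space_cube_measure [simp]: "space (cube_measure d) = cube d"
  by (simp add: cube_measure_def cube_def space_PiM space_restrict_space)

lemma integral_unit_measure: "(\<integral>x. f x \<partial>unit_measure) = (LINT x:{0..1}|lborel. f x)" for f :: "real \<Rightarrow> real"
  by (simp add: integral_restrict_space set_lebesgue_integral_def)

lemma integral_abs_le_integral:
  fixes f g :: "'a \<Rightarrow> real"
  assumes "integrable M f" "integrable M g" "\<And>x. x \<in> space M \<Longrightarrow> \<bar>f x\<bar> \<le> g x"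
  shows "\<bar>\<integral>x. f x \<partial>M\<bar> \<le> (\<integral>x. g x \<partial>M)"
  by (rule order_trans[OF integral_abs_bound integral_mono]) (use assms in auto)

lemma measure_cube [simp]: "measure (cube_measure d) (cube d) = 1"
  using cube.prob_space[of d] by simp

lemma measurable_cube_component:
  "j \<in> {1..d} \<Longrightarrow> (\<lambda>x. x j) \<in> borel_measurable (cube_measure d)"
proof -
  assume j: "j \<in> {1..d}"
  have "(\<lambda>x. x j) \<in> measurable (cube_measure d) unit_measure"
    unfolding cube_measure_def by (rule measurable_component_singleton[OF j])
  then have "(\<lambda>x. x j) \<in> measurable (cube_measure d) lborel"
    unfolding measurable_restrict_space2_iff by simp
  then show ?thesis by simp
qed

lemma cubeD: "x \<in> cube d \<Longrightarrow> j \<in> {1..d} \<Longrightarrow> 0 \<le> x j \<and> x j \<le> 1"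
  by (auto simp: cube_def PiE_def Pi_def)

lemma cube_upd: "x \<in> cube d \<Longrightarrow> j \<in> {1..d} \<Longrightarrow> t \<in> {0..1} \<Longrightarrow> x(j := t) \<in> cube d"
  by (auto simp: cube_def PiE_def Pi_def extensional_def)

lemma cube_restrictI: "(\<And>j. j \<in> {1..d} \<Longrightarrow> u j \<in> {0..1}) \<Longrightarrow> restrict u {1..d} \<in> cube d"
  by (auto simp: cube_def)

lemma compact_cube: "compact (cube d)"
proof -
  \<comment> \<open>An extensional function has the single value \<open>undefined\<close> outside
    \<open>{1..d}\<close>, so the cube is a product of compact sets over all indices and Tychonoff's
    theorem applies.\<close>
  have eq: "cube d = PiE UNIV (\<lambda>j. if j \<in> {1..d} then {0..1} else {undefined})"
    by (auto simp: cube_def PiE_def Pi_def extensional_def split: if_splits)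
  have "compactin (product_topology (\<lambda>_. euclidean) UNIV)
      (PiE UNIV (\<lambda>j. if j \<in> {1..d} then {0..1::real} else {undefined}))"
    by (rule compactin_PiE[THEN iffD2]) auto
  then show ?thesis
    unfolding eq euclidean_product_topology by simp
qed

lemma tendsto_pointwise_fun:
  fixes X :: "nat \<Rightarrow> point"
  assumes "\<And>j. (\<lambda>n. X n j) \<longlonglongrightarrow> x j"
  shows "X \<longlonglongrightarrow> x"
proof -
  have "limitin (product_topology (\<lambda>_. euclidean) UNIV) X x sequentially"
    unfolding limitin_componentwise using assms by simp
  then show ?thesis by (simp add: euclidean_product_topology)
qed

text \<open>Rounding down to the grid of mesh \<open>1/(n+1)\<close> makes every function on the cube measurable after
  composition, which yields measurability of continuous functions in the limit.\<close>

definition grid :: "nat \<Rightarrow> nat \<Rightarrow> point \<Rightarrow> point" where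
  "grid d n x = (\<lambda>j\<in>{1..d}. real_of_int \<lfloor>real (Suc n) * x j\<rfloor> / real (Suc n))"

lemma floor_div_unit:
  assumes "0 \<le> x" "x \<le> 1"
  shows "real_of_int \<lfloor>real (Suc n) * x\<rfloor> / real (Suc n) \<in> {0..1}"
proof -
  have "real_of_int \<lfloor>real (Suc n) * x\<rfloor> \<le> real (Suc n)"
    using assms by (smt (verit) mult_left_le of_int_floor_le of_nat_0_le_iff)
  then show ?thesis using assms by (auto simp: field_simps)
qed

lemma grid_in_cube: "x \<in> cube d \<Longrightarrow> grid d n x \<in> cube d"
  unfolding grid_def by (intro cube_restrictI floor_div_unit) (auto dest: cubeD)

lemma grid_range: "grid d n ` cube d \<subseteq> (\<Pi>\<^sub>E j\<in>{1..d}. \<rat> \<inter> {0..1})"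
  using grid_in_cube[of _ d n] by (auto simp: grid_def cube_def PiE_iff)

lemma countable_grid_range: "countable (grid d n ` cube d)"
  by (rule countable_subset[OF grid_range], rule countable_PiE) (auto intro: countable_Int1 countable_rat)

lemma grid_tendsto: "x \<in> cube d \<Longrightarrow> (\<lambda>n. grid d n x) \<longlonglongrightarrow> x"
proof (rule tendsto_pointwise_fun)
  fix j assume x: "x \<in> cube d"
  show "(\<lambda>n. grid d n x j) \<longlonglongrightarrow> x j"
  proof (cases "j \<in> {1..d}")
    case True
    have "\<bar>grid d n x j - x j\<bar> \<le> 1 / real (Suc n)" for n
    proof -
      have "\<bar>real_of_int \<lfloor>real (Suc n) * x j\<rfloor> - real (Suc n) * x j\<bar> \<le> 1" by linarith
      moreover have "grid d n x j - x j
          = (real_of_int \<lfloor>real (Suc n) * x j\<rfloor> - real (Suc n) * x j) / real (Suc n)"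
        using True by (simp add: grid_def diff_divide_distrib del: of_nat_Suc)
      ultimately show ?thesis
        by (simp add: abs_divide divide_le_cancel del: of_nat_Suc)
    qed
    moreover have "(\<lambda>n. 1 / real (Suc n)) \<longlonglongrightarrow> 0"
      using LIMSEQ_inverse_real_of_nat by (simp add: inverse_eq_divide)
    ultimately have "(\<lambda>n. grid d n x j - x j) \<longlonglongrightarrow> 0"
      by (intro Lim_null_comparison[of "\<lambda>n. grid d n x j - x j" "\<lambda>n. 1 / real (Suc n)"]) (auto simp del: of_nat_Suc)
    then show ?thesis by (simp only: Lim_null[symmetric])
  next
    case False
    then show ?thesis using x by (auto simp: grid_def cube_def PiE_iff extensional_def)
  qed
qed

lemma measurable_grid:
  "grid d n \<in> measurable (cube_measure d) (count_space (grid d n ` cube d))"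
proof (rule measurable_count_space_eq_countable[THEN iffD2, OF countable_grid_range], intro conjI ballI)
  show "grid d n \<in> space (cube_measure d) \<rightarrow> grid d n ` cube d" by auto
  fix a assume a: "a \<in> grid d n ` cube d"
  then have aE: "a \<in> extensional {1..d}" by (auto simp: grid_def)
  note measurable_cube_component[measurable]
  have "grid d n -` {a} \<inter> space (cube_measure d) = {x \<in> space (cube_measure d).
      \<forall>j\<in>{1..d}. real_of_int \<lfloor>real (Suc n) * x j\<rfloor> / real (Suc n) = a j}"
    using aE by (auto simp: grid_def restrict_def extensional_def fun_eq_iff)
  also have "\<dots> \<in> sets (cube_measure d)" by measurable
  finally show "grid d n -` {a} \<inter> space (cube_measure d) \<in> sets (cube_measure d)" .
qed

text \<open>Caratheodory functions are jointly measurable: at the rounded point only countably many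
  values of \<open>x\<close> occur, and continuity in \<open>x\<close> removes the rounding in the
  limit. Applied to evaluation on the function space, this is what makes Fubini available.\<close>

lemma measurable_pair_eval:
  assumes cont: "\<And>w. w \<in> space M \<Longrightarrow> continuous_on (cube d) (G w)"
    and meas: "\<And>x. x \<in> cube d \<Longrightarrow> (\<lambda>w. G w x) \<in> borel_measurable M"
  shows "(\<lambda>(w, x). G w x :: real) \<in> borel_measurable (M \<Otimes>\<^sub>M cube_measure d)"
proof (rule borel_measurable_LIMSEQ_real[where u="\<lambda>n (w, x). G w (grid d n x)"])
  fix n
  have "(\<lambda>p. G (fst p) (grid d n (snd p))) \<in> borel_measurable (M \<Otimes>\<^sub>M cube_measure d)"
  proof (rule measurable_compose_countable'[where f="\<lambda>i p. G (fst p) i" and I="grid d n ` cube d"])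
    show "(\<lambda>p. grid d n (snd p)) \<in> M \<Otimes>\<^sub>M cube_measure d \<rightarrow>\<^sub>M count_space (grid d n ` cube d)"
      by (rule measurable_compose[OF measurable_snd measurable_grid])
    show "(\<lambda>p. G (fst p) i) \<in> borel_measurable (M \<Otimes>\<^sub>M cube_measure d)" if "i \<in> grid d n ` cube d" for i
      by (rule measurable_compose[OF measurable_fst meas]) (use that grid_in_cube in auto)
    show "countable (grid d n ` cube d)" by (rule countable_grid_range)
  qed
  then show "(\<lambda>(w, x). G w (grid d n x)) \<in> borel_measurable (M \<Otimes>\<^sub>M cube_measure d)"
    by (simp add: case_prod_beta)
next
  fix p assume p: "p \<in> space (M \<Otimes>\<^sub>M cube_measure d)"
  then have w: "fst p \<in> space M" and x: "snd p \<in> cube d" by (auto simp: space_pair_measure)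
  show "(\<lambda>n. (\<lambda>(w, x). G w (grid d n x)) p) \<longlonglongrightarrow> (\<lambda>(w, x). G w x) p"
    unfolding case_prod_beta
    by (rule continuous_on_tendsto_compose[OF cont[OF w] grid_tendsto[OF x] x])
      (simp add: grid_in_cube x)
qed

lemma measurable_cube_continuous:
  assumes "continuous_on (cube d) (g :: func)"
  shows "g \<in> borel_measurable (cube_measure d)"
proof -
  have "(\<lambda>(w::unit, x). g x) \<in> borel_measurable (count_space {()} \<Otimes>\<^sub>M cube_measure d)"
    by (rule measurable_pair_eval[where M="count_space {()}" and G="\<lambda>_. g"]) (auto simp: assms)
  from measurable_compose[OF measurable_Pair1'[of "()" "count_space {()}"] this] show ?thesis
    by simp
qed

lemma continuous_cube_bounded:
  assumes "continuous_on (cube d) (g :: func)"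
  obtains B where "B \<ge> 0" "\<And>x. x \<in> cube d \<Longrightarrow> \<bar>g x\<bar> \<le> B"
proof -
  have "bounded (g ` cube d)"
    by (rule compact_imp_bounded[OF compact_continuous_image[OF assms compact_cube]])
  then obtain B where "\<forall>y\<in>g ` cube d. norm y \<le> B" unfolding bounded_iff by blast
  then show ?thesis by (intro that[of "max B 0"]) (auto simp: le_max_iff_disj)
qed

lemma continuous_on_point_component: "continuous_on A (\<lambda>x::point. x j)"
  by (rule continuous_on_product_then_coordinatewise) (rule continuous_on_id)

lemma continuous_on_tensor:
  assumes "\<And>j. j \<in> {1..d} \<Longrightarrow> continuous_on {0..1} (\<phi> j)"
  shows "continuous_on (cube d) (\<lambda>x. \<Prod>j=1..d. \<phi> j (x j) :: real)"
proof (rule continuous_on_prod)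
  fix j assume j: "j \<in> {1..d}"
  show "continuous_on (cube d) (\<lambda>x. \<phi> j (x j))"
    by (rule continuous_on_compose2[OF assms[OF j] continuous_on_point_component])
      (use j cubeD in auto)
qed

lemma nn_integral_tensor:
  assumes "\<And>j. j \<in> {1..d} \<Longrightarrow> \<phi> j \<in> borel_measurable unit_measure"
  shows "(\<integral>\<^sup>+x. (\<Prod>j=1..d. \<phi> j (x j)) \<partial>cube_measure d) = (\<Prod>j=1..d. \<integral>\<^sup>+t. \<phi> j t \<partial>unit_measure)"
  unfolding cube_measure_def by (rule units.product_nn_integral_prod) (auto simp: assms)

lemma integral_tensor:
  fixes \<phi> :: "nat \<Rightarrow> real \<Rightarrow> real"
  assumes "\<And>j. j \<in> {1..d} \<Longrightarrow> integrable unit_measure (\<phi> j)"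
  shows "(\<integral>x. (\<Prod>j=1..d. \<phi> j (x j)) \<partial>cube_measure d) = (\<Prod>j=1..d. \<integral>t. \<phi> j t \<partial>unit_measure)"
  unfolding cube_measure_def by (rule units.product_integral_prod) (auto simp: assms)

subsection \<open>The function space\<close>

lemma zero_in_multi_indices: "restrict (\<lambda>_. 0) {1..d} \<in> multi_indices d r"
  by (auto simp: multi_indices_def)

lemma multi_indices_upd:
  "a \<in> multi_indices d r \<Longrightarrow> j \<in> {1..d} \<Longrightarrow> k \<le> r j \<Longrightarrow> a(j := k) \<in> multi_indices d r"
  by (auto simp: multi_indices_def PiE_def Pi_def extensional_def)

text \<open>Induction on the total order: lowering one index gives two functions that agree on a
  whole segment, and one-sided derivatives are unique because every point of \<open>{0..1}\<close>
  is a limit point of it.\<close>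

lemma has_mixed_derivs_unique:
  assumes g: "has_mixed_derivs d r f g" and g': "has_mixed_derivs d r f' g'"
    and ff: "\<And>x. x \<in> cube d \<Longrightarrow> f x = f' x"
    and "a \<in> multi_indices d r" "x \<in> cube d"
  shows "g a x = g' a x"
  using assms(4,5)
proof (induction "\<Sum>j=1..d. a j" arbitrary: a x rule: less_induct)
  case less
  show ?case
  proof (cases "\<exists>j\<in>{1..d}. a j > 0")
    case False
    then have "a = restrict (\<lambda>_. 0) {1..d}"
      using less.prems(1) by (auto simp: multi_indices_def PiE_def extensional_def fun_eq_iff)
    then show ?thesis
      using g g' ff less.prems(2) by (simp add: has_mixed_derivs_def)
  next
    case True
    then obtain j where j: "j \<in> {1..d}" "a j > 0" by blast
    define b where "b = a(j := a j - 1)"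
    have aj: "a j \<le> r j" using less.prems(1) j by (auto simp: multi_indices_def)
    have b: "b \<in> multi_indices d r" unfolding b_def
      by (rule multi_indices_upd[OF less.prems(1) j(1)]) (use aj in simp)
    have ba: "b(j := Suc (b j)) = a" using j by (auto simp: b_def)
    have bj: "b j < r j" using j aj by (simp add: b_def)
    have lt: "(\<Sum>j=1..d. b j) < (\<Sum>j=1..d. a j)"
      by (rule sum_strict_mono_ex1) (use j in \<open>auto simp: b_def intro!: bexI[of _ j]\<close>)
    have xj: "x j \<in> {0..1}" using cubeD[OF less.prems(2) j(1)] by simp
    have d1: "((\<lambda>t. g b (x(j := t))) has_real_derivative g a x) (at (x j) within {0..1})"
      using g b j(1) bj less.prems(2) ba unfolding has_mixed_derivs_def by metis
    have d2: "((\<lambda>t. g' b (x(j := t))) has_real_derivative g' a x) (at (x j) within {0..1})"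
      using g' b j(1) bj less.prems(2) ba unfolding has_mixed_derivs_def by metis
    have eq: "g b (x(j := t)) = g' b (x(j := t))" if "t \<in> {0..1}" for t
      by (rule less.hyps[OF lt b cube_upd[OF less.prems(2) j(1) that]])
    have d3: "((\<lambda>t. g b (x(j := t))) has_real_derivative g' a x) (at (x j) within {0..1})"
      by (rule has_field_derivative_transform_within[OF d2 zero_less_one xj]) (simp add: eq)
    have "at (x j) within {0..1} \<noteq> bot"
      using xj by (simp add: trivial_limit_within)
    then show ?thesis
      using d1 d3 unfolding has_field_derivative_iff by (rule tendsto_unique)
  qed
qed

lemma mixed_deriv_works: "f \<in> F_space d r \<Longrightarrow> has_mixed_derivs d r f (mixed_deriv d r f)"
proof -
  assume "f \<in> F_space d r"
  then obtain g where "has_mixed_derivs d r f g" by (auto simp: F_space_def)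
  then show ?thesis unfolding mixed_deriv_def by (rule someI[of "has_mixed_derivs d r f"])
qed

text \<open>By uniqueness any explicit family \<open>g\<close> agrees with the one that
  \<open>mixed_deriv\<close> selects, so the boundary conditions may be checked on
  \<open>g\<close>.\<close>

lemma F_spaceI:
  assumes "\<And>x. x \<notin> cube d \<Longrightarrow> f x = 0" and g: "has_mixed_derivs d r f g"
    and v: "\<And>a x j. a \<in> multi_indices d r \<Longrightarrow> x \<in> cube d \<Longrightarrow> j \<in> {1..d} \<Longrightarrow> x j = 0 \<Longrightarrow> g a x = 0"
  shows "f \<in> F_space d r"
proof -
  have m: "has_mixed_derivs d r f (mixed_deriv d r f)"
    unfolding mixed_deriv_def using g by (rule someI[of "has_mixed_derivs d r f"])
  have "mixed_deriv d r f a x = g a x" if "a \<in> multi_indices d r" "x \<in> cube d" for a x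
    by (rule has_mixed_derivs_unique[OF m g refl that])
  then show ?thesis unfolding F_space_def using assms by auto
qed

lemma F_space_outside: "f \<in> F_space d r \<Longrightarrow> x \<notin> cube d \<Longrightarrow> f x = 0"
  by (simp add: F_space_def)

lemma F_space_continuous: "f \<in> F_space d r \<Longrightarrow> continuous_on (cube d) f"
proof -
  assume f: "f \<in> F_space d r"
  note m = mixed_deriv_works[OF f]
  have "continuous_on (cube d) (mixed_deriv d r f (restrict (\<lambda>_. 0) {1..d}))"
    using m zero_in_multi_indices unfolding has_mixed_derivs_def by blast
  then show ?thesis
    by (rule continuous_on_eq) (use m in \<open>simp add: has_mixed_derivs_def\<close>)
qed

lemma F_space_linear:
  assumes "f \<in> F_space d r" "f' \<in> F_space d r"
  shows "(\<lambda>x. c * f x + f' x) \<in> F_space d r"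
proof (rule F_spaceI)
  let ?g = "mixed_deriv d r f" and ?g' = "mixed_deriv d r f'"
  note m = mixed_deriv_works[OF assms(1)] mixed_deriv_works[OF assms(2)]
  show "has_mixed_derivs d r (\<lambda>x. c * f x + f' x) (\<lambda>a x. c * ?g a x + ?g' a x)"
    unfolding has_mixed_derivs_def
  proof (intro conjI ballI impI)
    fix a j x assume "a \<in> multi_indices d r" "j \<in> {1..d}" "a j < r j" "x \<in> cube d"
    then have "((\<lambda>t. ?g a (x(j := t))) has_real_derivative ?g (a(j := Suc (a j))) x) (at (x j) within {0..1})"
      and "((\<lambda>t. ?g' a (x(j := t))) has_real_derivative ?g' (a(j := Suc (a j))) x) (at (x j) within {0..1})"
      using m unfolding has_mixed_derivs_def by blast+
    then show "((\<lambda>t. c * ?g a (x(j := t)) + ?g' a (x(j := t))) has_real_derivative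
        c * ?g (a(j := Suc (a j))) x + ?g' (a(j := Suc (a j))) x) (at (x j) within {0..1})"
      by (intro DERIV_add DERIV_cmult)
  qed (use m in \<open>auto simp: has_mixed_derivs_def intro!: continuous_intros\<close>)
  show "c * f x + f' x = 0" if "x \<notin> cube d" for x
    using that assms by (simp add: F_space_outside)
  show "c * ?g a x + ?g' a x = 0"
    if "a \<in> multi_indices d r" "x \<in> cube d" "j \<in> {1..d}" "x j = 0" for a x j
    using that assms unfolding F_space_def by fastforce
qed

lemma F_space_zero: "(\<lambda>_. 0) \<in> F_space d r"
  by (rule F_spaceI[where g="\<lambda>_ _. 0"]) (auto simp: has_mixed_derivs_def)

lemma F_space_scale: "f \<in> F_space d r \<Longrightarrow> (\<lambda>x. c * f x) \<in> F_space d r"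
  using F_space_linear[OF _ F_space_zero, of f d r c] by simp

lemma F_space_add: "f \<in> F_space d r \<Longrightarrow> g \<in> F_space d r \<Longrightarrow> (\<lambda>x. f x + g x) \<in> F_space d r"
  using F_space_linear[of f d r g 1] by simp

lemma F_space_diff: "f \<in> F_space d r \<Longrightarrow> g \<in> F_space d r \<Longrightarrow> (\<lambda>x. f x - g x) \<in> F_space d r"
  using F_space_linear[of g d r f "-1"] by simp

lemma F_space_sum:
  "(\<And>i. i \<in> I \<Longrightarrow> f i \<in> F_space d r) \<Longrightarrow> (\<lambda>x. \<Sum>i\<in>I. f i x) \<in> F_space d r"
  by (induction I rule: infinite_finite_induct) (auto simp: F_space_zero F_space_add)

text \<open>Every derivative vanishes on the faces through 0, so integrating along a coordinate over
  a length of at most 1 does not increase the supremum. Descending from the top derivative to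
  \<open>f\<close> shows that point evaluations are continuous.\<close>

lemma F_norm_upper:
  assumes "f \<in> F_space d r" "x \<in> cube d"
  shows "\<bar>f x\<bar> \<le> F_norm d r f"
proof -
  let ?g = "mixed_deriv d r f" and ?B = "F_norm d r f"
  note m = mixed_deriv_works[OF assms(1)]
  have "a \<in> multi_indices d r \<Longrightarrow> x \<in> cube d \<Longrightarrow> \<bar>?g a x\<bar> \<le> ?B" for a x
  proof (induction "\<Sum>j=1..d. r j - a j" arbitrary: a x rule: less_induct)
    case less
    show ?case
    proof (cases "\<exists>j\<in>{1..d}. a j < r j")
      case False
      then have a: "a = restrict r {1..d}"
        using less.prems(1) by (force simp: multi_indices_def PiE_def extensional_def fun_eq_iff)
      then have "continuous_on (cube d) (?g (restrict r {1..d}))"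
        using less.prems(1) m unfolding has_mixed_derivs_def by blast
      then obtain B where "\<And>x. x \<in> cube d \<Longrightarrow> \<bar>?g (restrict r {1..d}) x\<bar> \<le> B"
        using continuous_cube_bounded by metis
      then have "bdd_above ((\<lambda>x. \<bar>?g (restrict r {1..d}) x\<bar>) ` cube d)" by (intro bdd_aboveI2) auto
      then show ?thesis unfolding F_norm_def a using less.prems(2) by (rule cSUP_upper2) auto
    next
      case True
      then obtain j where j: "j \<in> {1..d}" "a j < r j" by blast
      define b where "b = a(j := Suc (a j))"
      have b: "b \<in> multi_indices d r" unfolding b_def
        by (rule multi_indices_upd[OF less.prems(1) j(1)]) (use j in simp)
      have lt: "(\<Sum>j=1..d. r j - b j) < (\<Sum>j=1..d. r j - a j)"
        by (rule sum_strict_mono_ex1) (use j in \<open>auto simp: b_def intro!: bexI[of _ j]\<close>)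
      have up: "x(j := t) \<in> cube d" if "t \<in> {0..1}" for t
        by (rule cube_upd[OF less.prems(2) j(1) that])
      have "((\<lambda>u. ?g a ((x(j := t))(j := u))) has_real_derivative ?g b (x(j := t)))
          (at ((x(j := t)) j) within {0..1})" if "t \<in> {0..1}" for t
        using m less.prems(1) j up[OF that] unfolding has_mixed_derivs_def b_def by blast
      then have der: "((\<lambda>u. ?g a (x(j := u))) has_real_derivative ?g b (x(j := t)))
          (at t within {0..1})" if "t \<in> {0..1}" for t using that by simp
      have xj: "0 \<le> x j" "x j \<le> 1" using cubeD[OF less.prems(2) j(1)] by auto
      have bd: "norm (?g b (x(j := t))) \<le> ?B" if "t \<in> {0..1}" for t
        using less.hyps[OF lt b up[OF that]] by simp
      have "norm (?g a (x(j := x j)) - ?g a (x(j := 0))) \<le> ?B * norm (x j - 0)"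
        by (rule field_differentiable_bound[where S="{0..1}" and f="\<lambda>t. ?g a (x(j := t))"
              and f'="\<lambda>t. ?g b (x(j := t))"]) (use der bd xj in auto)
      moreover have "?g a (x(j := 0)) = 0"
        using assms(1) less.prems(1) j(1) up[of 0] unfolding F_space_def by force
      moreover have "0 \<le> ?B" using bd[of 0] by (smt (verit) atLeastAtMost_iff norm_ge_zero)
      ultimately show ?thesis using xj by simp (smt (verit) mult_left_le)
    qed
  qed
  from this[OF zero_in_multi_indices assms(2)] show ?thesis
    using m assms(2) by (simp add: has_mixed_derivs_def)
qed

lemma eval_in_F_dual:
  assumes "x \<in> cube d" shows "(\<lambda>f. f x) \<in> F_dual d r"
  unfolding F_dual_def using F_norm_upper[OF _ assms] by (auto intro!: exI[of _ 1])

definition tensor :: "nat \<Rightarrow> (nat \<Rightarrow> real \<Rightarrow> real) \<Rightarrow> func" where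
  "tensor d \<phi> x = (if x \<in> cube d then \<Prod>j=1..d. \<phi> j (x j) else 0)"

lemma tensor_in_F_space:
  assumes cont: "\<And>j k. j \<in> {1..d} \<Longrightarrow> k \<le> r j \<Longrightarrow> continuous_on {0..1} (D j k)"
    and der: "\<And>j k t. j \<in> {1..d} \<Longrightarrow> k < r j \<Longrightarrow> t \<in> {0..1} \<Longrightarrow>
      (D j k has_real_derivative D j (Suc k) t) (at t within {0..1})"
    and zero: "\<And>j k. j \<in> {1..d} \<Longrightarrow> k \<le> r j \<Longrightarrow> D j k 0 = 0"
  shows "tensor d (\<lambda>j. D j 0) \<in> F_space d r"
proof (rule F_spaceI)
  let ?g = "\<lambda>a x. \<Prod>j=1..d. D j (a j) (x j)"
  have ar: "a j \<le> r j" if "a \<in> multi_indices d r" "j \<in> {1..d}" for a j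
    using that by (auto simp: multi_indices_def)
  show "has_mixed_derivs d r (tensor d (\<lambda>j. D j 0)) ?g"
    unfolding has_mixed_derivs_def
  proof (intro conjI ballI impI)
    show "(\<Prod>j=1..d. D j (restrict (\<lambda>_. 0) {1..d} j) (x j)) = tensor d (\<lambda>j. D j 0) x"
      if "x \<in> cube d" for x
      using that by (simp add: tensor_def)
    show "continuous_on (cube d) (?g a)" if "a \<in> multi_indices d r" for a
      by (rule continuous_on_tensor) (use cont ar that in auto)
    fix a j x assume a: "a \<in> multi_indices d r" and j: "j \<in> {1..d}" "a j < r j" and x: "x \<in> cube d"
    let ?R = "\<Prod>i\<in>{1..d} - {j}. D i (a i) (x i)"
    have xj: "x j \<in> {0..1}" using cubeD[OF x j(1)] by simp
    have split: "(\<Prod>i=1..d. D i (b i) (y i)) = D j (b j) (y j) * (\<Prod>i\<in>{1..d} - {j}. D i (b i) (y i))"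
      for b y by (rule prod.remove) (use j in auto)
    have e1: "(\<lambda>t. ?g a (x(j := t))) = (\<lambda>t. D j (a j) t * ?R)"
      unfolding split by (auto intro!: ext arg_cong2[where f="(*)"] prod.cong)
    have e2: "?g (a(j := Suc (a j))) x = D j (Suc (a j)) (x j) * ?R"
      unfolding split by (auto intro!: arg_cong2[where f="(*)"] prod.cong)
    show "((\<lambda>t. ?g a (x(j := t))) has_real_derivative ?g (a(j := Suc (a j))) x)
        (at (x j) within {0..1})"
      unfolding e1 e2 by (rule DERIV_cmult_right) (rule der[OF j xj])
  qed
  show "?g a x = 0"
    if "a \<in> multi_indices d r" "x \<in> cube d" "j \<in> {1..d}" "x j = 0" for a x j
    by (rule prod_zero) (use that zero ar in \<open>auto intro!: bexI[of _ j]\<close>)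
qed (simp add: tensor_def)

text \<open>After \<open>k\<close> derivatives a factor of order \<open>Suc (r j) - k\<close> at 0
  is left, which is positive for all \<open>k\<close> up to \<open>r j\<close>; this yields the
  boundary conditions.\<close>

lemma tensor_poly_in_F_space:
  assumes "\<And>j. j \<in> {1..d} \<Longrightarrow> monom 1 (Suc (r j)) dvd p j"
  shows "tensor d (\<lambda>j. poly (p j)) \<in> F_space d r"
proof -
  have "tensor d (\<lambda>j. poly ((pderiv ^^ 0) (p j))) \<in> F_space d r"
  proof (rule tensor_in_F_space[where D="\<lambda>j k. poly ((pderiv ^^ k) (p j))"])
    show "poly ((pderiv ^^ k) (p j)) 0 = 0" if "j \<in> {1..d}" "k \<le> r j" for j k
    proof -
      from assms[OF that(1)] obtain q where q: "p j = monom 1 (Suc (r j)) * q" by (auto simp: dvd_def)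
      have "\<exists>q. (pderiv ^^ k) (p j) = monom 1 (Suc (r j) - k) * q" using that(2)
      proof (induction k)
        case 0 then show ?case using q by auto
      next
        case (Suc k)
        then obtain q where q: "(pderiv ^^ k) (p j) = monom 1 (Suc (r j) - k) * q" by auto
        have s: "Suc (r j) - k = Suc (Suc (r j) - Suc k)" using Suc.prems by simp
        have "pderiv (monom 1 (Suc n) * q) = monom 1 n * (smult (of_nat (Suc n)) q + monom 1 1 * pderiv q)" for n
          and q :: "real poly"
        proof -
          have pd: "pderiv (monom 1 (Suc n)) = smult (1 + real n) (monom 1 n)"
            by (simp add: pderiv_monom smult_monom)
          have "monom 1 (Suc n) = monom (1::real) n * monom 1 1" by (simp add: mult_monom)
          then show ?thesis unfolding pderiv_mult pd by (simp add: algebra_simps)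
        qed
        then show ?case using q s by auto
      qed
      then show ?thesis using that(2) by (auto simp: poly_monom)
    qed
  qed (auto intro: poly_DERIV continuous_intros has_field_derivative_at_within)
  then show ?thesis by simp
qed

subsection \<open>Integration against truncated powers\<close>

lemma trunc_pow_nonneg: "0 \<le> trunc_pow k u"
  by (simp add: trunc_pow_def)

lemma trunc_pow_le_power: "h \<ge> 0 \<Longrightarrow> u \<le> h \<Longrightarrow> trunc_pow k u \<le> h ^ k"
proof -
  assume h: "h \<ge> 0" "u \<le> h"
  have "u ^ k / fact k \<le> h ^ k" if "u > 0"
  proof -
    have "u ^ k / fact k \<le> u ^ k / 1"
      by (intro divide_left_mono) (use that in \<open>auto simp: fact_ge_1\<close>)
    also have "\<dots> \<le> h ^ k" using h that by (auto intro: power_mono)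
    finally show ?thesis .
  qed
  then show ?thesis using h by (auto simp: trunc_pow_def)
qed

lemma trunc_pow_le_1: "u \<le> 1 \<Longrightarrow> trunc_pow k u \<le> 1"
  using trunc_pow_le_power[of 1 u k] by simp

lemma trunc_pow_measurable [measurable]: "trunc_pow k \<in> borel_measurable borel"
  unfolding trunc_pow_def by measurable

lemma trunc_pow_scale: "h > 0 \<Longrightarrow> trunc_pow k (h * u) = h ^ k * trunc_pow k u"
  by (simp add: trunc_pow_def zero_less_mult_iff power_mult_distrib)

lemma has_real_derivative_power_fact:
  "((\<lambda>z::real. z ^ Suc n / fact (Suc n)) has_real_derivative z ^ n / fact n) (at z)"
proof -
  have "((\<lambda>z::real. z ^ Suc n / fact (Suc n)) has_real_derivative
      real (Suc n) * z ^ (Suc n - Suc 0) / fact (Suc n)) (at z)"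
    by (rule DERIV_cdivide[OF DERIV_pow])
  moreover have "real (Suc n) * z ^ (Suc n - Suc 0) / fact (Suc n) = z ^ n / fact n"
    unfolding fact_Suc of_nat_mult of_nat_fact by (simp del: of_nat_Suc)
  ultimately show ?thesis by simp
qed

text \<open>\<open>trunc_pow n\<close> is the increasing derivative of
  \<open>trunc_pow (Suc n)\<close>, so the increment lies between its two tangent estimates. The
  form with inequalities also covers \<open>n = 0\<close>, where \<open>trunc_pow 1\<close> has a
  kink at 0.\<close>

lemma trunc_pow_convex:
  assumes "u \<le> v"
  shows "(v - u) * trunc_pow n u \<le> trunc_pow (Suc n) v - trunc_pow (Suc n) u"
    and "trunc_pow (Suc n) v - trunc_pow (Suc n) u \<le> (v - u) * trunc_pow n v"
proof -
  consider "v \<le> 0" | "u \<le> 0" "v > 0" | "u > 0" "u < v" | "u = v" using assms by linarith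
  then have "(v - u) * trunc_pow n u \<le> trunc_pow (Suc n) v - trunc_pow (Suc n) u \<and>
      trunc_pow (Suc n) v - trunc_pow (Suc n) u \<le> (v - u) * trunc_pow n v"
  proof cases
    case 2
    have "v ^ Suc n / fact (Suc n) \<le> (v - u) * (v ^ n / fact n)"
    proof -
      have "v ^ Suc n / fact (Suc n) = v * (v ^ n / fact n) / real (Suc n)"
        by (simp add: field_simps)
      also have "\<dots> \<le> v * (v ^ n / fact n) / 1"
        by (intro divide_left_mono) (use 2 in auto)
      also have "\<dots> \<le> (v - u) * (v ^ n / fact n)"
        unfolding div_by_1 by (rule mult_right_mono) (use 2 in auto)
      finally show ?thesis .
    qed
    then show ?thesis using 2 by (simp add: trunc_pow_def)
  next
    case 3
    have "\<exists>z. u < z \<and> z < v \<and>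
        v ^ Suc n / fact (Suc n) - u ^ Suc n / fact (Suc n) = (v - u) * (z ^ n / fact n)"
      by (rule MVT2[OF 3(2)]) (rule has_real_derivative_power_fact)
    then obtain z where z: "u < z" "z < v"
      and e: "v ^ Suc n / fact (Suc n) - u ^ Suc n / fact (Suc n) = (v - u) * (z ^ n / fact n)"
      by blast
    have "u ^ n / fact n \<le> z ^ n / fact n" "z ^ n / fact n \<le> v ^ n / fact n"
      using z 3 by (auto intro!: divide_right_mono power_mono)
    then have "(v - u) * (u ^ n / fact n) \<le> (v - u) * (z ^ n / fact n)"
      "(v - u) * (z ^ n / fact n) \<le> (v - u) * (v ^ n / fact n)"
      using mult_left_mono[of "u ^ n / fact n" "z ^ n / fact n" "v - u"]
        mult_left_mono[of "z ^ n / fact n" "v ^ n / fact n" "v - u"] 3 by simp_all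
    then show ?thesis using e 3 by (simp add: trunc_pow_def del: fact_Suc power_Suc)
  qed (use assms in \<open>auto simp: trunc_pow_def\<close>)
  then show "(v - u) * trunc_pow n u \<le> trunc_pow (Suc n) v - trunc_pow (Suc n) u"
    and "trunc_pow (Suc n) v - trunc_pow (Suc n) u \<le> (v - u) * trunc_pow n v" by auto
qed

lemma trunc_pow_mono: "u \<le> v \<Longrightarrow> trunc_pow n u \<le> trunc_pow n v"
  by (auto simp: trunc_pow_def intro!: divide_right_mono power_mono)

lemma trunc_pow_Suc_Lipschitz:
  "u \<le> v \<Longrightarrow> v \<le> 1 \<Longrightarrow> trunc_pow (Suc n) v - trunc_pow (Suc n) u \<le> v - u"
  using trunc_pow_convex(2)[of u v n] trunc_pow_le_1[of v n]
  by (smt (verit) mult_left_le)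

lemma unit_AE: "AE x in unit_measure. x \<in> {0..1}"
  by (rule AE_I2) (simp add: space_restrict_space)

lemma measurable_unit: "f \<in> borel_measurable borel \<Longrightarrow> f \<in> borel_measurable unit_measure"
  by (rule measurable_restrict_space1) simp

lemma integrable_unit_bounded:
  fixes f :: "real \<Rightarrow> real"
  assumes "f \<in> borel_measurable unit_measure" "\<And>x. x \<in> {0..1} \<Longrightarrow> \<bar>f x\<bar> \<le> B"
  shows "integrable unit_measure f"
proof (rule unit.integrable_const_bound[where B=B])
  show "AE x in unit_measure. norm (f x) \<le> B" using unit_AE by eventually_elim (use assms in auto)
qed fact

lemma integral_trunc_pow:
  assumes "0 \<le> x" "x \<le> 1"
  shows "(\<integral>s. trunc_pow n (x - s) \<partial>unit_measure) = trunc_pow (Suc n) x"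
proof -
  have "(\<integral>s. trunc_pow n (x - s) \<partial>unit_measure)
      = (LINT s|lborel. indicator {0..1} s * trunc_pow n (x - s))"
    unfolding integral_unit_measure set_lebesgue_integral_def by simp
  also have "\<dots> = (LINT s|lborel. ((x - s) ^ n / fact n) * indicator {0..x} s)"
  proof (rule integral_cong_AE)
    show "AE s in lborel. indicator {0..1} s * trunc_pow n (x - s) = (x - s) ^ n / fact n * indicator {0..x} s"
      using AE_lborel_singleton[of x]
      by eventually_elim (use assms in \<open>auto simp: trunc_pow_def indicator_def\<close>)
  qed measurable
  also have "\<dots> = (- ((x - x) ^ Suc n / fact (Suc n))) - (- ((x - 0) ^ Suc n / fact (Suc n)))"
  proof (rule integral_FTC_Icc_real[OF assms(1)])
    fix s :: real
    have "((\<lambda>s. (x - s) ^ Suc n / fact (Suc n)) has_real_derivative (x - s) ^ n / fact n * (0 - 1)) (at s)"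
      by (rule DERIV_chain2[OF has_real_derivative_power_fact DERIV_diff[OF DERIV_const DERIV_ident]])
    from DERIV_minus[OF this]
    show "((\<lambda>s. - ((x - s) ^ Suc n / fact (Suc n))) has_real_derivative (x - s) ^ n / fact n) (at s)"
      by simp
  qed (auto intro!: continuous_intros)
  also have "\<dots> = trunc_pow (Suc n) x"
    using assms by (auto simp: trunc_pow_def)
  finally show ?thesis .
qed

text \<open>For \<open>x\<close> in \<open>{0..1}\<close> this is, by Cauchy's formula for repeated
  integration, the (n + 1)-fold antiderivative of \<open>\<psi>\<close> that starts from 0 at
  0.\<close>

definition fold_int :: "nat \<Rightarrow> (real \<Rightarrow> real) \<Rightarrow> real \<Rightarrow> real" where
  "fold_int n \<psi> x = (\<integral>s. trunc_pow n (x - s) * \<psi> s \<partial>unit_measure)"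

context
  fixes \<psi> :: "real \<Rightarrow> real" and B :: real
  assumes \<psi>_meas: "\<psi> \<in> borel_measurable borel" and \<psi>_bound: "\<And>s. s \<in> {0..1} \<Longrightarrow> \<bar>\<psi> s\<bar> \<le> B"
begin

lemma fold_int_integrable: "x \<le> 1 \<Longrightarrow> integrable unit_measure (\<lambda>s. trunc_pow n (x - s) * \<psi> s)"
proof (rule integrable_unit_bounded[where B="1 * B"])
  show "(\<lambda>s. trunc_pow n (x - s) * \<psi> s) \<in> borel_measurable unit_measure"
    by (intro measurable_unit borel_measurable_times measurable_compose[OF _ trunc_pow_measurable] \<psi>_meas) simp
  fix s :: real assume "s \<in> {0..1}" "x \<le> 1"
  then show "\<bar>trunc_pow n (x - s) * \<psi> s\<bar> \<le> 1 * B"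
    unfolding abs_mult using trunc_pow_nonneg[of n "x - s"] trunc_pow_le_1[of "x - s" n]
    by (intro mult_mono \<psi>_bound) auto
qed

lemma trunc_pow_integrable: "x \<le> 1 \<Longrightarrow> integrable unit_measure (\<lambda>s. trunc_pow n (x - s))"
  by (rule integrable_unit_bounded[where B=1])
    (auto intro!: measurable_unit simp: trunc_pow_nonneg trunc_pow_le_1 abs_of_nonneg)

text \<open>The kernel increases with \<open>x\<close>, so the difference of two kernels has one
  sign and its integral is explicit by \<open>integral_trunc_pow\<close>.\<close>

lemma fold_int_diff_bound:
  assumes "0 \<le> x" "x \<le> y" "y \<le> 1"
  shows "\<bar>fold_int n \<psi> y - fold_int n \<psi> x\<bar> \<le> B * (trunc_pow (Suc n) y - trunc_pow (Suc n) x)"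
proof -
  have "\<bar>fold_int n \<psi> y - fold_int n \<psi> x\<bar>
      = \<bar>\<integral>s. trunc_pow n (y - s) * \<psi> s - trunc_pow n (x - s) * \<psi> s \<partial>unit_measure\<bar>"
    unfolding fold_int_def
    by (subst Bochner_Integration.integral_diff) (use assms in \<open>auto intro!: fold_int_integrable\<close>)
  also have "\<dots> \<le> (\<integral>s. B * (trunc_pow n (y - s) - trunc_pow n (x - s)) \<partial>unit_measure)"
  proof (rule integral_abs_le_integral)
    show "integrable unit_measure (\<lambda>s. trunc_pow n (y - s) * \<psi> s - trunc_pow n (x - s) * \<psi> s)"
      using assms by (intro Bochner_Integration.integrable_diff fold_int_integrable) auto
    show "integrable unit_measure (\<lambda>s. B * (trunc_pow n (y - s) - trunc_pow n (x - s)))"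
      using assms by (intro integrable_mult_right Bochner_Integration.integrable_diff trunc_pow_integrable) auto
    fix s assume "s \<in> space unit_measure"
    then have s: "s \<in> {0..1}" by (simp add: space_restrict_space)
    have "\<bar>trunc_pow n (y - s) * \<psi> s - trunc_pow n (x - s) * \<psi> s\<bar>
        = \<bar>\<psi> s\<bar> * (trunc_pow n (y - s) - trunc_pow n (x - s))"
    proof -
      have "trunc_pow n (y - s) * \<psi> s - trunc_pow n (x - s) * \<psi> s
          = \<psi> s * (trunc_pow n (y - s) - trunc_pow n (x - s))" by (simp add: algebra_simps)
      then show ?thesis
        using trunc_pow_mono[of "x - s" "y - s" n] assms by (simp only: abs_mult) simp
    qed
    also have "\<dots> \<le> B * (trunc_pow n (y - s) - trunc_pow n (x - s))"
      using trunc_pow_mono[of "x - s" "y - s" n] assms s by (intro mult_right_mono \<psi>_bound) auto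
    finally show "\<bar>trunc_pow n (y - s) * \<psi> s - trunc_pow n (x - s) * \<psi> s\<bar>
        \<le> B * (trunc_pow n (y - s) - trunc_pow n (x - s))" .
  qed
  also have "\<dots> = B * (trunc_pow (Suc n) y - trunc_pow (Suc n) x)"
    using assms by (simp add: trunc_pow_integrable integral_trunc_pow)
  finally show ?thesis .
qed

lemma B_nonneg: "0 \<le> B"
  using \<psi>_bound[of 0] by force

lemma fold_int_Lipschitz:
  assumes "x \<in> {0..1}" "y \<in> {0..1}"
  shows "\<bar>fold_int n \<psi> y - fold_int n \<psi> x\<bar> \<le> B * \<bar>y - x\<bar>"
proof -
  have *: "\<bar>fold_int n \<psi> y - fold_int n \<psi> x\<bar> \<le> B * \<bar>y - x\<bar>" if "0 \<le> x" "x \<le> y" "y \<le> 1" for x y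
    using fold_int_diff_bound[OF that, of n] mult_left_mono[OF trunc_pow_Suc_Lipschitz[OF that(2,3), of n] B_nonneg]
      that by simp
  show ?thesis using *[of x y] *[of y x] assms by (cases "x \<le> y") (auto simp: abs_minus_commute)
qed

lemma fold_int_continuous: "continuous_on {0..1} (fold_int n \<psi>)"
proof (rule continuous_onI)
  fix x e :: real assume x: "x \<in> {0..1}" and e: "e > 0"
  show "\<exists>d>0. \<forall>x'\<in>{0..1}. dist x' x < d \<longrightarrow> dist (fold_int n \<psi> x') (fold_int n \<psi> x) \<le> e"
  proof (intro exI[of _ "e / (B + 1)"] conjI ballI impI)
    show "0 < e / (B + 1)" using e B_nonneg by simp
    fix y assume y: "y \<in> {0..1}" "dist y x < e / (B + 1)"
    have "\<bar>fold_int n \<psi> y - fold_int n \<psi> x\<bar> \<le> B * \<bar>y - x\<bar>" by (rule fold_int_Lipschitz[OF x y(1)])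
    also have "\<dots> \<le> (B + 1) * (e / (B + 1))"
      using y(2) B_nonneg by (intro mult_mono) (auto simp: dist_real_def)
    finally show "dist (fold_int n \<psi> y) (fold_int n \<psi> x) \<le> e"
      using B_nonneg by (simp add: dist_real_def)
  qed
qed

text \<open>A Taylor estimate with quadratic remainder for a merely bounded measurable
  \<open>\<psi>\<close>. Convexity bounds the remainder of the kernel by
  \<open>\<bar>y - x\<bar>\<close> times the increment of \<open>trunc_pow n\<close>, and that
  increment integrates over \<open>s\<close> to at most another
  \<open>\<bar>y - x\<bar>\<close>.\<close>

lemma fold_int_increment:
  assumes "x \<in> {0..1}" "y \<in> {0..1}"
  shows "\<bar>fold_int (Suc n) \<psi> y - fold_int (Suc n) \<psi> x - (y - x) * fold_int n \<psi> x\<bar> \<le> B * \<bar>y - x\<bar> * \<bar>y - x\<bar>"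
proof -
  let ?d = "\<lambda>s. trunc_pow (Suc n) (y - s) - trunc_pow (Suc n) (x - s) - (y - x) * trunc_pow n (x - s)"
  let ?b = "\<lambda>s. \<bar>trunc_pow n (y - s) - trunc_pow n (x - s)\<bar>"
  have pw: "\<bar>?d s\<bar> \<le> \<bar>y - x\<bar> * ?b s" for s
  proof (cases "x \<le> y")
    case True
    have "\<bar>y - x\<bar> * ?b s = (y - x) * trunc_pow n (y - s) - (y - x) * trunc_pow n (x - s)"
      using True trunc_pow_mono[of "x - s" "y - s" n] by (simp add: right_diff_distrib)
    then show ?thesis using trunc_pow_convex[of "x - s" "y - s" n] True by (simp add: abs_le_iff)
  next
    case False
    have "\<bar>y - x\<bar> * ?b s = (x - y) * trunc_pow n (x - s) - (x - y) * trunc_pow n (y - s)"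
      using False trunc_pow_mono[of "y - s" "x - s" n] by (simp add: right_diff_distrib)
    then show ?thesis using trunc_pow_convex[of "y - s" "x - s" n] False
      by (simp add: abs_le_iff left_diff_distrib)
  qed
  have i1: "integrable unit_measure ?d"
    using assms by (intro Bochner_Integration.integrable_diff integrable_mult_right trunc_pow_integrable) auto
  have i2: "integrable unit_measure ?b"
    using assms by (intro integrable_abs Bochner_Integration.integrable_diff trunc_pow_integrable) auto
  have "fold_int (Suc n) \<psi> y - fold_int (Suc n) \<psi> x - (y - x) * fold_int n \<psi> x
      = (\<integral>s. trunc_pow (Suc n) (y - s) * \<psi> s - trunc_pow (Suc n) (x - s) * \<psi> s
          - (y - x) * (trunc_pow n (x - s) * \<psi> s) \<partial>unit_measure)"
    unfolding fold_int_def using assms by (simp add: fold_int_integrable)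
  also have "\<dots> = (\<integral>s. ?d s * \<psi> s \<partial>unit_measure)"
    by (simp add: algebra_simps)
  finally have "\<bar>fold_int (Suc n) \<psi> y - fold_int (Suc n) \<psi> x - (y - x) * fold_int n \<psi> x\<bar>
      = \<bar>\<integral>s. ?d s * \<psi> s \<partial>unit_measure\<bar>" by simp
  also have "\<dots> \<le> (\<integral>s. B * \<bar>y - x\<bar> * ?b s \<partial>unit_measure)"
  proof (rule integral_abs_le_integral)
    show "integrable unit_measure (\<lambda>s. B * \<bar>y - x\<bar> * ?b s)" using i2 by simp
    have "integrable unit_measure (\<lambda>s. trunc_pow (Suc n) (y - s) * \<psi> s - trunc_pow (Suc n) (x - s) * \<psi> s
          - (y - x) * (trunc_pow n (x - s) * \<psi> s))"
      using assms by (intro Bochner_Integration.integrable_diff integrable_mult_right fold_int_integrable) auto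
    then show "integrable unit_measure (\<lambda>s. ?d s * \<psi> s)" by (simp add: algebra_simps)
    fix s assume "s \<in> space unit_measure"
    then have s: "s \<in> {0..1}" by (simp add: space_restrict_space)
    have "\<bar>?d s * \<psi> s\<bar> \<le> (\<bar>y - x\<bar> * ?b s) * B"
      unfolding abs_mult by (intro mult_mono pw \<psi>_bound s) auto
    then show "\<bar>?d s * \<psi> s\<bar> \<le> B * \<bar>y - x\<bar> * ?b s" by (simp add: mult_ac)
  qed
  also have "\<dots> = B * \<bar>y - x\<bar> * (\<integral>s. ?b s \<partial>unit_measure)" by simp
  also have "(\<integral>s. ?b s \<partial>unit_measure) \<le> \<bar>y - x\<bar>"
  proof -
    have *: "(\<integral>s. \<bar>trunc_pow n (y - s) - trunc_pow n (x - s)\<bar> \<partial>unit_measure) \<le> y - x"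
      if "0 \<le> x" "x \<le> y" "y \<le> 1" for x y
    proof -
      have "(\<integral>s. \<bar>trunc_pow n (y - s) - trunc_pow n (x - s)\<bar> \<partial>unit_measure)
          = (\<integral>s. trunc_pow n (y - s) - trunc_pow n (x - s) \<partial>unit_measure)"
        by (rule Bochner_Integration.integral_cong) (use that in \<open>auto intro!: abs_of_nonneg trunc_pow_mono\<close>)
      also have "\<dots> = trunc_pow (Suc n) y - trunc_pow (Suc n) x"
        using that by (simp add: trunc_pow_integrable integral_trunc_pow)
      also have "\<dots> \<le> y - x" by (rule trunc_pow_Suc_Lipschitz[OF that(2,3)])
      finally show ?thesis .
    qed
    show ?thesis using *[of x y] *[of y x] assms by (cases "x \<le> y") (auto simp: abs_minus_commute)
  qed
  then have "B * \<bar>y - x\<bar> * (\<integral>s. ?b s \<partial>unit_measure) \<le> B * \<bar>y - x\<bar> * \<bar>y - x\<bar>"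
    using B_nonneg by (intro mult_left_mono) auto
  finally show ?thesis by simp
qed

lemma fold_int_derivative:
  assumes "x \<in> {0..1}"
  shows "(fold_int (Suc n) \<psi> has_real_derivative fold_int n \<psi> x) (at x within {0..1})"
  unfolding has_field_derivative_iff
proof (rule Lim_null[THEN iffD2], rule Lim_null_comparison)
  show "\<forall>\<^sub>F y in at x within {0..1}. norm ((fold_int (Suc n) \<psi> y - fold_int (Suc n) \<psi> x) / (y - x)
      - fold_int n \<psi> x) \<le> B * \<bar>y - x\<bar>"
    unfolding eventually_at_filter
  proof (intro always_eventually allI impI)
    fix y assume y: "y \<noteq> x" "y \<in> {0..1}"
    have "(fold_int (Suc n) \<psi> y - fold_int (Suc n) \<psi> x) / (y - x) - fold_int n \<psi> x
        = (fold_int (Suc n) \<psi> y - fold_int (Suc n) \<psi> x - (y - x) * fold_int n \<psi> x) / (y - x)"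
      using y by (simp add: field_simps)
    then show "norm ((fold_int (Suc n) \<psi> y - fold_int (Suc n) \<psi> x) / (y - x)
      - fold_int n \<psi> x) \<le> B * \<bar>y - x\<bar>"
      using fold_int_increment[OF assms y(2), of n] y by (simp add: abs_divide pos_divide_le_eq)
  qed
  have "((\<lambda>y. B * \<bar>y - x\<bar>) \<longlongrightarrow> B * \<bar>x - x\<bar>) (at x within {0..1})" by (intro tendsto_intros)
  then show "((\<lambda>y. B * \<bar>y - x\<bar>) \<longlongrightarrow> 0) (at x within {0..1})" by simp
qed

lemma fold_int_zero: "fold_int n \<psi> 0 = 0"
proof -
  have "fold_int n \<psi> 0 = (\<integral>s. 0 \<partial>unit_measure)" unfolding fold_int_def
    by (rule Bochner_Integration.integral_cong) (auto simp: space_restrict_space trunc_pow_def)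
  then show ?thesis by simp
qed

end

subsection \<open>The folded Wiener sheet\<close>

definition sheet_kernel :: "nat \<Rightarrow> (nat \<Rightarrow> nat) \<Rightarrow> point \<Rightarrow> point \<Rightarrow> real" where
  "sheet_kernel d r x s = (\<Prod>j=1..d. trunc_pow (r j) (x j - s j))"

lemma sheet_kernel_bounds:
  assumes "x \<in> cube d" "s \<in> cube d"
  shows "0 \<le> sheet_kernel d r x s" "sheet_kernel d r x s \<le> 1"
proof -
  have "x j - s j \<le> 1" if "j \<in> {1..d}" for j
    using cubeD[OF assms(1) that] cubeD[OF assms(2) that] by simp
  then show "0 \<le> sheet_kernel d r x s" "sheet_kernel d r x s \<le> 1" unfolding sheet_kernel_def
    by (auto intro!: prod_nonneg prod_le_1 trunc_pow_nonneg trunc_pow_le_1)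
qed

lemma sheet_kernel_measurable: "sheet_kernel d r x \<in> borel_measurable (cube_measure d)"
  unfolding sheet_kernel_def[abs_def]
  by (intro borel_measurable_prod measurable_compose[OF _ trunc_pow_measurable] borel_measurable_diff
      measurable_cube_component) auto

lemma wiener_kernel_fold_int:
  "wiener_kernel d r t x = (\<Prod>j=1..d. fold_int (r j) (\<lambda>s. trunc_pow (r j) (t j - s)) (x j))"
  unfolding wiener_kernel_def fold_int_def integral_unit_measure by (simp add: mult.commute)

lemma trunc_pow_section:
  assumes "t \<le> 1"
  shows "(\<lambda>s. trunc_pow n (t - s)) \<in> borel_measurable borel"
    and "s \<in> {0..1} \<Longrightarrow> \<bar>trunc_pow n (t - s)\<bar> \<le> 1"
  using assms by (auto simp: abs_of_nonneg[OF trunc_pow_nonneg] intro!: trunc_pow_le_1)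

lemma wiener_kernel_integral:
  assumes "t \<in> cube d" "x \<in> cube d"
  shows "wiener_kernel d r t x = (\<integral>s. sheet_kernel d r t s * sheet_kernel d r x s \<partial>cube_measure d)"
proof -
  have "(\<integral>s. sheet_kernel d r t s * sheet_kernel d r x s \<partial>cube_measure d)
      = (\<integral>s. (\<Prod>j=1..d. trunc_pow (r j) (x j - s j) * trunc_pow (r j) (t j - s j)) \<partial>cube_measure d)"
    unfolding sheet_kernel_def prod.distrib by (simp add: mult.commute)
  also have "\<dots> = wiener_kernel d r t x" unfolding wiener_kernel_fold_int fold_int_def
  proof (rule integral_tensor)
    fix j assume j: "j \<in> {1..d}"
    show "integrable unit_measure (\<lambda>s. trunc_pow (r j) (x j - s) * trunc_pow (r j) (t j - s))"
      using cubeD[OF assms(1) j] cubeD[OF assms(2) j]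
      by (intro fold_int_integrable[where B=1] trunc_pow_section) auto
  qed
  finally show ?thesis by simp
qed

lemma sheet_kernel_prod_integrable:
  assumes "t \<in> cube d" "x \<in> cube d"
  shows "integrable (cube_measure d) (\<lambda>s. sheet_kernel d r t s * sheet_kernel d r x s)"
proof (rule cube.integrable_const_bound[where B=1])
  show "AE s in cube_measure d. norm (sheet_kernel d r t s * sheet_kernel d r x s) \<le> 1"
    using sheet_kernel_bounds[OF assms(1), of _ r] sheet_kernel_bounds[OF assms(2), of _ r]
    by (auto simp: abs_mult intro!: mult_le_one)
qed (intro borel_measurable_times sheet_kernel_measurable)

lemma wiener_kernel_diag:
  assumes "x \<in> cube d"
  shows "0 \<le> wiener_kernel d r x x" "wiener_kernel d r x x \<le> 1"
proof -
  have "(\<integral>s. sheet_kernel d r x s * sheet_kernel d r x s \<partial>cube_measure d) \<le> (\<integral>s. 1 \<partial>cube_measure d)"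
    using sheet_kernel_bounds[OF assms]
    by (intro integral_mono sheet_kernel_prod_integrable assms) (auto intro!: mult_le_one)
  then show "wiener_kernel d r x x \<le> 1" by (simp add: wiener_kernel_integral assms cube.prob_space)
  show "0 \<le> wiener_kernel d r x x" by (simp add: wiener_kernel_integral assms)
qed

text \<open>This is the one-variable factor of the variance of a point value; it rules out
  degenerate evaluations off the faces through 0.\<close>

lemma trunc_pow_energy_pos:
  assumes "0 < x" "x \<le> 1"
  shows "0 < fold_int n (\<lambda>s. trunc_pow n (x - s)) x"
proof -
  \<comment> \<open>For \<open>s\<close> up to \<open>x / 2\<close> the argument
    \<open>x - s\<close> is at least \<open>x / 2\<close>, so \<open>?c\<close> bounds the integrand
    from below there.\<close>
  let ?c = "((x / 2) ^ n / fact n)\<^sup>2"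
  have "?c * (x / 2) = (\<integral>s. ?c * indicator {0..x/2} s \<partial>unit_measure)"
    using assms by (simp add: measure_restrict_space space_restrict_space Int_absorb1)
  also have "\<dots> \<le> (\<integral>s. trunc_pow n (x - s) * trunc_pow n (x - s) \<partial>unit_measure)"
  proof (rule integral_mono)
    show "integrable unit_measure (\<lambda>s. ?c * indicator {0..x/2} s)"
      by (rule integrable_unit_bounded[where B="?c"])
        (auto intro!: measurable_unit borel_measurable_times simp: indicator_def)
    show "integrable unit_measure (\<lambda>s. trunc_pow n (x - s) * trunc_pow n (x - s))"
      using assms by (intro fold_int_integrable[where B=1] trunc_pow_section) auto
    fix s assume "s \<in> space unit_measure"
    have "?c \<le> trunc_pow n (x - s) * trunc_pow n (x - s)" if "s \<le> x/2"
      unfolding power2_eq_square using that assms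
      by (intro mult_mono) (auto simp: trunc_pow_def intro!: divide_right_mono power_mono)
    then show "?c * indicator {0..x/2} s \<le> trunc_pow n (x - s) * trunc_pow n (x - s)"
      by (auto simp: indicator_def)
  qed
  finally have "?c * (x / 2) \<le> fold_int n (\<lambda>s. trunc_pow n (x - s)) x" by (simp add: fold_int_def)
  moreover have "0 < ?c * (x / 2)" using assms by simp
  ultimately show ?thesis by linarith
qed

lemma abs_mult_le_squares: "\<bar>a * b\<bar> \<le> a\<^sup>2 + b\<^sup>2" for a b :: real
proof -
  have "2 * \<bar>a * b\<bar> \<le> a\<^sup>2 + b\<^sup>2"
    using sum_squares_bound[of "\<bar>a\<bar>" "\<bar>b\<bar>"] by (simp add: abs_mult mult.assoc)
  then show ?thesis by linarith
qed

section \<open>Laws and covariances of functionals of the sheet\<close>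

locale wiener_sheet =
  fixes d :: nat and r :: "nat \<Rightarrow> nat" and \<mu> :: "func measure"
  assumes sheet: "folded_wiener_sheet d r \<mu>"
begin

lemma space_sheet: "space \<mu> = F_space d r"
  using sheet by (simp add: folded_wiener_sheet_def centered_gaussian_def)

sublocale prob_space \<mu>
  using sheet by (simp add: folded_wiener_sheet_def centered_gaussian_def)

lemma gaussian_cases:
  assumes "L \<in> F_dual d r"
  obtains "AE f in \<mu>. L f = 0" | \<sigma> where "\<sigma> > 0" "distributed \<mu> lborel L (normal_density 0 \<sigma>)"
  using sheet assms unfolding folded_wiener_sheet_def centered_gaussian_def by blast

lemma covariance_eval: "t \<in> cube d \<Longrightarrow> x \<in> cube d \<Longrightarrow> expectation (\<lambda>f. f t * f x) = wiener_kernel d r t x"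
  using sheet by (simp add: folded_wiener_sheet_def)

text \<open>\<open>F_norm\<close> is unspecified outside the space, so \<open>Metric_space\<close> is not provable for the distance
  in \<open>F_borel\<close> and continuous functionals are not known to be measurable. Measurability of point
  evaluations is read off their Gaussian law instead.\<close>

lemma eval_measurable:
  assumes x: "x \<in> cube d"
  shows "(\<lambda>f. f x) \<in> borel_measurable \<mu>"
proof (cases "\<exists>j\<in>{1..d}. x j = 0")
  \<comment> \<open>On a face through 0 the evaluation is zero on the whole space. Elsewhere its
    variance is positive, which excludes the degenerate alternative in
    \<open>centered_gaussian\<close>; the other one supplies a density and with it
    measurability.\<close>
  case True
  have "f x = 0" if "f \<in> F_space d r" for f
  proof -
    have "mixed_deriv d r f (restrict (\<lambda>_. 0) {1..d}) x = 0"
      using that True x zero_in_multi_indices unfolding F_space_def by blast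
    then show ?thesis using mixed_deriv_works[OF that] x by (simp add: has_mixed_derivs_def)
  qed
  then have "(\<lambda>f. f x) \<in> borel_measurable \<mu> \<longleftrightarrow> (\<lambda>_. 0::real) \<in> borel_measurable \<mu>"
    by (intro measurable_cong) (simp add: space_sheet)
  then show ?thesis by simp
next
  case False
  then have pos: "0 < x j" "x j \<le> 1" if "j \<in> {1..d}" for j
    using cubeD[OF x that] that by (auto simp: order_less_le)
  show ?thesis
  proof (rule gaussian_cases[OF eval_in_F_dual[OF x]])
    assume "AE f in \<mu>. f x = 0"
    then have "expectation (\<lambda>f. f x * f x) = 0" by (intro integral_eq_zero_AE) auto
    moreover have "wiener_kernel d r x x > 0"
      unfolding wiener_kernel_fold_int by (intro prod_pos trunc_pow_energy_pos) (use pos in auto)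
    ultimately show ?thesis using covariance_eval[OF x x] by simp
  next
    fix \<sigma> assume "distributed \<mu> lborel (\<lambda>f. f x) (normal_density 0 \<sigma>)"
    then show ?thesis by (auto dest: distributed_measurable)
  qed
qed

lemma eval_pair_measurable: "(\<lambda>(f, x). f x) \<in> borel_measurable (\<mu> \<Otimes>\<^sub>M cube_measure d)"
  by (rule measurable_pair_eval) (auto simp: space_sheet F_space_continuous eval_measurable)

text \<open>The degenerate and the nondegenerate alternative of \<open>centered_gaussian\<close>
  lead to the same formula, with the second moment as variance. The characteristic function is the
  form in which the small ball estimate uses the law.\<close>

lemma gaussian_functional:
  assumes L: "L \<in> F_dual d r" and m: "L \<in> borel_measurable \<mu>"
  shows "integrable \<mu> (\<lambda>f. (L f)\<^sup>2)"
    and "(CLINT f|\<mu>. iexp (L f)) = complex_of_real (exp (- expectation (\<lambda>f. (L f)\<^sup>2) / 2))"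
proof -
  have "integrable \<mu> (\<lambda>f. (L f)\<^sup>2) \<and>
      (CLINT f|\<mu>. iexp (L f)) = complex_of_real (exp (- expectation (\<lambda>f. (L f)\<^sup>2) / 2))"
  proof (rule gaussian_cases[OF L])
    assume ae: "AE f in \<mu>. L f = 0"
    have "integrable \<mu> (\<lambda>f. (L f)\<^sup>2) \<longleftrightarrow> integrable \<mu> (\<lambda>f. 0::real)"
      by (rule integrable_cong_AE) (use ae m in auto)
    moreover have "expectation (\<lambda>f. (L f)\<^sup>2) = 0" by (rule integral_eq_zero_AE) (use ae in auto)
    moreover have "(CLINT f|\<mu>. iexp (L f)) = (CLINT f|\<mu>. 1)"
      by (rule integral_cong_AE) (use ae m in auto)
    ultimately show ?thesis by (simp add: prob_space)
  next
    fix \<sigma> assume \<sigma>: "\<sigma> > 0" and D: "distributed \<mu> lborel L (normal_density 0 \<sigma>)"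
    have i: "integrable \<mu> (\<lambda>f. (L f)\<^sup>2)"
      using distributed_integrable[OF D, of "\<lambda>x. x\<^sup>2"] integrable_normal_moment[OF \<sigma>, of 0 2]
      by simp
    have "expectation L = 0" using normal_distributed_expectation[OF \<sigma> D] .
    then have v: "expectation (\<lambda>f. (L f)\<^sup>2) = \<sigma>\<^sup>2"
      using normal_distributed_variance[OF \<sigma> D] by simp
    have Z: "distributed \<mu> lborel (\<lambda>f. L f / \<sigma>) std_normal_density"
      using D normal_standard_normal_convert[OF \<sigma>, of L 0] by simp
    have dZ: "distr \<mu> borel (\<lambda>f. L f / \<sigma>) = std_normal_distribution"
      using distributed_distr_eq_density[OF Z] by (simp cong: distr_cong)
    have "(CLINT f|\<mu>. iexp (L f)) = (CLINT f|\<mu>. iexp (\<sigma> * (L f / \<sigma>)))" using \<sigma> by simp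
    also have "\<dots> = char (distr \<mu> borel (\<lambda>f. L f / \<sigma>)) \<sigma>"
      unfolding char_def by (subst integral_distr) (use m in auto)
    also have "\<dots> = complex_of_real (exp (- \<sigma>\<^sup>2 / 2))" unfolding dZ char_std_normal_distribution ..
    finally show ?thesis using i v by simp
  qed
  then show "integrable \<mu> (\<lambda>f. (L f)\<^sup>2)"
    and "(CLINT f|\<mu>. iexp (L f)) = complex_of_real (exp (- expectation (\<lambda>f. (L f)\<^sup>2) / 2))" by auto
qed

lemma integrable_product:
  fixes X Y :: "func \<Rightarrow> real"
  assumes "integrable \<mu> (\<lambda>f. (X f)\<^sup>2)" "integrable \<mu> (\<lambda>f. (Y f)\<^sup>2)"
    "X \<in> borel_measurable \<mu>" "Y \<in> borel_measurable \<mu>"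
  shows "integrable \<mu> (\<lambda>f. X f * Y f)"
proof (rule Bochner_Integration.integrable_bound)
  show "integrable \<mu> (\<lambda>f. (X f)\<^sup>2 + (Y f)\<^sup>2)" using assms by simp
  show "AE f in \<mu>. norm (X f * Y f) \<le> norm ((X f)\<^sup>2 + (Y f)\<^sup>2)"
    by (auto simp: abs_mult_le_squares simp del: abs_mult)
qed (use assms in measurable)

lemma eval_square_integrable: "x \<in> cube d \<Longrightarrow> integrable \<mu> (\<lambda>f. (f x)\<^sup>2)"
  by (intro gaussian_functional eval_in_F_dual eval_measurable)

lemma eval_product_integrable: "x \<in> cube d \<Longrightarrow> t \<in> cube d \<Longrightarrow> integrable \<mu> (\<lambda>f. f x * f t)"
  by (intro integrable_product eval_square_integrable eval_measurable)

lemma eval_sum_measurable: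
  "(\<And>i. i \<in> I \<Longrightarrow> x i \<in> cube d) \<Longrightarrow> (\<lambda>f. \<Sum>i\<in>I. c i * f (x i)) \<in> borel_measurable \<mu>"
  by (intro borel_measurable_sum borel_measurable_times eval_measurable) auto

lemma covariance_sum:
  assumes "\<And>i. i \<in> I \<Longrightarrow> x i \<in> cube d" "\<And>j. j \<in> J \<Longrightarrow> y j \<in> cube d"
  shows "integrable \<mu> (\<lambda>f. (\<Sum>i\<in>I. c i * f (x i)) * (\<Sum>j\<in>J. b j * f (y j)))"
    and "expectation (\<lambda>f. (\<Sum>i\<in>I. c i * f (x i)) * (\<Sum>j\<in>J. b j * f (y j)))
      = (\<Sum>i\<in>I. \<Sum>j\<in>J. c i * b j * wiener_kernel d r (x i) (y j))"
proof -
  have eq: "(\<Sum>i\<in>I. c i * f (x i)) * (\<Sum>j\<in>J. b j * f (y j))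
      = (\<Sum>i\<in>I. \<Sum>j\<in>J. c i * b j * (f (x i) * f (y j)))" for f
    unfolding sum_product by (simp add: mult_ac)
  have i: "integrable \<mu> (\<lambda>f. c i * b j * (f (x i) * f (y j)))" if "i \<in> I" "j \<in> J" for i j
    by (intro integrable_mult_right eval_product_integrable assms that)
  show "integrable \<mu> (\<lambda>f. (\<Sum>i\<in>I. c i * f (x i)) * (\<Sum>j\<in>J. b j * f (y j)))"
    unfolding eq by (intro Bochner_Integration.integrable_sum i)
  show "expectation (\<lambda>f. (\<Sum>i\<in>I. c i * f (x i)) * (\<Sum>j\<in>J. b j * f (y j)))
      = (\<Sum>i\<in>I. \<Sum>j\<in>J. c i * b j * wiener_kernel d r (x i) (y j))"
    unfolding eq using i assms
    by (simp add: Bochner_Integration.integral_sum covariance_eval)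
qed

text \<open>The sheet is the white noise integral of \<open>sheet_kernel\<close>; this is the corresponding isometry.\<close>

lemma variance_sum:
  assumes "\<And>i. i \<in> I \<Longrightarrow> x i \<in> cube d"
  shows "expectation (\<lambda>f. (\<Sum>i\<in>I. c i * f (x i))\<^sup>2)
    = (\<integral>s. (\<Sum>i\<in>I. c i * sheet_kernel d r (x i) s)\<^sup>2 \<partial>cube_measure d)"
proof -
  have eq: "(\<Sum>i\<in>I. c i * sheet_kernel d r (x i) s)\<^sup>2
      = (\<Sum>i\<in>I. \<Sum>j\<in>I. c i * c j * (sheet_kernel d r (x i) s * sheet_kernel d r (x j) s))" for s
    unfolding power2_eq_square sum_product by (simp add: mult_ac)
  have "expectation (\<lambda>f. (\<Sum>i\<in>I. c i * f (x i))\<^sup>2)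
      = (\<Sum>i\<in>I. \<Sum>j\<in>I. c i * c j * wiener_kernel d r (x i) (x j))"
    unfolding power2_eq_square by (rule covariance_sum(2)) (use assms in auto)
  also have "\<dots> = (\<integral>s. (\<Sum>i\<in>I. c i * sheet_kernel d r (x i) s)\<^sup>2 \<partial>cube_measure d)"
    unfolding eq using assms
    by (simp add: Bochner_Integration.integral_sum sheet_kernel_prod_integrable wiener_kernel_integral
       Bochner_Integration.integrable_sum)
  finally show ?thesis .
qed

text \<open>Measurability comes from joint measurability of \<open>(f, x) \<mapsto> f x\<close> and
  not from continuity of the functional.\<close>

lemma integral_in_F_dual:
  assumes \<psi>: "\<psi> \<in> borel_measurable (cube_measure d)" "\<And>x. x \<in> cube d \<Longrightarrow> \<bar>\<psi> x\<bar> \<le> B"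
  shows "(\<lambda>f. \<integral>x. f x * \<psi> x \<partial>cube_measure d) \<in> F_dual d r"
    and "(\<lambda>f. \<integral>x. f x * \<psi> x \<partial>cube_measure d) \<in> borel_measurable \<mu>"
proof -
  have meas: "f \<in> borel_measurable (cube_measure d)" if "f \<in> F_space d r" for f
    by (rule measurable_cube_continuous[OF F_space_continuous[OF that]])
  have bd: "\<bar>f x * \<psi> x\<bar> \<le> F_norm d r f * B" if "f \<in> F_space d r" "x \<in> cube d" for f x
    unfolding abs_mult using F_norm_upper[OF that] by (intro mult_mono assms that) auto
  have int: "integrable (cube_measure d) (\<lambda>x. f x * \<psi> x)" if "f \<in> F_space d r" for f
    by (rule cube.integrable_const_bound[where B="F_norm d r f * B"])
      (use bd[OF that] meas[OF that] \<psi> in auto)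
  have "\<bar>\<integral>x. f x * \<psi> x \<partial>cube_measure d\<bar> \<le> B * F_norm d r f" if f: "f \<in> F_space d r" for f
  proof -
    have "\<bar>\<integral>x. f x * \<psi> x \<partial>cube_measure d\<bar> \<le> (\<integral>x. F_norm d r f * B \<partial>cube_measure d)"
      by (intro integral_abs_le_integral int f) (use bd[OF f] in auto)
    then show ?thesis by (simp add: cube.prob_space mult.commute)
  qed
  then show "(\<lambda>f. \<integral>x. f x * \<psi> x \<partial>cube_measure d) \<in> F_dual d r"
    unfolding F_dual_def using int by (auto simp: distrib_right mult.assoc)
  have "(\<lambda>(f, x). f x * \<psi> x) \<in> borel_measurable (\<mu> \<Otimes>\<^sub>M cube_measure d)"
    unfolding case_prod_unfold
    by (intro borel_measurable_times measurable_compose[OF measurable_snd \<psi>(1)])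
      (use eval_pair_measurable in \<open>simp add: case_prod_unfold\<close>)
  then show "(\<lambda>f. \<integral>x. f x * \<psi> x \<partial>cube_measure d) \<in> borel_measurable \<mu>"
    by (rule cube.borel_measurable_lebesgue_integral)
qed

text \<open>Fubini reduces the covariance to point values. Integrability on the product holds
  because the absolute moments at fixed \<open>x\<close> are bounded uniformly in
  \<open>x\<close>.\<close>

lemma covariance_integral:
  assumes \<psi>: "\<psi> \<in> borel_measurable (cube_measure d)" "\<And>x. x \<in> cube d \<Longrightarrow> \<bar>\<psi> x\<bar> \<le> B"
    and y: "\<And>k. k \<in> J \<Longrightarrow> y k \<in> cube d"
  shows "expectation (\<lambda>f. (\<integral>x. f x * \<psi> x \<partial>cube_measure d) * (\<Sum>k\<in>J. c k * f (y k)))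
    = (\<integral>x. \<psi> x * (\<Sum>k\<in>J. c k * wiener_kernel d r x (y k)) \<partial>cube_measure d)"
proof -
  note measurable_expectation = borel_measurable_lebesgue_integral
  interpret pair_sigma_finite "cube_measure d" \<mu> by unfold_locales
  let ?\<xi> = "\<lambda>f. \<Sum>k\<in>J. c k * f (y k)"
  let ?G = "\<lambda>x f. f x * \<psi> x * ?\<xi> f"
  have \<xi>m: "?\<xi> \<in> borel_measurable \<mu>" by (rule eval_sum_measurable[OF y])
  have \<xi>i: "integrable \<mu> (\<lambda>f. (?\<xi> f)\<^sup>2)"
    using covariance_sum(1)[of J y J y c c] y by (simp add: power2_eq_square)
  have ev: "(\<lambda>p. snd p (fst p)) \<in> borel_measurable (cube_measure d \<Otimes>\<^sub>M \<mu>)"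
    using measurable_compose[OF measurable_pair_swap' eval_pair_measurable] by (simp add: case_prod_beta)
  have Gm: "(\<lambda>p. ?G (fst p) (snd p)) \<in> borel_measurable (cube_measure d \<Otimes>\<^sub>M \<mu>)"
    by (intro borel_measurable_times ev measurable_compose[OF measurable_fst \<psi>(1)]
        measurable_compose[OF measurable_snd \<xi>m])
  have Gi: "integrable \<mu> (?G x)" if "x \<in> cube d" for x
  proof -
    have "integrable \<mu> (\<lambda>f. \<psi> x * (f x * ?\<xi> f))"
      by (intro integrable_mult_right integrable_product eval_square_integrable \<xi>i \<xi>m eval_measurable that)
    then show ?thesis by (simp add: mult_ac)
  qed
  \<comment> \<open>The summand 1 is the bound of \<open>wiener_kernel_diag\<close> for the variance
    of \<open>f x\<close>.\<close>
  let ?C = "B * (1 + expectation (\<lambda>f. (?\<xi> f)\<^sup>2))"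
  have Gb: "(\<integral>f. norm (?G x f) \<partial>\<mu>) \<le> ?C" if x: "x \<in> cube d" for x
  proof -
    have "norm (?G x f) \<le> B * ((f x)\<^sup>2 + (?\<xi> f)\<^sup>2)" for f
    proof -
      have "norm (?G x f) = \<bar>\<psi> x\<bar> * \<bar>f x * ?\<xi> f\<bar>" by (simp add: abs_mult)
      also have "\<dots> \<le> B * ((f x)\<^sup>2 + (?\<xi> f)\<^sup>2)"
        by (intro mult_mono \<psi>(2) x abs_mult_le_squares) (use \<psi>(2)[OF x] in auto)
      finally show ?thesis .
    qed
    then have "(\<integral>f. norm (?G x f) \<partial>\<mu>) \<le> (\<integral>f. B * ((f x)\<^sup>2 + (?\<xi> f)\<^sup>2) \<partial>\<mu>)"
      by (intro integral_mono integrable_norm Gi x integrable_mult_right Bochner_Integration.integrable_add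
          eval_square_integrable \<xi>i)
    also have "\<dots> = B * (wiener_kernel d r x x + expectation (\<lambda>f. (?\<xi> f)\<^sup>2))"
      using eval_square_integrable[OF x] \<xi>i covariance_eval[OF x x] by (simp add: power2_eq_square)
    also have "\<dots> \<le> ?C"
      using \<psi>(2)[OF x] wiener_kernel_diag[OF x] by (intro mult_left_mono) auto
    finally show ?thesis .
  qed
  have int: "integrable (cube_measure d \<Otimes>\<^sub>M \<mu>) (\<lambda>p. ?G (fst p) (snd p))"
  proof (rule Fubini_integrable[OF Gm])
    show "integrable (cube_measure d) (\<lambda>x. \<integral>f. norm (?G (fst (x, f)) (snd (x, f))) \<partial>\<mu>)"
    proof (rule cube.integrable_const_bound[where B="?C"])
      show "AE x in cube_measure d. norm (\<integral>f. norm (?G (fst (x, f)) (snd (x, f))) \<partial>\<mu>) \<le> ?C"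
        using Gb by auto
      show "(\<lambda>x. \<integral>f. norm (?G (fst (x, f)) (snd (x, f))) \<partial>\<mu>) \<in> borel_measurable (cube_measure d)"
        by (rule measurable_expectation) (use Gm in \<open>simp add: case_prod_beta\<close>)
    qed
    show "AE x in cube_measure d. integrable \<mu> (\<lambda>f. ?G (fst (x, f)) (snd (x, f)))"
      using Gi by auto
  qed
  have "expectation (\<lambda>f. (\<integral>x. f x * \<psi> x \<partial>cube_measure d) * ?\<xi> f)
      = (\<integral>f. (\<integral>x. ?G x f \<partial>cube_measure d) \<partial>\<mu>)" by simp
  also have "\<dots> = (\<integral>x. (\<integral>f. ?G x f \<partial>\<mu>) \<partial>cube_measure d)"
    using int by (intro Fubini_integral) (simp add: case_prod_unfold)
  also have "\<dots> = (\<integral>x. \<psi> x * (\<Sum>k\<in>J. c k * wiener_kernel d r x (y k)) \<partial>cube_measure d)"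
  proof (rule Bochner_Integration.integral_cong[OF refl])
    fix x assume "x \<in> space (cube_measure d)"
    then have x: "x \<in> cube d" by simp
    have "(\<integral>f. ?G x f \<partial>\<mu>) = (\<integral>f. \<psi> x * ((\<Sum>i\<in>{x}. 1 * f i) * ?\<xi> f) \<partial>\<mu>)" by (simp add: mult_ac)
    also have "\<dots> = \<psi> x * (\<integral>f. (\<Sum>i\<in>{x}. 1 * f i) * ?\<xi> f \<partial>\<mu>)" by (rule integral_mult_right_zero)
    also have "(\<integral>f. (\<Sum>i\<in>{x}. 1 * f i) * ?\<xi> f \<partial>\<mu>) = (\<Sum>k\<in>J. c k * wiener_kernel d r x (y k))"
      using covariance_sum(2)[of "{x}" "\<lambda>i. i" J y "\<lambda>_. 1" c] x y by simp
    finally show "(\<integral>f. ?G x f \<partial>\<mu>) = \<psi> x * (\<Sum>k\<in>J. c k * wiener_kernel d r x (y k))" .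
  qed
  finally show ?thesis .
qed

end

subsection \<open>Linear algorithms\<close>

text \<open>A continuous function on the cube is described up to \<open>1 / Suc k\<close> by a
  finite cover with basic open sets and one rational value on each. There are countably many
  descriptions, and one member of the space is chosen for each that is realized. The dense set
  serves \<open>norm_S_measurable\<close>.\<close>

lemma F_space_separable:
  "\<exists>H \<subseteq> F_space d r. countable H \<and> (\<forall>f\<in>F_space d r. \<forall>e>0. \<exists>h\<in>H. \<forall>x\<in>cube d. \<bar>f x - h x\<bar> \<le> e)"
proof -
  obtain \<B> :: "point set set" where \<B>: "countable \<B>" "topological_basis \<B>"
    using ex_countable_basis by blast
  \<comment> \<open>The members of the space that fit the description; any two of them differ by at
    most \<open>2 / Suc k\<close> on the cube.\<close>
  define C where "C = (\<lambda>(T, k::nat). {f \<in> F_space d r. cube d \<subseteq> \<Union>(fst ` T) \<and>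
    (\<forall>(V, q)\<in>T. \<forall>x\<in>V \<inter> cube d. \<bar>f x - q\<bar> \<le> 1 / Suc k)})"
  define Z where "Z = {T. finite T \<and> T \<subseteq> \<B> \<times> (\<rat> :: real set)} \<times> (UNIV :: nat set)"
  define H where "H = (\<lambda>z. SOME f. f \<in> C z) ` {z \<in> Z. C z \<noteq> {}}"
  have inC: "(SOME f. f \<in> C z) \<in> C z" if "C z \<noteq> {}" for z using that by (simp add: some_in_eq)
  show ?thesis
  proof (intro exI[of _ H] conjI ballI allI impI)
    show "H \<subseteq> F_space d r" using inC unfolding H_def C_def by fastforce
    have "countable Z" unfolding Z_def
      by (intro countable_SIGMA countable_Collect_finite_subset \<B> countable_rat) auto
    then show "countable H" unfolding H_def by (intro countable_image) (auto intro: countable_subset)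
    fix f and e :: real assume f: "f \<in> F_space d r" and e: "e > 0"
    obtain k :: nat where k: "2 / real (Suc k) \<le> e"
    proof -
      obtain k where "inverse (real (Suc k)) < e / 2" using reals_Archimedean[of "e/2"] e by auto
      then have "2 / real (Suc k) \<le> e" by (simp add: inverse_eq_divide field_simps)
      then show ?thesis by (rule that)
    qed
    \<comment> \<open>The tolerance is split evenly between the oscillation of \<open>f\<close> on a
      basic set and the distance from \<open>f x\<close> to the rational value.\<close>
    define \<delta> where "\<delta> = 1 / (2 * real (Suc k))"
    have d0: "\<delta> > 0" and d2: "\<delta> + \<delta> = 1 / Suc k" by (simp_all add: \<delta>_def field_simps)
    have "\<exists>V q. V \<in> \<B> \<and> q \<in> \<rat> \<and> x \<in> V \<and> (\<forall>y\<in>V \<inter> cube d. \<bar>f y - q\<bar> \<le> 1 / Suc k)" if x: "x \<in> cube d" for x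
    proof -
      obtain A where A: "open A" "x \<in> A" "\<forall>y\<in>cube d. y \<in> A \<longrightarrow> dist (f y) (f x) < \<delta>"
        using F_space_continuous[OF f] x d0 unfolding continuous_on_topological
        by (metis dist_commute mem_ball centre_in_ball open_ball)
      obtain V where V: "V \<in> \<B>" "x \<in> V" "V \<subseteq> A"
        using topological_basisE[OF \<B>(2) A(1,2)] by metis
      obtain q where q: "q \<in> \<rat>" "f x - \<delta> < q" "q < f x + \<delta>"
        using Rats_dense_in_real[of "f x - \<delta>" "f x + \<delta>"] d0 by (auto simp del: of_nat_Suc)
      have "\<bar>f y - q\<bar> \<le> 1 / Suc k" if "y \<in> V \<inter> cube d" for y
      proof -
        have "\<bar>f y - f x\<bar> < \<delta>" using A(3) V(3) that by (auto simp: dist_real_def)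
        then show ?thesis using q d2 by linarith
      qed
      then show ?thesis using V q by blast
    qed
    then obtain V q where Vq: "\<And>x. x \<in> cube d \<Longrightarrow> V x \<in> \<B> \<and> q x \<in> \<rat> \<and> x \<in> V x
        \<and> (\<forall>y\<in>V x \<inter> cube d. \<bar>f y - q x\<bar> \<le> 1 / Suc k)" by metis
    have "open (V x)" if "x \<in> cube d" for x
      using Vq[OF that] \<B>(2) by (auto simp: topological_basis_open)
    then obtain X where X: "X \<subseteq> cube d" "finite X" "cube d \<subseteq> (\<Union>x\<in>X. V x)"
      using compactE_image[OF compact_cube[of d], of "cube d" V] Vq by (metis UN_I subsetI)
    define z where "z = ((\<lambda>x. (V x, q x)) ` X, k)"
    have "f \<in> C z" unfolding C_def z_def using X f Vq by (auto simp: image_image)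
    then have z: "z \<in> Z" "C z \<noteq> {}" using X Vq by (auto simp: Z_def z_def)
    define h where "h = (SOME f. f \<in> C z)"
    have h: "h \<in> C z" unfolding h_def by (rule inC[OF z(2)])
    show "\<exists>h\<in>H. \<forall>x\<in>cube d. \<bar>f x - h x\<bar> \<le> e"
    proof (intro bexI ballI)
      show "h \<in> H" using z by (auto simp: H_def h_def)
      fix y assume y: "y \<in> cube d"
      then obtain x where x: "x \<in> X" "y \<in> V x" using X by blast
      then have "\<bar>f y - q x\<bar> \<le> 1 / Suc k" "\<bar>h y - q x\<bar> \<le> 1 / Suc k"
        using Vq X y h unfolding C_def z_def by auto
      moreover have "1 / real (Suc k) + 1 / real (Suc k) \<le> e" using k by simp
      ultimately show "\<bar>f y - h y\<bar> \<le> e" by linarith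
    qed
  qed
qed

section \<open>Square integrable functions and their classes\<close>

lemma L2_fun_bounded:
  assumes "f \<in> borel_measurable (cube_measure d)" "\<And>x. x \<in> cube d \<Longrightarrow> \<bar>f x\<bar> \<le> B"
  shows "f \<in> L2_funs d"
proof -
  have "integrable (cube_measure d) (\<lambda>x. (f x)\<^sup>2)"
  proof (rule cube.integrable_const_bound[where B="B\<^sup>2"])
    show "AE x in cube_measure d. norm ((f x)\<^sup>2) \<le> B\<^sup>2"
      by (intro AE_I2) (auto simp flip: abs_le_square_iff intro: order_trans[OF assms(2) abs_ge_self])
  qed (use assms in measurable)
  then show ?thesis using assms by (simp add: L2_funs_def)
qed

lemma F_space_L2: "f \<in> F_space d r \<Longrightarrow> f \<in> L2_funs d"
  using F_norm_upper by (intro L2_fun_bounded measurable_cube_continuous F_space_continuous)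

lemma L2_product_integrable:
  assumes "f \<in> L2_funs d" "g \<in> L2_funs d"
  shows "integrable (cube_measure d) (\<lambda>x. f x * g x)"
proof (rule Bochner_Integration.integrable_bound)
  show "integrable (cube_measure d) (\<lambda>x. (f x)\<^sup>2 + (g x)\<^sup>2)" using assms by (simp add: L2_funs_def)
  show "AE x in cube_measure d. norm (f x * g x) \<le> norm ((f x)\<^sup>2 + (g x)\<^sup>2)"
    by (auto simp: abs_mult_le_squares simp del: abs_mult)
qed (use assms in \<open>auto simp: L2_funs_def\<close>)

lemma L2_funs_linear:
  assumes "f \<in> L2_funs d" "g \<in> L2_funs d"
  shows "(\<lambda>x. c * f x + g x) \<in> L2_funs d"
proof -
  have "(c * f x + g x)\<^sup>2 = c\<^sup>2 * (f x)\<^sup>2 + 2 * c * (f x * g x) + (g x)\<^sup>2" for x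
    by (simp add: power2_eq_square algebra_simps)
  then show ?thesis
    using assms L2_product_integrable[OF assms] by (auto simp: L2_funs_def)
qed

lemma L2_funs_zero: "(\<lambda>_. 0) \<in> L2_funs d"
  by (simp add: L2_funs_def)

lemma L2_class_self: "f \<in> L2_funs d \<Longrightarrow> f \<in> L2_class d f"
  by (simp add: L2_class_def)

lemma L2_rep_class:
  assumes "f \<in> L2_funs d"
  shows "L2_rep (L2_class d f) \<in> L2_funs d" "AE x in cube_measure d. L2_rep (L2_class d f) x = f x"
proof -
  have "L2_rep (L2_class d f) \<in> L2_class d f"
    unfolding L2_rep_def using L2_class_self[OF assms] by (rule someI[where P="\<lambda>g. g \<in> L2_class d f"])
  then show "L2_rep (L2_class d f) \<in> L2_funs d" "AE x in cube_measure d. L2_rep (L2_class d f) x = f x"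
    by (auto simp: L2_class_def)
qed

lemma L2_class_cong: "AE x in cube_measure d. f x = g x \<Longrightarrow> L2_class d f = L2_class d g"
  unfolding L2_class_def by (rule Collect_cong) auto

lemma L2_hadd:
  "f \<in> L2_funs d \<Longrightarrow> g \<in> L2_funs d \<Longrightarrow>
    hadd (L2 d) (L2_class d f) (L2_class d g) = L2_class d (\<lambda>x. f x + g x)"
  using L2_rep_class(2)[of f d] L2_rep_class(2)[of g d] by (auto simp: L2_def intro!: L2_class_cong)

lemma L2_hscale:
  "f \<in> L2_funs d \<Longrightarrow> hscale (L2 d) c (L2_class d f) = L2_class d (\<lambda>x. c * f x)"
  using L2_rep_class(2)[of f d] by (auto simp: L2_def intro!: L2_class_cong)

lemma L2_hinner:
  assumes "f \<in> L2_funs d" "g \<in> L2_funs d"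
  shows "hinner (L2 d) (L2_class d f) (L2_class d g) = (\<integral>x. f x * g x \<partial>cube_measure d)"
proof -
  note m = L2_rep_class[OF assms(1)] L2_rep_class[OF assms(2)]
  have "(\<integral>x. L2_rep (L2_class d f) x * L2_rep (L2_class d g) x \<partial>cube_measure d) = (\<integral>x. f x * g x \<partial>cube_measure d)"
    by (rule integral_cong_AE) (use m assms in \<open>auto simp: L2_funs_def\<close>)
  then show ?thesis by (simp add: L2_def)
qed

lemma L2_carrier: "f \<in> L2_funs d \<Longrightarrow> L2_class d f \<in> hcarrier (L2 d)"
  by (simp add: L2_def)

lemma L2_hnorm: "f \<in> L2_funs d \<Longrightarrow> hnorm (L2 d) (L2_class d f) = sqrt (\<integral>x. (f x)\<^sup>2 \<partial>cube_measure d)"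
  by (simp add: hnorm_def L2_hinner power2_eq_square)

text \<open>Cauchy-Schwarz and the triangle inequality are read off the nonnegative quadratic
  polynomial in \<open>c\<close> alone. In this form the lemma serves integrals over the cube as
  well as the record \<open>hilbert\<close>.\<close>

lemma semi_inner_triangle:
  fixes B :: "'a \<Rightarrow> 'a \<Rightarrow> real"
  assumes nonneg: "\<And>c. 0 \<le> B u u + 2 * c * B u v + c\<^sup>2 * B v v" and "0 \<le> B v v"
  shows "sqrt (B u u + 2 * B u v + B v v) \<le> sqrt (B u u) + sqrt (B v v)"
proof -
  have u: "0 \<le> B u u" using nonneg[of 0] by simp
  have cs: "(B u v)\<^sup>2 \<le> B u u * B v v"
  proof (cases "B v v = 0")
    case True
    have "B u v = 0"
    proof (rule ccontr)
      assume n: "B u v \<noteq> 0"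
      \<comment> \<open>With \<open>B v v = 0\<close> the polynomial is affine in \<open>c\<close>,
        and at this \<open>c\<close> it takes the value -1.\<close>
      have "2 * (- (B u u + 1) / (2 * B u v)) * B u v = - (B u u + 1)" using n by simp
      then show False using nonneg[of "- (B u u + 1) / (2 * B u v)"] True by simp
    qed
    then show ?thesis using True by simp
  next
    case False
    then have "B v v > 0" using assms by simp
    then show ?thesis using nonneg[of "- B u v / B v v"] by (simp add: field_simps power2_eq_square)
  qed
  have "B u v \<le> sqrt (B u u) * sqrt (B v v)"
    using real_sqrt_le_mono[OF cs] by (simp add: real_sqrt_mult)
  then have "B u u + 2 * B u v + B v v \<le> (sqrt (B u u) + sqrt (B v v))\<^sup>2"
    using u assms(2) by (simp add: power2_sum)
  then show ?thesis by (rule real_le_lsqrt[rotated -1, OF _ add_nonneg_nonneg]) (use u assms(2) in auto)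
qed

\<comment> \<open>Linear sampling algorithms and their cost\<close>
inductive_simps runs_ReturnI: "runs H (Return x) xs us v k"
inductive_simps runs_VAddI: "runs H (VAdd x y p) xs us v k"
inductive_simps runs_VScaleI: "runs H (VScale x y p) xs us v k"

text \<open>Vector register \<open>k\<close> holds the partial sum and scalar register
  \<open>i\<close> the next coefficient. Each term appends the scaled element as register
  \<open>Suc k\<close> and the new sum as register \<open>Suc (Suc k)\<close>.\<close>

primrec combine_prog :: "nat \<Rightarrow> nat \<Rightarrow> 'g list \<Rightarrow> 'g program" where
  "combine_prog i k [] = Return (Reg k)"
| "combine_prog i k (g # gs) =
     VScale (Reg i) (Const g) (VAdd (Reg k) (Reg (Suc k)) (combine_prog (Suc i) (Suc (Suc k)) gs))"

fun linear_prog :: "'g \<Rightarrow> 'g list \<Rightarrow> 'g program" where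
  "linear_prog z [] = Return (Const z)"
| "linear_prog z (g # gs) = VScale (Reg 0) (Const g) (combine_prog 1 0 gs)"

text \<open>By the isometry \<open>variance_sum\<close> this is the mean square L2 error, under the
  sheet, of recovering \<open>f\<close> by the sum of the \<open>f (t i)\<close> times
  \<open>b i\<close>. It no longer mentions the Gaussian measure.\<close>

definition sampling_error :: "nat \<Rightarrow> (nat \<Rightarrow> nat) \<Rightarrow> nat \<Rightarrow> (nat \<Rightarrow> point) \<Rightarrow> (nat \<Rightarrow> func) \<Rightarrow> ennreal" where
  "sampling_error d r n t b = (\<integral>\<^sup>+x. (\<integral>\<^sup>+s. ennreal ((sheet_kernel d r x s
     - (\<Sum>i<n. b i x * sheet_kernel d r (t i) s))\<^sup>2) \<partial>cube_measure d) \<partial>cube_measure d)"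

text \<open>The algebraic laws are stated on the range of \<open>S\<close>, so that
  \<open>L2 d\<close> with its quotient operations and an abstract target space are treated
  together.\<close>

locale bounded_problem = wiener_sheet +
  fixes H :: "'g hilbert" and S :: "func \<Rightarrow> 'g" and K :: real
  assumes carrier: "f \<in> F_space d r \<Longrightarrow> S f \<in> hcarrier H"
    and S_add: "f \<in> F_space d r \<Longrightarrow> g \<in> F_space d r \<Longrightarrow> hadd H (S f) (S g) = S (\<lambda>x. f x + g x)"
    and S_scale: "f \<in> F_space d r \<Longrightarrow> hscale H c (S f) = S (\<lambda>x. c * f x)"
    and norm_nonneg: "f \<in> F_space d r \<Longrightarrow> 0 \<le> hnorm H (S f)"
    and triangle: "f \<in> F_space d r \<Longrightarrow> g \<in> F_space d r \<Longrightarrow>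
      hnorm H (S (\<lambda>x. f x + g x)) \<le> hnorm H (S f) + hnorm H (S g)"
    and K: "0 \<le> K"
    and bound: "f \<in> F_space d r \<Longrightarrow> hnorm H (S f) \<le> K * sqrt (\<integral>x. (f x)\<^sup>2 \<partial>cube_measure d)"
begin

lemma hdist_S: "f \<in> F_space d r \<Longrightarrow> g \<in> F_space d r \<Longrightarrow> hdist H (S f) (S g) = hnorm H (S (\<lambda>x. f x - g x))"
  by (simp only: hdist_def S_scale S_add F_space_scale) simp

lemma runs_combine_prog:
  assumes "\<And>b. b \<in> set bs \<Longrightarrow> b \<in> F_space d r" "a \<in> F_space d r"
    and "us \<noteq> []" "k = length us - 1" "us ! k = S a" "i + length bs \<le> length xs"
  shows "runs H (combine_prog i k (map S bs)) xs us v j \<longleftrightarrow>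
    v = S (\<lambda>x. a x + (\<Sum>l<length bs. xs ! (i + l) * (bs ! l) x)) \<and> j = 2 * length bs"
  using assms
proof (induction bs arbitrary: a us k i j)
  case Nil
  then show ?case by (auto simp: runs_ReturnI carrier)
next
  case (Cons b bs)
  let ?u = "S (\<lambda>x. xs ! i * b x)" and ?a = "\<lambda>x. a x + xs ! i * b x"
  have b: "b \<in> F_space d r" "(\<lambda>x. xs ! i * b x) \<in> F_space d r" "?a \<in> F_space d r"
    using Cons.prems by (auto intro!: F_space_scale F_space_add)
  have k: "k < length us" "Suc k = length us" using Cons.prems by (auto simp: Suc_leI)
  have eq: "(\<lambda>x. ?a x + (\<Sum>l<length bs. xs ! (Suc i + l) * (bs ! l) x))
      = (\<lambda>x. a x + (\<Sum>l<length (b # bs). xs ! (i + l) * ((b # bs) ! l) x))"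
    by (simp add: sum.lessThan_Suc_shift add.assoc del: sum.lessThan_Suc)
  have IH: "runs H (combine_prog (Suc i) (Suc (Suc k)) (map S bs)) xs (us @ [?u, S ?a]) v j' \<longleftrightarrow>
      v = S (\<lambda>x. ?a x + (\<Sum>l<length bs. xs ! (Suc i + l) * (bs ! l) x)) \<and> j' = 2 * length bs" for j'
    by (rule Cons.IH) (use Cons.prems b k in \<open>auto simp: nth_append\<close>)
  have "runs H (combine_prog i k (map S (b # bs))) xs us v j \<longleftrightarrow>
      (\<exists>j'. j = Suc (Suc j') \<and> runs H (combine_prog (Suc i) (Suc (Suc k)) (map S bs)) xs (us @ [?u, S ?a]) v j')"
    using Cons.prems b k by (auto simp: runs_VScaleI runs_VAddI S_scale S_add nth_append carrier)
  also have "\<dots> \<longleftrightarrow> v = S (\<lambda>x. a x + (\<Sum>l<length (b # bs). xs ! (i + l) * ((b # bs) ! l) x)) \<and> j = 2 * length (b # bs)"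
    unfolding IH eq by auto
  finally show ?case .
qed

text \<open>The first term costs one scaling, each further term a scaling and an addition. For
  \<open>n = 0\<close> the zero element is returned at no cost, in agreement with truncated
  subtraction.\<close>

lemma runs_linear_prog:
  assumes b: "\<And>i. i < n \<Longrightarrow> b i \<in> F_space d r" and "length xs = n"
  shows "runs H (linear_prog (S (\<lambda>_. 0)) (map S (map b [0..<n]))) xs [] v j \<longleftrightarrow>
    v = S (\<lambda>x. \<Sum>i<n. xs ! i * b i x) \<and> j = 2 * n - 1"
proof (cases n)
  case 0
  then show ?thesis by (auto simp: runs_ReturnI carrier F_space_zero)
next
  case (Suc m)
  let ?bs = "map b [1..<Suc m]"
  have l: "[0..<n] = 0 # [1..<Suc m]" by (simp add: Suc upt_rec)
  have b0: "b 0 \<in> F_space d r" using b Suc by simp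
  have *: "runs H (combine_prog 1 0 (map S ?bs)) xs [S (\<lambda>x. xs ! 0 * b 0 x)] v j' \<longleftrightarrow>
      v = S (\<lambda>x. xs ! 0 * b 0 x + (\<Sum>l<length ?bs. xs ! (1 + l) * (?bs ! l) x)) \<and> j' = 2 * length ?bs" for j'
    by (rule runs_combine_prog) (use b b0 Suc assms in \<open>auto intro: F_space_scale\<close>)
  have eq: "(\<lambda>x. xs ! 0 * b 0 x + (\<Sum>l<length ?bs. xs ! (1 + l) * (?bs ! l) x)) = (\<lambda>x. \<Sum>i<n. xs ! i * b i x)"
    by (auto simp: Suc sum.lessThan_Suc_shift nth_map_upt simp del: sum.lessThan_Suc upt_Suc
        intro!: ext sum.cong)
  have "runs H (linear_prog (S (\<lambda>_. 0)) (map S (map b [0..<n]))) xs [] v j \<longleftrightarrow>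
      (\<exists>j'. j = Suc j' \<and> runs H (combine_prog 1 0 (map S ?bs)) xs [S (\<lambda>x. xs ! 0 * b 0 x)] v j')"
    unfolding l using assms Suc b0 by (auto simp: runs_VScaleI S_scale carrier)
  also have "\<dots> \<longleftrightarrow> v = S (\<lambda>x. \<Sum>i<n. xs ! i * b i x) \<and> j = 2 * n - 1"
    unfolding * eq using Suc by auto
  finally show ?thesis .
qed

text \<open>\<open>S\<close> is Lipschitz with respect to the L2 norm, so the norm of
  \<open>S (T f)\<close> is the infimum, over a countable dense set of \<open>h\<close>, of the norm
  of \<open>S h\<close> plus \<open>K\<close> times the L2 distance of \<open>T f\<close> and
  \<open>h\<close>. Each of these bounds is measurable in \<open>f\<close> as a parameter
  integral.\<close>

lemma norm_S_measurable:
  assumes T: "\<And>f. f \<in> F_space d r \<Longrightarrow> T f \<in> F_space d r"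
    and Tm: "(\<lambda>(f, x). T f x) \<in> borel_measurable (\<mu> \<Otimes>\<^sub>M cube_measure d)"
  shows "(\<lambda>f. ennreal (hnorm H (S (T f)))) \<in> borel_measurable \<mu>"
proof -
  obtain A where A: "A \<subseteq> F_space d r" "countable A"
    "\<And>f e. f \<in> F_space d r \<Longrightarrow> e > 0 \<Longrightarrow> \<exists>h\<in>A. \<forall>x\<in>cube d. \<bar>f x - h x\<bar> \<le> e"
    using F_space_separable[of d r] by blast
  let ?b = "\<lambda>h f. hnorm H (S h) + K * sqrt (\<integral>x. (T f x - h x)\<^sup>2 \<partial>cube_measure d)"
  have meas: "(\<lambda>f. ennreal (?b h f)) \<in> borel_measurable \<mu>" if "h \<in> A" for h
  proof -
    have hm: "h \<in> borel_measurable (cube_measure d)"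
      using that A(1) by (intro measurable_cube_continuous F_space_continuous) auto
    have "(\<lambda>(f, x). (T f x - h x)\<^sup>2) \<in> borel_measurable (\<mu> \<Otimes>\<^sub>M cube_measure d)"
      unfolding case_prod_unfold
      by (intro borel_measurable_power borel_measurable_diff measurable_compose[OF measurable_snd hm])
        (use Tm in \<open>simp add: case_prod_unfold\<close>)
    then have "(\<lambda>f. \<integral>x. (T f x - h x)\<^sup>2 \<partial>cube_measure d) \<in> borel_measurable \<mu>"
      by (rule cube.borel_measurable_lebesgue_integral)
    then show ?thesis by measurable
  qed
  have eq: "ennreal (hnorm H (S (T f))) = (INF h\<in>A. ennreal (?b h f))" if f: "f \<in> F_space d r" for f
  proof (rule antisym)
    note Tf = T[OF f]
    have le: "hnorm H (S g) \<le> hnorm H (S h) + K * sqrt (\<integral>x. (g x - h x)\<^sup>2 \<partial>cube_measure d)"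
      if "g \<in> F_space d r" "h \<in> F_space d r" for g h
      using triangle[OF that(2) F_space_diff[OF that]] bound[OF F_space_diff[OF that]] by simp
    show "ennreal (hnorm H (S (T f))) \<le> (INF h\<in>A. ennreal (?b h f))"
      using le[OF Tf] A(1) by (intro INF_greatest ennreal_leI) auto
    show "(INF h\<in>A. ennreal (?b h f)) \<le> ennreal (hnorm H (S (T f)))"
    proof (rule ennreal_le_epsilon)
      fix e :: real assume e: "e > 0"
      \<comment> \<open>The Lipschitz bound is used twice at distance \<open>e'\<close>; the added 1
        keeps the denominator positive when \<open>K = 0\<close>.\<close>
      define e' where "e' = e / (2 * K + 1)"
      have e': "e' > 0" "2 * K * e' \<le> e" using e K by (auto simp: e'_def field_simps)
      obtain h where h: "h \<in> A" "\<And>x. x \<in> cube d \<Longrightarrow> \<bar>T f x - h x\<bar> \<le> e'" using A(3)[OF Tf e'(1)] by blast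
      have hF: "h \<in> F_space d r" using h A by auto
      have small: "sqrt (\<integral>x. (g x)\<^sup>2 \<partial>cube_measure d) \<le> e'"
        if "g \<in> F_space d r" "\<And>x. x \<in> cube d \<Longrightarrow> \<bar>g x\<bar> \<le> e'" for g
      proof -
        have "(\<integral>x. (g x)\<^sup>2 \<partial>cube_measure d) \<le> (\<integral>x. e'\<^sup>2 \<partial>cube_measure d)"
          using F_space_L2[OF that(1)] that(2) e'
          by (intro integral_mono) (auto simp: L2_funs_def intro!: abs_le_square_iff[THEN iffD1])
        then show ?thesis using e' by (intro real_le_lsqrt) auto
      qed
      have s1: "sqrt (\<integral>x. (T f x - h x)\<^sup>2 \<partial>cube_measure d) \<le> e'"
        by (rule small) (use h F_space_diff[OF Tf hF] in auto)
      have s2: "sqrt (\<integral>x. (h x - T f x)\<^sup>2 \<partial>cube_measure d) \<le> e'"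
        by (rule small) (use h F_space_diff[OF hF Tf] in \<open>auto simp: abs_minus_commute\<close>)
      have "?b h f \<le> hnorm H (S (T f)) + K * e' + K * e'"
        using le[OF hF Tf] mult_left_mono[OF s1 K] mult_left_mono[OF s2 K] by linarith
      also have "\<dots> \<le> hnorm H (S (T f)) + e" using e' by simp
      finally have "ennreal (?b h f) \<le> ennreal (hnorm H (S (T f))) + ennreal e"
        using norm_nonneg[OF Tf] e by (simp flip: ennreal_plus add: ennreal_leI)
      then show "(INF h\<in>A. ennreal (?b h f)) \<le> ennreal (hnorm H (S (T f))) + ennreal e"
        using h(1) by (intro INF_lower2) auto
    qed
  qed
  have "(\<lambda>f. INF h\<in>A. ennreal (?b h f)) \<in> borel_measurable \<mu>"
    using A(2) meas by (intro borel_measurable_INF) auto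
  then show ?thesis
    using eq by (subst measurable_cong[where g="\<lambda>f. INF h\<in>A. ennreal (?b h f)"]) (auto simp: space_sheet)
qed

text \<open>Nonadaptive sampling costs \<open>c\<close> per value plus at most two operations.
  Tonelli exchanges the L2 norm with the expectation, and at each fixed \<open>x\<close> the
  isometry turns the expectation into an integral of \<open>sheet_kernel\<close>. All
  \<open>t i\<close> lie in the cube because \<open>next_fun\<close> must belong to the class at
  every list, including lists longer than \<open>n\<close>.\<close>

lemma linear_algorithm:
  fixes \<kappa> :: "information \<Rightarrow> func \<Rightarrow> real"
  assumes t: "\<And>i. t i \<in> cube d" and b: "\<And>i. i < n \<Longrightarrow> b i \<in> F_space d r"
    and c: "c > 0" and \<kappa>: "information_cost (F_space d r) c \<kappa>"
    and P: "P = \<lparr>dimension = d, smoothness = r, meas = \<mu>, target = H, solution = S,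
      eval_cost = c, info_cost = \<kappa>\<rparr>"
  obtains U where "is_algorithm P Std U" "avg_cost P U \<le> ennreal ((c + 2) * real n)"
    "(\<integral>\<^sup>+f. sq_error P U f \<partial>\<mu>) \<le> ennreal (K\<^sup>2) * sampling_error d r n t b"
proof -
  define N where "N = \<lparr>next_fun = (\<lambda>ys f. f (t (length ys))), stop = (\<lambda>ys. length ys = n)\<rparr>"
  define \<phi> where "\<phi> = (\<lambda>ys. S (\<lambda>x. \<Sum>i<n. ys ! i * b i x))"
  define prg where "prg = (\<lambda>m::nat. linear_prog (S (\<lambda>_. 0)) (map S (map b [0..<n])))"
  define T where "T = (\<lambda>f x. f x - (\<Sum>i<n. f (t i) * b i x))"
  have len: "length (info_values N f k) = k" for f k by (induction k) auto
  have val: "info_values N f k = map (\<lambda>i. f (t i)) [0..<k]" for f k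
    by (induction k) (auto simp: N_def len)
  have stop: "stop N ys \<longleftrightarrow> length ys = n" for ys by (simp add: N_def)
  have trm: "terminates N f" for f unfolding terminates_def by (simp add: stop len)
  have card: "cardinality N f = n" for f
    unfolding cardinality_def by (rule Least_equality) (simp_all add: stop len)
  have info: "info N f = map (\<lambda>i. f (t i)) [0..<n]" for f by (simp add: info_def card val)
  have nonad: "nonadaptive N" by (simp add: nonadaptive_def N_def)
  have sumF: "(\<lambda>x. \<Sum>i<n. ys i * b i x) \<in> F_space d r" for ys
    by (intro F_space_sum F_space_scale b) auto
  have TF: "T f \<in> F_space d r" if "f \<in> F_space d r" for f
    unfolding T_def by (intro F_space_diff sumF that)
  have \<phi>info: "\<phi> (info N f) = S (\<lambda>x. \<Sum>i<n. f (t i) * b i x)" for f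
    by (simp add: \<phi>_def info)
  have err: "sq_error P (N, \<phi>, prg) f = (ennreal (hnorm H (S (T f))))\<^sup>2" if f: "f \<in> F_space d r" for f
  proof -
    have "hdist H (S f) (\<phi> (info N f)) = hnorm H (S (T f))"
      unfolding \<phi>info T_def by (rule hdist_S[OF f sumF])
    then show ?thesis using norm_nonneg[OF TF[OF f]] by (simp add: P ennreal_power)
  qed
  have ops: "operations H \<phi> prg (info N f) = of_nat (2 * n - 1)" for f
  proof -
    have "{k. runs H (prg (length (info N f))) (info N f) [] (\<phi> (info N f)) k} = {2 * n - 1}"
      unfolding prg_def using runs_linear_prog[of n b "info N f" "\<phi> (info N f)"] b
      by (auto simp: info \<phi>_def)
    then show ?thesis by (simp add: operations_def)
  qed
  have cost: "total_cost P (N, \<phi>, prg) f = ennreal (c * real n) + of_nat (2 * n - 1)" if "f \<in> F_space d r" for f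
    using \<kappa> trm nonad that unfolding information_cost_def by (simp add: P card ops)
  have Tm: "(\<lambda>(f, x). T f x) \<in> borel_measurable (\<mu> \<Otimes>\<^sub>M cube_measure d)"
    unfolding T_def case_prod_unfold
  proof (intro borel_measurable_diff borel_measurable_sum borel_measurable_times)
    show "(\<lambda>p. fst p (snd p)) \<in> borel_measurable (\<mu> \<Otimes>\<^sub>M cube_measure d)"
      using eval_pair_measurable by (simp add: case_prod_unfold)
    show "(\<lambda>p. fst p (t i)) \<in> borel_measurable (\<mu> \<Otimes>\<^sub>M cube_measure d)" for i
      by (rule measurable_compose[OF measurable_fst eval_measurable[OF t]])
    show "(\<lambda>p. b i (snd p)) \<in> borel_measurable (\<mu> \<Otimes>\<^sub>M cube_measure d)" if "i \<in> {..<n}" for i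
      by (rule measurable_compose[OF measurable_snd measurable_cube_continuous[OF F_space_continuous[OF b]]])
        (use that in auto)
  qed
  have qm: "(\<lambda>f. ennreal (hnorm H (S (T f)))) \<in> borel_measurable \<mu>"
    by (rule norm_S_measurable[OF TF Tm])
  have "(\<lambda>f. (ennreal (hnorm H (S (T f))))\<^sup>2) \<in> borel_measurable \<mu>" using qm by measurable
  then have em: "sq_error P (N, \<phi>, prg) \<in> borel_measurable \<mu>"
    using err by (subst measurable_cong[where g="\<lambda>f. (ennreal (hnorm H (S (T f))))\<^sup>2"]) (auto simp: space_sheet)
  have cm: "total_cost P (N, \<phi>, prg) \<in> borel_measurable \<mu>"
    using cost by (subst measurable_cong[where g="\<lambda>_. ennreal (c * real n) + of_nat (2 * n - 1)"])
      (auto simp: space_sheet)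
  have nf: "next_fun N ys \<in> (\<lambda>x f. f x) ` cube d" for ys using t by (simp add: N_def)
  show ?thesis
  proof
    show "is_algorithm P Std (N, \<phi>, prg)"
      using em cm nf sumF carrier trm
      by (simp add: P \<phi>info del: sq_error.simps total_cost.simps)
    have meas_P: "meas P = \<mu>" by (simp add: P)
    have "avg_cost P (N, \<phi>, prg) = (\<integral>\<^sup>+f. ennreal (c * real n) + of_nat (2 * n - 1) \<partial>\<mu>)"
      unfolding avg_cost_def meas_P
      by (intro nn_integral_cong) (use cost in \<open>auto simp: space_sheet simp del: total_cost.simps\<close>)
    also have "\<dots> = ennreal (c * real n + real (2 * n - 1))"
      using c by (simp add: emeasure_space_1 ennreal_of_nat_eq_real_of_nat flip: ennreal_plus)
    also have "\<dots> \<le> ennreal ((c + 2) * real n)"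
      by (rule ennreal_leI) (auto simp: algebra_simps of_nat_diff)
    finally show "avg_cost P (N, \<phi>, prg) \<le> ennreal ((c + 2) * real n)" .
    have "sq_error P (N, \<phi>, prg) f \<le> ennreal (K\<^sup>2) * (\<integral>\<^sup>+x. ennreal ((T f x)\<^sup>2) \<partial>cube_measure d)"
      if f: "f \<in> F_space d r" for f
    proof -
      have i: "integrable (cube_measure d) (\<lambda>x. (T f x)\<^sup>2)"
        using F_space_L2[OF TF[OF f]] by (simp add: L2_funs_def)
      have "(hnorm H (S (T f)))\<^sup>2 \<le> (K * sqrt (\<integral>x. (T f x)\<^sup>2 \<partial>cube_measure d))\<^sup>2"
        by (intro power_mono bound norm_nonneg TF f)
      also have "\<dots> = K\<^sup>2 * (\<integral>x. (T f x)\<^sup>2 \<partial>cube_measure d)"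
        by (simp add: power_mult_distrib)
      finally have "ennreal ((hnorm H (S (T f)))\<^sup>2) \<le> ennreal (K\<^sup>2 * (\<integral>x. (T f x)\<^sup>2 \<partial>cube_measure d))"
        by (rule ennreal_leI)
      then show ?thesis
        unfolding err[OF f] using norm_nonneg[OF TF[OF f]] i
        by (simp add: ennreal_power ennreal_mult nn_integral_eq_integral)
    qed
    then have "(\<integral>\<^sup>+f. sq_error P (N, \<phi>, prg) f \<partial>\<mu>)
        \<le> (\<integral>\<^sup>+f. ennreal (K\<^sup>2) * (\<integral>\<^sup>+x. ennreal ((T f x)\<^sup>2) \<partial>cube_measure d) \<partial>\<mu>)"
      by (intro nn_integral_mono) (auto simp: space_sheet)
    also have "\<dots> = ennreal (K\<^sup>2) * (\<integral>\<^sup>+f. (\<integral>\<^sup>+x. ennreal ((T f x)\<^sup>2) \<partial>cube_measure d) \<partial>\<mu>)"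
    proof (rule nn_integral_cmult)
      show "(\<lambda>f. \<integral>\<^sup>+x. ennreal ((T f x)\<^sup>2) \<partial>cube_measure d) \<in> borel_measurable \<mu>"
        by (rule cube.borel_measurable_nn_integral) (use Tm in \<open>simp add: case_prod_unfold\<close>)
    qed
    also have "(\<integral>\<^sup>+f. (\<integral>\<^sup>+x. ennreal ((T f x)\<^sup>2) \<partial>cube_measure d) \<partial>\<mu>)
        = (\<integral>\<^sup>+x. (\<integral>\<^sup>+f. ennreal ((T f x)\<^sup>2) \<partial>\<mu>) \<partial>cube_measure d)"
    proof -
      interpret pair_sigma_finite \<mu> "cube_measure d" by unfold_locales
      show ?thesis by (rule Fubini'[symmetric]) (use Tm in \<open>simp add: case_prod_unfold\<close>)
    qed
    also have "\<dots> = sampling_error d r n t b" unfolding sampling_error_def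
    proof (rule nn_integral_cong)
      fix x assume "x \<in> space (cube_measure d)"
      then have x: "x \<in> cube d" by simp
      \<comment> \<open>The point \<open>x\<close> is appended as node number \<open>n\<close> with
        coefficient 1, so that \<open>T f x\<close> becomes a single linear combination of point
        values.\<close>
      let ?x = "\<lambda>i. if i < n then t i else x" and ?c = "\<lambda>i. if i < n then - b i x else 1"
      have xc: "?x i \<in> cube d" for i using t x by simp
      have e1: "(\<Sum>i\<le>n. ?c i * f (?x i)) = T f x" for f
        unfolding lessThan_Suc_atMost[symmetric] sum.lessThan_Suc T_def
        by (simp add: sum_negf mult.commute)
      have e2: "(\<Sum>i\<le>n. ?c i * sheet_kernel d r (?x i) s)
          = sheet_kernel d r x s - (\<Sum>i<n. b i x * sheet_kernel d r (t i) s)" for s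
        unfolding lessThan_Suc_atMost[symmetric] sum.lessThan_Suc by (simp add: sum_negf)
      have i1: "integrable \<mu> (\<lambda>f. (T f x)\<^sup>2)"
        using covariance_sum(1)[of "{..n}" ?x "{..n}" ?x ?c ?c] xc by (simp add: e1 power2_eq_square)
      have "integrable (cube_measure d) (\<lambda>s. \<Sum>i\<le>n. \<Sum>j\<le>n. ?c i * ?c j *
          (sheet_kernel d r (?x i) s * sheet_kernel d r (?x j) s))"
        by (intro Bochner_Integration.integrable_sum integrable_mult_right sheet_kernel_prod_integrable xc)
      also have "(\<lambda>s. \<Sum>i\<le>n. \<Sum>j\<le>n. ?c i * ?c j * (sheet_kernel d r (?x i) s * sheet_kernel d r (?x j) s))
          = (\<lambda>s. (\<Sum>i\<le>n. ?c i * sheet_kernel d r (?x i) s)\<^sup>2)"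
        unfolding power2_eq_square sum_product by (simp only: mult_ac)
      finally have i2: "integrable (cube_measure d) (\<lambda>s. (\<Sum>i\<le>n. ?c i * sheet_kernel d r (?x i) s)\<^sup>2)" .
      have "(\<integral>\<^sup>+f. ennreal ((T f x)\<^sup>2) \<partial>\<mu>) = ennreal (expectation (\<lambda>f. (T f x)\<^sup>2))"
        by (rule nn_integral_eq_integral) (use i1 in auto)
      also have "expectation (\<lambda>f. (T f x)\<^sup>2)
          = (\<integral>s. (\<Sum>i\<le>n. ?c i * sheet_kernel d r (?x i) s)\<^sup>2 \<partial>cube_measure d)"
        unfolding e1[symmetric] by (rule variance_sum) (rule xc)
      also have "ennreal \<dots> = (\<integral>\<^sup>+s. ennreal ((\<Sum>i\<le>n. ?c i * sheet_kernel d r (?x i) s)\<^sup>2) \<partial>cube_measure d)"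
        by (rule nn_integral_eq_integral[symmetric]) (use i2 in auto)
      finally show "(\<integral>\<^sup>+f. ennreal ((T f x)\<^sup>2) \<partial>\<mu>) = (\<integral>\<^sup>+s. ennreal ((sheet_kernel d r x s
          - (\<Sum>i<n. b i x * sheet_kernel d r (t i) s))\<^sup>2) \<partial>cube_measure d)"
        unfolding e2 .
    qed
    finally show "(\<integral>\<^sup>+f. sq_error P (N, \<phi>, prg) f \<partial>\<mu>) \<le> ennreal (K\<^sup>2) * sampling_error d r n t b" .
  qed
qed

end

subsection \<open>Sampling in one variable\<close>

text \<open>Dividing by \<open>Suc r\<close> keeps all nodes strictly below 1, hence inside a
  half-open cell after scaling, and it makes sense for \<open>r = 0\<close>.\<close>

definition lagrange_node :: "nat \<Rightarrow> nat \<Rightarrow> real" where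
  "lagrange_node r i = real i / real (Suc r)"

definition lagrange_basis :: "nat \<Rightarrow> nat \<Rightarrow> real poly" where
  "lagrange_basis r i = (\<Prod>k\<in>{..r} - {i}.
     smult (1 / (lagrange_node r i - lagrange_node r k)) [:- lagrange_node r k, 1:])"

lemma lagrange_node_eq_iff: "lagrange_node r i = lagrange_node r k \<longleftrightarrow> i = k"
  by (simp add: lagrange_node_def divide_simps)

lemma lagrange_node_bounds: "i \<le> r \<Longrightarrow> 0 \<le> lagrange_node r i" "i \<le> r \<Longrightarrow> lagrange_node r i < 1"
  by (auto simp: lagrange_node_def)

lemma poly_lagrange_basis:
  assumes "i \<le> r" "k \<le> r"
  shows "poly (lagrange_basis r i) (lagrange_node r k) = (if i = k then 1 else 0)"
proof (cases "i = k")
  case True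
  have "poly (lagrange_basis r i) (lagrange_node r i) = (\<Prod>k\<in>{..r} - {i}. 1)"
    unfolding lagrange_basis_def poly_prod
  proof (rule prod.cong[OF refl])
    fix k assume "k \<in> {..r} - {i}"
    then have "lagrange_node r i \<noteq> lagrange_node r k" by (simp add: lagrange_node_eq_iff)
    then show "poly (smult (1 / (lagrange_node r i - lagrange_node r k)) [:- lagrange_node r k, 1:])
        (lagrange_node r i) = 1"
      unfolding poly_smult by simp
  qed
  then show ?thesis using True by simp
next
  case False
  then show ?thesis unfolding lagrange_basis_def poly_prod
    using assms by (auto intro!: bexI[of _ k])
qed

lemma degree_lagrange_basis: "i \<le> r \<Longrightarrow> degree (lagrange_basis r i) \<le> r"
proof -
  assume i: "i \<le> r"
  have "degree (lagrange_basis r i) \<le> (\<Sum>k\<in>{..r} - {i}. degree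
      (smult (1 / (lagrange_node r i - lagrange_node r k)) [:- lagrange_node r k, 1:]))"
    unfolding lagrange_basis_def
    by (rule order_trans[OF degree_prod_sum_le]) (simp_all only: o_def finite_Diff finite_atMost order_refl)
  also have "\<dots> \<le> (\<Sum>k\<in>{..r} - {i}. 1)" by (rule sum_mono) (simp add: degree_smult_le)
  also have "\<dots> = r" using i by simp
  finally show ?thesis .
qed

lemma lagrange_interpolation:
  assumes "degree p \<le> r"
  shows "(\<Sum>i\<le>r. smult (poly p (lagrange_node r i)) (lagrange_basis r i)) = p"
proof (rule ccontr)
  let ?q = "(\<Sum>i\<le>r. smult (poly p (lagrange_node r i)) (lagrange_basis r i)) - p"
  assume "(\<Sum>i\<le>r. smult (poly p (lagrange_node r i)) (lagrange_basis r i)) \<noteq> p"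
  then have q: "?q \<noteq> 0" by simp
  have d: "degree ?q \<le> r"
    by (intro degree_diff_le degree_sum_le order_trans[OF degree_smult_le] degree_lagrange_basis assms) auto
  have "lagrange_node r ` {..r} \<subseteq> {x. poly ?q x = 0}"
    by (auto simp: poly_sum poly_lagrange_basis if_distrib[of "\<lambda>x. _ * x"] sum.delta' cong: if_cong)
  then have "card (lagrange_node r ` {..r}) \<le> card {x. poly ?q x = 0}"
    by (rule card_mono[OF poly_roots_finite[OF q]])
  also have "\<dots> \<le> r" using card_poly_roots_bound[OF q] d by simp
  also have "card (lagrange_node r ` {..r}) = Suc r"
    by (subst card_image) (auto simp: inj_on_def lagrange_node_eq_iff)
  finally show False by simp
qed

lemma poly_measurable [measurable]: "poly (p :: real poly) \<in> borel_measurable borel"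
  by (intro borel_measurable_continuous_onI continuous_intros)

lemma lagrange_basis_bound: "\<exists>B\<ge>0. \<forall>i\<le>r. \<forall>x\<in>{0..1}. \<bar>poly (lagrange_basis r i) x\<bar> \<le> B"
proof -
  have "\<exists>B. \<forall>x\<in>{0..1}. \<bar>poly (lagrange_basis r i) x\<bar> \<le> B" for i
  proof -
    have "bounded (poly (lagrange_basis r i) ` {0..1})"
      by (intro compact_imp_bounded compact_continuous_image continuous_intros) auto
    then show ?thesis unfolding bounded_iff by auto
  qed
  then obtain B where B: "\<And>i x. x \<in> {0..1} \<Longrightarrow> \<bar>poly (lagrange_basis r i) x\<bar> \<le> B i" by metis
  have "\<bar>poly (lagrange_basis r i) x\<bar> \<le> (\<Sum>i\<le>r. \<bar>B i\<bar>)" if "i \<le> r" "x \<in> {0..1}" for i x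
  proof -
    have "B i \<le> \<bar>B i\<bar>" by simp
    also have "\<dots> \<le> (\<Sum>i\<le>r. \<bar>B i\<bar>)" by (rule member_le_sum) (use that in auto)
    finally show ?thesis using B[OF that(2), of i] by linarith
  qed
  then show ?thesis by (intro exI[of _ "\<Sum>i\<le>r. \<bar>B i\<bar>"]) (auto simp: sum_nonneg)
qed

section \<open>Polynomial substitutes for piecewise polynomials\<close>

lemma ident_unit: "(\<lambda>x. x) \<in> borel_measurable unit_measure"
  by (rule measurable_unit) simp

text \<open>Weighting the Weierstrass approximation by \<open>x^(r+1)\<close> costs nothing in \<open>L\<^sub>2\<close> and places the
  approximants in the space.\<close>

lemma step_polynomial_approximation:
  fixes q :: "real poly"
  assumes "0 \<le> \<alpha>" "\<alpha> < \<beta>" "\<beta> \<le> 1" and e: "e > 0"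
  shows "\<exists>p. monom 1 (Suc r) dvd p \<and>
    (\<integral>\<^sup>+x. ennreal ((indicator {\<alpha>..<\<beta>} x * poly q x - poly p x)\<^sup>2) \<partial>unit_measure) \<le> ennreal e"
proof -
  define a where "a = (\<lambda>x. indicator {\<alpha>..<\<beta>} x * poly q x)"
  \<comment> \<open>A trapezoid approximating the indicator of the cell. The shift by 1 makes it
    vanish up to \<open>\<alpha> + 1 / n\<close>, so it is zero near 0 even if
    \<open>\<alpha> = 0\<close> and can be divided by a power of \<open>x\<close>.\<close>
  define \<tau> where "\<tau> = (\<lambda>n x. max 0 (min 1 (min (real n * (x - \<alpha>) - 1) (real n * (\<beta> - x)))))"
  define cn where "cn = (\<lambda>n x. \<tau> n x * poly q x)"
  have am: "a \<in> borel_measurable unit_measure"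
    unfolding a_def by (intro measurable_unit borel_measurable_times poly_measurable) simp
  have \<tau>c: "continuous_on A (\<tau> n)" for A n unfolding \<tau>_def by (intro continuous_intros)
  have \<tau>b: "0 \<le> \<tau> n x" "\<tau> n x \<le> 1" for n x by (auto simp: \<tau>_def)
  have cm: "cn n \<in> borel_measurable unit_measure" for n
    unfolding cn_def
    by (intro measurable_unit borel_measurable_times poly_measurable borel_measurable_continuous_onI \<tau>c)
  have "bounded (poly q ` {0..1})"
    by (intro compact_imp_bounded compact_continuous_image continuous_intros) auto
  then have "\<exists>Q. \<forall>x\<in>{0..1}. \<bar>poly q x\<bar> \<le> Q" unfolding bounded_iff by auto
  then obtain Q where Q: "\<And>x. x \<in> {0..1} \<Longrightarrow> \<bar>poly q x\<bar> \<le> Q" by blast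
  have diff_b: "\<bar>a x - cn n x\<bar> \<le> Q" if "x \<in> {0..1}" for n x
  proof -
    have "\<bar>a x - cn n x\<bar> = \<bar>indicator {\<alpha>..<\<beta>} x - \<tau> n x\<bar> * \<bar>poly q x\<bar>"
      by (simp add: a_def cn_def left_diff_distrib[symmetric] abs_mult)
    also have "\<dots> \<le> 1 * Q"
      using \<tau>b[where n=n and x=x] Q[OF that] by (intro mult_mono) (auto simp: indicator_def)
    finally show ?thesis by simp
  qed
  have lim: "(\<lambda>n. \<tau> n x) \<longlonglongrightarrow> indicator {\<alpha>..<\<beta>} x" if "x \<noteq> \<alpha>" for x
  proof (cases "\<alpha> < x \<and> x < \<beta>")
    case True
    obtain N where N: "real N > max (2 / (x - \<alpha>)) (1 / (\<beta> - x))" using reals_Archimedean2 by blast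
    have "\<tau> n x = 1" if "n \<ge> N" for n
    proof -
      have "real n > 2 / (x - \<alpha>)" "real n > 1 / (\<beta> - x)" using N that by (auto simp: max_def split: if_splits)
      then have "real n * (x - \<alpha>) > 2" "real n * (\<beta> - x) > 1" using True by (auto simp: field_simps)
      then show ?thesis by (simp add: \<tau>_def)
    qed
    then have "\<forall>\<^sub>F n in sequentially. \<tau> n x = indicator {\<alpha>..<\<beta>} x"
      using True by (auto simp: eventually_sequentially)
    then show ?thesis by (rule tendsto_eventually)
  next
    case False
    have "\<tau> n x = 0" for n
    proof -
      have "real n * (x - \<alpha>) - 1 \<le> 0 \<or> real n * (\<beta> - x) \<le> 0"
        using False that by (smt (verit) mult_nonneg_nonpos of_nat_0_le_iff)
      then show ?thesis by (auto simp: \<tau>_def)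
    qed
    then show ?thesis using False that by (auto simp: indicator_def)
  qed
  have "(\<lambda>n. \<integral>x. (a x - cn n x)\<^sup>2 \<partial>unit_measure) \<longlonglongrightarrow> (\<integral>x. 0 \<partial>unit_measure)"
  proof (rule integral_dominated_convergence[where w="\<lambda>_. Q\<^sup>2"])
    have "AE x in unit_measure. x \<noteq> \<alpha>"
      using AE_lborel_singleton[of \<alpha>] by (auto simp: AE_restrict_space_iff elim: eventually_mono)
    then show "AE x in unit_measure. (\<lambda>n. (a x - cn n x)\<^sup>2) \<longlonglongrightarrow> 0"
    proof eventually_elim
      case (elim x)
      have "(\<lambda>n. (indicator {\<alpha>..<\<beta>} x * poly q x - \<tau> n x * poly q x)\<^sup>2)
          \<longlonglongrightarrow> (indicator {\<alpha>..<\<beta>} x * poly q x - indicator {\<alpha>..<\<beta>} x * poly q x)\<^sup>2"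
        by (intro tendsto_intros lim elim)
      then show ?case by (simp add: a_def cn_def)
    qed
    show "AE x in unit_measure. norm ((a x - cn n x)\<^sup>2) \<le> Q\<^sup>2" for n
      using unit_AE
    proof eventually_elim
      case (elim x)
      then show ?case using diff_b[OF elim, of n] Q[OF elim] by (simp add: abs_le_square_iff[symmetric])
    qed
  qed (use am cm in auto)
  \<comment> \<open>Smoothing and the Weierstrass approximation are each allowed a mean square of
    \<open>e / 4\<close>, since the square of a sum is at most twice the sum of the squares.\<close>
  then have "\<forall>\<^sub>F n in sequentially. (\<integral>x. (a x - cn n x)\<^sup>2 \<partial>unit_measure) < e / 4"
    using e by (intro order_tendstoD(2)) auto
  then have "\<forall>\<^sub>F n in sequentially. (\<integral>x. (a x - cn n x)\<^sup>2 \<partial>unit_measure) < e / 4 \<and> n > 0"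
    by (intro eventually_conj eventually_gt_at_top)
  then obtain n where n: "(\<integral>x. (a x - cn n x)\<^sup>2 \<partial>unit_measure) < e / 4" "n > 0"
    unfolding eventually_sequentially by blast
  \<comment> \<open>Where \<open>x\<close> is below \<open>1 / n\<close>, \<open>cn n\<close>
    vanishes; elsewhere the maximum is \<open>x\<close>. So \<open>g\<close> is continuous and
    \<open>cn n x\<close> equals \<open>x ^ Suc r * g x\<close>.\<close>
  define g where "g = (\<lambda>x. cn n x / (max x (1 / n)) ^ Suc r)"
  have gc: "continuous_on {0..1} g" unfolding g_def cn_def
    using n(2) by (intro continuous_intros \<tau>c) (auto simp: max_def)
  obtain p0 where p0: "real_polynomial_function p0" "\<And>x. x \<in> {0..1} \<Longrightarrow> \<bar>g x - p0 x\<bar> < sqrt (e / 4)"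
    using Stone_Weierstrass_real_polynomial_function[OF compact_Icc gc, of "sqrt (e / 4)"] e by auto
  obtain b m where bm: "p0 = (\<lambda>x. \<Sum>i\<le>m. b i * x ^ i)"
    using p0(1) real_polynomial_function_iff_sum by blast
  define p where "p = monom 1 (Suc r) * (\<Sum>i\<le>m::nat. monom (b i) i)"
  have pp: "poly p x = x ^ Suc r * p0 x" for x
    by (simp add: p_def poly_sum poly_monom bm)
  have cp: "(cn n x - poly p x)\<^sup>2 \<le> e / 4" if x: "x \<in> {0..1}" for x
  proof -
    have "cn n x = x ^ Suc r * g x"
    proof (cases "x \<ge> 1 / n")
      case True
      then have "x > 0" using n(2) by (smt (verit) divide_pos_pos of_nat_0_less_iff)
      then show ?thesis using True by (simp add: g_def max_absorb1)
    next
      case False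
      then have "real n * x < 1" using n(2) by (simp add: field_simps)
      then have "real n * (x - \<alpha>) - 1 < 0" using assms(1) by (simp add: algebra_simps) (smt (verit) mult_nonneg_nonneg of_nat_0_le_iff)
      then have "cn n x = 0" by (simp add: cn_def \<tau>_def)
      then show ?thesis by (simp add: g_def)
    qed
    then have "\<bar>cn n x - poly p x\<bar> = \<bar>x ^ Suc r\<bar> * \<bar>g x - p0 x\<bar>"
      by (simp add: pp right_diff_distrib[symmetric] abs_mult del: power_Suc)
    also have "\<dots> \<le> 1 * sqrt (e / 4)"
      using p0(2)[OF x] x by (intro mult_mono) (auto simp: power_le_one simp del: power_Suc)
    finally have "\<bar>cn n x - poly p x\<bar>\<^sup>2 \<le> (sqrt (e / 4))\<^sup>2" by (intro power_mono) auto
    then show ?thesis using e by simp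
  qed
  have ic: "integrable unit_measure (\<lambda>x. (a x - cn n x)\<^sup>2)"
    by (rule integrable_unit_bounded[where B="Q\<^sup>2"])
      (use am cm diff_b Q in \<open>auto simp: abs_le_square_iff[symmetric] intro: order_trans[OF _ abs_ge_self]\<close>)
  have "(\<integral>\<^sup>+x. ennreal ((a x - poly p x)\<^sup>2) \<partial>unit_measure)
      \<le> (\<integral>\<^sup>+x. ennreal (2 * (a x - cn n x)\<^sup>2 + e / 2) \<partial>unit_measure)"
  proof (rule nn_integral_mono, rule ennreal_leI)
    fix x assume "x \<in> space unit_measure"
    then have x: "x \<in> {0..1}" by (simp add: space_restrict_space)
    have "(a x - poly p x)\<^sup>2 \<le> 2 * (a x - cn n x)\<^sup>2 + 2 * (cn n x - poly p x)\<^sup>2"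
      using sum_squares_bound[of "a x - cn n x" "cn n x - poly p x"]
      by (simp add: power2_eq_square algebra_simps)
    then show "(a x - poly p x)\<^sup>2 \<le> 2 * (a x - cn n x)\<^sup>2 + e / 2" using cp[OF x] by linarith
  qed
  also have "\<dots> = ennreal (\<integral>x. 2 * (a x - cn n x)\<^sup>2 + e / 2 \<partial>unit_measure)"
    using ic e by (intro nn_integral_eq_integral) auto
  also have "(\<integral>x. 2 * (a x - cn n x)\<^sup>2 + e / 2 \<partial>unit_measure) = 2 * (\<integral>x. (a x - cn n x)\<^sup>2 \<partial>unit_measure) + e / 2"
    using ic unit.prob_space by simp
  also have "ennreal \<dots> \<le> ennreal e" using n(1) by (intro ennreal_leI) linarith
  finally have "(\<integral>\<^sup>+x. ennreal ((a x - poly p x)\<^sup>2) \<partial>unit_measure) \<le> ennreal e" .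
  then show ?thesis unfolding a_def by (intro exI[of _ p]) (simp add: p_def)
qed

section \<open>Interpolation error of truncated powers on the unit square\<close>

definition square_norm :: "(real \<Rightarrow> real \<Rightarrow> real) \<Rightarrow> ennreal" where
  "square_norm g = (\<integral>\<^sup>+x. (\<integral>\<^sup>+s. ennreal ((g x s)\<^sup>2) \<partial>unit_measure) \<partial>unit_measure)"

abbreviation jointly_measurable :: "(real \<Rightarrow> real \<Rightarrow> real) \<Rightarrow> bool" where
  "jointly_measurable g \<equiv> (\<lambda>(x, s). g x s) \<in> borel_measurable (unit_measure \<Otimes>\<^sub>M unit_measure)"

lemma square_norm_mono:
  assumes "\<And>x s. x \<in> {0..1} \<Longrightarrow> s \<in> {0..1} \<Longrightarrow> \<bar>g x s\<bar> \<le> \<bar>h x s\<bar>"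
  shows "square_norm g \<le> square_norm h"
  unfolding square_norm_def
  by (intro nn_integral_mono ennreal_leI) (auto simp: space_restrict_space abs_le_square_iff[symmetric] assms)

lemma square_norm_diff:
  assumes g: "jointly_measurable g" and h: "jointly_measurable h"
  shows "square_norm (\<lambda>x s. g x s - h x s) \<le> 2 * square_norm g + 2 * square_norm h"
proof -
  have gm: "(\<lambda>s. g x s) \<in> borel_measurable unit_measure" "(\<lambda>s. h x s) \<in> borel_measurable unit_measure"
    if "x \<in> space unit_measure" for x
    using measurable_Pair2[OF g that] measurable_Pair2[OF h that] by simp_all
  have m2: "(\<lambda>x. \<integral>\<^sup>+s. ennreal ((g x s)\<^sup>2) \<partial>unit_measure) \<in> borel_measurable unit_measure"
    "(\<lambda>x. \<integral>\<^sup>+s. ennreal ((h x s)\<^sup>2) \<partial>unit_measure) \<in> borel_measurable unit_measure"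
    by (rule unit.borel_measurable_nn_integral, use g h in \<open>simp add: case_prod_unfold\<close>)+
  have "square_norm (\<lambda>x s. g x s - h x s)
      \<le> (\<integral>\<^sup>+x. (\<integral>\<^sup>+s. 2 * ennreal ((g x s)\<^sup>2) + 2 * ennreal ((h x s)\<^sup>2) \<partial>unit_measure) \<partial>unit_measure)"
    unfolding square_norm_def
  proof (intro nn_integral_mono)
    fix x s
    have "(g x s - h x s)\<^sup>2 \<le> 2 * (g x s)\<^sup>2 + 2 * (h x s)\<^sup>2"
      using zero_le_power2[of "g x s + h x s"] by (simp add: power2_eq_square algebra_simps)
    then have "ennreal ((g x s - h x s)\<^sup>2) \<le> ennreal (2 * (g x s)\<^sup>2 + 2 * (h x s)\<^sup>2)" by (rule ennreal_leI)
    then show "ennreal ((g x s - h x s)\<^sup>2) \<le> 2 * ennreal ((g x s)\<^sup>2) + 2 * ennreal ((h x s)\<^sup>2)"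
      by (simp add: ennreal_mult)
  qed
  also have "\<dots> = (\<integral>\<^sup>+x. 2 * (\<integral>\<^sup>+s. ennreal ((g x s)\<^sup>2) \<partial>unit_measure)
      + 2 * (\<integral>\<^sup>+s. ennreal ((h x s)\<^sup>2) \<partial>unit_measure) \<partial>unit_measure)"
  proof (rule nn_integral_cong)
    fix x assume x: "x \<in> space unit_measure"
    show "(\<integral>\<^sup>+s. 2 * ennreal ((g x s)\<^sup>2) + 2 * ennreal ((h x s)\<^sup>2) \<partial>unit_measure)
      = 2 * (\<integral>\<^sup>+s. ennreal ((g x s)\<^sup>2) \<partial>unit_measure) + 2 * (\<integral>\<^sup>+s. ennreal ((h x s)\<^sup>2) \<partial>unit_measure)"
      using gm[OF x] by (subst nn_integral_add) (auto simp: nn_integral_cmult)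
  qed
  also have "\<dots> = 2 * square_norm g + 2 * square_norm h"
    unfolding square_norm_def using m2 by (subst nn_integral_add) (auto simp: nn_integral_cmult)
  finally show ?thesis .
qed

definition cell :: "real \<Rightarrow> nat \<Rightarrow> real set" where
  "cell h k = {real k * h..<(real k + 1) * h}"

lemma cell_unique: "h > 0 \<Longrightarrow> x \<in> cell h k \<Longrightarrow> x \<in> cell h k' \<Longrightarrow> k = k'"
proof -
  assume h: "h > 0" "x \<in> cell h k" "x \<in> cell h k'"
  then have "real k * h < (real k' + 1) * h" "real k' * h < (real k + 1) * h"
    unfolding cell_def atLeastLessThan_iff by linarith+
  then have "real k < real k' + 1" "real k' < real k + 1" using h(1) by auto
  then show ?thesis by linarith
qed

lemma cell_cover:
  assumes "m > 0" "0 \<le> x" "x < 1"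
  obtains k where "k < m" "x \<in> cell (1 / real m) k"
proof
  let ?k = "nat \<lfloor>x * real m\<rfloor>"
  have fl: "real ?k \<le> x * real m" "x * real m < real ?k + 1" using assms by simp_all
  show "x \<in> cell (1 / real m) ?k" using fl assms(1) by (auto simp: cell_def field_simps)
  have "x * real m < real m" using assms by simp
  then show "?k < m" using fl by linarith
qed

lemma trunc_pow_nonpos: "u \<le> 0 \<Longrightarrow> trunc_pow n u = 0"
  by (simp add: trunc_pow_def)

definition local_error :: "nat \<Rightarrow> real \<Rightarrow> nat \<Rightarrow> real \<Rightarrow> real \<Rightarrow> real" where
  "local_error r h k x s = trunc_pow r (x - s)
    - (\<Sum>i\<le>r. trunc_pow r ((real k + lagrange_node r i) * h - s) * poly (lagrange_basis r i) (x / h - real k))"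

text \<open>If \<open>s\<close> lies to the left of the cell, the truncated power is on the cell a
  polynomial of degree at most \<open>r\<close>, which interpolation reproduces. If \<open>s\<close>
  lies to the right, it vanishes at \<open>x\<close> and at all nodes, as these stay inside the
  cell.\<close>

lemma local_error_exact:
  assumes h: "h > 0" and x: "x \<in> cell h k" and s: "s \<notin> cell h k"
  shows "local_error r h k x s = 0"
proof (cases "s < real k * h")
  case True
  define p where "p = smult (1 / fact r) ([:real k * h - s, h:] ^ r)"
  have deg: "degree p \<le> r"
    unfolding p_def by (intro order_trans[OF degree_smult_le] order_trans[OF degree_power_le]) simp
  have val: "trunc_pow r ((real k + u) * h - s) = poly p u" if "u \<ge> 0" for u
  proof -
    have "0 < (real k + u) * h - s" using True h that by (simp add: distrib_right) (smt (verit) mult_nonneg_nonneg)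
    then show ?thesis by (simp add: trunc_pow_def p_def poly_power algebra_simps)
  qed
  have u: "x = (real k + (x / h - real k)) * h" "0 \<le> x / h - real k"
    using x h by (auto simp: cell_def field_simps)
  have "(\<Sum>i\<le>r. trunc_pow r ((real k + lagrange_node r i) * h - s) * poly (lagrange_basis r i) (x / h - real k))
      = poly (\<Sum>i\<le>r. smult (poly p (lagrange_node r i)) (lagrange_basis r i)) (x / h - real k)"
    by (simp add: poly_sum val lagrange_node_bounds)
  also have "\<dots> = trunc_pow r (x - s)"
    unfolding lagrange_interpolation[OF deg] using val[OF u(2)] u(1) by simp
  finally show ?thesis by (simp add: local_error_def)
next
  case False
  then have s': "(real k + 1) * h \<le> s" using s by (simp add: cell_def)
  have "(real k + lagrange_node r i) * h - s \<le> 0" if "i \<le> r" for i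
  proof -
    have "(real k + lagrange_node r i) * h \<le> (real k + 1) * h"
      using lagrange_node_bounds(2)[OF that] h by (intro mult_right_mono) auto
    with s' show ?thesis by linarith
  qed
  moreover have "x - s \<le> 0" using x s' by (simp add: cell_def)
  ultimately show ?thesis by (auto simp: local_error_def trunc_pow_nonpos intro!: sum.neutral)
qed

lemma local_error_bound:
  assumes h: "h > 0" and x: "x \<in> cell h k" and s: "s \<in> cell h k"
    and B: "\<And>i u. i \<le> r \<Longrightarrow> u \<in> {0..1} \<Longrightarrow> \<bar>poly (lagrange_basis r i) u\<bar> \<le> B"
  shows "\<bar>local_error r h k x s\<bar> \<le> (1 + real (Suc r) * B) * h ^ r"
proof -
  have tp: "\<bar>trunc_pow r (y - s)\<bar> \<le> h ^ r" if "y \<le> (real k + 1) * h" for y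
  proof -
    have "y - s \<le> h" using that s by (simp add: cell_def distrib_right)
    then show ?thesis using trunc_pow_le_power[of h "y - s" r] h trunc_pow_nonneg[of r "y - s"] by simp
  qed
  have u: "x / h - real k \<in> {0..1}" using x h by (auto simp: cell_def field_simps)
  have n: "(real k + lagrange_node r i) * h \<le> (real k + 1) * h" if "i \<le> r" for i
    using lagrange_node_bounds(2)[OF that] h by (intro mult_right_mono) auto
  have "\<bar>\<Sum>i\<le>r. trunc_pow r ((real k + lagrange_node r i) * h - s) * poly (lagrange_basis r i) (x / h - real k)\<bar>
      \<le> (\<Sum>i\<le>r. \<bar>trunc_pow r ((real k + lagrange_node r i) * h - s) * poly (lagrange_basis r i) (x / h - real k)\<bar>)"
    by (rule sum_abs)
  also have "\<dots> \<le> (\<Sum>i\<le>r. h ^ r * B)"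
    unfolding abs_mult by (intro sum_mono mult_mono tp n B u) (use h in auto)
  also have "\<dots> = real (Suc r) * B * h ^ r" by simp
  finally have *: "\<bar>\<Sum>i\<le>r. trunc_pow r ((real k + lagrange_node r i) * h - s) * poly (lagrange_basis r i) (x / h - real k)\<bar>
      \<le> real (Suc r) * B * h ^ r" .
  have "\<bar>trunc_pow r (x - s)\<bar> \<le> h ^ r" by (rule tp) (use x in \<open>simp add: cell_def\<close>)
  with * show ?thesis unfolding local_error_def by (simp add: distrib_right)
qed

lemma emeasure_cell:
  assumes "m > 0" "k < m"
  shows "emeasure unit_measure (cell (1 / real m) k) = ennreal (1 / real m)" "cell (1 / real m) k \<in> sets unit_measure"
proof -
  have "(real k + 1) * (1 / real m) \<le> 1" using assms by (simp add: divide_simps)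
  moreover have "0 \<le> real k * (1 / real m)" by simp
  ultimately have sub: "cell (1 / real m) k \<subseteq> {0..1}"
    unfolding cell_def subset_iff atLeastLessThan_iff atLeastAtMost_iff by linarith
  show "emeasure unit_measure (cell (1 / real m) k) = ennreal (1 / real m)"
  proof -
    have "real k * (1 / real m) \<le> (real k + 1) * (1 / real m)" by (simp add: divide_simps)
    from emeasure_lborel_Ico[OF this]
    have "emeasure lborel (cell (1 / real m) k) = ennreal ((real k + 1) * (1 / real m) - real k * (1 / real m))"
      by (simp only: cell_def)
    also have "(real k + 1) * (1 / real m) - real k * (1 / real m) = 1 / real m"
      by (simp only: left_diff_distrib[symmetric]) simp
    finally show ?thesis using sub by (subst emeasure_restrict_space) auto
  qed
  show "cell (1 / real m) k \<in> sets unit_measure"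
    using sub by (subst sets_restrict_space_iff) (auto simp: cell_def)
qed

lemma jointly_measurable_trunc_pow: "jointly_measurable (\<lambda>x s. trunc_pow r (x - s))"
  unfolding case_prod_unfold
  by (intro measurable_compose[OF _ trunc_pow_measurable] borel_measurable_diff
      measurable_compose[OF measurable_fst ident_unit] measurable_compose[OF measurable_snd ident_unit])

lemma jointly_measurable_product:
  assumes "f \<in> borel_measurable unit_measure" "g \<in> borel_measurable unit_measure"
  shows "jointly_measurable (\<lambda>x s. g s * f x)"
  unfolding case_prod_unfold
  by (intro borel_measurable_times measurable_compose[OF measurable_fst assms(1)]
      measurable_compose[OF measurable_snd assms(2)])

lemma trunc_pow_section_measurable: "(\<lambda>s. trunc_pow r (t - s)) \<in> borel_measurable unit_measure"
  by (intro measurable_unit measurable_compose[OF _ trunc_pow_measurable]) simp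

lemma jointly_measurable_sum:
  "(\<And>i. i \<in> I \<Longrightarrow> jointly_measurable (g i)) \<Longrightarrow> jointly_measurable (\<lambda>x s. \<Sum>i\<in>I. g i x s)"
  unfolding case_prod_unfold by (intro borel_measurable_sum)

lemma jointly_measurable_diff:
  "jointly_measurable g \<Longrightarrow> jointly_measurable h \<Longrightarrow> jointly_measurable (\<lambda>x s. g x s - h x s)"
  unfolding case_prod_unfold by (intro borel_measurable_diff)

text \<open>Interpolating the truncated powers on each cell is exact unless the cell contains the knot \<open>s\<close>;
  this accounts for the additional half in the exponent \<open>r + 1/2\<close>.\<close>

lemma interpolation_error:
  assumes m: "m > 0" and h: "h = 1 / real m"
    and B: "B \<ge> 0" "\<And>i u. i \<le> r \<Longrightarrow> u \<in> {0..1} \<Longrightarrow> \<bar>poly (lagrange_basis r i) u\<bar> \<le> B"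
  shows "square_norm (\<lambda>x s. trunc_pow r (x - s) - (\<Sum>(k, i)\<in>{..<m} \<times> {..r}.
      trunc_pow r ((real k + lagrange_node r i) * h - s) *
      (indicator (cell h k) x * poly (lagrange_basis r i) (x / h - real k))))
    \<le> ennreal ((1 + real (Suc r) * B)\<^sup>2 * h ^ (2 * r + 1))"
proof -
  have h0: "h > 0" using m h by simp
  let ?E = "\<lambda>x s. trunc_pow r (x - s) - (\<Sum>(k, i)\<in>{..<m} \<times> {..r}.
      trunc_pow r ((real k + lagrange_node r i) * h - s) *
      (indicator (cell h k) x * poly (lagrange_basis r i) (x / h - real k)))"
  let ?c = "((1 + real (Suc r) * B) * h ^ r)\<^sup>2"
  \<comment> \<open>Only the diagonal squares, with \<open>x\<close> and \<open>s\<close> in the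
    same cell, contribute. There are \<open>m\<close> of them with area \<open>h * h\<close>, in
    total \<open>h\<close>.\<close>
  have le: "ennreal ((?E x s)\<^sup>2) \<le> (\<Sum>k<m. ennreal ?c * indicator (cell h k) x * indicator (cell h k) s)"
    if x: "0 \<le> x" "x < 1" for x s
  proof -
    obtain k where "k < m" "x \<in> cell (1 / real m) k" by (rule cell_cover[OF m x])
    then have k: "k < m" "x \<in> cell h k" by (simp_all only: h)
    have ind: "indicator (cell h k') x = (if k' = k then 1 else 0 :: real)" for k'
    proof (cases "k' = k")
      case False
      then have "x \<notin> cell h k'" using cell_unique[OF h0 k(2)] by blast
      then show ?thesis using False by simp
    qed (use k in simp)
    have "(\<Sum>(k, i)\<in>{..<m} \<times> {..r}. trunc_pow r ((real k + lagrange_node r i) * h - s) *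
        (indicator (cell h k) x * poly (lagrange_basis r i) (x / h - real k)))
        = (\<Sum>k'<m. if k' = k then (\<Sum>i\<le>r. trunc_pow r ((real k' + lagrange_node r i) * h - s) *
             poly (lagrange_basis r i) (x / h - real k')) else 0)"
      unfolding sum.cartesian_product[symmetric] by (intro sum.cong) (auto simp: ind)
    also have "\<dots> = (\<Sum>i\<le>r. trunc_pow r ((real k + lagrange_node r i) * h - s) *
             poly (lagrange_basis r i) (x / h - real k))" using k by simp
    finally have E: "?E x s = local_error r h k x s" by (simp add: local_error_def)
    have "ennreal ((?E x s)\<^sup>2) \<le> ennreal ?c * indicator (cell h k) x * indicator (cell h k) s"
    proof (cases "s \<in> cell h k")
      case True
      have "(?E x s)\<^sup>2 \<le> ?c"
        using local_error_bound[OF h0 k(2) True B(2)] B(1) h0 unfolding E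
        by (intro abs_le_square_iff[THEN iffD1]) (auto simp: abs_mult)
      then show ?thesis using True k by (simp add: ennreal_leI)
    qed (use local_error_exact[OF h0 k(2)] in \<open>simp add: E\<close>)
    also have "\<dots> \<le> (\<Sum>k<m. ennreal ?c * indicator (cell h k) x * indicator (cell h k) s)"
      by (rule member_le_sum[where f="\<lambda>k. ennreal ?c * indicator (cell h k) x * indicator (cell h k) s"])
        (use k in auto)
    finally show ?thesis .
  qed
  \<comment> \<open>The endpoint 1 belongs to none of the \<open>m\<close> half-open cells.\<close>
  have ae: "AE x in unit_measure. 0 \<le> x \<and> x < 1"
    using AE_lborel_singleton[of "1::real"] by (simp add: AE_restrict_space_iff) (auto elim!: eventually_mono)
  have mk: "cell h k \<in> sets unit_measure" "emeasure unit_measure (cell h k) = ennreal h" if "k < m" for k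
    using emeasure_cell[OF m that] h by auto
  have "square_norm ?E \<le> (\<integral>\<^sup>+x. (\<integral>\<^sup>+s. (\<Sum>k<m. ennreal ?c * indicator (cell h k) x * indicator (cell h k) s)
      \<partial>unit_measure) \<partial>unit_measure)"
    unfolding square_norm_def
    by (rule nn_integral_mono_AE, use ae in eventually_elim) (intro nn_integral_mono le, auto)
  also have "\<dots> = (\<integral>\<^sup>+x. (\<Sum>k<m. ennreal ?c * ennreal h * indicator (cell h k) x) \<partial>unit_measure)"
  proof (intro nn_integral_cong)
    fix x
    have "(\<integral>\<^sup>+s. (\<Sum>k<m. ennreal ?c * indicator (cell h k) x * indicator (cell h k) s) \<partial>unit_measure)
        = (\<Sum>k<m. (\<integral>\<^sup>+s. ennreal ?c * indicator (cell h k) x * indicator (cell h k) s \<partial>unit_measure))"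
      by (rule nn_integral_sum) (use mk in auto)
    also have "\<dots> = (\<Sum>k<m. ennreal ?c * indicator (cell h k) x * ennreal h)"
      by (intro sum.cong refl, subst nn_integral_cmult_indicator) (use mk in auto)
    finally show "(\<integral>\<^sup>+s. (\<Sum>k<m. ennreal ?c * indicator (cell h k) x * indicator (cell h k) s) \<partial>unit_measure)
        = (\<Sum>k<m. ennreal ?c * ennreal h * indicator (cell h k) x)" by (simp add: mult_ac)
  qed
  also have "\<dots> = (\<Sum>k<m. (\<integral>\<^sup>+x. ennreal ?c * ennreal h * indicator (cell h k) x \<partial>unit_measure))"
    by (rule nn_integral_sum) (use mk in auto)
  also have "\<dots> = (\<Sum>k<m. ennreal ?c * ennreal h * ennreal h)"
    by (intro sum.cong refl, subst nn_integral_cmult_indicator) (use mk in auto)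
  also have "\<dots> = ennreal (real m * (?c * h * h))"
    using h0 by (simp add: ennreal_mult ennreal_of_nat_eq_real_of_nat mult.assoc)
  also have "real m * (?c * h * h) = (1 + real (Suc r) * B)\<^sup>2 * h ^ (2 * r + 1)"
  proof -
    have "real m * h = 1" using m h by simp
    then have "real m * (?c * h * h) = ?c * h" by (simp add: algebra_simps)
    then show ?thesis by (simp add: power_mult_distrib power_mult[symmetric] mult.commute[of r])
  qed
  finally show ?thesis .
qed

text \<open>The interpolation weights are discontinuous. Replacing each of them by a polynomial
  divisible by \<open>x ^ Suc r\<close> changes the result by an amount that can be made as small as
  the interpolation error itself.\<close>

lemma sampling_level:
  "\<exists>C>0. \<forall>l::nat. \<exists>n t w. real n \<le> C * 2 ^ l \<and> (\<forall>i<n. t i \<in> {0..1} \<and> monom 1 (Suc r) dvd w i) \<and>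
      square_norm (\<lambda>x s. trunc_pow r (x - s) - (\<Sum>i<n. trunc_pow r (t i - s) * poly (w i) x))
        \<le> ennreal (C * (1 / 2 ^ l) ^ (2 * r + 1))"
proof -
  obtain B where B: "B \<ge> 0" "\<And>i u. i \<le> r \<Longrightarrow> u \<in> {0..1} \<Longrightarrow> \<bar>poly (lagrange_basis r i) u\<bar> \<le> B"
    using lagrange_basis_bound[of r] by blast
  define C0 where "C0 = (1 + real (Suc r) * B)\<^sup>2"
  \<comment> \<open>\<open>Suc r\<close> counts the nodes per cell. The other entry adds the
    interpolation constant \<open>C0\<close> and the constant 1 of the substitution, both doubled by
    \<open>square_norm_diff\<close>.\<close>
  define C where "C = max (real (Suc r)) (2 * C0 + 2)"
  have "\<exists>n t w. real n \<le> C * 2 ^ l \<and> (\<forall>i<n. t i \<in> {0..1} \<and> monom 1 (Suc r) dvd w i) \<and>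
      square_norm (\<lambda>x s. trunc_pow r (x - s) - (\<Sum>i<n. trunc_pow r (t i - s) * poly (w i) x))
        \<le> ennreal (C * (1 / 2 ^ l) ^ (2 * r + 1))" for l :: nat
  proof -
    define m :: nat where "m = 2 ^ l"
    define h where "h = 1 / real m"
    have m: "m > 0" and h0: "h > 0" and h1: "h = 1 / 2 ^ l" by (auto simp: m_def h_def)
    define J where "J = {..<m} \<times> {..r}"
    define \<tau> where "\<tau> = (\<lambda>(k, i). (real k + lagrange_node r i) * h)"
    define a where "a = (\<lambda>(k, i) x. indicator (cell h k) x * poly (lagrange_basis r i) (x / h - real k))"
    define N where "N = card J"
    have J: "finite J" "N = m * Suc r" by (auto simp: J_def N_def)
    have N0: "N > 0" using m J by simp
    \<comment> \<open>One factor \<open>N\<close> is lost in the Cauchy-Schwarz inequality over the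
      nodes, the other in adding up the \<open>N\<close> errors.\<close>
    define \<eta> where "\<eta> = h ^ (2 * r + 1) / (real N * real N)"
    have \<eta>: "\<eta> > 0" using h0 N0 by (simp add: \<eta>_def)
    have am: "a p \<in> borel_measurable unit_measure" for p
      unfolding a_def case_prod_unfold
      by (intro measurable_unit borel_measurable_times measurable_compose[OF _ poly_measurable]) (auto simp: cell_def)
    have \<tau>01: "\<tau> p \<in> {0..1}" if "p \<in> J" for p
    proof -
      obtain k i where p: "p = (k, i)" "k < m" "i \<le> r" using \<open>p \<in> J\<close> by (auto simp: J_def)
      have "real k + lagrange_node r i \<le> real m" using p lagrange_node_bounds(2)[OF p(3)] by linarith
      then show ?thesis using lagrange_node_bounds(1)[OF p(3)] m by (auto simp: \<tau>_def p h_def)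
    qed
    have "\<exists>w. monom 1 (Suc r) dvd w \<and> (\<integral>\<^sup>+x. ennreal ((a p x - poly w x)\<^sup>2) \<partial>unit_measure) \<le> ennreal \<eta>"
      if "p \<in> J" for p
    proof -
      obtain k i where p: "p = (k, i)" "k < m" using \<open>p \<in> J\<close> by (auto simp: J_def)
      have "(real k + 1) * h \<le> 1" using p m by (simp add: h_def divide_simps)
      then obtain w where w: "monom 1 (Suc r) dvd w"
        "(\<integral>\<^sup>+x. ennreal ((indicator {real k * h..<(real k + 1) * h} x
          * poly (pcompose (lagrange_basis r i) [:- real k, 1 / h:]) x - poly w x)\<^sup>2) \<partial>unit_measure) \<le> ennreal \<eta>"
        using step_polynomial_approximation[of "real k * h" "(real k + 1) * h" \<eta> r
            "pcompose (lagrange_basis r i) [:- real k, 1 / h:]"] h0 \<eta> by auto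
      then show ?thesis
        by (intro exI[of _ w]) (simp add: a_def p cell_def poly_pcompose algebra_simps)
    qed
    then obtain w where w: "\<And>p. p \<in> J \<Longrightarrow> monom 1 (Suc r) dvd w p"
      "\<And>p. p \<in> J \<Longrightarrow> (\<integral>\<^sup>+x. ennreal ((a p x - poly (w p) x)\<^sup>2) \<partial>unit_measure) \<le> ennreal \<eta>" by metis
    let ?E = "\<lambda>x s. trunc_pow r (x - s) - (\<Sum>p\<in>J. trunc_pow r (\<tau> p - s) * a p x)"
    let ?D = "\<lambda>x s. \<Sum>p\<in>J. trunc_pow r (\<tau> p - s) * (poly (w p) x - a p x)"
    have wm: "poly (w p) \<in> borel_measurable unit_measure" for p by (intro measurable_unit poly_measurable)
    have jE: "jointly_measurable ?E"
      by (intro jointly_measurable_diff jointly_measurable_sum jointly_measurable_product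
          jointly_measurable_trunc_pow trunc_pow_section_measurable am)
    have jD: "jointly_measurable ?D"
      by (intro jointly_measurable_sum jointly_measurable_product borel_measurable_diff
          trunc_pow_section_measurable am wm)
    have sE: "square_norm ?E \<le> ennreal (C0 * h ^ (2 * r + 1))"
    proof -
      have "?E = (\<lambda>x s. trunc_pow r (x - s) - (\<Sum>(k, i)\<in>{..<m} \<times> {..r}.
          trunc_pow r ((real k + lagrange_node r i) * h - s) *
          (indicator (cell h k) x * poly (lagrange_basis r i) (x / h - real k))))"
        by (simp add: J_def \<tau>_def a_def case_prod_unfold)
      then show ?thesis using interpolation_error[OF m h_def B] by (simp add: C0_def)
    qed
    have sD: "square_norm ?D \<le> ennreal (h ^ (2 * r + 1))"
    proof -
      have "square_norm ?D \<le> (\<integral>\<^sup>+x. (\<integral>\<^sup>+s. ennreal (real N) * (\<Sum>p\<in>J. ennreal ((a p x - poly (w p) x)\<^sup>2))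
          \<partial>unit_measure) \<partial>unit_measure)"
        unfolding square_norm_def
      proof (intro nn_integral_mono)
        fix x s assume "x \<in> space unit_measure" "s \<in> space unit_measure"
        then have s: "s \<in> {0..1}" by (simp add: space_restrict_space)
        have "(?D x s)\<^sup>2 \<le> (\<Sum>p\<in>J. (trunc_pow r (\<tau> p - s))\<^sup>2) * (\<Sum>p\<in>J. (poly (w p) x - a p x)\<^sup>2)"
          by (rule Cauchy_Schwarz_ineq_sum)
        also have "\<dots> \<le> (\<Sum>p\<in>J. 1) * (\<Sum>p\<in>J. (poly (w p) x - a p x)\<^sup>2)"
        proof (intro mult_right_mono sum_mono sum_nonneg)
          fix p assume "p \<in> J"
          then have "\<tau> p - s \<le> 1" using \<tau>01[of p] s by auto
          then show "(trunc_pow r (\<tau> p - s))\<^sup>2 \<le> 1"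
            by (intro power_le_one trunc_pow_nonneg trunc_pow_le_1)
        qed auto
        also have "\<dots> = real N * (\<Sum>p\<in>J. (a p x - poly (w p) x)\<^sup>2)"
          by (simp add: N_def power2_commute)
        finally have "ennreal ((?D x s)\<^sup>2) \<le> ennreal (real N * (\<Sum>p\<in>J. (a p x - poly (w p) x)\<^sup>2))"
          by (rule ennreal_leI)
        also have "\<dots> = ennreal (real N) * (\<Sum>p\<in>J. ennreal ((a p x - poly (w p) x)\<^sup>2))"
          by (subst ennreal_mult) (auto intro!: sum_nonneg)
        finally show "ennreal ((?D x s)\<^sup>2) \<le> ennreal (real N) * (\<Sum>p\<in>J. ennreal ((a p x - poly (w p) x)\<^sup>2))" .
      qed
      also have "\<dots> = ennreal (real N) * (\<integral>\<^sup>+x. (\<Sum>p\<in>J. ennreal ((a p x - poly (w p) x)\<^sup>2)) \<partial>unit_measure)"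
        by (subst nn_integral_const, subst unit.emeasure_space_1, subst mult_1_right, rule nn_integral_cmult)
          (use am wm in \<open>auto intro!: borel_measurable_sum\<close>)
      also have "(\<integral>\<^sup>+x. (\<Sum>p\<in>J. ennreal ((a p x - poly (w p) x)\<^sup>2)) \<partial>unit_measure)
          = (\<Sum>p\<in>J. (\<integral>\<^sup>+x. ennreal ((a p x - poly (w p) x)\<^sup>2) \<partial>unit_measure))"
        by (rule nn_integral_sum) (use am wm in auto)
      also have "\<dots> \<le> (\<Sum>p\<in>J. ennreal \<eta>)" by (rule sum_mono) (rule w)
      also have "\<dots> = ennreal (real N * \<eta>)"
        using \<eta> by (simp add: N_def ennreal_mult ennreal_of_nat_eq_real_of_nat)
      also have "ennreal (real N) * \<dots> = ennreal (real N * (real N * \<eta>))"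
        using \<eta> by (simp add: ennreal_mult)
      also have "real N * (real N * \<eta>) = h ^ (2 * r + 1)" using N0 by (simp add: \<eta>_def)
      finally show ?thesis by (simp add: mult_left_mono)
    qed
    have ED: "?E x s - ?D x s = trunc_pow r (x - s) - (\<Sum>p\<in>J. trunc_pow r (\<tau> p - s) * poly (w p) x)" for x s
      by (simp add: right_diff_distrib sum_subtractf)
    have "square_norm (\<lambda>x s. ?E x s - ?D x s) \<le> 2 * ennreal (C0 * h ^ (2 * r + 1)) + 2 * ennreal (h ^ (2 * r + 1))"
      by (rule order_trans[OF square_norm_diff[OF jE jD]]) (intro add_mono mult_left_mono sE sD, auto)
    also have "\<dots> = ennreal ((2 * C0 + 2) * h ^ (2 * r + 1))"
    proof -
      have "2 * ennreal a + 2 * ennreal b = ennreal (2 * a + 2 * b)" if "a \<ge> 0" "b \<ge> 0" for a b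
        using that by (simp add: ennreal_mult)
      from this[of "C0 * h ^ (2 * r + 1)" "h ^ (2 * r + 1)"] show ?thesis
        using h0 by (simp add: C0_def distrib_right mult.assoc)
    qed
    also have "\<dots> \<le> ennreal (C * h ^ (2 * r + 1))"
      using h0 by (intro ennreal_leI mult_right_mono) (auto simp: C_def)
    finally have sF: "square_norm (\<lambda>x s. trunc_pow r (x - s) - (\<Sum>p\<in>J. trunc_pow r (\<tau> p - s) * poly (w p) x))
        \<le> ennreal (C * h ^ (2 * r + 1))" unfolding ED .
    obtain \<beta> where \<beta>: "bij_betw \<beta> {0..<N} J" using ex_bij_betw_nat_finite[OF J(1)] N_def by auto
    then have \<beta>J: "\<beta> i \<in> J" if "i < N" for i using that by (auto simp: bij_betw_def)
    have re: "(\<Sum>i<N. trunc_pow r (\<tau> (\<beta> i) - s) * poly (w (\<beta> i)) x)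
        = (\<Sum>p\<in>J. trunc_pow r (\<tau> p - s) * poly (w p) x)" for x s
      using sum.reindex_bij_betw[OF \<beta>, of "\<lambda>p. trunc_pow r (\<tau> p - s) * poly (w p) x"]
      by (simp add: atLeast0LessThan)
    have "real N = real (Suc r) * 2 ^ l" by (simp add: J(2) m_def algebra_simps)
    also have "\<dots> \<le> C * 2 ^ l" by (intro mult_right_mono) (auto simp: C_def)
    finally show ?thesis
      using \<beta>J \<tau>01 w(1) sF unfolding h1
      by (intro exI[of _ N] exI[of _ "\<lambda>i. \<tau> (\<beta> i)"] exI[of _ "\<lambda>i. w (\<beta> i)"]) (auto simp: re)
  qed
  moreover have "C > 0" by (simp add: C_def)
  ultimately show ?thesis by blast
qed

subsection \<open>Sparse grids\<close>

lemma measurable_component_unit: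
  "j \<in> {1..d} \<Longrightarrow> (\<lambda>x. x j) \<in> measurable (cube_measure d) unit_measure"
  unfolding cube_measure_def by (rule measurable_component_singleton)

definition level_sum :: "nat \<Rightarrow> nat \<Rightarrow> (nat \<Rightarrow> real) \<Rightarrow> (nat \<Rightarrow> real poly) \<Rightarrow> real \<Rightarrow> real \<Rightarrow> real" where
  "level_sum r n t w x s = (\<Sum>i<n. trunc_pow r (t i - s) * poly (w i) x)"

lemma jointly_measurable_level_sum: "jointly_measurable (level_sum r n t w)"
  unfolding level_sum_def
  by (intro jointly_measurable_sum jointly_measurable_product trunc_pow_section_measurable
      measurable_unit poly_measurable)

text \<open>The sections \<open>level_sum\<close> are increments whose sum up to \<open>q\<close> is
  the approximation of level \<open>q\<close>. The remainder after level \<open>q\<close> obeys the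
  same bound as an increment of level \<open>Suc q\<close>, so it can play that part in tensor
  products.\<close>

definition incremental_sampling ::
    "nat \<Rightarrow> real \<Rightarrow> (nat \<Rightarrow> nat) \<Rightarrow> (nat \<Rightarrow> nat \<Rightarrow> real) \<Rightarrow> (nat \<Rightarrow> nat \<Rightarrow> real poly) \<Rightarrow> bool" where
  "incremental_sampling r C n t w \<longleftrightarrow> C > 0 \<and> (\<forall>l. real (n l) \<le> C * 2 ^ l) \<and>
    (\<forall>l. \<forall>i<n l. t l i \<in> {0..1} \<and> monom 1 (Suc r) dvd w l i) \<and>
    (\<forall>l. square_norm (level_sum r (n l) (t l) (w l)) \<le> ennreal (C * (1 / 2 ^ l) ^ (2 * r + 1))) \<and>
    (\<forall>q. square_norm (\<lambda>x s. trunc_pow r (x - s) - (\<Sum>l\<le>q. level_sum r (n l) (t l) (w l) x s))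
      \<le> ennreal (C * (1 / 2 ^ Suc q) ^ (2 * r + 1)))"

text \<open>Increments are differences of consecutive approximations from
  \<open>sampling_level\<close>: the two node lists are concatenated and the coarser weights
  negated. Their size follows by comparing both approximations with the truncated power.\<close>

lemma ex_incremental_sampling: "\<exists>C n t w. incremental_sampling r C n t w"
proof -
  obtain C where C: "C > 0"
    and ex: "\<forall>l::nat. \<exists>n t w. real n \<le> C * 2 ^ l \<and> (\<forall>i<n. t i \<in> {0..1} \<and> monom 1 (Suc r) dvd w i) \<and>
      square_norm (\<lambda>x s. trunc_pow r (x - s) - (\<Sum>i<n. trunc_pow r (t i - s) * poly (w i) x))
        \<le> ennreal (C * (1 / 2 ^ l) ^ (2 * r + 1))"
    using sampling_level[of r] by blast
  define \<rho> :: real where "\<rho> = (1 / 2) ^ (2 * r + 1)"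
  have \<rho>: "\<rho> > 0" "\<rho> \<le> 1" unfolding \<rho>_def by (auto intro!: power_le_one simp del: power_Suc)
  have rho: "(1 / 2 ^ l) ^ (2 * r + 1) = \<rho> ^ l" for l :: nat
    unfolding \<rho>_def by (simp only: power_one_over[symmetric] power_mult[symmetric] mult.commute)
  define P where "P = (\<lambda>l n t w. real n \<le> C * 2 ^ l \<and> (\<forall>i<n. t i \<in> {0..1} \<and> monom 1 (Suc r) dvd w i) \<and>
      square_norm (\<lambda>x s. trunc_pow r (x - s) - level_sum r n t w x s) \<le> ennreal (C * \<rho> ^ l))"
  have "\<exists>n t w. P l n t w" for l
    using spec[OF ex, of l] unfolding P_def level_sum_def rho .
  then obtain n0 t0 w0 where P: "\<And>l. P l (n0 l) (t0 l) (w0 l)" by metis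
  have n0: "real (n0 l) \<le> C * 2 ^ l" for l using P[of l] by (simp add: P_def)
  have tw0: "t0 l i \<in> {0..1} \<and> monom 1 (Suc r) dvd w0 l i" if "i < n0 l" for l i
    using P[of l] that by (simp add: P_def)
  have e0: "square_norm (\<lambda>x s. trunc_pow r (x - s) - level_sum r (n0 l) (t0 l) (w0 l) x s) \<le> ennreal (C * \<rho> ^ l)" for l
    using P[of l] by (simp add: P_def)
  let ?U = "\<lambda>l. level_sum r (n0 l) (t0 l) (w0 l)"
  let ?e = "\<lambda>l x s. trunc_pow r (x - s) - ?U l x s"
  define n where "n = (\<lambda>l. n0 l + (if l = 0 then 0 else n0 (l - 1)))"
  define t where "t = (\<lambda>l i. if i < n0 l then t0 l i else t0 (l - 1) (i - n0 l))"
  define w where "w = (\<lambda>l i. if i < n0 l then w0 l i else - w0 (l - 1) (i - n0 l))"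
  let ?D = "\<lambda>l. level_sum r (n l) (t l) (w l)"
  have split: "(\<Sum>i<a + b. f i) = (\<Sum>i<a. f i) + (\<Sum>i<b. f (a + i))" for a b :: nat and f :: "nat \<Rightarrow> real"
    using sum.nat_group[of f] by (induction b) auto
  have D: "?D l x s = ?U l x s - (if l = 0 then 0 else ?U (l - 1) x s)" for l x s
    unfolding level_sum_def n_def split by (simp add: t_def w_def sum_negf)
  have tel: "(\<Sum>l\<le>q. ?D l x s) = ?U q x s" for q x s
    by (induction q) (simp_all add: D)
  have jm: "jointly_measurable (?e l)" for l
    by (intro jointly_measurable_diff jointly_measurable_trunc_pow jointly_measurable_level_sum)
  \<comment> \<open>\<open>2 * C\<close> pays for the joined node lists, \<open>2 + 2 * C\<close>
    for level 0, where the truncated powers have norm at most 1, and \<open>4 * C / \<rho>\<close>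
    for expressing the error of the previous level at the current one.\<close>
  define C' where "C' = Max {2 * C, 2 + 2 * C, 4 * C / \<rho>}"
  have C': "2 * C \<le> C'" "2 + 2 * C \<le> C'" "4 * C / \<rho> \<le> C'" unfolding C'_def by (rule Max_ge; simp)+
  have two: "2 * ennreal a + 2 * ennreal b = ennreal (2 * a + 2 * b)" if "a \<ge> 0" "b \<ge> 0" for a b
    using that by (simp add: ennreal_mult)
  have "incremental_sampling r C' n t w" unfolding incremental_sampling_def
  proof (intro conjI allI impI)
    show "C' > 0" using C C' by linarith
    show "real (n l) \<le> C' * 2 ^ l" for l
    proof (cases l)
      case 0
      then have "real (n l) \<le> C * 2 ^ l" using n0[of l] by (simp add: n_def)
      also have "\<dots> \<le> C' * 2 ^ l" using C' C by (intro mult_right_mono) auto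
      finally show ?thesis .
    next
      case (Suc k)
      have "real (n l) \<le> C * 2 ^ l + C * 2 ^ k" using n0[of l] n0[of k] Suc by (simp add: n_def)
      also have "\<dots> \<le> (2 * C) * 2 ^ l" using C Suc by simp
      also have "\<dots> \<le> C' * 2 ^ l" using C' by (intro mult_right_mono) auto
      finally show ?thesis .
    qed
    show "t l i \<in> {0..1}" "monom 1 (Suc r) dvd w l i" if "i < n l" for l i
      using that tw0[of i l] tw0[of "i - n0 l" "l - 1"] by (auto simp: n_def t_def w_def split: if_splits)
    show "square_norm (?D l) \<le> ennreal (C' * (1 / 2 ^ l) ^ (2 * r + 1))" for l
    proof (cases l)
      case 0
      have one: "square_norm (\<lambda>x s. trunc_pow r (x - s)) \<le> ennreal 1"
      proof -
        have "square_norm (\<lambda>x s. trunc_pow r (x - s)) \<le> square_norm (\<lambda>x s. 1)"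
          by (rule square_norm_mono) (auto simp: abs_of_nonneg[OF trunc_pow_nonneg] intro!: trunc_pow_le_1)
        also have "\<dots> = ennreal 1" using unit.emeasure_space_1 by (simp add: square_norm_def space_restrict_space)
        finally show ?thesis .
      qed
      have D0: "?D 0 = (\<lambda>x s. trunc_pow r (x - s) - ?e 0 x s)" by (simp add: fun_eq_iff D)
      have "square_norm (?D 0) \<le> 2 * square_norm (\<lambda>x s. trunc_pow r (x - s)) + 2 * square_norm (?e 0)"
        unfolding D0 by (rule square_norm_diff[OF jointly_measurable_trunc_pow jm])
      also have "\<dots> \<le> 2 * ennreal 1 + 2 * ennreal (C * \<rho> ^ 0)"
        by (intro add_mono mult_left_mono one e0) auto
      also have "\<dots> = ennreal (2 + 2 * C)" using C by (subst two) auto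
      also have "\<dots> \<le> ennreal C'" using C' by (intro ennreal_leI)
      finally show ?thesis using 0 by simp
    next
      case (Suc k)
      have "?D l = (\<lambda>x s. ?e k x s - ?e l x s)" using Suc by (simp add: fun_eq_iff D)
      then have "square_norm (?D l) \<le> 2 * square_norm (?e k) + 2 * square_norm (?e l)"
        using square_norm_diff[OF jm jm] by simp
      also have "\<dots> \<le> 2 * ennreal (C * \<rho> ^ k) + 2 * ennreal (C * \<rho> ^ l)"
        by (intro add_mono mult_left_mono e0) auto
      also have "\<dots> = ennreal (2 * (C * \<rho> ^ k) + 2 * (C * \<rho> ^ l))" using C \<rho> by (subst two) auto
      also have "\<dots> \<le> ennreal (C' * \<rho> ^ l)"
      proof (rule ennreal_leI)
        have "\<rho> ^ l \<le> \<rho> ^ k" using \<rho> Suc by (intro power_decreasing) auto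
        then have "2 * (C * \<rho> ^ k) + 2 * (C * \<rho> ^ l) \<le> 4 * C * \<rho> ^ k" using C by (simp add: mult_left_mono)
        also have "\<dots> = (4 * C / \<rho>) * \<rho> ^ l" using \<rho> Suc by simp
        also have "\<dots> \<le> C' * \<rho> ^ l" using C' \<rho> by (intro mult_right_mono) auto
        finally show "2 * (C * \<rho> ^ k) + 2 * (C * \<rho> ^ l) \<le> C' * \<rho> ^ l" .
      qed
      finally show ?thesis unfolding rho .
    qed
    show "square_norm (\<lambda>x s. trunc_pow r (x - s) - (\<Sum>l\<le>q. ?D l x s)) \<le> ennreal (C' * (1 / 2 ^ Suc q) ^ (2 * r + 1))" for q
    proof -
      have "square_norm (\<lambda>x s. trunc_pow r (x - s) - (\<Sum>l\<le>q. ?D l x s)) \<le> ennreal (C * \<rho> ^ q)"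
        unfolding tel by (rule e0)
      also have "\<dots> \<le> ennreal (C' * \<rho> ^ Suc q)"
      proof (rule ennreal_leI)
        have "C * \<rho> ^ q = (C / \<rho>) * \<rho> ^ Suc q" using \<rho> by simp
        also have "\<dots> \<le> C' * \<rho> ^ Suc q"
        proof (intro mult_right_mono)
          have "C / \<rho> \<le> 4 * C / \<rho>" using C \<rho> by (intro divide_right_mono) auto
          then show "C / \<rho> \<le> C'" using C' by linarith
        qed (use \<rho> in auto)
        finally show "C * \<rho> ^ q \<le> C' * \<rho> ^ Suc q" .
      qed
      finally show ?thesis unfolding rho .
    qed
  qed
  then show ?thesis by blast
qed

lemma ennreal_prod_mono:
  "(\<And>i. i \<in> A \<Longrightarrow> f i \<le> g i) \<Longrightarrow> prod f A \<le> (prod g A :: ennreal)"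
  by (induction A rule: infinite_finite_induct) (auto intro!: mult_mono)

lemma prod_le_power_sum:
  fixes a :: "nat \<Rightarrow> real"
  assumes "\<And>j. j \<in> {1..d} \<Longrightarrow> 0 \<le> a j \<and> a j \<le> C * z ^ l j" "C \<ge> 0" "z \<ge> 0"
  shows "(\<Prod>j=1..d. a j) \<le> C ^ d * z ^ (\<Sum>j=1..d. l j)"
proof -
  have "(\<Prod>j=1..d. a j) \<le> (\<Prod>j=1..d. C * z ^ l j)" by (rule prod_mono) (use assms in auto)
  then show ?thesis by (simp add: prod.distrib power_sum)
qed

text \<open>Smolyak's construction: among all tensor products of the one-dimensional increments keep those
  of total level at most \<open>q\<close>.\<close>

lemma sparse_grid:
  assumes m: "\<And>j. j \<in> {1..d} \<Longrightarrow> m \<le> r j"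
  shows "\<exists>C>0. \<forall>q::nat. \<exists>n t b. real n \<le> C * real (q + 2) ^ d * 2 ^ q \<and> (\<forall>i. t i \<in> cube d) \<and>
      (\<forall>i<n. b i \<in> F_space d r) \<and>
      sampling_error d r n t b \<le> ennreal (C * (real (q + 2) ^ d)\<^sup>2 * (1 / 2 ^ q) ^ (2 * m + 1))"
proof -
  obtain Ck nk tk wk where P: "\<And>k. incremental_sampling k (Ck k) (nk k) (tk k) (wk k)"
    using ex_incremental_sampling by metis
  have Ck: "Ck k > 0" and nk: "real (nk k l) \<le> Ck k * 2 ^ l"
    and tk: "i < nk k l \<Longrightarrow> tk k l i \<in> {0..1} \<and> monom 1 (Suc k) dvd wk k l i"
    and inc: "square_norm (level_sum k (nk k l) (tk k l) (wk k l)) \<le> ennreal (Ck k * (1 / 2 ^ l) ^ (2 * k + 1))"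
    and rest: "square_norm (\<lambda>x s. trunc_pow k (x - s) - (\<Sum>l\<le>q. level_sum k (nk k l) (tk k l) (wk k l) x s))
      \<le> ennreal (Ck k * (1 / 2 ^ Suc q) ^ (2 * k + 1))" for k l i q
    using P[of k] unfolding incremental_sampling_def by blast+
  define C1 where "C1 = 1 + (\<Sum>j=1..d. Ck (r j))"
  have C1: "C1 \<ge> 1" unfolding C1_def using Ck by (simp add: sum_nonneg less_imp_le)
  have CkC1: "Ck (r j) \<le> C1" if "j \<in> {1..d}" for j
    using member_le_sum[of j "{1..d}" "\<lambda>j. Ck (r j)"] that Ck by (simp add: C1_def less_imp_le)
  define \<rho> :: real where "\<rho> = (1 / 2) ^ (2 * m + 1)"
  have \<rho>: "\<rho> > 0" "\<rho> \<le> 1" unfolding \<rho>_def by (auto intro!: power_le_one simp del: power_Suc)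
  have rho: "(1 / 2 ^ l) ^ (2 * m + 1) = \<rho> ^ l" for l :: nat
    unfolding \<rho>_def by (simp only: power_one_over[symmetric] power_mult[symmetric] mult.commute)
  \<comment> \<open>Smoother coordinates are credited only with the rate of smoothness
    \<open>m\<close>; the bound of a tensor product then depends on the total level alone.\<close>
  have rate: "Ck (r j) * (1 / 2 ^ l) ^ (2 * r j + 1) \<le> C1 * \<rho> ^ l" if "j \<in> {1..d}" for j l
  proof -
    have "(1 / 2 ^ l :: real) ^ (2 * r j + 1) \<le> (1 / 2 ^ l) ^ (2 * m + 1)"
      using m[OF that] by (intro power_decreasing) auto
    then show ?thesis unfolding rho using CkC1[OF that] C1 by (intro mult_mono) auto
  qed
  have "\<exists>n t b. real n \<le> C1 ^ d * real (q + 2) ^ d * 2 ^ q \<and> (\<forall>i. t i \<in> cube d) \<and>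
      (\<forall>i<n. b i \<in> F_space d r) \<and>
      sampling_error d r n t b \<le> ennreal (C1 ^ d * (real (q + 2) ^ d)\<^sup>2 * (1 / 2 ^ q) ^ (2 * m + 1))" for q :: nat
  proof -
    \<comment> \<open>The remainder is filed under level \<open>Suc q\<close>, so finitely many
      levels add up exactly to the truncated power.\<close>
    define \<delta> where "\<delta> = (\<lambda>j l x s. if l \<le> q then level_sum (r j) (nk (r j) l) (tk (r j) l) (wk (r j) l) x s
      else trunc_pow (r j) (x - s) - (\<Sum>l\<le>q. level_sum (r j) (nk (r j) l) (tk (r j) l) (wk (r j) l) x s))"
    have \<delta>j: "jointly_measurable (\<delta> j l)" for j l
      unfolding \<delta>_def
      by (cases "l \<le> q") (simp_all add: jointly_measurable_level_sum jointly_measurable_diff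
          jointly_measurable_trunc_pow jointly_measurable_sum del: split_paired_All)
    have \<delta>n: "square_norm (\<delta> j l) \<le> ennreal (C1 * \<rho> ^ l)" if "j \<in> {1..d}" "l \<le> Suc q" for j l
    proof -
      have "square_norm (\<delta> j l) \<le> ennreal (Ck (r j) * (1 / 2 ^ l) ^ (2 * r j + 1))"
      proof (cases "l \<le> q")
        case True then show ?thesis using inc unfolding \<delta>_def by simp
      next
        case False
        then have "l = Suc q" using that by simp
        then show ?thesis using rest[of "r j" q] unfolding \<delta>_def by simp
      qed
      also have "\<dots> \<le> ennreal (C1 * \<rho> ^ l)" by (rule ennreal_leI[OF rate[OF that(1)]])
      finally show ?thesis .
    qed
    have tele: "trunc_pow (r j) (x - s) = (\<Sum>l\<le>Suc q. \<delta> j l x s)" for j x s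
      by (simp add: \<delta>_def)
    define \<Lambda> where "\<Lambda> = (\<Pi>\<^sub>E j\<in>{1..d}. {..Suc q})"
    define G where "G = {l \<in> \<Lambda>. (\<Sum>j=1..d. l j) \<le> q}"
    have "finite \<Lambda>" unfolding \<Lambda>_def by (rule finite_PiE) auto
    then have fin: "finite \<Lambda>" "finite G" "finite (\<Lambda> - G)" by (auto simp: G_def)
    have card\<Lambda>: "card \<Lambda> = (q + 2) ^ d" by (simp add: \<Lambda>_def card_PiE)
    have Gq: "l j \<le> q" if "l \<in> G" "j \<in> {1..d}" for l j
      using member_le_sum[of j "{1..d}" l] that by (auto simp: G_def)
    define I where "I = (\<lambda>l. \<Pi>\<^sub>E j\<in>{1..d}. {..<nk (r j) (l j)})"
    define J where "J = (SIGMA l:G. I l)"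
    have finI: "finite (I l)" for l by (auto simp: I_def intro: finite_PiE)
    have finJ: "finite J" using fin finI by (auto simp: J_def)
    define node where "node = (\<lambda>(l, k). \<lambda>j\<in>{1..d}. tk (r j) (l j) (k j))"
    define bas where "bas = (\<lambda>(l, k). tensor d (\<lambda>j. poly (wk (r j) (l j) (k j))))"
    have node_in: "node p \<in> cube d" if "p \<in> J" for p
    proof -
      obtain l k where p: "p = (l, k)" "k \<in> I l" using \<open>p \<in> J\<close> by (auto simp: J_def)
      show ?thesis unfolding node_def p(1) prod.case
      proof (rule cube_restrictI)
        fix j assume "j \<in> {1..d}"
        then have "k j < nk (r j) (l j)" using p(2) by (auto simp: I_def)
        then show "tk (r j) (l j) (k j) \<in> {0..1}" using tk by blast
      qed
    qed
    have bas_in: "bas p \<in> F_space d r" if "p \<in> J" for p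
    proof -
      obtain l k where p: "p = (l, k)" "k \<in> I l" using \<open>p \<in> J\<close> by (auto simp: J_def)
      show ?thesis unfolding bas_def p(1) prod.case
      proof (rule tensor_poly_in_F_space)
        fix j assume "j \<in> {1..d}"
        then have "k j < nk (r j) (l j)" using p(2) by (auto simp: I_def)
        then show "monom 1 (Suc (r j)) dvd wk (r j) (l j) (k j)" using tk by blast
      qed
    qed
    \<comment> \<open>Expanding the product of the telescoping sums gives all multi-levels in
      \<open>\<Lambda>\<close>. Those in \<open>G\<close> have every component at most
      \<open>q\<close>, so they contain no remainder and are exactly what the sampling formula
      computes; the error is the sum over the others.\<close>
    have err: "sheet_kernel d r x s - (\<Sum>p\<in>J. bas p x * sheet_kernel d r (node p) s)
        = (\<Sum>l\<in>\<Lambda> - G. \<Prod>j=1..d. \<delta> j (l j) (x j) (s j))" if x: "x \<in> cube d" for x s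
    proof -
      have "(\<Sum>p\<in>J. bas p x * sheet_kernel d r (node p) s)
          = (\<Sum>l\<in>G. \<Sum>k\<in>I l. \<Prod>j=1..d. trunc_pow (r j) (tk (r j) (l j) (k j) - s j) * poly (wk (r j) (l j) (k j)) (x j))"
      proof -
        have "(\<Sum>p\<in>J. bas p x * sheet_kernel d r (node p) s)
            = (\<Sum>l\<in>G. \<Sum>k\<in>I l. bas (l, k) x * sheet_kernel d r (node (l, k)) s)"
          unfolding J_def
          using sum.Sigma[of G I "\<lambda>l k. bas (l, k) x * sheet_kernel d r (node (l, k)) s"] fin finI by simp
        also have "\<dots> = (\<Sum>l\<in>G. \<Sum>k\<in>I l. \<Prod>j=1..d.
            trunc_pow (r j) (tk (r j) (l j) (k j) - s j) * poly (wk (r j) (l j) (k j)) (x j))"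
          by (intro sum.cong refl)
            (simp add: bas_def node_def tensor_def x sheet_kernel_def prod.distrib mult.commute)
        finally show ?thesis .
      qed
      also have "\<dots> = (\<Sum>l\<in>G. \<Prod>j=1..d. \<delta> j (l j) (x j) (s j))"
      proof (rule sum.cong[OF refl])
        fix l assume l: "l \<in> G"
        have "(\<Sum>k\<in>I l. \<Prod>j=1..d. trunc_pow (r j) (tk (r j) (l j) (k j) - s j) * poly (wk (r j) (l j) (k j)) (x j))
            = (\<Prod>j=1..d. \<Sum>i<nk (r j) (l j). trunc_pow (r j) (tk (r j) (l j) i - s j) * poly (wk (r j) (l j) i) (x j))"
          unfolding I_def by (rule prod_sum_PiE[symmetric]) auto
        also have "\<dots> = (\<Prod>j=1..d. \<delta> j (l j) (x j) (s j))"
          by (rule prod.cong) (use Gq[OF l] in \<open>auto simp: \<delta>_def level_sum_def\<close>)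
        finally show "(\<Sum>k\<in>I l. \<Prod>j=1..d. trunc_pow (r j) (tk (r j) (l j) (k j) - s j) * poly (wk (r j) (l j) (k j)) (x j))
            = (\<Prod>j=1..d. \<delta> j (l j) (x j) (s j))" .
      qed
      moreover have "sheet_kernel d r x s = (\<Sum>l\<in>\<Lambda>. \<Prod>j=1..d. \<delta> j (l j) (x j) (s j))"
        unfolding sheet_kernel_def tele \<Lambda>_def by (rule prod_sum_PiE) auto
      moreover have "(\<Sum>l\<in>\<Lambda> - G. \<Prod>j=1..d. \<delta> j (l j) (x j) (s j))
          = (\<Sum>l\<in>\<Lambda>. \<Prod>j=1..d. \<delta> j (l j) (x j) (s j)) - (\<Sum>l\<in>G. \<Prod>j=1..d. \<delta> j (l j) (x j) (s j))"
        by (rule sum_diff) (use fin in \<open>auto simp: G_def\<close>)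
      ultimately show ?thesis by simp
    qed
    \<comment> \<open>This count enters twice, once by squaring the sum and once by adding the
      bounds. It is at most \<open>(q + 2) ^ d\<close>, a factor that \<open>level_choice\<close>
      absorbs.\<close>
    let ?N = "card (\<Lambda> - G)"
    let ?g = "\<lambda>j l x s. ennreal ((\<delta> j l x s)\<^sup>2)"
    have gs: "?g j l x \<in> borel_measurable unit_measure" if "x \<in> {0..1}" for j l x
      using measurable_Pair2[OF \<delta>j, of x] that by (simp add: space_restrict_space)
    have gx: "(\<lambda>x. \<integral>\<^sup>+s. ?g j l x s \<partial>unit_measure) \<in> borel_measurable unit_measure" for j l
      by (rule unit.borel_measurable_nn_integral) (use \<delta>j[of j l] in \<open>simp add: case_prod_unfold\<close>)
    have "(\<integral>\<^sup>+x. (\<integral>\<^sup>+s. ennreal ((sheet_kernel d r x s - (\<Sum>p\<in>J. bas p x * sheet_kernel d r (node p) s))\<^sup>2)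
          \<partial>cube_measure d) \<partial>cube_measure d)
        \<le> (\<integral>\<^sup>+x. (\<integral>\<^sup>+s. (\<Sum>l\<in>\<Lambda> - G. of_nat ?N * (\<Prod>j=1..d. ?g j (l j) (x j) (s j)))
          \<partial>cube_measure d) \<partial>cube_measure d)"
    proof (intro nn_integral_mono)
      fix x s assume "x \<in> space (cube_measure d)"
      then have x: "x \<in> cube d" by simp
      have "(\<Sum>l\<in>\<Lambda> - G. \<Prod>j=1..d. \<delta> j (l j) (x j) (s j))\<^sup>2
          \<le> (\<Sum>l\<in>\<Lambda> - G. 1\<^sup>2) * (\<Sum>l\<in>\<Lambda> - G. (\<Prod>j=1..d. \<delta> j (l j) (x j) (s j))\<^sup>2)"
        using Cauchy_Schwarz_ineq_sum[of "\<lambda>_. 1" "\<lambda>l. \<Prod>j=1..d. \<delta> j (l j) (x j) (s j)" "\<Lambda> - G"] by simp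
      also have "\<dots> = (\<Sum>l\<in>\<Lambda> - G. real ?N * (\<Prod>j=1..d. (\<delta> j (l j) (x j) (s j))\<^sup>2))"
        by (simp add: sum_distrib_left prod_power_distrib)
      finally have "ennreal ((\<Sum>l\<in>\<Lambda> - G. \<Prod>j=1..d. \<delta> j (l j) (x j) (s j))\<^sup>2)
          \<le> ennreal (\<Sum>l\<in>\<Lambda> - G. real ?N * (\<Prod>j=1..d. (\<delta> j (l j) (x j) (s j))\<^sup>2))"
        by (rule ennreal_leI)
      also have "\<dots> = (\<Sum>l\<in>\<Lambda> - G. ennreal (real ?N * (\<Prod>j=1..d. (\<delta> j (l j) (x j) (s j))\<^sup>2)))"
        by (subst sum_ennreal) (auto intro!: mult_nonneg_nonneg prod_nonneg)
      also have "\<dots> = (\<Sum>l\<in>\<Lambda> - G. of_nat ?N * (\<Prod>j=1..d. ?g j (l j) (x j) (s j)))"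
        by (auto intro!: sum.cong simp: ennreal_mult prod_nonneg prod_ennreal ennreal_of_nat_eq_real_of_nat)
      finally show "ennreal ((sheet_kernel d r x s - (\<Sum>p\<in>J. bas p x * sheet_kernel d r (node p) s))\<^sup>2)
          \<le> (\<Sum>l\<in>\<Lambda> - G. of_nat ?N * (\<Prod>j=1..d. ?g j (l j) (x j) (s j)))"
        unfolding err[OF x] .
    qed
    also have "\<dots> = (\<integral>\<^sup>+x. (\<Sum>l\<in>\<Lambda> - G. of_nat ?N * (\<Prod>j=1..d. \<integral>\<^sup>+s. ?g j (l j) (x j) s \<partial>unit_measure)) \<partial>cube_measure d)"
    proof (rule nn_integral_cong)
      fix x assume "x \<in> space (cube_measure d)"
      then have x: "x j \<in> {0..1}" if "j \<in> {1..d}" for j using cubeD[of x d j] that by simp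
      have pm: "(\<lambda>s. \<Prod>j=1..d. ?g j (l j) (x j) (s j)) \<in> borel_measurable (cube_measure d)" for l
        by (intro borel_measurable_prod_ennreal measurable_compose[OF measurable_component_unit gs] x) auto
      have "(\<integral>\<^sup>+s. (\<Sum>l\<in>\<Lambda> - G. of_nat ?N * (\<Prod>j=1..d. ?g j (l j) (x j) (s j))) \<partial>cube_measure d)
          = (\<Sum>l\<in>\<Lambda> - G. \<integral>\<^sup>+s. of_nat ?N * (\<Prod>j=1..d. ?g j (l j) (x j) (s j)) \<partial>cube_measure d)"
        by (rule nn_integral_sum) (intro borel_measurable_times_ennreal borel_measurable_const pm)
      also have "\<dots> = (\<Sum>l\<in>\<Lambda> - G. of_nat ?N * (\<Prod>j=1..d. \<integral>\<^sup>+s. ?g j (l j) (x j) s \<partial>unit_measure))"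
        by (intro sum.cong refl, subst nn_integral_cmult[OF pm], subst nn_integral_tensor) (use gs x in auto)
      finally show "(\<integral>\<^sup>+s. (\<Sum>l\<in>\<Lambda> - G. of_nat ?N * (\<Prod>j=1..d. ?g j (l j) (x j) (s j))) \<partial>cube_measure d)
          = (\<Sum>l\<in>\<Lambda> - G. of_nat ?N * (\<Prod>j=1..d. \<integral>\<^sup>+s. ?g j (l j) (x j) s \<partial>unit_measure))" .
    qed
    also have "\<dots> = (\<Sum>l\<in>\<Lambda> - G. of_nat ?N * (\<Prod>j=1..d. square_norm (\<delta> j (l j))))"
    proof -
      have pm: "(\<lambda>x. \<Prod>j=1..d. \<integral>\<^sup>+s. ?g j (l j) (x j) s \<partial>unit_measure) \<in> borel_measurable (cube_measure d)" for l
        by (intro borel_measurable_prod_ennreal measurable_compose[OF measurable_component_unit gx]) auto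
      have "(\<integral>\<^sup>+x. (\<Sum>l\<in>\<Lambda> - G. of_nat ?N * (\<Prod>j=1..d. \<integral>\<^sup>+s. ?g j (l j) (x j) s \<partial>unit_measure)) \<partial>cube_measure d)
          = (\<Sum>l\<in>\<Lambda> - G. \<integral>\<^sup>+x. of_nat ?N * (\<Prod>j=1..d. \<integral>\<^sup>+s. ?g j (l j) (x j) s \<partial>unit_measure) \<partial>cube_measure d)"
        by (rule nn_integral_sum) (intro borel_measurable_times_ennreal borel_measurable_const pm)
      also have "\<dots> = (\<Sum>l\<in>\<Lambda> - G. of_nat ?N * (\<Prod>j=1..d. square_norm (\<delta> j (l j))))"
        unfolding square_norm_def
        by (intro sum.cong refl, subst nn_integral_cmult[OF pm],
            subst nn_integral_tensor[of d "\<lambda>j x. \<integral>\<^sup>+s. ?g j (l j) x s \<partial>unit_measure" for l]) (use gx in auto)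
      finally show ?thesis .
    qed
    also have "\<dots> \<le> (\<Sum>l\<in>\<Lambda> - G. of_nat ?N * ennreal (C1 ^ d * \<rho> ^ q))"
    proof (intro sum_mono mult_left_mono)
      fix l assume l: "l \<in> \<Lambda> - G"
      then have lq: "l j \<le> Suc q" if "j \<in> {1..d}" for j using that by (auto simp: \<Lambda>_def)
      have "(\<Prod>j=1..d. square_norm (\<delta> j (l j))) \<le> (\<Prod>j=1..d. ennreal (C1 * \<rho> ^ l j))"
        by (intro ennreal_prod_mono \<delta>n lq)
      also have "\<dots> = ennreal (\<Prod>j=1..d. C1 * \<rho> ^ l j)"
        by (rule prod_ennreal) (use C1 \<rho> in auto)
      also have "(\<Prod>j=1..d. C1 * \<rho> ^ l j) = C1 ^ d * \<rho> ^ (\<Sum>j=1..d. l j)"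
        by (simp add: prod.distrib power_sum)
      also have "ennreal \<dots> \<le> ennreal (C1 ^ d * \<rho> ^ q)"
        using l \<rho> C1 by (intro ennreal_leI mult_left_mono power_decreasing) (auto simp: G_def)
      finally show "(\<Prod>j=1..d. square_norm (\<delta> j (l j))) \<le> ennreal (C1 ^ d * \<rho> ^ q)" .
    qed auto
    also have "\<dots> = ennreal (real ?N * real ?N * (C1 ^ d * \<rho> ^ q))"
      using C1 \<rho> by (simp add: ennreal_mult ennreal_of_nat_eq_real_of_nat mult.assoc)
    also have "\<dots> \<le> ennreal (C1 ^ d * (real (q + 2) ^ d)\<^sup>2 * (1 / 2 ^ q) ^ (2 * m + 1))"
    proof (rule ennreal_leI)
      have "?N \<le> card \<Lambda>" by (rule card_mono) (use fin in auto)
      then have "real ?N \<le> real (card \<Lambda>)" by (rule of_nat_mono)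
      also have "real (card \<Lambda>) = real (q + 2) ^ d" unfolding card\<Lambda> by (simp add: of_nat_power)
      finally have N: "real ?N \<le> real (q + 2) ^ d" .
      have "real ?N * real ?N * (C1 ^ d * \<rho> ^ q) \<le> real (q + 2) ^ d * real (q + 2) ^ d * (C1 ^ d * \<rho> ^ q)"
        using C1 \<rho> by (intro mult_right_mono mult_mono N) auto
      then show "real ?N * real ?N * (C1 ^ d * \<rho> ^ q) \<le> C1 ^ d * (real (q + 2) ^ d)\<^sup>2 * (1 / 2 ^ q) ^ (2 * m + 1)"
        unfolding rho by (simp add: power2_eq_square mult_ac)
    qed
    finally have E: "(\<integral>\<^sup>+x. (\<integral>\<^sup>+s. ennreal ((sheet_kernel d r x s - (\<Sum>p\<in>J. bas p x * sheet_kernel d r (node p) s))\<^sup>2)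
          \<partial>cube_measure d) \<partial>cube_measure d) \<le> ennreal (C1 ^ d * (real (q + 2) ^ d)\<^sup>2 * (1 / 2 ^ q) ^ (2 * m + 1))" .
    have cardJ: "real (card J) \<le> C1 ^ d * real (q + 2) ^ d * 2 ^ q"
    proof -
      have "real (card J) = (\<Sum>l\<in>G. real (card (I l)))" unfolding J_def using fin finI by (simp add: card_SigmaI)
      also have "\<dots> \<le> (\<Sum>l\<in>G. C1 ^ d * 2 ^ q)"
      proof (rule sum_mono)
        fix l assume l: "l \<in> G"
        have "real (card (I l)) = (\<Prod>j=1..d. real (nk (r j) (l j)))" by (simp add: I_def card_PiE)
        also have "\<dots> \<le> C1 ^ d * 2 ^ (\<Sum>j=1..d. l j)"
        proof (rule prod_le_power_sum)
          fix j assume j: "j \<in> {1..d}"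
          have "real (nk (r j) (l j)) \<le> Ck (r j) * 2 ^ l j" by (rule nk)
          also have "\<dots> \<le> C1 * 2 ^ l j" using CkC1[OF j] by (intro mult_right_mono) auto
          finally show "0 \<le> real (nk (r j) (l j)) \<and> real (nk (r j) (l j)) \<le> C1 * 2 ^ l j" by simp
        qed (use C1 in auto)
        also have "\<dots> \<le> C1 ^ d * 2 ^ q" using l C1 by (intro mult_left_mono power_increasing) (auto simp: G_def)
        finally show "real (card (I l)) \<le> C1 ^ d * 2 ^ q" .
      qed
      also have "\<dots> = real (card G) * (C1 ^ d * 2 ^ q)" by simp
      also have "\<dots> \<le> real (q + 2) ^ d * (C1 ^ d * 2 ^ q)"
      proof (rule mult_right_mono)
        have "card G \<le> card \<Lambda>" by (rule card_mono) (use fin in \<open>auto simp: G_def\<close>)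
        then have "real (card G) \<le> real (card \<Lambda>)" by (rule of_nat_mono)
        then show "real (card G) \<le> real (q + 2) ^ d" unfolding card\<Lambda> by (simp add: of_nat_power)
      qed (use C1 in auto)
      finally show ?thesis by (simp add: mult_ac)
    qed
    obtain \<beta> where \<beta>: "bij_betw \<beta> {0..<card J} J" using ex_bij_betw_nat_finite[OF finJ] by auto
    then have \<beta>J: "\<beta> i \<in> J" if "i < card J" for i using that by (auto simp: bij_betw_def)
    \<comment> \<open>Beyond the grid the nodes default to the origin, because
      \<open>linear_algorithm\<close> expects every index to give a point of the cube.\<close>
    define tt where "tt = (\<lambda>i. if i < card J then node (\<beta> i) else (\<lambda>j\<in>{1..d}. 0))"
    have re: "(\<Sum>i<card J. bas (\<beta> i) x * sheet_kernel d r (tt i) s) = (\<Sum>p\<in>J. bas p x * sheet_kernel d r (node p) s)" for x s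
    proof -
      have "(\<Sum>i<card J. bas (\<beta> i) x * sheet_kernel d r (tt i) s) = (\<Sum>i<card J. bas (\<beta> i) x * sheet_kernel d r (node (\<beta> i)) s)"
        by (rule sum.cong) (auto simp: tt_def)
      then show ?thesis
        using sum.reindex_bij_betw[OF \<beta>, of "\<lambda>p. bas p x * sheet_kernel d r (node p) s"] by (simp add: atLeast0LessThan)
    qed
    show ?thesis
    proof (intro exI[of _ "card J"] exI[of _ tt] exI[of _ "\<lambda>i. bas (\<beta> i)"] conjI allI impI)
      show "tt i \<in> cube d" for i using node_in \<beta>J cube_restrictI[of d "\<lambda>_. 0"] by (simp add: tt_def)
      show "bas (\<beta> i) \<in> F_space d r" if "i < card J" for i by (rule bas_in[OF \<beta>J[OF that]])
      show "sampling_error d r (card J) tt (\<lambda>i. bas (\<beta> i))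
          \<le> ennreal (C1 ^ d * (real (q + 2) ^ d)\<^sup>2 * (1 / 2 ^ q) ^ (2 * m + 1))"
        unfolding sampling_error_def re by (rule E)
    qed (rule cardJ)
  qed
  moreover have "C1 ^ d > 0" using C1 by simp
  ultimately show ?thesis by blast
qed

section \<open>Balancing accuracy and cost\<close>

lemma power_le_fact_exp:
  fixes y :: real
  assumes "y \<ge> 0"
  shows "y ^ n \<le> fact n * exp y"
proof -
  have s: "(\<lambda>k. y ^ k /\<^sub>R fact k) sums exp y" by (rule exp_converges)
  have "(\<Sum>k\<in>{n}. y ^ k /\<^sub>R fact k) \<le> (\<Sum>k. y ^ k /\<^sub>R fact k)"
    by (rule sum_le_suminf) (use s assms in \<open>auto simp: sums_iff\<close>)
  then have "y ^ n / fact n \<le> exp y" using s by (simp add: sums_iff divide_inverse mult.commute)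
  then show ?thesis by (simp add: field_simps)
qed

lemma polynomial_growth_bound:
  fixes \<eta> :: real
  assumes "\<eta> > 0"
  obtains D where "D > 0" "\<And>q::nat. real (q + 2) ^ d \<le> D * 2 powr (\<eta> * real q)"
proof -
  define z where "z = \<eta> * ln 2"
  have z: "z > 0" using assms by (simp add: z_def)
  let ?D = "fact d * 2 powr (2 * \<eta>) / z ^ d"
  have "real (q + 2) ^ d \<le> ?D * 2 powr (\<eta> * real q)" for q :: nat
  proof -
    have "(z * real (q + 2)) ^ d \<le> fact d * exp (z * real (q + 2))"
      by (rule power_le_fact_exp) (use z in simp)
    also have "exp (z * real (q + 2)) = 2 powr (2 * \<eta>) * 2 powr (\<eta> * real q)"
      unfolding powr_add[symmetric] by (simp add: powr_def z_def algebra_simps)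
    finally have "z ^ d * real (q + 2) ^ d \<le> fact d * (2 powr (2 * \<eta>) * 2 powr (\<eta> * real q))"
      unfolding power_mult_distrib .
    then have "real (q + 2) ^ d \<le> fact d * (2 powr (2 * \<eta>) * 2 powr (\<eta> * real q)) / z ^ d"
      using z by (subst pos_le_divide_eq) (auto simp: mult.commute)
    then show ?thesis by (simp add: mult_ac)
  qed
  then show ?thesis using z by (intro that[of ?D]) auto
qed

text \<open>The two exponents are perturbed by the same \<open>\<eta>\<close>, chosen with
  \<open>(1 + \<eta>) / (\<alpha> - \<eta>) = p\<close>.\<close>

lemma level_choice:
  fixes A B \<alpha> p :: real
  assumes "\<alpha> > 0" "p > 1 / \<alpha>" "A \<ge> 0" "B \<ge> 0"
  obtains C where "C \<ge> 0"
    "\<And>\<epsilon>. 0 < \<epsilon> \<Longrightarrow> \<epsilon> < 1 \<Longrightarrow> \<exists>q::nat. A * real (q + 2) ^ d * 2 powr (- \<alpha> * real q) \<le> \<epsilon> \<and>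
      B * real (q + 2) ^ d * 2 ^ q \<le> C * \<epsilon> powr (- p)"
proof -
  have p0: "p > 0" using assms by (smt (verit) divide_pos_pos)
  define \<eta> where "\<eta> = (p * \<alpha> - 1) / (1 + p)"
  define \<beta> where "\<beta> = \<alpha> - \<eta>"
  have "p * \<alpha> > 1" using assms by (simp add: field_simps)
  then have \<eta>: "\<eta> > 0" using p0 by (simp add: \<eta>_def)
  have \<beta>eq: "\<beta> = (\<alpha> + 1) / (1 + p)" using p0 by (simp add: \<beta>_def \<eta>_def field_simps)
  have \<beta>: "\<beta> > 0" unfolding \<beta>eq using assms p0 by simp
  have pe: "1 + \<eta> = p * \<beta>" using p0 by (simp add: \<beta>eq \<eta>_def field_simps)
  obtain D where D: "D > 0" "\<And>q::nat. real (q + 2) ^ d \<le> D * 2 powr (\<eta> * real q)"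
    using polynomial_growth_bound[OF \<eta>] by blast
  \<comment> \<open>The added 1 ensures \<open>E / \<epsilon> > 1\<close>, hence a positive level
    \<open>u\<close>, also when \<open>A = 0\<close>.\<close>
  define E where "E = A * D + 1"
  have E: "E \<ge> 1" using assms D by (simp add: E_def)
  define C where "C = B * D * 2 powr (1 + \<eta>) * E powr p"
  show thesis
  proof (rule that[of C])
    show "C \<ge> 0" using assms D by (simp add: C_def)
    fix \<epsilon> :: real assume \<epsilon>: "0 < \<epsilon>" "\<epsilon> < 1"
    \<comment> \<open>The real level at which the error bound
      \<open>E * 2 powr (- (\<beta> * u))\<close> equals \<open>\<epsilon>\<close>. Rounding it up
      costs the factor \<open>2 powr (1 + \<eta>)\<close> contained in \<open>C\<close>.\<close>
    define u where "u = log 2 (E / \<epsilon>) / \<beta>"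
    have "E / \<epsilon> > 1" using E \<epsilon> by (simp add: field_simps)
    then have u0: "u > 0" using \<beta> by (simp add: u_def)
    define q where "q = nat \<lceil>u\<rceil>"
    have q: "u \<le> real q" "real q \<le> u + 1" using u0 by (auto simp: q_def of_nat_ceiling) 
    have pu: "2 powr (\<beta> * u) = E / \<epsilon>" using \<beta> E \<epsilon> by (simp add: u_def)
    have "A * real (q + 2) ^ d * 2 powr (- \<alpha> * real q) \<le> A * (D * 2 powr (\<eta> * real q)) * 2 powr (- \<alpha> * real q)"
      by (intro mult_right_mono mult_left_mono D assms) auto
    also have "\<dots> = A * D * 2 powr (- (\<beta> * real q))"
      by (simp add: \<beta>_def powr_add[symmetric] algebra_simps)
    also have "\<dots> \<le> E * 2 powr (- (\<beta> * u))"
      using q \<beta> assms D by (intro mult_mono) (auto simp: E_def)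
    also have "\<dots> = \<epsilon>" unfolding powr_minus pu using E \<epsilon> by simp
    finally have 1: "A * real (q + 2) ^ d * 2 powr (- \<alpha> * real q) \<le> \<epsilon>" .
    have "B * real (q + 2) ^ d * 2 ^ q \<le> B * (D * 2 powr (\<eta> * real q)) * 2 powr (real q)"
      using assms D(1) by (intro mult_mono D(2) mult_nonneg_nonneg) (auto simp: powr_realpow)
    also have "\<dots> = B * D * 2 powr ((1 + \<eta>) * real q)" by (simp add: powr_add[symmetric] algebra_simps)
    also have "\<dots> \<le> B * D * 2 powr ((1 + \<eta>) * (u + 1))"
      using q \<eta> assms D by (intro mult_left_mono) auto
    also have "2 powr ((1 + \<eta>) * (u + 1)) = 2 powr (1 + \<eta>) * (2 powr (\<beta> * u)) powr p"
      unfolding powr_powr powr_add[symmetric] pe by (simp add: algebra_simps)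
    also have "B * D * \<dots> = C * \<epsilon> powr (- p)"
      unfolding pu C_def using E \<epsilon> by (simp add: powr_divide powr_minus field_simps)
    finally show "\<exists>q::nat. A * real (q + 2) ^ d * 2 powr (- \<alpha> * real q) \<le> \<epsilon> \<and>
      B * real (q + 2) ^ d * 2 ^ q \<le> C * \<epsilon> powr (- p)" using 1 by blast
  qed
qed

subsection \<open>Output spaces of programs\<close>

fun operand_consts :: "'a operand \<Rightarrow> 'a set" where
  "operand_consts (Const g) = {g}"
| "operand_consts (Reg i) = {}"

text \<open>The constants on the path that a program takes when the outcome of its \<open>i\<close>-th step, if that is
  a comparison, is the \<open>i\<close>-th bit.\<close>

primrec path_consts :: "bool list \<Rightarrow> 'g program \<Rightarrow> 'g set" where
  "path_consts [] p = (case p of Return x \<Rightarrow> operand_consts x | _ \<Rightarrow> {})"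
| "path_consts (b # bs) p = (case p of
      Return x \<Rightarrow> operand_consts x
    | Arith _ _ _ q \<Rightarrow> path_consts bs q
    | Branch _ _ _ q q' \<Rightarrow> path_consts bs (if b then q else q')
    | VAdd x y q \<Rightarrow> operand_consts x \<union> operand_consts y \<union> path_consts bs q
    | VScale _ y q \<Rightarrow> operand_consts y \<union> path_consts bs q)"

lemma finite_operand_consts: "finite (operand_consts x)" "card (operand_consts x) \<le> 1"
  by (cases x; simp)+

lemma finite_path_consts: "finite (path_consts bs p)"
  by (induction bs arbitrary: p) (auto simp: finite_operand_consts split: program.split)

text \<open>A step uses at most two vector constants, with \<open>VAdd\<close> as the extreme case,
  and the final \<open>Return\<close> uses at most one.\<close>

lemma card_path_consts: "card (path_consts bs p) \<le> 2 * length bs + 1"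
proof (induction bs arbitrary: p)
  case Nil
  show ?case using finite_operand_consts(2) by (auto split: program.split intro: order_trans)
next
  case (Cons b bs)
  show ?case
  proof (cases p)
    case (Return x)
    then show ?thesis using finite_operand_consts(2)[of x] by simp
  next
    case (Arith x1 x2 x3 x4)
    then show ?thesis using Cons[of x4] by simp
  next
    case (Branch x1 x2 x3 x4 x5)
    then show ?thesis using Cons[of x4] Cons[of x5] by simp
  next
    case (VAdd x y q)
    have "card (operand_consts x \<union> operand_consts y \<union> path_consts bs q)
        \<le> card (operand_consts x) + card (operand_consts y) + card (path_consts bs q)"
      by (meson add_mono card_Un_le order_refl order_trans)
    then show ?thesis
      using VAdd Cons[of q] finite_operand_consts(2)[of x] finite_operand_consts(2)[of y] by simp
  next
    case (VScale x y q)
    have "card (operand_consts y \<union> path_consts bs q) \<le> card (operand_consts y) + card (path_consts bs q)"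
      by (rule card_Un_le)
    then show ?thesis using VScale Cons[of q] finite_operand_consts(2)[of y] by simp
  qed
qed

lemma fetch_cases:
  "fetch us x = Some g \<Longrightarrow> g \<in> set us \<or> g \<in> operand_consts x"
  by (cases x) (auto split: if_splits)

text \<open>The output lies in the span of the initial vector registers and the constants on the
  path; the span is expressed by all predicates \<open>P\<close> closed under the operations. The
  bits \<open>bs\<close> are fixed before \<open>P\<close>, so one path serves all \<open>P\<close>.
  Scalars are unrestricted, which removes the dependence on the data. Intersecting with the carrier
  is justified because \<open>runs\<close> demands operands in it.\<close>

lemma runs_path:
  "runs H p xs us v k \<Longrightarrow> \<exists>bs. length bs = k \<and>
    (\<forall>P. (\<forall>g h. P g \<longrightarrow> P h \<longrightarrow> P (hadd H g h)) \<longrightarrow> (\<forall>a g. P g \<longrightarrow> P (hscale H a g)) \<longrightarrow>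
      (\<forall>u\<in>set us \<inter> hcarrier H. P u) \<longrightarrow> (\<forall>g\<in>path_consts bs p \<inter> hcarrier H. P g) \<longrightarrow> P v)"
proof (induction rule: runs.induct)
  case (run_Return us x v xs)
  then show ?case using fetch_cases[OF run_Return(1)] by (intro exI[of _ "[]"]) auto
next
  case (run_Arith xs x a y b opr p us v k)
  then obtain bs where "length bs = k" "\<forall>P. (\<forall>g h. P g \<longrightarrow> P h \<longrightarrow> P (hadd H g h)) \<longrightarrow> (\<forall>a g. P g \<longrightarrow> P (hscale H a g)) \<longrightarrow>
      (\<forall>u\<in>set us \<inter> hcarrier H. P u) \<longrightarrow> (\<forall>g\<in>path_consts bs p \<inter> hcarrier H. P g) \<longrightarrow> P v" by blast
  then show ?case by (intro exI[of _ "True # bs"]) simp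
next
  case (run_Branch xs x a y b opr p q us v k)
  then obtain bs where "length bs = k" "\<forall>P. (\<forall>g h. P g \<longrightarrow> P h \<longrightarrow> P (hadd H g h)) \<longrightarrow> (\<forall>a g. P g \<longrightarrow> P (hscale H a g)) \<longrightarrow>
      (\<forall>u\<in>set us \<inter> hcarrier H. P u) \<longrightarrow> (\<forall>g\<in>path_consts bs (if cmp opr a b then p else q) \<inter> hcarrier H. P g) \<longrightarrow> P v"
    by blast
  then show ?case by (intro exI[of _ "cmp opr a b # bs"]) simp
next
  case (run_VAdd us x g y h p xs v k)
  then obtain bs where bs: "length bs = k" and *: "\<And>P. (\<forall>g h. P g \<longrightarrow> P h \<longrightarrow> P (hadd H g h)) \<Longrightarrow> (\<forall>a g. P g \<longrightarrow> P (hscale H a g)) \<Longrightarrow>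
      (\<forall>u\<in>set (us @ [hadd H g h]) \<inter> hcarrier H. P u) \<Longrightarrow> (\<forall>g\<in>path_consts bs p \<inter> hcarrier H. P g) \<Longrightarrow> P v" by blast
  show ?case
  proof (intro exI[of _ "True # bs"] conjI allI impI)
    fix P assume c: "\<forall>g h. P g \<longrightarrow> P h \<longrightarrow> P (hadd H g h)" "\<forall>a g. P g \<longrightarrow> P (hscale H a g)"
      and u: "\<forall>u\<in>set us \<inter> hcarrier H. P u" and k: "\<forall>g\<in>path_consts (True # bs) (VAdd x y p) \<inter> hcarrier H. P g"
    have "P g" "P h" using fetch_cases[OF run_VAdd(1)] fetch_cases[OF run_VAdd(2)] run_VAdd(3,4) u k by auto
    then show "P v" using c u k by (intro *[of P]) auto
  qed (simp add: bs)
next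
  case (run_VScale xs x a us y g p v k)
  then obtain bs where bs: "length bs = k" and *: "\<And>P. (\<forall>g h. P g \<longrightarrow> P h \<longrightarrow> P (hadd H g h)) \<Longrightarrow> (\<forall>a g. P g \<longrightarrow> P (hscale H a g)) \<Longrightarrow>
      (\<forall>u\<in>set (us @ [hscale H a g]) \<inter> hcarrier H. P u) \<Longrightarrow> (\<forall>g\<in>path_consts bs p \<inter> hcarrier H. P g) \<Longrightarrow> P v" by blast
  show ?case
  proof (intro exI[of _ "True # bs"] conjI allI impI)
    fix P assume c: "\<forall>g h. P g \<longrightarrow> P h \<longrightarrow> P (hadd H g h)" "\<forall>a g. P g \<longrightarrow> P (hscale H a g)"
      and u: "\<forall>u\<in>set us \<inter> hcarrier H. P u" and k: "\<forall>g\<in>path_consts (True # bs) (VScale x y p) \<inter> hcarrier H. P g"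
    have "P g" using fetch_cases[OF run_VScale(2)] run_VScale(3) u k by auto
    then show "P v" using c u k by (intro *[of P]) auto
  qed (simp add: bs)
qed

text \<open>The reflection that takes \<open>b\<close> to a multiple of the unit vector with index
  0. Its rows form an orthonormal basis, and all rows except the first are orthogonal to
  \<open>b\<close>.\<close>

lemma householder:
  fixes b :: "nat \<Rightarrow> real"
  assumes m: "0 < m" and nz: "\<exists>a<m. b a \<noteq> 0"
  shows "\<exists>H. (\<forall>a<m. \<forall>a'<m. (\<Sum>e<m. H a e * H a' e) = (if a = a' then 1 else 0)) \<and>
    (\<forall>a. 0 < a \<longrightarrow> a < m \<longrightarrow> (\<Sum>e<m. H a e * b e) = 0)"
proof -
  define n where "n = sqrt (\<Sum>e<m. (b e)\<^sup>2)"
  \<comment> \<open>The sign avoids cancellation in \<open>v 0\<close>, so that the reflecting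
    vector is nonzero.\<close>
  define s :: real where "s = (if b 0 \<ge> 0 then 1 else -1)"
  define v where "v = (\<lambda>a. b a + (if a = 0 then s * n else 0))"
  define w where "w = (\<Sum>e<m. (v e)\<^sup>2)"
  define H where "H = (\<lambda>a e. (if a = e then 1 else 0) - 2 * v a * v e / w)"
  have n2: "n\<^sup>2 = (\<Sum>e<m. (b e)\<^sup>2)" by (simp add: n_def sum_nonneg)
  have npos: "n > 0"
  proof -
    obtain a where a: "a < m" "b a \<noteq> 0" using nz by blast
    have "0 < (b a)\<^sup>2" using a by simp
    also have "\<dots> \<le> (\<Sum>e<m. (b e)\<^sup>2)" by (rule member_le_sum) (use a in auto)
    finally show ?thesis by (simp add: n_def)
  qed
  have del: "(\<Sum>e<m. (if e = 0 then c else 0) * g e) = c * g 0" for c and g :: "nat \<Rightarrow> real"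
  proof -
    have "(\<Sum>e<m. (if e = 0 then c else 0) * g e) = (\<Sum>e<m. if e = 0 then c * g e else 0)"
      by (intro sum.cong) auto
    then show ?thesis using m by simp
  qed
  have vb: "(\<Sum>e<m. v e * b e) = n\<^sup>2 + s * n * b 0"
  proof -
    have "(\<Sum>e<m. v e * b e) = (\<Sum>e<m. (b e)\<^sup>2) + (\<Sum>e<m. (if e = 0 then s * n else 0) * b e)"
      by (simp add: v_def distrib_right sum.distrib power2_eq_square)
    then show ?thesis by (simp add: n2 del)
  qed
  have ww: "w = 2 * (n\<^sup>2 + s * n * b 0)"
  proof -
    have "w = (\<Sum>e<m. v e * b e) + (\<Sum>e<m. (if e = 0 then s * n else 0) * v e)"
      by (simp add: w_def power2_eq_square v_def algebra_simps sum.distrib[symmetric])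
    also have "\<dots> = n\<^sup>2 + s * n * b 0 + s * n * v 0" by (simp add: vb del)
    also have "s * n * v 0 = s * n * b 0 + n\<^sup>2" by (simp add: v_def s_def algebra_simps power2_eq_square)
    finally show ?thesis by simp
  qed
  have wpos: "w > 0"
  proof -
    have "s * n * b 0 \<ge> 0" using npos by (auto simp: s_def mult_nonneg_nonneg mult_nonneg_nonpos zero_le_mult_iff)
    then show ?thesis using npos by (simp add: ww add_pos_nonneg)
  qed
  have id: "(\<Sum>e<m. (if a = e then 1 else 0) * g e) = g a" if "a < m" for a and g :: "nat \<Rightarrow> real"
  proof -
    have "(\<Sum>e<m. (if a = e then 1 else 0) * g e) = (\<Sum>e<m. if e = a then g e else 0)"
      by (intro sum.cong) auto
    then show ?thesis using that by simp
  qed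
  have Hg: "(\<Sum>e<m. H a e * g e) = g a - 2 * v a / w * (\<Sum>e<m. v e * g e)" if "a < m" for a and g :: "nat \<Rightarrow> real"
  proof -
    have "H a e * g e = (if a = e then 1 else 0) * g e - 2 * v a / w * (v e * g e)" for e
      by (simp only: H_def left_diff_distrib times_divide_eq_left mult.assoc)
    then show ?thesis
      by (simp only: sum_subtractf id[OF that] sum_distrib_left[symmetric])
  qed
  show ?thesis
  proof (intro exI[of _ H] conjI allI impI)
    fix a a' assume a: "a < m" "a' < m"
    have "(\<Sum>e<m. v e * H a' e) = (\<Sum>e<m. H a' e * v e)" by (simp add: mult.commute)
    also have "\<dots> = v a' - 2 * v a' / w * w" unfolding Hg[OF a(2)] by (simp add: w_def power2_eq_square)
    also have "\<dots> = - v a'" using wpos by simp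
    finally have vH: "(\<Sum>e<m. v e * H a' e) = - v a'" .
    have "(\<Sum>e<m. H a e * H a' e) = H a' a + 2 * v a / w * v a'"
      unfolding Hg[OF a(1)] vH by simp
    then show "(\<Sum>e<m. H a e * H a' e) = (if a = a' then 1 else 0)" by (simp add: H_def)
  next
    fix a assume a: "0 < a" "a < m"
    have "(\<Sum>e<m. H a e * b e) = b a - v a * (2 * (n\<^sup>2 + s * n * b 0) / w)"
      unfolding Hg[OF a(2)] vb by simp
    also have "2 * (n\<^sup>2 + s * n * b 0) / w = 1" using wpos ww by simp
    finally show "(\<Sum>e<m. H a e * b e) = 0" using a by (simp add: v_def)
  qed
qed

text \<open>The constraints are imposed one at a time: a reflection within the current orthonormal
  system makes all members but one orthogonal to the new vector, and that one is dropped.\<close>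

lemma orthonormal_complement:
  fixes V :: "(nat \<Rightarrow> real) set"
  assumes "finite V"
  shows "\<exists>c. (\<forall>a<M - card V. \<forall>a'<M - card V. (\<Sum>i<M. c a i * c a' i) = (if a = a' then 1 else 0)) \<and>
    (\<forall>a<M - card V. \<forall>u\<in>V. (\<Sum>i<M. c a i * u i) = (0::real))"
  using assms
proof (induction V rule: finite_induct)
  case empty
  have "(\<Sum>i<M. (if a = i then 1 else 0) * (if a' = i then 1 else 0)) = (if a = a' then 1 else 0 :: real)"
    if "a < M" for a a'
  proof -
    have "(\<Sum>i<M. (if a = i then 1 else 0) * (if a' = i then 1 else 0)) = (\<Sum>i<M. if i = a then (if a' = a then 1 else 0) else (0::real))"
      by (intro sum.cong) auto
    then show ?thesis using that by auto
  qed
  then show ?case by (intro exI[of _ "\<lambda>a i. if a = i then 1 else 0"]) auto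
next
  case (insert u V)
  define m where "m = M - card V"
  have mc: "M - card (insert u V) = m - 1" using insert by (simp add: m_def)
  obtain c where on: "\<And>a a'. a < m \<Longrightarrow> a' < m \<Longrightarrow> (\<Sum>i<M. c a i * c a' i) = (if a = a' then 1 else 0)"
    and orth: "\<And>a w. a < m \<Longrightarrow> w \<in> V \<Longrightarrow> (\<Sum>i<M. c a i * w i) = (0::real)"
    using insert.IH unfolding m_def by blast
  define b where "b = (\<lambda>a. \<Sum>i<M. c a i * u i)"
  show ?case unfolding mc
  proof (cases "\<exists>a<m. b a \<noteq> 0")
    case False
    then show "\<exists>c. (\<forall>a<m - 1. \<forall>a'<m - 1. (\<Sum>i<M. c a i * c a' i) = (if a = a' then 1 else 0)) \<and>
      (\<forall>a<m - 1. \<forall>w\<in>insert u V. (\<Sum>i<M. c a i * w i) = 0)"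
      using on orth by (intro exI[of _ c]) (auto simp: b_def)
  next
    case True
    then have m0: "0 < m" by auto
    obtain H where H: "\<And>a a'. a < m \<Longrightarrow> a' < m \<Longrightarrow> (\<Sum>e<m. H a e * H a' e) = (if a = a' then 1 else 0)"
      "\<And>a. 0 < a \<Longrightarrow> a < m \<Longrightarrow> (\<Sum>e<m. H a e * b e) = 0"
      using householder[OF m0 True] by blast
    \<comment> \<open>The index shift drops row 0 of the reflection, the only one that may have a
      component along \<open>u\<close>.\<close>
    define c' where "c' = (\<lambda>a i. \<Sum>e<m. H (Suc a) e * c e i)"
    have lin: "(\<Sum>i<M. c' a i * w i) = (\<Sum>e<m. H (Suc a) e * (\<Sum>i<M. c e i * w i))" for a w
      unfolding c'_def sum_distrib_right sum_distrib_left by (subst sum.swap) (simp add: mult_ac)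
    have cc: "(\<Sum>i<M. c e i * c' a' i) = H (Suc a') e" if "e < m" for e a'
    proof -
      have "(\<Sum>i<M. c e i * c' a' i) = (\<Sum>e'<m. H (Suc a') e' * (\<Sum>i<M. c e' i * c e i))"
        using lin[of a' "c e"] by (simp add: mult.commute)
      also have "\<dots> = (\<Sum>e'<m. if e' = e then H (Suc a') e' else 0)"
        using on that by (intro sum.cong) auto
      finally show ?thesis using that by simp
    qed
    show "\<exists>c. (\<forall>a<m - 1. \<forall>a'<m - 1. (\<Sum>i<M. c a i * c a' i) = (if a = a' then 1 else 0)) \<and>
      (\<forall>a<m - 1. \<forall>w\<in>insert u V. (\<Sum>i<M. c a i * w i) = 0)"
    proof (intro exI[of _ c'] conjI allI impI ballI)
      fix a a' assume "a < m - 1" "a' < m - 1"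
      then show "(\<Sum>i<M. c' a i * c' a' i) = (if a = a' then 1 else 0)"
        unfolding lin using cc H(1)[of "Suc a" "Suc a'"] by simp
    next
      fix a w assume a: "a < m - 1" and w: "w \<in> insert u V"
      show "(\<Sum>i<M. c' a i * w i) = 0"
      proof (cases "w = u")
        case True
        then show ?thesis unfolding lin using H(2)[of "Suc a"] a by (simp add: b_def)
      next
        case False
        then show ?thesis unfolding lin using orth w by simp
      qed
    qed
  qed
qed

subsection \<open>Small balls\<close>

text \<open>For a standard normal \<open>g\<close> the mean of \<open>exp (- t * g\<^sup>2)\<close>
  is the inverse square root of \<open>1 + 2 * t\<close>; the value \<open>t = 3 / 2\<close> is
  chosen to make it exactly one half.\<close>

lemma std_normal_gaussian_moment: "(\<integral>g. exp (- 3 / 2 * g\<^sup>2) \<partial>std_normal_distribution) = 1 / 2"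
proof -
  have "(\<integral>g. exp (- 3 / 2 * g\<^sup>2) \<partial>std_normal_distribution) = (\<integral>g. std_normal_density g * exp (- 3 / 2 * g\<^sup>2) \<partial>lborel)"
    by (subst integral_density) auto
  also have "\<dots> = (\<integral>g. 1 / 2 * normal_density 0 (1 / 2) g \<partial>lborel)"
  proof (rule Bochner_Integration.integral_cong[OF refl])
    fix g :: real
    have "sqrt (2 * pi * (1 / 2)\<^sup>2) = sqrt (2 * pi) / 2" 
    proof -
      have "sqrt (2 * pi * (1 / 2)\<^sup>2) = sqrt (2 * pi) * sqrt ((1 / 2)\<^sup>2)" by (rule real_sqrt_mult)
      then show ?thesis by (subst (asm) real_sqrt_abs) simp
    qed
    moreover have "exp (- g\<^sup>2 / 2) * exp (- 3 / 2 * g\<^sup>2) = exp (- (g - 0)\<^sup>2 / (2 * (1 / 2)\<^sup>2))"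
      by (simp add: exp_add[symmetric] power2_eq_square)
    ultimately show "std_normal_density g * exp (- 3 / 2 * g\<^sup>2) = 1 / 2 * normal_density 0 (1 / 2) g"
      unfolding normal_density_def by simp
  qed
  also have "\<dots> = 1 / 2" by simp
  finally show ?thesis .
qed

lemma linear_combination_integral:
  fixes X :: "'a \<Rightarrow> 'b \<Rightarrow> real"
  assumes "\<And>i. i \<in> I \<Longrightarrow> integrable N (X i)"
  shows "integrable N (\<lambda>f. \<Sum>i\<in>I. a i * X i f)"
    and "(\<integral>f. (\<Sum>i\<in>I. a i * X i f) \<partial>N) = (\<Sum>i\<in>I. a i * (\<integral>f. X i f \<partial>N))"
  using assms by (simp_all add: Bochner_Integration.integral_sum)

text \<open>Functionals \<open>\<xi>\<^sub>i\<close>, orthonormal in \<open>L\<^sub>2(\<mu>)\<close>, whose representers are \<open>\<sigma>\<close> times the orthonormal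
  functions \<open>e\<^sub>i\<close>.\<close>

locale sheet_system = wiener_sheet +
  fixes M :: nat and \<sigma> :: real and e :: "nat \<Rightarrow> func" and B :: real
    and J :: "'i set" and c :: "nat \<Rightarrow> 'i \<Rightarrow> real" and y :: "nat \<Rightarrow> 'i \<Rightarrow> point"
  assumes \<sigma>: "\<sigma> > 0"
    and e_meas: "i < M \<Longrightarrow> e i \<in> borel_measurable (cube_measure d)"
    and e_bound: "i < M \<Longrightarrow> x \<in> cube d \<Longrightarrow> \<bar>e i x\<bar> \<le> B"
    and e_orth: "i < M \<Longrightarrow> j < M \<Longrightarrow> (\<integral>x. e i x * e j x \<partial>cube_measure d) = (if i = j then 1 else 0)"
    and y: "i < M \<Longrightarrow> k \<in> J \<Longrightarrow> y i k \<in> cube d"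
    and \<xi>_orth: "i < M \<Longrightarrow> j < M \<Longrightarrow>
      (\<Sum>k\<in>J. \<Sum>l\<in>J. c i k * c j l * wiener_kernel d r (y i k) (y j l)) = (if i = j then 1 else 0)"
    and representer: "i < M \<Longrightarrow> x \<in> cube d \<Longrightarrow> (\<Sum>k\<in>J. c i k * wiener_kernel d r x (y i k)) = \<sigma> * e i x"
begin

definition combination :: "(nat \<Rightarrow> real) \<Rightarrow> func" where
  "combination z x = (\<Sum>i<M. z i * e i x)"

definition pairing :: "(nat \<Rightarrow> real) \<Rightarrow> functional" where
  "pairing z f = (\<integral>x. f x * combination z x \<partial>cube_measure d)"

lemma combination_meas: "combination z \<in> borel_measurable (cube_measure d)"
  unfolding combination_def by (intro borel_measurable_sum borel_measurable_times e_meas) auto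

lemma combination_bound: "x \<in> cube d \<Longrightarrow> \<bar>combination z x\<bar> \<le> (\<Sum>i<M. \<bar>z i\<bar>) * B"
proof -
  assume x: "x \<in> cube d"
  have "\<bar>combination z x\<bar> \<le> (\<Sum>i<M. \<bar>z i * e i x\<bar>)" unfolding combination_def by (rule sum_abs)
  also have "\<dots> \<le> (\<Sum>i<M. \<bar>z i\<bar> * B)" unfolding abs_mult by (intro sum_mono mult_left_mono e_bound x) auto
  finally show ?thesis by (simp add: sum_distrib_right)
qed

lemma pairing_meas: "pairing z \<in> borel_measurable \<mu>"
  unfolding pairing_def[abs_def] by (rule integral_in_F_dual[OF combination_meas combination_bound])

lemma pairing_dual: "pairing z \<in> F_dual d r"
  unfolding pairing_def[abs_def] by (rule integral_in_F_dual[OF combination_meas combination_bound])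

lemma pairing_scale: "pairing (\<lambda>i. s * z i) f = s * pairing z f"
proof -
  have *: "f x * combination (\<lambda>i. s * z i) x = s * (f x * combination z x)" for x
    unfolding combination_def by (simp add: sum_distrib_left mult_ac)
  show ?thesis unfolding pairing_def * by (rule integral_mult_right_zero)
qed

lemma e_L2: "i < M \<Longrightarrow> e i \<in> L2_funs d"
  by (rule L2_fun_bounded[OF e_meas e_bound])

lemma combination_inner: "i < M \<Longrightarrow> (\<integral>x. combination z x * e i x \<partial>cube_measure d) = z i"
proof -
  assume i: "i < M"
  have "(\<integral>x. combination z x * e i x \<partial>cube_measure d) = (\<integral>x. (\<Sum>j<M. z j * (e j x * e i x)) \<partial>cube_measure d)"
    by (simp add: combination_def sum_distrib_right mult.assoc)
  also have "\<dots> = (\<Sum>j<M. \<integral>x. z j * (e j x * e i x) \<partial>cube_measure d)"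
    by (rule Bochner_Integration.integral_sum) (use i in \<open>auto intro!: L2_product_integrable e_L2\<close>)
  also have "\<dots> = (\<Sum>j<M. if j = i then z j else 0)" using i by (intro sum.cong) (auto simp: e_orth)
  also have "\<dots> = z i" using i by simp
  finally show ?thesis .
qed

text \<open>Bessel's inequality in the space of square integrable random variables: by
  \<open>representer\<close> and \<open>e_orth\<close> the covariance of \<open>pairing z\<close>
  with the i-th orthonormal functional is \<open>\<sigma> * z i\<close>.\<close>

lemma pairing_variance: "\<sigma>\<^sup>2 * (\<Sum>i<M. (z i)\<^sup>2) \<le> expectation (\<lambda>f. (pairing z f)\<^sup>2)"
proof -
  let ?\<xi> = "\<lambda>i f. \<Sum>k\<in>J. c i k * f (y i k)"
  let ?L = "pairing z"
  have cov: "expectation (\<lambda>f. ?L f * ?\<xi> i f) = \<sigma> * z i" if i: "i < M" for i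
  proof -
    have "expectation (\<lambda>f. ?L f * ?\<xi> i f)
        = (\<integral>x. combination z x * (\<Sum>k\<in>J. c i k * wiener_kernel d r x (y i k)) \<partial>cube_measure d)"
      unfolding pairing_def by (rule covariance_integral[OF combination_meas combination_bound]) (use y i in auto)
    also have "\<dots> = (\<integral>x. \<sigma> * (combination z x * e i x) \<partial>cube_measure d)"
      by (rule Bochner_Integration.integral_cong) (use representer[OF i] in auto)
    finally show ?thesis by (simp add: combination_inner i)
  qed
  have \<xi>m: "?\<xi> i \<in> borel_measurable \<mu>" if "i < M" for i by (rule eval_sum_measurable) (use y that in auto)
  have \<xi>\<xi>: "integrable \<mu> (\<lambda>f. ?\<xi> i f * ?\<xi> j f)" "expectation (\<lambda>f. ?\<xi> i f * ?\<xi> j f) = (if i = j then 1 else 0)"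
    if "i < M" "j < M" for i j
    using covariance_sum[of J "y i" J "y j" "c i" "c j"] y that \<xi>_orth by auto
  have L2: "integrable \<mu> (\<lambda>f. (?L f)\<^sup>2)" by (rule gaussian_functional(1)[OF pairing_dual pairing_meas])
  have L\<xi>: "integrable \<mu> (\<lambda>f. ?L f * ?\<xi> i f)" if "i < M" for i
    by (rule integrable_product[OF L2 _ pairing_meas \<xi>m[OF that]])
      (use \<xi>\<xi>(1)[OF that that] in \<open>simp add: power2_eq_square\<close>)
  have exp: "(?L f - (\<Sum>i<M. \<sigma> * z i * ?\<xi> i f))\<^sup>2 = (?L f)\<^sup>2 - 2 * (\<Sum>i<M. \<sigma> * z i * (?L f * ?\<xi> i f))
      + (\<Sum>i<M. \<Sum>j<M. \<sigma> * z i * (\<sigma> * z j) * (?\<xi> i f * ?\<xi> j f))" for f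
  proof -
    have "(\<Sum>i<M. \<sigma> * z i * ?\<xi> i f) * (\<Sum>i<M. \<sigma> * z i * ?\<xi> i f)
        = (\<Sum>i<M. \<Sum>j<M. \<sigma> * z i * (\<sigma> * z j) * (?\<xi> i f * ?\<xi> j f))"
      using sum_product[of "\<lambda>i. \<sigma> * z i * ?\<xi> i f" "{..<M}" "\<lambda>i. \<sigma> * z i * ?\<xi> i f" "{..<M}"]
      by (simp only: mult_ac)
    moreover have "?L f * (\<Sum>i<M. \<sigma> * z i * ?\<xi> i f) = (\<Sum>i<M. \<sigma> * z i * (?L f * ?\<xi> i f))"
      unfolding sum_distrib_left by (simp only: mult_ac)
    moreover have "(a - b)\<^sup>2 = a\<^sup>2 - 2 * (a * b) + b * b" for a b :: real
      by (simp add: power2_eq_square algebra_simps)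
    ultimately show ?thesis by (simp only:)
  qed
  have "0 \<le> expectation (\<lambda>f. (?L f - (\<Sum>i<M. \<sigma> * z i * ?\<xi> i f))\<^sup>2)" by simp
  also have "\<dots> = expectation (\<lambda>f. (?L f)\<^sup>2) - 2 * (\<Sum>i<M. \<sigma> * z i * expectation (\<lambda>f. ?L f * ?\<xi> i f))
      + (\<Sum>i<M. \<Sum>j<M. \<sigma> * z i * (\<sigma> * z j) * expectation (\<lambda>f. ?\<xi> i f * ?\<xi> j f))"
  proof -
    let ?X = "\<lambda>f. \<Sum>i<M. \<sigma> * z i * (?L f * ?\<xi> i f)"
    let ?Y = "\<lambda>i f. \<Sum>j<M. \<sigma> * z i * (\<sigma> * z j) * (?\<xi> i f * ?\<xi> j f)"
    have X: "integrable \<mu> ?X" "expectation ?X = (\<Sum>i<M. \<sigma> * z i * expectation (\<lambda>f. ?L f * ?\<xi> i f))"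
      by (rule linear_combination_integral, rule L\<xi>, simp)+
    have Y: "integrable \<mu> (?Y i)"
      "expectation (?Y i) = (\<Sum>j<M. \<sigma> * z i * (\<sigma> * z j) * expectation (\<lambda>f. ?\<xi> i f * ?\<xi> j f))" if "i < M" for i
      by (rule linear_combination_integral, rule \<xi>\<xi>(1)[OF that], simp)+
    have Z: "integrable \<mu> (\<lambda>f. \<Sum>i<M. ?Y i f)" "expectation (\<lambda>f. \<Sum>i<M. ?Y i f) = (\<Sum>i<M. expectation (?Y i))"
      by (rule Bochner_Integration.integrable_sum Bochner_Integration.integral_sum, rule Y(1), simp)+
    have "expectation (\<lambda>f. (?L f)\<^sup>2 - 2 * ?X f + (\<Sum>i<M. ?Y i f))
        = expectation (\<lambda>f. (?L f)\<^sup>2) - 2 * expectation ?X + expectation (\<lambda>f. \<Sum>i<M. ?Y i f)"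
      using L2 X(1) Z(1)
      by (subst Bochner_Integration.integral_add)
        (auto intro!: Bochner_Integration.integrable_diff integrable_mult_right simp del: integral_mult_right_zero
          simp: Bochner_Integration.integral_diff[OF L2 integrable_mult_right[OF X(1)]] integral_mult_right_zero)
    then show ?thesis unfolding exp X(2) Z(2) using Y(2) by simp
  qed
  also have "\<dots> = expectation (\<lambda>f. (?L f)\<^sup>2) - 2 * (\<Sum>i<M. \<sigma> * z i * (\<sigma> * z i)) + (\<Sum>i<M. \<Sum>j<M. if j = i then \<sigma> * z i * (\<sigma> * z j) else 0)"
    by (intro arg_cong2[where f="(+)"] arg_cong2[where f="(-)"] refl arg_cong2[where f="(*)"] sum.cong)
      (auto simp: cov \<xi>\<xi>(2))
  also have "\<dots> = expectation (\<lambda>f. (?L f)\<^sup>2) - \<sigma>\<^sup>2 * (\<Sum>i<M. (z i)\<^sup>2)"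
    by (simp add: sum_distrib_left power2_eq_square mult_ac)
  finally show ?thesis by simp
qed

text \<open>\<open>centered_gaussian\<close> speaks of single functionals. The exponential of the
  negative quadratic form is therefore written as a characteristic function of auxiliary independent
  normals \<open>g\<close>. After Fubini, for fixed \<open>g\<close>, a single functional
  \<open>pairing (?z g)\<close> remains, to which \<open>gaussian_functional\<close> and
  \<open>pairing_variance\<close> apply, and the integral over \<open>g\<close> splits into
  \<open>n\<close> factors of one half.\<close>

lemma exponential_moment:
  assumes on: "\<And>a a'. a < n \<Longrightarrow> a' < n \<Longrightarrow> (\<Sum>i<M. q a i * q a' i) = (if a = a' then 1 else 0)"
  shows "expectation (\<lambda>f. exp (- 3 / (2 * \<sigma>\<^sup>2) * (\<Sum>a<n. (pairing (q a) f)\<^sup>2))) \<le> (1 / 2) ^ n"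
proof -
  \<comment> \<open>Chosen so that \<open>\<gamma> * \<sigma>\<^sup>2 = 3 / 2\<close>, the parameter
    in \<open>std_normal_gaussian_moment\<close>.\<close>
  define \<gamma> where "\<gamma> = 3 / (2 * \<sigma>\<^sup>2)"
  define s where "s = sqrt (2 * \<gamma>)"
  have \<gamma>: "\<gamma> > 0" "\<gamma> * \<sigma>\<^sup>2 = 3 / 2" using \<sigma> by (auto simp: \<gamma>_def)
  have s2: "s\<^sup>2 = 2 * \<gamma>" using \<gamma> by (simp add: s_def)
  let ?N = "\<lambda>_::nat. std_normal_distribution"
  interpret S: prob_space std_normal_distribution by (rule prob_space_normal_density) simp
  interpret N: product_prob_space ?N "{..<n}" by unfold_locales
  let ?P = "Pi\<^sub>M {..<n} ?N"
  interpret P: prob_space ?P by (rule prob_space_PiM) (rule S.prob_space_axioms)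
  interpret PP: pair_prob_space \<mu> ?P by unfold_locales
  let ?z = "\<lambda>g i. \<Sum>a<n. g a * q a i"
  have lin: "pairing (?z g) f = (\<Sum>a<n. g a * pairing (q a) f)" if f: "f \<in> F_space d r" for g f
  proof -
    have "f x * combination (?z g) x = (\<Sum>a<n. g a * (f x * combination (q a) x))" for x
    proof -
      have "combination (?z g) x = (\<Sum>a<n. g a * combination (q a) x)"
        unfolding combination_def sum_distrib_right sum_distrib_left by (subst sum.swap) (simp only: mult.assoc)
      then show ?thesis by (simp only: sum_distrib_left mult_ac)
    qed
    moreover have "integrable (cube_measure d) (\<lambda>x. f x * combination (q a) x)" for a
      by (rule L2_product_integrable[OF F_space_L2[OF f] L2_fun_bounded[OF combination_meas combination_bound]])
    ultimately show ?thesis unfolding pairing_def by (simp add: Bochner_Integration.integral_sum)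
  qed
  have comp: "(\<lambda>g. g a) \<in> borel_measurable ?P" if "a < n" for a
    using measurable_component_singleton[of a "{..<n}" ?N] that by simp
  have jm: "(\<lambda>(f, g). iexp (s * (\<Sum>a<n. g a * pairing (q a) f))) \<in> borel_measurable (\<mu> \<Otimes>\<^sub>M ?P)"
  proof -
    have "(\<lambda>p. \<Sum>a<n. snd p a * pairing (q a) (fst p)) \<in> borel_measurable (\<mu> \<Otimes>\<^sub>M ?P)"
      by (intro borel_measurable_sum borel_measurable_times measurable_compose[OF measurable_snd comp]
          measurable_compose[OF measurable_fst pairing_meas]) auto
    then show ?thesis unfolding case_prod_unfold by measurable
  qed
  have key: "complex_of_real (exp (- \<gamma> * (\<Sum>a<n. (pairing (q a) f)\<^sup>2)))
      = (CLINT g|?P. iexp (s * (\<Sum>a<n. g a * pairing (q a) f)))" for f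
  proof -
    have "complex_of_real (exp (- \<gamma> * (\<Sum>a<n. (pairing (q a) f)\<^sup>2)))
        = (\<Prod>a<n. complex_of_real (exp (- (s * pairing (q a) f)\<^sup>2 / 2)))"
      by (simp add: power_mult_distrib s2 sum_distrib_left exp_sum sum_negf[symmetric])
    also have "\<dots> = (\<Prod>a<n. CLINT g|std_normal_distribution. iexp (s * pairing (q a) f * g))"
      using fun_cong[OF char_std_normal_distribution] by (simp only: char_def)
    also have "\<dots> = (CLINT g|?P. (\<Prod>a<n. iexp (s * pairing (q a) f * g a)))"
    proof (rule N.product_integral_prod[symmetric])
      show "integrable std_normal_distribution (\<lambda>g. iexp (s * pairing (q a) f * g))" for a
        by (rule prob_space.integrable_iexp[OF prob_space_normal_density]) auto
    qed simp
    also have "\<dots> = (CLINT g|?P. iexp (s * (\<Sum>a<n. g a * pairing (q a) f)))"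
      by (simp add: exp_sum[symmetric] sum_distrib_left mult_ac)
    finally show ?thesis .
  qed
  have "complex_of_real (expectation (\<lambda>f. exp (- \<gamma> * (\<Sum>a<n. (pairing (q a) f)\<^sup>2))))
      = (CLINT f|\<mu>. CLINT g|?P. iexp (s * (\<Sum>a<n. g a * pairing (q a) f)))"
    unfolding key[symmetric] by (rule integral_complex_of_real[symmetric])
  also have "\<dots> = (CLINT g|?P. CLINT f|\<mu>. iexp (s * (\<Sum>a<n. g a * pairing (q a) f)))"
  proof (rule PP.Fubini_integral[symmetric])
    show "integrable (\<mu> \<Otimes>\<^sub>M ?P) (\<lambda>(f, g). iexp (s * (\<Sum>a<n. g a * pairing (q a) f)))"
      by (rule PP.P.integrable_const_bound[where B=1]) (use jm in \<open>auto simp: case_prod_unfold\<close>)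
  qed
  also have "\<dots> = (CLINT g|?P. complex_of_real (exp (- \<gamma> * expectation (\<lambda>f. (pairing (?z g) f)\<^sup>2))))"
  proof (rule Bochner_Integration.integral_cong[OF refl])
    fix g
    let ?L = "\<lambda>f. s * pairing (?z g) f"
    have L: "?L = pairing (\<lambda>i. s * ?z g i)" by (simp add: fun_eq_iff pairing_scale)
    have "?L \<in> F_dual d r" "?L \<in> borel_measurable \<mu>"
      unfolding L by (rule pairing_dual pairing_meas)+
    then have "(CLINT f|\<mu>. iexp (?L f)) = complex_of_real (exp (- expectation (\<lambda>f. (?L f)\<^sup>2) / 2))"
      by (rule gaussian_functional(2))
    moreover have "expectation (\<lambda>f. (?L f)\<^sup>2) = 2 * \<gamma> * expectation (\<lambda>f. (pairing (?z g) f)\<^sup>2)"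
      by (simp add: power_mult_distrib s2)
    moreover have "(CLINT f|\<mu>. iexp (s * (\<Sum>a<n. g a * pairing (q a) f))) = (CLINT f|\<mu>. iexp (?L f))"
      by (rule Bochner_Integration.integral_cong) (auto simp: lin space_sheet)
    ultimately show "(CLINT f|\<mu>. iexp (s * (\<Sum>a<n. g a * pairing (q a) f)))
        = complex_of_real (exp (- \<gamma> * expectation (\<lambda>f. (pairing (?z g) f)\<^sup>2)))" by simp
  qed
  also have "\<dots> = complex_of_real (\<integral>g. exp (- \<gamma> * expectation (\<lambda>f. (pairing (?z g) f)\<^sup>2)) \<partial>?P)"
    by (rule integral_complex_of_real)
  finally have eq: "expectation (\<lambda>f. exp (- \<gamma> * (\<Sum>a<n. (pairing (q a) f)\<^sup>2)))
      = (\<integral>g. exp (- \<gamma> * expectation (\<lambda>f. (pairing (?z g) f)\<^sup>2)) \<partial>?P)"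
    using of_real_eq_iff by blast
  have norm: "(\<Sum>i<M. (?z g i)\<^sup>2) = (\<Sum>a<n. (g a)\<^sup>2)" for g
  proof -
    have "(\<Sum>i<M. (?z g i)\<^sup>2) = (\<Sum>i<M. \<Sum>a<n. \<Sum>b<n. g a * g b * (q a i * q b i))"
      unfolding power2_eq_square sum_product by (simp only: mult_ac)
    also have "\<dots> = (\<Sum>a<n. \<Sum>b<n. g a * g b * (\<Sum>i<M. q a i * q b i))"
      unfolding sum_distrib_left by (rule trans[OF sum.swap], rule sum.cong[OF refl], rule sum.swap)
    also have "\<dots> = (\<Sum>a<n. \<Sum>b<n. if b = a then g a * g b else 0)" by (intro sum.cong refl) (simp add: on)
    finally show ?thesis by (simp add: power2_eq_square)
  qed
  have bnd: "exp (- \<gamma> * expectation (\<lambda>f. (pairing (?z g) f)\<^sup>2)) \<le> (\<Prod>a<n. exp (- 3 / 2 * (g a)\<^sup>2))" for g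
  proof -
    have "\<gamma> * (\<sigma>\<^sup>2 * (\<Sum>a<n. (g a)\<^sup>2)) \<le> \<gamma> * expectation (\<lambda>f. (pairing (?z g) f)\<^sup>2)"
      using pairing_variance[of "?z g"] \<gamma> unfolding norm by (intro mult_left_mono) auto
    then have "3 / 2 * (\<Sum>a<n. (g a)\<^sup>2) \<le> \<gamma> * expectation (\<lambda>f. (pairing (?z g) f)\<^sup>2)"
      unfolding mult.assoc[symmetric] \<gamma>(2) .
    moreover have "(\<Sum>a<n. - 3 / 2 * (g a)\<^sup>2) = - 3 / 2 * (\<Sum>a<n. (g a)\<^sup>2)"
      by (rule sum_distrib_left[symmetric])
    ultimately have "- \<gamma> * expectation (\<lambda>f. (pairing (?z g) f)\<^sup>2) \<le> (\<Sum>a<n. - 3 / 2 * (g a)\<^sup>2)"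
      by linarith
    then show ?thesis by (simp only: exp_sum[symmetric] exp_le_cancel_iff finite_lessThan)
  qed
  have int1: "integrable std_normal_distribution (\<lambda>g::real. exp (- 3 / 2 * g\<^sup>2))"
    by (rule finite_measure.integrable_const_bound[OF prob_space.finite_measure[OF prob_space_normal_density], where B=1]) auto
  have "(\<integral>g. exp (- \<gamma> * expectation (\<lambda>f. (pairing (?z g) f)\<^sup>2)) \<partial>?P) \<le> (\<integral>g. (\<Prod>a<n. exp (- 3 / 2 * (g a)\<^sup>2)) \<partial>?P)"
  proof (rule integral_mono')
    show "integrable ?P (\<lambda>g. \<Prod>a<n. exp (- 3 / 2 * (g a)\<^sup>2))"
      by (rule N.product_integrable_prod) (use int1 in auto)
  qed (use bnd in \<open>auto simp: prod_nonneg\<close>)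
  also have "\<dots> = (\<Prod>a<n. \<integral>g. exp (- 3 / 2 * g\<^sup>2) \<partial>std_normal_distribution)"
    by (rule N.product_integral_prod) (use int1 in auto)
  also have "\<dots> = (1 / 2) ^ n" unfolding std_normal_gaussian_moment by simp
  finally show ?thesis using eq unfolding \<gamma>_def by simp
qed

text \<open>The exponential Markov inequality applied to \<open>exponential_moment\<close>.\<close>

lemma small_ball:
  assumes on: "\<And>a a'. a < n \<Longrightarrow> a' < n \<Longrightarrow> (\<Sum>i<M. q a i * q a' i) = (if a = a' then 1 else 0)"
  shows "{f \<in> space \<mu>. (\<Sum>a<n. (pairing (q a) f)\<^sup>2) \<le> \<tau>} \<in> sets \<mu>"
    and "prob {f \<in> space \<mu>. (\<Sum>a<n. (pairing (q a) f)\<^sup>2) \<le> \<tau>} \<le> exp (3 / (2 * \<sigma>\<^sup>2) * \<tau>) * (1 / 2) ^ n"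
proof -
  let ?Q = "\<lambda>f. \<Sum>a<n. (pairing (q a) f)\<^sup>2"
  let ?\<gamma> = "3 / (2 * \<sigma>\<^sup>2)"
  let ?A = "{f \<in> space \<mu>. ?Q f \<le> \<tau>}"
  have Qm: "?Q \<in> borel_measurable \<mu>" using pairing_meas by measurable
  then show A: "?A \<in> sets \<mu>" by measurable
  have \<gamma>: "?\<gamma> > 0" using \<sigma> by simp
  have i: "integrable \<mu> (\<lambda>f. exp (- 3 / (2 * \<sigma>\<^sup>2) * ?Q f))"
  proof (rule integrable_const_bound[where B=1])
    have "- 3 / (2 * \<sigma>\<^sup>2) * ?Q f \<le> 0" for f
      using \<gamma> by (simp add: sum_nonneg)
    then show "AE f in \<mu>. norm (exp (- 3 / (2 * \<sigma>\<^sup>2) * ?Q f)) \<le> 1" by simp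
  qed (use Qm in measurable)
  have "exp (- ?\<gamma> * \<tau>) * prob ?A = expectation (\<lambda>f. exp (- ?\<gamma> * \<tau>) * indicator ?A f)"
    using A by (simp add: Int_absorb1)
  also have "\<dots> \<le> expectation (\<lambda>f. exp (- 3 / (2 * \<sigma>\<^sup>2) * ?Q f))"
  proof (rule integral_mono)
    show "integrable \<mu> (\<lambda>f. exp (- ?\<gamma> * \<tau>) * indicator ?A f)"
      using A by (intro integrable_mult_right integrable_real_indicator) (auto simp: emeasure_eq_measure)
    fix f
    show "exp (- ?\<gamma> * \<tau>) * indicator ?A f \<le> exp (- 3 / (2 * \<sigma>\<^sup>2) * ?Q f)"
    proof (cases "f \<in> ?A")
      case True
      then have "?\<gamma> * ?Q f \<le> ?\<gamma> * \<tau>" using \<gamma> by (intro mult_left_mono) auto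
      then show ?thesis using True by simp
    qed simp
  qed (rule i)
  also have "\<dots> \<le> (1 / 2) ^ n" by (rule exponential_moment[OF on])
  finally have "exp (- ?\<gamma> * \<tau>) * prob ?A \<le> (1 / 2) ^ n" .
  then have "exp (?\<gamma> * \<tau>) * (exp (- ?\<gamma> * \<tau>) * prob ?A) \<le> exp (?\<gamma> * \<tau>) * (1 / 2) ^ n"
    by (intro mult_left_mono) auto
  then show "prob ?A \<le> exp (3 / (2 * \<sigma>\<^sup>2) * \<tau>) * (1 / 2) ^ n"
    by (simp add: mult.assoc[symmetric] exp_add[symmetric])
qed

end

subsection \<open>Spline bumps\<close>

lemma fold_int_sum:
  assumes "\<And>k. k \<in> I \<Longrightarrow> t k \<le> 1" "x \<le> 1"
  shows "fold_int n (\<lambda>s. \<Sum>k\<in>I. c k * trunc_pow n (t k - s)) x = (\<Sum>k\<in>I. c k * fold_int n (\<lambda>s. trunc_pow n (t k - s)) x)"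
proof -
  have "(\<lambda>s. trunc_pow n (x - s) * (\<Sum>k\<in>I. c k * trunc_pow n (t k - s)))
      = (\<lambda>s. \<Sum>k\<in>I. c k * (trunc_pow n (x - s) * trunc_pow n (t k - s)))"
    by (simp add: sum_distrib_left mult_ac)
  moreover have "integrable unit_measure (\<lambda>s. trunc_pow n (x - s) * trunc_pow n (t k - s))" if "k \<in> I" for k
    using assms(1)[OF that] assms(2) by (intro fold_int_integrable[where B=1] trunc_pow_section) auto
  ultimately show ?thesis unfolding fold_int_def by (simp add: Bochner_Integration.integral_sum)
qed

lemma fold_int_symmetric:
  "fold_int n (\<lambda>s. trunc_pow n (t - s)) x = fold_int n (\<lambda>s. trunc_pow n (x - s)) t"
  unfolding fold_int_def by (simp add: mult.commute)

lemma spline_measurable: "(\<lambda>s. \<Sum>k\<in>I. c k * trunc_pow n (t k - s)) \<in> borel_measurable borel"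
  by (intro borel_measurable_sum borel_measurable_times measurable_compose[OF _ trunc_pow_measurable]) auto

lemma spline_bound:
  assumes "\<And>k. k \<in> I \<Longrightarrow> t k \<le> 1" "s \<in> {0..1}"
  shows "\<bar>\<Sum>k\<in>I. c k * trunc_pow n (t k - s)\<bar> \<le> (\<Sum>k\<in>I. \<bar>c k\<bar>)"
proof -
  have "\<bar>trunc_pow n (t k - s)\<bar> \<le> 1" if "k \<in> I" for k
    using assms(1)[OF that] assms(2) by (auto simp: abs_of_nonneg[OF trunc_pow_nonneg] intro!: trunc_pow_le_1)
  note b = this
  have "\<bar>\<Sum>k\<in>I. c k * trunc_pow n (t k - s)\<bar> \<le> (\<Sum>k\<in>I. \<bar>c k * trunc_pow n (t k - s)\<bar>)" by (rule sum_abs)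
  also have "\<dots> \<le> (\<Sum>k\<in>I. \<bar>c k\<bar> * 1)"
    unfolding abs_mult by (intro sum_mono mult_left_mono b) auto
  finally show ?thesis by simp
qed

lemma continuous_unit_zero:
  fixes g :: "real \<Rightarrow> real"
  assumes g: "continuous_on {0..1} g" and z: "(\<integral>x. (g x)\<^sup>2 \<partial>unit_measure) = 0" and x: "x \<in> {0..1}"
  shows "g x = 0"
proof -
  obtain B where B: "\<And>x. x \<in> {0..1} \<Longrightarrow> \<bar>g x\<bar> \<le> B"
    using compact_imp_bounded[OF compact_continuous_image[OF g compact_Icc]] unfolding bounded_iff by force
  have gm: "g \<in> borel_measurable unit_measure"
    using borel_measurable_continuous_on_restrict[OF g] by (simp add: measurable_def space_restrict_space sets_restrict_space)
  have "integrable unit_measure (\<lambda>x. (g x)\<^sup>2)"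
    by (rule integrable_unit_bounded[where B="B\<^sup>2"])
      (use gm B in \<open>auto simp flip: abs_le_square_iff intro: order_trans[OF B abs_ge_self]\<close>)
  then have "AE x in unit_measure. (g x)\<^sup>2 = 0"
    using z by (subst (asm) integral_nonneg_eq_0_iff_AE) auto
  then have ae: "AE x in lborel. x \<in> {0..1} \<longrightarrow> g x = 0" by (simp add: AE_restrict_space_iff)
  define U where "U = {x \<in> {0<..<1}. g x \<in> - {0}}"
  have oU: "open U" unfolding U_def
    by (rule continuous_open_preimage[of "{0<..<1}" g "- {0}", unfolded vimage_def Int_def mem_Collect_eq])
      (auto intro: continuous_on_subset[OF g])
  have "AE x in lborel. x \<notin> U" using ae by eventually_elim (auto simp: U_def)
  then have "U \<in> null_sets lborel" using oU AE_iff_null_sets[of U lborel] by simp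
  then have "negligible U" unfolding negligible_iff_null_sets by (rule null_sets_completionI)
  then have "U = {}" using open_not_negligible[OF oU] by blast
  then have z: "\<And>x. x \<in> {0<..<1} \<Longrightarrow> g x = 0" by (auto simp: U_def)
  have "x \<in> closure {0<..<1::real}" using x by simp
  have "closure {0<..<1::real} = {0..1}" by simp
  then show ?thesis
    using continuous_constant_on_closure[of "{0<..<1}" g 0 x] g z x by simp
qed

text \<open>The sum in the second assumption is the integral of the squared spline. If the folded
  spline had zero norm, it would vanish at all nodes by continuity, and so would this sum.\<close>

lemma fold_int_energy_pos:
  assumes t: "\<And>k. k \<in> I \<Longrightarrow> t k \<in> {0..1}"
    and pos: "(\<Sum>k\<in>I. c k * fold_int n (\<lambda>s. \<Sum>k\<in>I. c k * trunc_pow n (t k - s)) (t k)) \<noteq> 0"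
  shows "0 < (\<integral>x. (fold_int n (\<lambda>s. \<Sum>k\<in>I. c k * trunc_pow n (t k - s)) x)\<^sup>2 \<partial>unit_measure)"
proof (rule ccontr)
  let ?\<psi> = "\<lambda>s. \<Sum>k\<in>I. c k * trunc_pow n (t k - s)"
  assume "\<not> ?thesis"
  moreover have "0 \<le> (\<integral>x. (fold_int n ?\<psi> x)\<^sup>2 \<partial>unit_measure)" by simp
  ultimately have z: "(\<integral>x. (fold_int n ?\<psi> x)\<^sup>2 \<partial>unit_measure) = 0" by linarith
  have "continuous_on {0..1} (fold_int n ?\<psi>)"
    by (rule fold_int_continuous[where B="\<Sum>k\<in>I. \<bar>c k\<bar>"]) (use t in \<open>auto intro!: spline_measurable spline_bound\<close>)
  from continuous_unit_zero[OF this z] have "fold_int n ?\<psi> (t k) = 0" if "k \<in> I" for k using t[OF that] by blast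
  then show False using pos by simp
qed

lemma unit_power_fact_bound: "s \<in> {0..1} \<Longrightarrow> \<bar>s ^ j / fact j\<bar> \<le> (1::real)"
proof -
  assume "s \<in> {0..1}"
  then have "s ^ j \<le> 1" "0 \<le> s ^ j" by (auto intro: power_le_one)
  moreover have "(1::real) \<le> fact j" by (rule fact_ge_1)
  ultimately have "s ^ j \<le> fact j" "0 \<le> s ^ j" by linarith+
  then show ?thesis by simp
qed

text \<open>Induction on \<open>n\<close>: both sides vanish at 0 and have the same derivative by
  the induction hypothesis.\<close>

lemma fold_int_power:
  assumes "x \<in> {0..1}"
  shows "fold_int n (\<lambda>s. s ^ j / fact j) x = x ^ (n + j + 1) / fact (n + j + 1)"
  using assms
proof (induction n arbitrary: x)
  case 0
  then have x: "0 \<le> x" "x \<le> 1" by auto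
  have "fold_int 0 (\<lambda>s. s ^ j / fact j) x = (LINT s|lborel. indicator {0..1} s * (trunc_pow 0 (x - s) * (s ^ j / fact j)))"
    unfolding fold_int_def integral_unit_measure set_lebesgue_integral_def by simp
  also have "\<dots> = (LINT s|lborel. (s ^ j / fact j) * indicator {0..x} s)"
  proof (rule integral_cong_AE)
    show "AE s in lborel. indicator {0..1} s * (trunc_pow 0 (x - s) * (s ^ j / fact j)) = s ^ j / fact j * indicator {0..x} s"
      using AE_lborel_singleton[of x]
      by eventually_elim (use x in \<open>auto simp: trunc_pow_def indicator_def\<close>)
  qed measurable
  also have "\<dots> = x ^ Suc j / fact (Suc j) - 0 ^ Suc j / fact (Suc j)"
    by (rule integral_FTC_Icc_real[OF x(1)]) (rule has_real_derivative_power_fact, auto intro!: continuous_intros)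
  finally show ?case by simp
next
  case (Suc n)
  let ?\<psi> = "\<lambda>s::real. s ^ j / fact j"
  have \<psi>: "?\<psi> \<in> borel_measurable borel" "\<And>s. s \<in> {0..1} \<Longrightarrow> \<bar>?\<psi> s\<bar> \<le> 1"
    by (measurable, rule unit_power_fact_bound)
  have "\<exists>c. \<forall>y\<in>{0..1}. fold_int (Suc n) ?\<psi> y - y ^ (Suc n + j + 1) / fact (Suc n + j + 1) = c"
  proof (rule has_field_derivative_zero_constant)
    fix y :: real assume y: "y \<in> {0..1}"
    have e: "Suc n + j + 1 = Suc (n + j + 1)" by simp
    have z: "fold_int n ?\<psi> y - y ^ (n + j + 1) / fact (n + j + 1) = 0" unfolding Suc.IH[OF y] by (rule diff_self)
    show "((\<lambda>y. fold_int (Suc n) ?\<psi> y - y ^ (Suc n + j + 1) / fact (Suc n + j + 1)) has_real_derivative 0) (at y within {0..1})"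
      using DERIV_diff[OF fold_int_derivative[where B=1 and n=n, OF \<psi>(1) \<psi>(2) y, simplified] has_field_derivative_at_within[OF has_real_derivative_power_fact[of "n + j + 1" y]]]
      unfolding e z .
  qed simp
  then obtain c where c: "\<And>y. y \<in> {0..1} \<Longrightarrow> fold_int (Suc n) ?\<psi> y - y ^ (Suc n + j + 1) / fact (Suc n + j + 1) = c" by blast
  have "c = 0" using c[of 0] fold_int_zero[OF \<psi>, of "Suc n"] by simp
  then show ?case using c[OF Suc.prems] by simp
qed

text \<open>The weights of the divided difference of order \<open>R\<close> at the Lagrange nodes.\<close>

definition difference_weight :: "nat \<Rightarrow> nat \<Rightarrow> real" where
  "difference_weight R k = coeff (lagrange_basis R k) R"

lemma difference_weight_sum:
  assumes "degree p \<le> R"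
  shows "(\<Sum>k\<le>R. difference_weight R k * poly p (lagrange_node R k)) = coeff p R"
proof -
  have "coeff p R = coeff (\<Sum>k\<le>R. smult (poly p (lagrange_node R k)) (lagrange_basis R k)) R"
    using lagrange_interpolation[OF assms] by simp
  then show ?thesis by (simp add: coeff_sum difference_weight_def mult.commute)
qed

text \<open>A divided difference of order \<open>2 m + 2\<close> instead of \<open>m + 1\<close> makes not only this spline but also
  its \<open>(m + 1)\<close>-fold integral vanish beyond the last node.\<close>

definition bump_spline :: "nat \<Rightarrow> real \<Rightarrow> real" where
  "bump_spline m s = (\<Sum>k\<le>2 * m + 2. difference_weight (2 * m + 2) k * trunc_pow m (lagrange_node (2 * m + 2) k - s))"

text \<open>To the left of 0 the truncated power is a polynomial of degree at most \<open>m\<close>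
  in the node, which the divided difference annihilates. To the right of the nodes every term is
  zero.\<close>

lemma bump_spline_outside: "s < 0 \<or> s \<ge> 1 \<Longrightarrow> bump_spline m s = 0"
proof -
  let ?R = "2 * m + 2"
  assume "s < 0 \<or> s \<ge> 1"
  then show ?thesis
  proof
    assume s: "s < 0"
    let ?p = "smult (1 / fact m) ([:- s, 1:] ^ m)"
    have deg: "degree ?p < ?R"
      by (rule le_less_trans[OF order_trans[OF degree_smult_le degree_power_le]]) simp
    have "bump_spline m s = (\<Sum>k\<le>?R. difference_weight ?R k * poly ?p (lagrange_node ?R k))"
      unfolding bump_spline_def
    proof (intro sum.cong refl arg_cong2[where f="(*)"])
      fix k assume "k \<in> {..?R}"
      then have "lagrange_node ?R k - s > 0" using lagrange_node_bounds(1)[of k ?R] s by simp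
      then show "trunc_pow m (lagrange_node ?R k - s) = poly ?p (lagrange_node ?R k)"
        by (simp add: trunc_pow_def poly_power)
    qed
    also have "\<dots> = 0"
      using difference_weight_sum[of ?p ?R] deg coeff_eq_0[OF deg] by simp
    finally show ?thesis .
  next
    assume s: "s \<ge> 1"
    have "trunc_pow m (lagrange_node ?R k - s) = 0" if "k \<le> ?R" for k
      using lagrange_node_bounds(2)[OF that] s by (intro trunc_pow_nonpos) simp
    then show ?thesis unfolding bump_spline_def by simp
  qed
qed

lemma node_le_1: "k \<le> R \<Longrightarrow> lagrange_node R k \<in> {0..1}"
  using lagrange_node_bounds[of k R] by simp

lemma bump_spline_measurable: "bump_spline m \<in> borel_measurable borel"
  unfolding bump_spline_def[abs_def] by (rule spline_measurable)

lemma bump_spline_bound: "s \<in> {0..1} \<Longrightarrow> \<bar>bump_spline m s\<bar> \<le> (\<Sum>k\<le>2 * m + 2. \<bar>difference_weight (2 * m + 2) k\<bar>)"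
  unfolding bump_spline_def by (rule spline_bound) (use node_le_1 in auto)

lemma bump_spline_moment:
  "(\<integral>s. s ^ j / fact j * bump_spline m s \<partial>unit_measure)
    = (\<Sum>k\<le>2 * m + 2. difference_weight (2 * m + 2) k * (lagrange_node (2 * m + 2) k) ^ (m + j + 1)) / fact (m + j + 1)"
proof -
  let ?R = "2 * m + 2" and ?u = "lagrange_node (2 * m + 2)" and ?c = "difference_weight (2 * m + 2)"
  have i: "integrable unit_measure (\<lambda>s. trunc_pow m (?u k - s) * (s ^ j / fact j))" if "k \<le> ?R" for k
    by (rule fold_int_integrable[where B=1]) (use unit_power_fact_bound node_le_1[OF that] in auto)
  have "(\<integral>s. s ^ j / fact j * bump_spline m s \<partial>unit_measure)
      = (\<integral>s. (\<Sum>k\<le>?R. ?c k * (trunc_pow m (?u k - s) * (s ^ j / fact j))) \<partial>unit_measure)"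
    unfolding bump_spline_def sum_distrib_left by (simp only: mult_ac)
  also have "\<dots> = (\<Sum>k\<le>?R. ?c k * fold_int m (\<lambda>s. s ^ j / fact j) (?u k))"
    unfolding fold_int_def
    by (subst Bochner_Integration.integral_sum, rule integrable_mult_right[OF i], simp, simp only: integral_mult_right_zero)
  also have "\<dots> = (\<Sum>k\<le>?R. ?c k * ((?u k) ^ (m + j + 1) / fact (m + j + 1)))"
    by (intro sum.cong refl) (simp only: fold_int_power node_le_1 atMost_iff)
  finally show ?thesis by (simp only: sum_divide_distrib times_divide_eq_right)
qed

text \<open>The moment of order \<open>j\<close> is a multiple of the divided difference of the
  power \<open>m + j + 1\<close>. For \<open>j \<le> m\<close> this exponent stays below the order
  \<open>2 * m + 2\<close>.\<close>

lemma bump_spline_orthogonal: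
  assumes "j \<le> m"
  shows "(\<integral>s. s ^ j / fact j * bump_spline m s \<partial>unit_measure) = 0"
proof -
  let ?R = "2 * m + 2"
  have deg: "degree (monom (1::real) (m + j + 1)) < ?R" using assms by (simp add: degree_monom_eq)
  have "(\<Sum>k\<le>?R. difference_weight ?R k * (lagrange_node ?R k) ^ (m + j + 1)) = coeff (monom (1::real) (m + j + 1)) ?R"
    using difference_weight_sum[of "monom 1 (m + j + 1)" ?R] deg by (simp add: poly_monom)
  also have "\<dots> = 0" using assms by (simp add: coeff_monom)
  finally show ?thesis unfolding bump_spline_moment by simp
qed

text \<open>The first moment beyond the range of \<open>bump_spline_orthogonal\<close> is the
  divided difference of the power \<open>2 * m + 2\<close>, which is 1, over a factorial; so the
  spline is not almost everywhere zero.\<close>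

lemma bump_spline_energy: "(\<integral>s. (bump_spline m s)\<^sup>2 \<partial>unit_measure) > 0"
proof (rule ccontr)
  let ?R = "2 * m + 2"
  obtain B where B: "\<And>s. s \<in> {0..1} \<Longrightarrow> \<bar>bump_spline m s\<bar> \<le> B" using bump_spline_bound by blast
  assume "\<not> ?thesis"
  moreover have "0 \<le> (\<integral>s. (bump_spline m s)\<^sup>2 \<partial>unit_measure)" by simp
  ultimately have z: "(\<integral>s. (bump_spline m s)\<^sup>2 \<partial>unit_measure) = 0" by linarith
  have "integrable unit_measure (\<lambda>s. (bump_spline m s)\<^sup>2)"
    by (rule integrable_unit_bounded[where B="B\<^sup>2"])
      (auto intro!: measurable_unit borel_measurable_power bump_spline_measurable simp flip: abs_le_square_iff
        intro: order_trans[OF B abs_ge_self])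
  then have "AE s in unit_measure. (bump_spline m s)\<^sup>2 = 0" using z by (subst (asm) integral_nonneg_eq_0_iff_AE) auto
  then have "AE s in unit_measure. s ^ (m + 1) / fact (m + 1) * bump_spline m s = 0" by eventually_elim simp
  then have "(\<integral>s. s ^ (m + 1) / fact (m + 1) * bump_spline m s \<partial>unit_measure) = 0" by (rule integral_eq_zero_AE)
  moreover have "(\<Sum>k\<le>?R. difference_weight ?R k * (lagrange_node ?R k) ^ (m + (m + 1) + 1)) = 1"
  proof -
    have e: "m + (m + 1) + 1 = ?R" by simp
    have p: "poly (monom 1 R) x = x ^ R" for x :: real and R by (simp add: poly_monom)
    have "(\<Sum>k\<le>?R. difference_weight ?R k * poly (monom 1 ?R) (lagrange_node ?R k)) = 1"
      using difference_weight_sum[of "monom 1 ?R" ?R] by (simp only: degree_monom_le coeff_monom if_True simp_thms)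
    then show ?thesis unfolding p e .
  qed
  ultimately have "1 / fact (m + (m + 1) + 1) = (0::real)" unfolding bump_spline_moment by (simp only:)
  moreover have "1 / fact k \<noteq> (0::real)" for k by simp
  ultimately show False by (simp only: simp_thms)
qed

text \<open>Beyond 1 the truncation is inactive on the unit interval up to a null set, and the
  binomial expansion of the kernel contains only powers of \<open>s\<close> up to \<open>m\<close>,
  all orthogonal to the spline.\<close>

lemma fold_int_bump_spline_beyond:
  assumes "y \<ge> 1"
  shows "fold_int m (bump_spline m) y = 0"
proof -
  have "fold_int m (bump_spline m) y = (\<integral>s. (\<Sum>j\<le>m. real (m choose j) * fact j * (- 1) ^ j * y ^ (m - j) / fact m
      * (s ^ j / fact j * bump_spline m s)) \<partial>unit_measure)"
    unfolding fold_int_def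
  proof (rule integral_cong_AE)
    have "AE s in unit_measure. s \<noteq> 1"
      using AE_lborel_singleton[of "1::real"] by (auto simp: AE_restrict_space_iff elim: eventually_mono)
    then show "AE s in unit_measure. trunc_pow m (y - s) * bump_spline m s
        = (\<Sum>j\<le>m. real (m choose j) * fact j * (- 1) ^ j * y ^ (m - j) / fact m * (s ^ j / fact j * bump_spline m s))"
      using unit_AE
    proof eventually_elim
      case (elim s)
      then have "y - s > 0" using assms by simp
      then have "trunc_pow m (y - s) = (- s + y) ^ m / fact m" by (simp add: trunc_pow_def)
      also have "(- s + y) ^ m = (\<Sum>j\<le>m. real (m choose j) * (- s) ^ j * y ^ (m - j))" by (rule binomial_ring)
      also have "(\<Sum>j\<le>m. real (m choose j) * (- s) ^ j * y ^ (m - j))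
          = (\<Sum>j\<le>m. real (m choose j) * fact j * (- 1) ^ j * y ^ (m - j) * (s ^ j / fact j))"
        by (intro sum.cong refl) (simp add: power_minus[of s] mult_ac)
      finally show ?case
        by (simp add: sum_divide_distrib sum_distrib_right mult.assoc)
    qed
    show "(\<lambda>s. trunc_pow m (y - s) * bump_spline m s) \<in> borel_measurable unit_measure"
      by (intro measurable_unit borel_measurable_times bump_spline_measurable measurable_compose[OF _ trunc_pow_measurable]) simp
    show "(\<lambda>s. \<Sum>j\<le>m. real (m choose j) * fact j * (- 1) ^ j * y ^ (m - j) / fact m * (s ^ j / fact j * bump_spline m s))
        \<in> borel_measurable unit_measure"
      by (intro measurable_unit borel_measurable_sum borel_measurable_times bump_spline_measurable) auto
  qed
  also have "\<dots> = (\<Sum>j\<le>m. real (m choose j) * fact j * (- 1) ^ j * y ^ (m - j) / fact m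
      * (\<integral>s. s ^ j / fact j * bump_spline m s \<partial>unit_measure))"
  proof -
    have i: "integrable unit_measure (\<lambda>s. s ^ j / fact j * bump_spline m s)" for j
    proof (rule integrable_unit_bounded[where B="1 * (\<Sum>k\<le>2 * m + 2. \<bar>difference_weight (2 * m + 2) k\<bar>)"])
      show "(\<lambda>s. s ^ j / fact j * bump_spline m s) \<in> borel_measurable unit_measure"
        by (intro measurable_unit borel_measurable_times bump_spline_measurable) auto
      fix s :: real assume s: "s \<in> {0..1}"
      show "\<bar>s ^ j / fact j * bump_spline m s\<bar> \<le> 1 * (\<Sum>k\<le>2 * m + 2. \<bar>difference_weight (2 * m + 2) k\<bar>)"
        unfolding abs_mult by (intro mult_mono bump_spline_bound unit_power_fact_bound s) auto
    qed
    show ?thesis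
      by (subst Bochner_Integration.integral_sum, rule integrable_mult_right[OF i], simp only: integral_mult_right_zero)
  qed
  also have "\<dots> = 0" by (intro sum.neutral ballI) (simp only: bump_spline_orthogonal atMost_iff mult_zero_right)
  finally show ?thesis .
qed

lemma fold_int_bump_spline_before: "y \<le> 0 \<Longrightarrow> fold_int m (bump_spline m) y = 0"
proof -
  assume y: "y \<le> 0"
  have "fold_int m (bump_spline m) y = (\<integral>s. 0 \<partial>unit_measure)" unfolding fold_int_def
    by (rule Bochner_Integration.integral_cong) (use y in \<open>auto simp: space_restrict_space trunc_pow_nonpos\<close>)
  then show ?thesis by simp
qed

section \<open>Scaled bumps and their orthogonality\<close>

lemma unit_cell_integral:
  fixes G :: "real \<Rightarrow> real" and i M :: nat
  assumes i: "i < M" and z: "\<And>s. s < real i / M \<or> s > (real i + 1) / M \<Longrightarrow> G s = 0"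
  shows "(\<integral>s. G s \<partial>unit_measure) = 1 / M * (\<integral>s. G ((real i + s) / M) \<partial>unit_measure)"
proof -
  have M: "real M > 0" "real i + 1 \<le> real M" using i by auto
  have "(\<integral>s. G s \<partial>unit_measure) = (LINT s|lborel. indicator {0..1} s * G s)"
    unfolding integral_unit_measure set_lebesgue_integral_def by simp
  also have "\<dots> = (LINT s|lborel. G s)"
  proof (rule Bochner_Integration.integral_cong[OF refl])
    fix s :: real
    have "s < real i / M" if "s < 0" using that M by (meson divide_nonneg_pos less_le_trans of_nat_0_le_iff)
    moreover have "s > (real i + 1) / M" if "s > 1"
      unfolding pos_divide_less_eq[OF M(1)] using mult_strict_right_mono[OF that M(1)] M(2) by linarith
    ultimately show "indicator {0..1} s * G s = G s" using z[of s] by (cases "s < 0 \<or> s > 1") (auto simp: indicator_def)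
  qed
  also have "\<dots> = 1 / M * (LINT s|lborel. G (real i / M + 1 / M * s))"
    using M by (subst lborel_integral_real_affine[where c="1 / M" and t="real i / M"]) auto
  also have "(LINT s|lborel. G (real i / M + 1 / M * s)) = (LINT s|lborel. indicator {0..1} s * G ((real i + s) / M))"
  proof (rule Bochner_Integration.integral_cong[OF refl])
    fix s :: real
    have e: "real i / M + 1 / M * s = (real i + s) / M" by (simp add: add_divide_distrib)
    have "G ((real i + s) / M) = 0" if "s \<notin> {0..1}"
      by (rule z) (use that M in \<open>auto simp: divide_less_cancel\<close>)
    then show "G (real i / M + 1 / M * s) = indicator {0..1} s * G ((real i + s) / M)"
      unfolding e by (auto simp: indicator_def)
  qed
  finally show ?thesis unfolding integral_unit_measure set_lebesgue_integral_def by simp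
qed

definition bump_node :: "nat \<Rightarrow> nat \<Rightarrow> nat \<Rightarrow> nat \<Rightarrow> real" where
  "bump_node m M i k = (real i + lagrange_node (2 * m + 2) k) / M"

text \<open>The one-variable representer of a functional: the covariance of \<open>f x\<close> with
  the divided difference of \<open>f\<close> at the nodes scaled to cell \<open>i\<close>.\<close>

definition bump :: "nat \<Rightarrow> nat \<Rightarrow> nat \<Rightarrow> real \<Rightarrow> real" where
  "bump m M i x = (\<Sum>k\<le>2 * m + 2. difference_weight (2 * m + 2) k
     * fold_int m (\<lambda>s. trunc_pow m (bump_node m M i k - s)) x)"

lemma bump_node_bounds:
  assumes "i < M" "k \<le> 2 * m + 2"
  shows "bump_node m M i k \<in> {0..1}"
proof -
  have "real i + 1 \<le> real M" using assms(1) by linarith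
  then show ?thesis using node_le_1[OF assms(2)] assms(1) by (simp add: bump_node_def)
qed

text \<open>Scaling the cell to the unit interval yields \<open>(1 / M) ^ m\<close> from each of the
  two truncated powers and \<open>1 / M\<close> from the substitution.\<close>

lemma bump_eq:
  assumes i: "i < M" and x: "x \<le> 1"
  shows "bump m M i x = (1 / M) ^ (2 * m + 1) * fold_int m (bump_spline m) (M * x - i)"
proof -
  let ?R = "2 * m + 2"
  have M: "real M > 0" using i by auto
  have "bump m M i x = fold_int m (\<lambda>s. \<Sum>k\<le>?R. difference_weight ?R k * trunc_pow m (bump_node m M i k - s)) x"
    unfolding bump_def by (rule fold_int_sum[symmetric]) (use bump_node_bounds[OF i] x in auto)
  also have "(\<lambda>s. \<Sum>k\<le>?R. difference_weight ?R k * trunc_pow m (bump_node m M i k - s))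
      = (\<lambda>s::real. (1 / M) ^ m * bump_spline m (M * s - i))"
  proof
    fix s :: real
    have e: "bump_node m M i k - s = 1 / M * (lagrange_node ?R k - (M * s - i))" for k
      using M unfolding bump_node_def by (simp add: field_simps)
    have t: "trunc_pow m (bump_node m M i k - s) = (1 / M) ^ m * trunc_pow m (lagrange_node ?R k - (M * s - i))" for k
      unfolding e by (rule trunc_pow_scale) (use M in simp)
    show "(\<Sum>k\<le>?R. difference_weight ?R k * trunc_pow m (bump_node m M i k - s)) = (1 / M) ^ m * bump_spline m (M * s - i)"
      unfolding t bump_spline_def sum_distrib_left by (simp only: mult_ac)
  qed
  also have "fold_int m (\<lambda>s::real. (1 / M) ^ m * bump_spline m (M * s - i)) x
      = 1 / M * (\<integral>s. trunc_pow m (x - (real i + s) / M) * ((1 / M) ^ m * bump_spline m (M * ((real i + s) / M) - i)) \<partial>unit_measure)"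
    unfolding fold_int_def
  proof (rule unit_cell_integral[OF i])
    fix s assume "s < real i / real M \<or> s > (real i + 1) / real M"
    then have "M * s - i < 0 \<or> M * s - i \<ge> 1" using M by (auto simp: field_simps)
    then show "trunc_pow m (x - s) * ((1 / M) ^ m * bump_spline m (M * s - i)) = 0"
      by (simp only: bump_spline_outside mult_zero_right)
  qed
  also have "(\<lambda>s. trunc_pow m (x - (real i + s) / M) * ((1 / M) ^ m * bump_spline m (M * ((real i + s) / M) - i)))
      = (\<lambda>s. (1 / M) ^ (2 * m) * (trunc_pow m (M * x - i - s) * bump_spline m s))"
  proof
    fix s :: real
    have e: "x - (real i + s) / M = 1 / M * (M * x - i - s)" "M * ((real i + s) / M) - i = s" using M by (auto simp: field_simps)
    have "trunc_pow m (x - (real i + s) / M) = (1 / M) ^ m * trunc_pow m (M * x - i - s)"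
      unfolding e(1) by (rule trunc_pow_scale) (use M in simp)
    then show "trunc_pow m (x - (real i + s) / M) * ((1 / M) ^ m * bump_spline m (M * ((real i + s) / M) - i))
        = (1 / M) ^ (2 * m) * (trunc_pow m (M * x - i - s) * bump_spline m s)"
      unfolding e(2) mult_2 power_add by (simp only: mult_ac)
  qed
  finally show ?thesis unfolding fold_int_def integral_mult_right_zero power_add by simp
qed

definition spline_energy :: "nat \<Rightarrow> real" where
  "spline_energy m = (\<integral>s. (bump_spline m s)\<^sup>2 \<partial>unit_measure)"

definition bump_energy :: "nat \<Rightarrow> real" where
  "bump_energy m = (\<integral>s. (fold_int m (bump_spline m) s)\<^sup>2 \<partial>unit_measure)"

lemma spline_energy_sum:
  "(\<Sum>k\<le>2 * m + 2. difference_weight (2 * m + 2) k * fold_int m (bump_spline m) (lagrange_node (2 * m + 2) k)) = spline_energy m"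
proof -
  have i: "integrable unit_measure (\<lambda>s. trunc_pow m (lagrange_node (2 * m + 2) k - s) * bump_spline m s)" if "k \<le> 2 * m + 2" for k
    using node_le_1[OF that] by (intro fold_int_integrable[OF bump_spline_measurable bump_spline_bound]) (simp_all only: atLeastAtMost_iff)
  have e: "(bump_spline m s)\<^sup>2 = (\<Sum>k\<le>2 * m + 2. difference_weight (2 * m + 2) k
      * (trunc_pow m (lagrange_node (2 * m + 2) k - s) * bump_spline m s))" for s
    unfolding power2_eq_square by (subst bump_spline_def) (simp only: sum_distrib_right mult.assoc)
  show ?thesis unfolding spline_energy_def e fold_int_def
    by (subst Bochner_Integration.integral_sum, rule integrable_mult_right[OF i], simp, simp only: integral_mult_right_zero)
qed

lemma spline_energy_pos: "spline_energy m > 0"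
  unfolding spline_energy_def by (rule bump_spline_energy)

lemma bump_energy_pos: "bump_energy m > 0"
proof -
  have "(\<Sum>k\<le>2 * m + 2. difference_weight (2 * m + 2) k * fold_int m (bump_spline m) (lagrange_node (2 * m + 2) k)) \<noteq> 0"
    unfolding spline_energy_sum using spline_energy_pos[of m] by linarith
  then show ?thesis unfolding bump_energy_def bump_spline_def[abs_def]
    by (rule fold_int_energy_pos[rotated]) (simp only: node_le_1 atMost_iff)
qed

text \<open>For different cells the nodes of one lie outside the support of the bump of the other.
  Within one cell the sum is the spline energy.\<close>

lemma bump_covariance:
  assumes "i < M" "j < M"
  shows "(\<Sum>l\<le>2 * m + 2. difference_weight (2 * m + 2) l * bump m M i (bump_node m M j l))
    = (if i = j then (1 / M) ^ (2 * m + 1) * spline_energy m else 0)"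
proof -
  let ?R = "2 * m + 2"
  have M: "real M > 0" using assms by auto
  have b: "bump m M i (bump_node m M j l) = (1 / M) ^ (2 * m + 1) * fold_int m (bump_spline m) (real j - real i + lagrange_node ?R l)"
    if "l \<le> ?R" for l
  proof -
    have e: "M * bump_node m M j l - i = real j - real i + lagrange_node ?R l" using M by (simp add: bump_node_def)
    have "bump_node m M j l \<le> 1" using bump_node_bounds[OF assms(2) that] by (simp only: atLeastAtMost_iff)
    from bump_eq[OF assms(1) this] show ?thesis unfolding e .
  qed
  show ?thesis
  proof (cases "i = j")
    case True
    have "(\<Sum>l\<le>?R. difference_weight ?R l * bump m M i (bump_node m M j l))
        = (\<Sum>l\<le>?R. (1 / M) ^ (2 * m + 1) * (difference_weight ?R l * fold_int m (bump_spline m) (lagrange_node ?R l)))"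
      unfolding True by (intro sum.cong refl) (simp only: b[unfolded True] atMost_iff diff_self add_0_left mult_ac)
    then show ?thesis unfolding sum_distrib_left[symmetric] spline_energy_sum using True by (simp only: if_True simp_thms)
  next
    case False
    have "fold_int m (bump_spline m) (real j - real i + lagrange_node ?R l) = 0" if "l \<le> ?R" for l
    proof (cases "i < j")
      case True
      then have "real i + 1 \<le> real j" by linarith
      then show ?thesis using node_le_1[OF that] by (intro fold_int_bump_spline_beyond) auto
    next
      case F: False
      then have "real j + 1 \<le> real i" using False by linarith
      then show ?thesis using node_le_1[OF that] by (intro fold_int_bump_spline_before) auto
    qed
    then have "(\<Sum>l\<le>?R. difference_weight ?R l * bump m M i (bump_node m M j l)) = 0"
      by (intro sum.neutral ballI) (simp only: b atMost_iff mult_zero_right)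
    then show ?thesis using False by (simp only: if_False)
  qed
qed

text \<open>Bumps of different cells have disjoint supports. The exponent consists of twice
  \<open>2 * m + 1\<close> and one more from the length of the cell.\<close>

lemma bump_inner:
  assumes "i < M" "j < M"
  shows "(\<integral>x. bump m M i x * bump m M j x \<partial>unit_measure)
    = (if i = j then (1 / M) ^ (4 * m + 3) * bump_energy m else 0)"
proof -
  let ?\<Gamma> = "fold_int m (bump_spline m)"
  have M: "real M > 0" using assms by auto
  have "(\<integral>x. bump m M i x * bump m M j x \<partial>unit_measure)
      = (\<integral>x. (1 / M) ^ (4 * m + 2) * (?\<Gamma> (M * x - i) * ?\<Gamma> (M * x - j)) \<partial>unit_measure)"
  proof (rule Bochner_Integration.integral_cong[OF refl])
    fix x assume "x \<in> space unit_measure"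
    then have x: "x \<le> 1" by (simp add: space_restrict_space)
    have "4 * m + 2 = (2 * m + 1) + (2 * m + 1)" by simp
    then show "bump m M i x * bump m M j x = (1 / M) ^ (4 * m + 2) * (?\<Gamma> (M * x - i) * ?\<Gamma> (M * x - j))"
      unfolding bump_eq[OF assms(1) x] bump_eq[OF assms(2) x] by (simp only: power_add mult_ac)
  qed
  also have "\<dots> = (if i = j then (1 / M) ^ (4 * m + 3) * bump_energy m else 0)"
  proof (cases "i = j")
    case True
    have "(\<integral>x. ?\<Gamma> (M * x - i) * ?\<Gamma> (M * x - i) \<partial>unit_measure)
        = 1 / M * (\<integral>s. ?\<Gamma> (M * ((real i + s) / M) - i) * ?\<Gamma> (M * ((real i + s) / M) - i) \<partial>unit_measure)"
    proof (rule unit_cell_integral[OF assms(1)])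
      fix s assume "s < real i / real M \<or> s > (real i + 1) / real M"
      then have "M * s - i \<le> 0 \<or> M * s - i \<ge> 1" using M by (auto simp: field_simps)
      then show "?\<Gamma> (M * s - i) * ?\<Gamma> (M * s - i) = 0"
        using fold_int_bump_spline_before fold_int_bump_spline_beyond by auto
    qed
    also have "\<dots> = 1 / M * bump_energy m" unfolding bump_energy_def power2_eq_square using M by simp
    finally show ?thesis using True M by (simp add: power_add[symmetric] eval_nat_numeral)
  next
    case False
    have "?\<Gamma> (M * x - i) * ?\<Gamma> (M * x - j) = 0" for x :: real
    proof -
      have "M * x - i \<le> 0 \<or> M * x - j \<ge> 1 \<or> M * x - i \<ge> 1 \<or> M * x - j \<le> 0"
      proof (cases "i < j")
        case True
        then have "real i + 1 \<le> real j" by linarith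
        then show ?thesis by linarith
      next
        case F: False
        then have "real j + 1 \<le> real i" using False by linarith
        then show ?thesis by linarith
      qed
      then show ?thesis using fold_int_bump_spline_before fold_int_bump_spline_beyond by auto
    qed
    then have "(\<lambda>x::real. (1 / M) ^ (4 * m + 2) * (?\<Gamma> (M * x - i) * ?\<Gamma> (M * x - j))) = (\<lambda>x. 0)" by (simp only: mult_zero_right)
    then show ?thesis using False by (simp only: integral_zero if_False)
  qed
  finally show ?thesis .
qed

lemma integrable_unit_continuous:
  fixes g :: "real \<Rightarrow> real"
  assumes "continuous_on {0..1} g"
  shows "integrable unit_measure g"
proof -
  obtain B where B: "\<And>x. x \<in> {0..1} \<Longrightarrow> \<bar>g x\<bar> \<le> B"
    using compact_imp_bounded[OF compact_continuous_image[OF assms compact_Icc]] unfolding bounded_iff by force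
  show ?thesis
  proof (rule integrable_unit_bounded[OF _ B])
    show "g \<in> borel_measurable unit_measure"
      using borel_measurable_continuous_on_restrict[OF assms]
      by (simp add: measurable_def space_restrict_space sets_restrict_space)
  qed
qed

lemma continuous_bump: "i < M \<Longrightarrow> continuous_on {0..1} (bump m M i)"
  unfolding bump_def[abs_def]
  by (intro continuous_on_sum continuous_on_mult continuous_on_const fold_int_continuous[where B=1]
      trunc_pow_section, simp_all only: atMost_iff atLeastAtMost_iff)
    (metis atLeastAtMost_iff bump_node_bounds)+

text \<open>The bumps live in coordinate \<open>j0\<close>. The other coordinates contribute fixed
  factors: \<open>A\<close> to the variance of the functionals and \<open>E\<close> to the norms of
  their representers. With variance \<open>V\<close> and squared norm \<open>W\<close>, normalizing
  both gives \<open>\<sigma> = sqrt (W / V)\<close>, whose powers of \<open>1 / M\<close> are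
  \<open>4 * m + 3\<close> minus \<open>2 * m + 1\<close>, halved.\<close>

lemma sheet_system_exists:
  assumes sheet: "wiener_sheet d r \<mu>" and j0: "j0 \<in> {1..d}"
  shows "\<exists>\<kappa>>0. \<forall>M>0. \<exists>e B J c y. sheet_system d r \<mu> M (\<kappa> * (1 / real M) ^ (r j0 + 1)) e B (J :: nat set) c y"
proof -
  define m where "m = r j0"
  define R where "R = 2 * m + 2"
  let ?D = "{1..d} - {j0}"
  define \<rho> where "\<rho> = (\<lambda>j. fold_int (r j) (\<lambda>s. trunc_pow (r j) (1 - s)))"
  define A where "A = (\<Prod>j\<in>?D. \<rho> j 1)"
  define E where "E = (\<Prod>j\<in>?D. \<integral>x. \<rho> j x * \<rho> j x \<partial>unit_measure)"
  have split: "(\<Prod>j=1..d. f j) = f j0 * (\<Prod>j\<in>?D. f j)" for f :: "nat \<Rightarrow> real"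
    using j0 by (simp add: prod.remove)
  have \<rho>1: "\<rho> j 1 > 0" for j unfolding \<rho>_def by (rule trunc_pow_energy_pos) auto
  have \<rho>c: "continuous_on {0..1} (\<rho> j)" for j unfolding \<rho>_def
    by (rule fold_int_continuous[where B=1]) (auto intro: trunc_pow_section)
  have \<rho>2: "(\<integral>x. \<rho> j x * \<rho> j x \<partial>unit_measure) > 0" for j
    using fold_int_energy_pos[of "{0::nat}" "\<lambda>_. 1" "\<lambda>_. 1" "r j"] \<rho>1[of j] unfolding \<rho>_def power2_eq_square by simp
  have A: "A > 0" unfolding A_def by (intro prod_pos ballI \<rho>1)
  have E: "E > 0" unfolding E_def by (intro prod_pos ballI \<rho>2)
  \<comment> \<open>The part of \<open>sqrt (W / V)\<close> that does not depend on
    \<open>M\<close>.\<close>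
  define \<kappa> where "\<kappa> = sqrt (bump_energy m * E / (A * spline_energy m))"
  have \<kappa>: "\<kappa> > 0" unfolding \<kappa>_def using A E bump_energy_pos spline_energy_pos by simp
  have "\<exists>e B J c y. sheet_system d r \<mu> M (\<kappa> * (1 / real M) ^ (r j0 + 1)) e B (J :: nat set) c y" if M: "M > 0" for M
  proof -
    define V where "V = A * ((1 / M) ^ (2 * m + 1) * spline_energy m)"
    define W where "W = (1 / M) ^ (4 * m + 3) * bump_energy m * E"
    have V: "V > 0" unfolding V_def using A spline_energy_pos M by simp
    have W: "W > 0" unfolding W_def using E bump_energy_pos M by simp
    define \<phi> where "\<phi> = (\<lambda>i j. if j = j0 then bump m M i else \<rho> j)"
    define g where "g = (\<lambda>i x. \<Prod>j=1..d. \<phi> i j (x j))"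
    \<comment> \<open>The remaining coordinates are frozen at 1, where \<open>\<rho>1\<close>
      provides a positive factor.\<close>
    define y where "y = (\<lambda>i k. \<lambda>j\<in>{1..d}. if j = j0 then bump_node m M i k else 1)"
    define c where "c = (\<lambda>(i::nat) k. difference_weight R k / sqrt V)"
    define e where "e = (\<lambda>i x. g i x / sqrt W)"
    have yc: "y i k \<in> cube d" if "i < M" "k \<in> {..R}" for i k
    proof -
      have "bump_node m M i k \<in> {0..1}" by (rule bump_node_bounds) (use that in \<open>simp_all add: R_def\<close>)
      then show ?thesis unfolding y_def by (intro cube_restrictI) auto
    qed
    have \<phi>c: "continuous_on {0..1} (\<phi> i j)" if "i < M" for i j
      unfolding \<phi>_def using continuous_bump[OF that] \<rho>c by simp
    have gc: "continuous_on (cube d) (g i)" if "i < M" for i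
      unfolding g_def by (rule continuous_on_tensor[OF \<phi>c[OF that]])
    have rep: "(\<Sum>k\<in>{..R}. difference_weight R k * wiener_kernel d r x (y i k)) = g i x" for i x
    proof -
      have "wiener_kernel d r x (y i k) = fold_int m (\<lambda>s. trunc_pow m (bump_node m M i k - s)) (x j0) * (\<Prod>j\<in>?D. \<rho> j (x j))" for k
        unfolding wiener_kernel_fold_int split using j0
        by (subst (1 2) fold_int_symmetric) (auto simp: y_def m_def \<rho>_def fold_int_symmetric[of _ "x _"] intro!: prod.cong)
      then have "(\<Sum>k\<in>{..R}. difference_weight R k * wiener_kernel d r x (y i k)) = bump m M i (x j0) * (\<Prod>j\<in>?D. \<rho> j (x j))"
        unfolding bump_def R_def[symmetric] sum_distrib_right by (simp only: mult.assoc)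
      also have "\<dots> = g i x" unfolding g_def split \<phi>_def by (auto intro!: prod.cong)
      finally show ?thesis .
    qed
    have gy: "g i (y j l) = A * bump m M i (bump_node m M j l)" for i j l
      unfolding g_def split A_def \<phi>_def y_def using j0 by (auto intro!: prod.cong)
    have cov: "(\<Sum>k\<in>{..R}. \<Sum>l\<in>{..R}. difference_weight R k * difference_weight R l * wiener_kernel d r (y i k) (y j l))
        = (if i = j then V else 0)" if "i < M" "j < M" for i j
    proof -
      have "(\<Sum>k\<in>{..R}. \<Sum>l\<in>{..R}. difference_weight R k * difference_weight R l * wiener_kernel d r (y i k) (y j l))
          = (\<Sum>l\<in>{..R}. \<Sum>k\<in>{..R}. difference_weight R k * difference_weight R l * wiener_kernel d r (y i k) (y j l))"
        by (rule sum.swap)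
      also have "\<dots> = (\<Sum>l\<in>{..R}. difference_weight R l * (\<Sum>k\<in>{..R}. difference_weight R k * wiener_kernel d r (y j l) (y i k)))"
        unfolding sum_distrib_left
        by (intro sum.cong refl) (simp add: wiener_kernel_def mult_ac)
      also have "\<dots> = A * (\<Sum>l\<le>R. difference_weight R l * bump m M i (bump_node m M j l))"
        unfolding rep gy sum_distrib_left by (simp only: mult_ac)
      also have "\<dots> = (if i = j then V else 0)"
        unfolding R_def bump_covariance[OF that] V_def by simp
      finally show ?thesis .
    qed
    have inner: "(\<integral>x. g i x * g j x \<partial>cube_measure d) = (if i = j then W else 0)" if ij: "i < M" "j < M" for i j
    proof -
      have "(\<integral>x. g i x * g j x \<partial>cube_measure d) = (\<integral>x. (\<Prod>k=1..d. \<phi> i k (x k) * \<phi> j k (x k)) \<partial>cube_measure d)"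
        unfolding g_def prod.distrib ..
      also have "\<dots> = (\<Prod>k=1..d. \<integral>t. \<phi> i k t * \<phi> j k t \<partial>unit_measure)"
        by (intro integral_tensor integrable_unit_continuous continuous_on_mult \<phi>c ij)
      also have "\<dots> = (\<integral>t. bump m M i t * bump m M j t \<partial>unit_measure) * E"
        unfolding split \<phi>_def E_def by (auto intro!: prod.cong)
      also have "\<dots> = (if i = j then W else 0)" unfolding bump_inner[OF ij] W_def by simp
      finally show ?thesis .
    qed
    have "\<forall>i. \<exists>B. i < M \<longrightarrow> B \<ge> 0 \<and> (\<forall>x\<in>cube d. \<bar>g i x\<bar> \<le> B)"
      using continuous_cube_bounded[OF gc] by metis
    then obtain B where B: "\<And>i x. i < M \<Longrightarrow> x \<in> cube d \<Longrightarrow> \<bar>g i x\<bar> \<le> B i" "\<And>i. i < M \<Longrightarrow> B i \<ge> 0" by metis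
    have \<sigma>: "\<kappa> * (1 / real M) ^ (r j0 + 1) = sqrt W / sqrt V"
    proof -
      have "(\<kappa> * (1 / real M) ^ (m + 1)) ^ 2 = W / V"
      proof -
        have "(1 / real M) ^ (4 * m + 3) = (1 / real M) ^ (2 * m + 1) * ((1 / real M) ^ (m + 1))\<^sup>2"
          unfolding power_mult[symmetric] power_add[symmetric] by (rule arg_cong[where f="power (1 / real M)"]) simp
        moreover have "\<kappa>\<^sup>2 = bump_energy m * E / (A * spline_energy m)"
          unfolding \<kappa>_def using A E bump_energy_pos[of m] spline_energy_pos[of m] by (intro real_sqrt_pow2) (simp add: less_imp_le)
        ultimately show ?thesis unfolding W_def V_def power_mult_distrib using M by simp
      qed
      moreover have "\<kappa> * (1 / real M) ^ (m + 1) \<ge> 0" using \<kappa> by simp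
      ultimately show ?thesis unfolding m_def by (metis real_sqrt_divide real_sqrt_unique)
    qed
    have "sheet_system d r \<mu> M (\<kappa> * (1 / real M) ^ (r j0 + 1)) e ((\<Sum>i<M. B i) / sqrt W) {..R} c y"
      unfolding sheet_system_def sheet_system_axioms_def \<sigma>
    proof (intro conjI allI impI sheet)
      show "0 < sqrt W / sqrt V" using V W by simp
      fix i assume i: "i < M"
      show "e i \<in> borel_measurable (cube_measure d)"
        unfolding e_def using measurable_cube_continuous[OF gc[OF i]] by measurable
      {
        fix x assume x: "x \<in> cube d"
        have "\<bar>g i x\<bar> \<le> (\<Sum>i<M. B i)" using B(1)[OF i x] member_le_sum[of i "{..<M}" B] B(2) i by force
        then show "\<bar>e i x\<bar> \<le> (\<Sum>i<M. B i) / sqrt W" unfolding e_def using W by (simp add: divide_right_mono)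
        have "(\<Sum>k\<in>{..R}. c i k * wiener_kernel d r x (y i k)) = g i x / sqrt V"
          unfolding rep[symmetric] c_def sum_divide_distrib by simp
        then show "(\<Sum>k\<in>{..R}. c i k * wiener_kernel d r x (y i k)) = sqrt W / sqrt V * e i x"
          unfolding e_def using W by simp
      }
      fix k assume "k \<in> {..R}"
      then show "y i k \<in> cube d" by (rule yc[OF i])
    next
      fix i j assume ij: "i < M" "j < M"
      have "e i x * e j x = g i x * g j x / W" for x using W by (simp add: e_def)
      then show "(\<integral>x. e i x * e j x \<partial>cube_measure d) = (if i = j then 1 else 0)"
        using inner[OF ij] W by simp
      have "c i k * c j l * w = difference_weight R k * difference_weight R l * w / V" for k l w
        using V by (simp add: c_def)
      then have "(\<Sum>k\<in>{..R}. \<Sum>l\<in>{..R}. c i k * c j l * wiener_kernel d r (y i k) (y j l)) = (if i = j then V else 0) / V"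
        unfolding cov[OF ij, symmetric] sum_divide_distrib by simp
      then show "(\<Sum>k\<in>{..R}. \<Sum>l\<in>{..R}. c i k * c j l * wiener_kernel d r (y i k) (y j l)) = (if i = j then 1 else 0)"
        using V by simp
    qed
    then show ?thesis by blast
  qed
  then show ?thesis using \<kappa> by blast
qed

subsection \<open>Complexity bounds\<close>

lemma L2_carrier_rep:
  assumes "u \<in> hcarrier (L2 d)"
  shows "L2_rep u \<in> L2_funs d" "u = L2_class d (L2_rep u)"
proof -
  obtain g where g: "g \<in> L2_funs d" "u = L2_class d g" using assms by (auto simp: L2_def)
  show "L2_rep u \<in> L2_funs d" using L2_rep_class(1)[OF g(1)] g(2) by simp
  have "L2_class d (L2_rep u) = L2_class d g"
    by (rule L2_class_cong) (use L2_rep_class(2)[OF g(1)] g(2) in simp)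
  then show "u = L2_class d (L2_rep u)" using g(2) by simp
qed

lemma L2_hdist:
  assumes "f \<in> L2_funs d" "g \<in> L2_funs d"
  shows "(hdist (L2 d) (L2_class d f) (L2_class d g))\<^sup>2 = (\<integral>x. (f x - g x)\<^sup>2 \<partial>cube_measure d)"
proof -
  have m: "(\<lambda>x. - 1 * g x) \<in> L2_funs d" using L2_funs_linear[OF assms(2) L2_funs_zero, of "- 1"] by simp
  have fg: "(\<lambda>x. f x + - 1 * g x) \<in> L2_funs d" using L2_funs_linear[OF m assms(1), of 1] by (simp add: add.commute)
  show ?thesis unfolding hdist_def L2_hscale[OF assms(2)] L2_hadd[OF assms(1) m] L2_hnorm[OF fg] by simp
qed

lemma (in sheet_system) L2_integral_combination:
  assumes "g \<in> L2_funs d"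
  shows "(\<integral>x. g x * combination z x \<partial>cube_measure d) = (\<Sum>i<M. z i * (\<integral>x. g x * e i x \<partial>cube_measure d))"
proof -
  have "(\<integral>x. g x * combination z x \<partial>cube_measure d) = (\<integral>x. (\<Sum>i<M. z i * (g x * e i x)) \<partial>cube_measure d)"
    unfolding combination_def sum_distrib_left by (simp only: mult_ac)
  also have "\<dots> = (\<Sum>i<M. z i * (\<integral>x. g x * e i x \<partial>cube_measure d))"
    by (rule linear_combination_integral(2)) (use assms e_L2 in \<open>auto intro!: L2_product_integrable\<close>)
  finally show ?thesis .
qed

text \<open>Since \<open>g\<close> is orthogonal to the combinations, the pairings of
  \<open>f\<close> are the coefficients of \<open>f - g\<close> in an orthonormal system, and
  Bessel's inequality bounds their squares.\<close>

lemma (in sheet_system) bessel: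
  fixes n :: nat
  assumes f: "f \<in> L2_funs d" and g: "g \<in> L2_funs d"
    and on: "\<And>a a'. a < n \<Longrightarrow> a' < n \<Longrightarrow> (\<Sum>i<M. q a i * q a' i) = (if a = a' then 1 else 0)"
    and orth: "\<And>a. a < n \<Longrightarrow> (\<integral>x. g x * combination (q a) x \<partial>cube_measure d) = 0"
  shows "(\<Sum>a<n. (pairing (q a) f)\<^sup>2) \<le> (\<integral>x. (f x - g x)\<^sup>2 \<partial>cube_measure d)"
proof -
  define h where "h = (\<lambda>x. f x - g x)"
  have h: "h \<in> L2_funs d" using L2_funs_linear[OF g f, of "- 1"] by (simp add: h_def add.commute[of "- g _"])
  define b where "b = (\<lambda>i. \<integral>x. h x * e i x \<partial>cube_measure d)"
  define p where "p = (\<lambda>a. pairing (q a) f)"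
  define z where "z = (\<lambda>i. \<Sum>a<n. p a * q a i)"
  have c: "combination w \<in> L2_funs d" for w by (rule L2_fun_bounded[OF combination_meas combination_bound])
  have p: "p a = (\<Sum>i<M. q a i * b i)" if "a < n" for a
  proof -
    have "(\<integral>x. h x * combination (q a) x \<partial>cube_measure d) = pairing (q a) f - (\<integral>x. g x * combination (q a) x \<partial>cube_measure d)"
      unfolding h_def pairing_def left_diff_distrib
      by (rule Bochner_Integration.integral_diff) (intro L2_product_integrable f g c)+
    then show ?thesis using orth[OF that] L2_integral_combination[OF h, of "q a"] by (simp add: p_def b_def)
  qed
  have zb: "(\<Sum>i<M. z i * b i) = (\<Sum>a<n. (p a)\<^sup>2)"
  proof -
    have "(\<Sum>i<M. z i * b i) = (\<Sum>a<n. \<Sum>i<M. p a * (q a i * b i))"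
      unfolding z_def sum_distrib_right mult.assoc by (rule sum.swap)
    also have "\<dots> = (\<Sum>a<n. p a * p a)" by (intro sum.cong refl) (simp add: p sum_distrib_left)
    finally show ?thesis by (simp add: power2_eq_square)
  qed
  have zz: "(\<Sum>i<M. z i * z i) = (\<Sum>a<n. (p a)\<^sup>2)"
  proof -
    have "(\<Sum>i<M. z i * z i) = (\<Sum>i<M. \<Sum>a<n. p a * (q a i * z i))"
      by (subst (1) z_def) (simp add: sum_distrib_right mult.assoc)
    also have "\<dots> = (\<Sum>a<n. p a * (\<Sum>i<M. q a i * z i))" unfolding sum_distrib_left by (rule sum.swap)
    also have "\<dots> = (\<Sum>a<n. p a * p a)"
    proof (intro sum.cong refl)
      fix a assume a: "a \<in> {..<n}"
      have "(\<Sum>i<M. q a i * z i) = (\<Sum>i<M. \<Sum>a'<n. p a' * (q a i * q a' i))"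
        unfolding z_def sum_distrib_left by (simp only: mult_ac)
      also have "\<dots> = (\<Sum>a'<n. p a' * (\<Sum>i<M. q a i * q a' i))" unfolding sum_distrib_left by (rule sum.swap)
      also have "\<dots> = (\<Sum>a'<n. if a' = a then p a' else 0)" by (intro sum.cong) (use a in \<open>auto simp: on\<close>)
      finally show "p a * (\<Sum>i<M. q a i * z i) = p a * p a" using a by simp
    qed
    finally show ?thesis by (simp add: power2_eq_square)
  qed
  have hz: "(\<integral>x. h x * combination z x \<partial>cube_measure d) = (\<Sum>a<n. (p a)\<^sup>2)"
    using zb unfolding L2_integral_combination[OF h] b_def .
  have cz: "(\<integral>x. combination z x * combination z x \<partial>cube_measure d) = (\<Sum>a<n. (p a)\<^sup>2)"
    unfolding L2_integral_combination[OF c] using zz by (simp add: combination_inner)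
  have e: "(h x - combination z x)\<^sup>2 = (h x)\<^sup>2 - 2 * (h x * combination z x) + combination z x * combination z x" for x
    by (simp add: power2_eq_square algebra_simps)
  have i: "integrable (cube_measure d) (\<lambda>x. (h x)\<^sup>2)" using h by (simp add: L2_funs_def)
  have "0 \<le> (\<integral>x. (h x - combination z x)\<^sup>2 \<partial>cube_measure d)" by simp
  also have "\<dots> = (\<integral>x. (h x)\<^sup>2 \<partial>cube_measure d) - 2 * (\<Sum>a<n. (p a)\<^sup>2) + (\<Sum>a<n. (p a)\<^sup>2)"
    unfolding e using i L2_product_integrable[OF h c] L2_product_integrable[OF c c] hz cz by simp
  finally show ?thesis unfolding h_def p_def by simp
qed

text \<open>\<open>runs_path\<close> for the predicate of being orthogonal to
  \<open>combination z\<close>. The path is fixed before \<open>z\<close>, so the same path works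
  for all directions of an orthonormal complement.\<close>

lemma (in sheet_system) output_orthogonal:
  assumes "runs (L2 d) p xs [] v k"
  shows "\<exists>bs. length bs = k \<and> (\<forall>z. (\<forall>g\<in>path_consts bs p \<inter> hcarrier (L2 d). (\<integral>x. L2_rep g x * combination z x \<partial>cube_measure d) = 0)
    \<longrightarrow> v \<in> hcarrier (L2 d) \<and> (\<integral>x. L2_rep v x * combination z x \<partial>cube_measure d) = 0)"
proof -
  obtain bs where bs: "length bs = k" and *: "\<And>P. (\<forall>g h. P g \<longrightarrow> P h \<longrightarrow> P (hadd (L2 d) g h)) \<Longrightarrow>
      (\<forall>a g. P g \<longrightarrow> P (hscale (L2 d) a g)) \<Longrightarrow> (\<forall>u\<in>set [] \<inter> hcarrier (L2 d). P u) \<Longrightarrow>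
      (\<forall>g\<in>path_consts bs p \<inter> hcarrier (L2 d). P g) \<Longrightarrow> P v"
    using runs_path[OF assms] by blast
  show ?thesis
  proof (intro exI[of _ bs] conjI allI impI bs)
    fix z assume z: "\<forall>g\<in>path_consts bs p \<inter> hcarrier (L2 d). (\<integral>x. L2_rep g x * combination z x \<partial>cube_measure d) = 0"
    define P where "P = (\<lambda>g. g \<in> hcarrier (L2 d) \<and> (\<integral>x. L2_rep g x * combination z x \<partial>cube_measure d) = 0)"
    have c: "combination z \<in> L2_funs d" by (rule L2_fun_bounded[OF combination_meas combination_bound])
    have lin: "P (L2_class d (\<lambda>x. a * L2_rep g x + L2_rep h x))" if "P g" "P h" for a g h
    proof -
      have g: "L2_rep g \<in> L2_funs d" and h: "L2_rep h \<in> L2_funs d" using that L2_carrier_rep by (auto simp: P_def)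
      let ?s = "\<lambda>x. a * L2_rep g x + L2_rep h x"
      have s: "?s \<in> L2_funs d" by (rule L2_funs_linear[OF g h])
      have "(\<integral>x. L2_rep (L2_class d ?s) x * combination z x \<partial>cube_measure d) = (\<integral>x. ?s x * combination z x \<partial>cube_measure d)"
        by (rule integral_cong_AE) (use L2_rep_class[OF s] s c in \<open>auto simp: L2_funs_def\<close>)
      also have "\<dots> = (\<integral>x. a * (L2_rep g x * combination z x) + L2_rep h x * combination z x \<partial>cube_measure d)"
        by (simp add: algebra_simps)
      also have "\<dots> = 0"
        using that L2_product_integrable[OF g c] L2_product_integrable[OF h c] by (simp add: P_def)
      finally show ?thesis using L2_carrier[OF s] by (simp add: P_def)
    qed
    have zero: "P (L2_class d (\<lambda>x. 0))"
    proof -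
      have "(\<integral>x. L2_rep (L2_class d (\<lambda>x. 0)) x * combination z x \<partial>cube_measure d) = (\<integral>x. 0 \<partial>cube_measure d)"
        by (rule integral_cong_AE) (use L2_rep_class[OF L2_funs_zero, of d] c in \<open>auto simp: L2_funs_def\<close>)
      then show ?thesis using L2_carrier[OF L2_funs_zero] by (simp add: P_def)
    qed
    have "P v"
    proof (rule *[of P])
      show "\<forall>g h. P g \<longrightarrow> P h \<longrightarrow> P (hadd (L2 d) g h)" using lin[of _ _ 1] by (simp add: L2_def)
      show "\<forall>a g. P g \<longrightarrow> P (hscale (L2 d) a g)"
      proof (intro allI impI)
        fix a g assume g: "P g"
        have "L2_class d (\<lambda>x. a * L2_rep g x + L2_rep (L2_class d (\<lambda>x. 0)) x) = L2_class d (\<lambda>x. a * L2_rep g x)"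
          by (rule L2_class_cong) (use L2_rep_class(2)[OF L2_funs_zero, of d] in auto)
        then show "P (hscale (L2 d) a g)" using lin[OF g zero, of a] by (simp add: L2_def)
      qed
    qed (use z in \<open>auto simp: P_def\<close>)
    then show "v \<in> hcarrier (L2 d)" "(\<integral>x. L2_rep v x * combination z x \<partial>cube_measure d) = 0" by (auto simp: P_def)
  qed
qed

text \<open>Whatever the information, a program outputs a point of one of few low-dimensional subspaces, and
  the sheet is rarely close to a given one.\<close>

lemma (in sheet_system) accurate_outputs:
  fixes prg :: "nat \<Rightarrow> func set program"
  shows "\<exists>E\<in>sets \<mu>. prob E \<le> real (Suc N0) * 2 ^ Suc k * (exp (3 / (2 * \<sigma>\<^sup>2) * \<tau>) * (1 / 2) ^ (M - (2 * k + 1))) \<and>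
    (\<forall>f\<in>F_space d r. \<forall>ys v j. length ys \<le> N0 \<longrightarrow> j \<le> k \<longrightarrow> runs (L2 d) (prg (length ys)) ys [] v j \<longrightarrow>
      (hdist (L2 d) (L2_class d f) v)\<^sup>2 \<le> \<tau> \<longrightarrow> f \<in> E)"
proof -
  define n where "n = M - (2 * k + 1)"
  \<comment> \<open>The coordinates, with respect to the functions \<open>e i\<close>, of the
    constants on a path. Vectors orthogonal to them give combinations orthogonal to every output of
    that path.\<close>
  define V where "V = (\<lambda>(l, bs). (\<lambda>g i. \<integral>x. L2_rep g x * e i x \<partial>cube_measure d) ` (path_consts bs (prg l) \<inter> hcarrier (L2 d)))"
  \<comment> \<open>A program may be chosen for each number of values, so the union runs over pairs
    of that number and a path; this is why \<open>N0\<close> enters the bound.\<close>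
  define I where "I = {..N0} \<times> {bs :: bool list. set bs \<subseteq> UNIV \<and> length bs \<le> k}"
  have fI: "finite I" unfolding I_def by (intro finite_cartesian_product finite_lists_length_le) auto
  have cI: "real (card I) \<le> real (Suc N0) * 2 ^ Suc k"
  proof -
    have "(\<Sum>i\<le>k. (2::nat) ^ i) \<le> 2 ^ Suc k" by (induction k) auto
    then have "card I \<le> Suc N0 * 2 ^ Suc k" unfolding I_def card_cartesian_product
      by (subst card_lists_length_le) (simp_all del: power_Suc mult_Suc add: mult_le_mono)
    then have "real (card I) \<le> real (Suc N0 * 2 ^ Suc k)" by (rule of_nat_mono)
    then show ?thesis by (simp add: distrib_right)
  qed
  have "\<forall>\<iota>. \<exists>q. \<iota> \<in> I \<longrightarrow> (\<forall>a<n. \<forall>a'<n. (\<Sum>i<M. q a i * q a' i) = (if a = a' then 1 else 0)) \<and>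
      (\<forall>a<n. \<forall>u\<in>V \<iota>. (\<Sum>i<M. q a i * u i) = (0::real))"
  proof
    fix \<iota> :: "nat \<times> bool list"
    obtain l bs where \<iota>: "\<iota> = (l, bs)" by (cases \<iota>)
    show "\<exists>q. \<iota> \<in> I \<longrightarrow> (\<forall>a<n. \<forall>a'<n. (\<Sum>i<M. q a i * q a' i) = (if a = a' then 1 else 0)) \<and>
      (\<forall>a<n. \<forall>u\<in>V \<iota>. (\<Sum>i<M. q a i * u i) = (0::real))"
    proof (cases "length bs \<le> k")
      case True
      have fV: "finite (V \<iota>)" unfolding V_def \<iota> by (auto intro: finite_path_consts)
      have "card (V \<iota>) \<le> card (path_consts bs (prg l))" unfolding V_def \<iota> prod.case
        by (rule order_trans[OF card_image_le card_mono]) (auto intro: finite_path_consts)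
      also have "\<dots> \<le> 2 * k + 1" using card_path_consts[of bs "prg l"] True by linarith
      finally have n: "a < n \<Longrightarrow> a < M - card (V \<iota>)" for a unfolding n_def by linarith
      obtain q where "\<forall>a<M - card (V \<iota>). \<forall>a'<M - card (V \<iota>). (\<Sum>i<M. q a i * q a' i) = (if a = a' then 1 else 0)"
        "\<forall>a<M - card (V \<iota>). \<forall>u\<in>V \<iota>. (\<Sum>i<M. q a i * u i) = (0::real)"
        using orthonormal_complement[OF fV, of M] by blast
      then show ?thesis using n by (intro exI[of _ q]) simp
    qed (auto simp: I_def \<iota>)
  qed
  then obtain q where on: "\<And>\<iota> a a'. \<iota> \<in> I \<Longrightarrow> a < n \<Longrightarrow> a' < n \<Longrightarrow> (\<Sum>i<M. q \<iota> a i * q \<iota> a' i) = (if a = a' then 1 else 0)"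
    and orth: "\<And>\<iota> a u. \<iota> \<in> I \<Longrightarrow> a < n \<Longrightarrow> u \<in> V \<iota> \<Longrightarrow> (\<Sum>i<M. q \<iota> a i * u i) = (0::real)"
    by metis
  define E where "E = (\<lambda>\<iota>. {f \<in> space \<mu>. (\<Sum>a<n. (pairing (q \<iota> a) f)\<^sup>2) \<le> \<tau>})"
  have E: "E \<iota> \<in> sets \<mu>" "prob (E \<iota>) \<le> exp (3 / (2 * \<sigma>\<^sup>2) * \<tau>) * (1 / 2) ^ n" if "\<iota> \<in> I" for \<iota>
    using small_ball[of n "q \<iota>" \<tau>] on[OF that] unfolding E_def by auto
  have "prob (\<Union>\<iota>\<in>I. E \<iota>) \<le> (\<Sum>\<iota>\<in>I. prob (E \<iota>))" by (rule finite_measure_subadditive_finite) (use fI E in auto)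
  also have "\<dots> \<le> (\<Sum>\<iota>\<in>I. exp (3 / (2 * \<sigma>\<^sup>2) * \<tau>) * (1 / 2) ^ n)" by (intro sum_mono E)
  also have "\<dots> \<le> real (Suc N0) * 2 ^ Suc k * (exp (3 / (2 * \<sigma>\<^sup>2) * \<tau>) * (1 / 2) ^ n)"
    using cI by (simp add: mult_right_mono)
  finally have p: "prob (\<Union>\<iota>\<in>I. E \<iota>) \<le> real (Suc N0) * 2 ^ Suc k * (exp (3 / (2 * \<sigma>\<^sup>2) * \<tau>) * (1 / 2) ^ n)" .
  show ?thesis
  proof (intro bexI[of _ "\<Union>\<iota>\<in>I. E \<iota>"] conjI ballI allI impI)
    show "prob (\<Union>\<iota>\<in>I. E \<iota>) \<le> real (Suc N0) * 2 ^ Suc k * (exp (3 / (2 * \<sigma>\<^sup>2) * \<tau>) * (1 / 2) ^ (M - (2 * k + 1)))"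
      using p unfolding n_def .
    show "(\<Union>\<iota>\<in>I. E \<iota>) \<in> sets \<mu>" using fI E by blast
    fix f ys v j assume f: "f \<in> F_space d r" and l: "length ys \<le> N0" and j: "j \<le> k"
      and run: "runs (L2 d) (prg (length ys)) ys [] v j" and \<tau>: "(hdist (L2 d) (L2_class d f) v)\<^sup>2 \<le> \<tau>"
    obtain bs where bs: "length bs = j" and o: "\<And>z. (\<forall>g\<in>path_consts bs (prg (length ys)) \<inter> hcarrier (L2 d).
        (\<integral>x. L2_rep g x * combination z x \<partial>cube_measure d) = 0) \<Longrightarrow>
        v \<in> hcarrier (L2 d) \<and> (\<integral>x. L2_rep v x * combination z x \<partial>cube_measure d) = 0"
      using output_orthogonal[OF run] by blast
    let ?\<iota> = "(length ys, bs)"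
    have \<iota>: "?\<iota> \<in> I" using l bs j by (simp add: I_def)
    have ov: "v \<in> hcarrier (L2 d) \<and> (\<integral>x. L2_rep v x * combination (q ?\<iota> a) x \<partial>cube_measure d) = 0" if a: "a < n" for a
    proof (rule o, rule ballI)
      fix g assume g: "g \<in> path_consts bs (prg (length ys)) \<inter> hcarrier (L2 d)"
      then have "L2_rep g \<in> L2_funs d" using L2_carrier_rep(1) by blast
      from L2_integral_combination[OF this]
      show "(\<integral>x. L2_rep g x * combination (q ?\<iota> a) x \<partial>cube_measure d) = 0"
        using orth[OF \<iota> a, of "\<lambda>i. \<integral>x. L2_rep g x * e i x \<partial>cube_measure d"] g by (auto simp: V_def)
    qed
    have "v \<in> hcarrier (L2 d)"
      using o[of "\<lambda>_. 0"] by (simp add: combination_def)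
    note v = L2_carrier_rep[OF this]
    have "(\<Sum>a<n. (pairing (q ?\<iota> a) f)\<^sup>2) \<le> (\<integral>x. (f x - L2_rep v x)\<^sup>2 \<partial>cube_measure d)"
      by (rule bessel[OF F_space_L2[OF f] v(1)]) (use on[OF \<iota>] ov in auto)
    also have "\<dots> \<le> \<tau>" using \<tau> L2_hdist[OF F_space_L2[OF f] v(1)] v(2) by simp
    finally show "f \<in> (\<Union>\<iota>\<in>I. E \<iota>)" using \<iota> f by (auto simp: E_def space_sheet)
  qed
qed

lemma operations_attained:
  assumes "operations H \<phi> prg ys < ennreal T"
  shows "\<exists>j. runs H (prg (length ys)) ys [] (\<phi> ys) j \<and> j \<le> nat \<lfloor>T\<rfloor>"
proof -
  obtain j where j: "runs H (prg (length ys)) ys [] (\<phi> ys) j" "of_nat j < ennreal T"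
    using assms unfolding operations_def INF_less_iff by auto
  from j(2) have "ennreal (real j) < ennreal T" by (simp add: ennreal_of_nat_eq_real_of_nat)
  then have "real j < T" by (simp add: ennreal_less_iff)
  then have "j \<le> nat \<lfloor>T\<rfloor>" by linarith
  then show ?thesis using j(1) by blast
qed

lemma length_info: "length (info N f) = cardinality N f"
proof -
  have "length (info_values N f k) = k" for k by (induction k) auto
  then show ?thesis by (simp add: info_def)
qed

lemma cheap_output:
  assumes P: "is_algorithm P \<Lambda> (N, \<phi>, prg)" and \<kappa>: "information_cost (F_space (dimension P) (smoothness P)) c (info_cost P)"
    and c: "c > 0" and f: "f \<in> F_space (dimension P) (smoothness P)"
    and T: "total_cost P (N, \<phi>, prg) f < ennreal T"
  shows "length (info N f) \<le> nat \<lfloor>T / c\<rfloor>"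
    and "\<exists>j. runs (target P) (prg (length (info N f))) (info N f) [] (\<phi> (info N f)) j \<and> j \<le> nat \<lfloor>T\<rfloor>"
proof -
  have k: "ennreal (info_cost P N f) < ennreal T" "operations (target P) \<phi> prg (info N f) < ennreal T"
    using T by (auto intro: le_less_trans[OF _ T])
  show "\<exists>j. runs (target P) (prg (length (info N f))) (info N f) [] (\<phi> (info N f)) j \<and> j \<le> nat \<lfloor>T\<rfloor>"
    by (rule operations_attained[OF k(2)])
  have "c * real (cardinality N f) \<le> info_cost P N f"
    using P \<kappa> f unfolding information_cost_def by auto
  moreover have "info_cost P N f < T" using k(1) by (metis ennreal_lessI ennreal_leI linorder_not_less)
  ultimately have "real (cardinality N f) \<le> T / c" using c by (simp add: pos_le_divide_eq mult.commute)
  then show "length (info N f) \<le> nat \<lfloor>T / c\<rfloor>" unfolding length_info by linarith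
qed

lemma exp_half_le_2: "exp (real L / 2) \<le> 2 ^ L"
proof -
  have "exp (1 / 2 :: real) ^ 2 \<le> 2\<^sup>2" using exp_le by (simp add: exp_double[symmetric] power2_eq_square exp_add[symmetric])
  then have "exp (1 / 2 :: real) \<le> 2" by (rule power2_le_imp_le) simp
  then have "exp (1 / 2 :: real) ^ L \<le> 2 ^ L" by (intro power_mono) auto
  then show ?thesis by (simp add: exp_of_nat_mult[symmetric])
qed

text \<open>With \<open>Suc N0 \<le> 2 ^ N0\<close> and \<open>exp (L / 2) \<le> 2 ^ L\<close> the
  left side is at most 2 to the power \<open>N0 + 3 * k + 2 - L\<close>, and the choice of
  \<open>L\<close> makes this exponent -2.\<close>

lemma union_bound_small:
  assumes L: "L = N0 + 3 * k + 4"
  shows "real (Suc N0) * 2 ^ Suc k * (exp (real L / 2) * (1 / 2) ^ (2 * L - (2 * k + 1))) \<le> 1 / 4"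
proof -
  have le: "2 * k + 1 \<le> 2 * L" using L by simp
  have h: "(1 / 2 :: real) ^ (2 * L - (2 * k + 1)) = 2 ^ (2 * k + 1) / 2 ^ (2 * L)"
    using le by (simp add: power_divide power_diff)
  have N0: "real (Suc N0) \<le> 2 ^ N0" by (metis Suc_leI less_exp of_nat_le_iff of_nat_numeral of_nat_power)
  have "real (Suc N0) * 2 ^ Suc k * (exp (real L / 2) * (1 / 2) ^ (2 * L - (2 * k + 1)))
      \<le> 2 ^ N0 * 2 ^ Suc k * (2 ^ L * (2 ^ (2 * k + 1) / 2 ^ (2 * L)))"
    unfolding h
    by (rule mult_mono[OF mult_right_mono[OF N0] mult_right_mono[OF exp_half_le_2]]) (simp_all del: power_Suc)
  also have "\<dots> = 2 ^ (N0 + Suc k + (2 * k + 1)) / 2 ^ L"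
  proof -
    have "a * b * (l * (z / (l * l))) = a * b * z / l" if "l \<noteq> 0" for a b z l :: real using that by simp
    then show ?thesis unfolding mult_2[of L] power_add[of _ L L] power_add[of _ "N0 + Suc k"] power_add[of _ N0] by simp
  qed
  also have "\<dots> = 1 / 4"
  proof -
    have "L = (N0 + Suc k + (2 * k + 1)) + 2" using L by simp
    then have "(2::real) ^ L = 2 ^ (N0 + Suc k + (2 * k + 1)) * 4" by (simp only: power_add) simp
    then show ?thesis by simp
  qed
  finally show ?thesis .
qed

lemma avg_error_square:
  assumes "avg_error P U \<le> ennreal \<epsilon>" "0 \<le> \<epsilon>"
  shows "(\<integral>\<^sup>+f. sq_error P U f \<partial>meas P) \<le> ennreal (\<epsilon>\<^sup>2)"
proof (cases "(\<integral>\<^sup>+f. sq_error P U f \<partial>meas P) = \<infinity>")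
  case True
  then show ?thesis using assms by (simp add: avg_error_def top_unique)
next
  case False
  then obtain x where x: "(\<integral>\<^sup>+f. sq_error P U f \<partial>meas P) = ennreal x" "x \<ge> 0"
    by (metis ennreal_cases infinity_ennreal_def)
  then have "ennreal (sqrt x) \<le> ennreal \<epsilon>" using assms by (simp add: avg_error_def)
  then have "sqrt x \<le> \<epsilon>" using assms(2) by (simp add: ennreal_le_iff)
  then have "x \<le> \<epsilon>\<^sup>2" using x(2) by (metis real_sqrt_ge_zero real_sqrt_pow2 power_mono)
  then show ?thesis using x by (simp add: ennreal_leI)
qed

text \<open>Two events of probability at most one quarter are removed: high cost, by Markov's
  inequality, and closeness to an output space, by \<open>accurate_outputs\<close>. On the rest the
  squared error is at least \<open>\<tau>\<close>, of order \<open>M * \<sigma>\<^sup>2\<close>, and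
  \<open>M\<close> is at most a multiple of \<open>A\<close>.\<close>

lemma approximation_lower_bound:
  assumes sheet: "wiener_sheet d r \<mu>" and j0: "j0 \<in> {1..d}" and c: "c > 0"
    and \<kappa>: "information_cost (F_space d r) c \<kappa>"
    and P: "P = \<lparr>dimension = d, smoothness = r, meas = \<mu>, target = L2 d, solution = L2_class d, eval_cost = c, info_cost = \<kappa>\<rparr>"
  shows "\<exists>K>0. \<forall>\<Lambda> U A \<epsilon>. is_algorithm P \<Lambda> U \<longrightarrow> A \<ge> 1 \<longrightarrow> \<epsilon> \<ge> 0 \<longrightarrow> avg_cost P U \<le> ennreal A \<longrightarrow> avg_error P U \<le> ennreal \<epsilon>
    \<longrightarrow> K * (1 / A) ^ (2 * r j0 + 1) \<le> \<epsilon>\<^sup>2"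
proof -
  interpret wiener_sheet d r \<mu> by (rule sheet)
  define m where "m = r j0"
  obtain \<gamma> where \<gamma>: "\<gamma> > 0" and sys: "\<And>M. M > 0 \<Longrightarrow> \<exists>e B J c y. sheet_system d r \<mu> M (\<gamma> * (1 / real M) ^ (m + 1)) e B (J :: nat set) c y"
    using sheet_system_exists[OF assms(1) j0] unfolding m_def by blast
  \<comment> \<open>From \<open>T = 4 * A\<close> and \<open>1 \<le> A\<close>, the number
    \<open>L\<close> is at most \<open>4 * A / c + 12 * A + 4 * A\<close>; the factor 2 passes from
    \<open>L\<close> to \<open>M\<close>.\<close>
  define C where "C = 2 * (4 / c + 16)"
  have C: "C > 0" unfolding C_def using c by (simp add: add_pos_pos)
  define K where "K = \<gamma>\<^sup>2 / 12 * (1 / C) ^ (2 * m + 1)"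
  have K: "K > 0" unfolding K_def using \<gamma> C by simp
  have "K * (1 / A) ^ (2 * m + 1) \<le> \<epsilon>\<^sup>2"
    if U: "is_algorithm P \<Lambda> U" and A: "A \<ge> 1" and \<epsilon>: "\<epsilon> \<ge> 0" and cost: "avg_cost P U \<le> ennreal A"
      and err: "avg_error P U \<le> ennreal \<epsilon>" for \<Lambda> U A \<epsilon>
  proof -
    obtain N \<phi> prg where Ueq: "U = (N, \<phi>, prg)" by (cases U) auto
    \<comment> \<open>Four times the average, so that Markov's inequality leaves probability at most
      one quarter for a cost of \<open>T\<close> or more.\<close>
    define T where "T = 4 * A"
    define N0 where "N0 = nat \<lfloor>T / c\<rfloor>"
    define k where "k = nat \<lfloor>T\<rfloor>"
    define L where "L = N0 + 3 * k + 4"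
    define M where "M = 2 * L"
    have M: "M > 0" "real M = 2 * real L" by (auto simp: M_def L_def)
    have "T \<ge> 0" "T / c \<ge> 0" using A c by (auto simp: T_def)
    then have "real N0 \<le> T / c" "real k \<le> T" unfolding N0_def k_def by linarith+
    then have "real L \<le> T / c + 3 * T + 4 * A" unfolding L_def using A by simp
    also have "\<dots> = (4 / c + 16) * A" unfolding T_def by (simp add: algebra_simps)
    finally have "2 * real L \<le> 2 * ((4 / c + 16) * A)" by simp
    then have MA: "real M \<le> C * A" unfolding M C_def by (simp only: mult.assoc)
    define \<sigma> where "\<sigma> = \<gamma> * (1 / real M) ^ (m + 1)"
    have \<sigma>: "\<sigma> > 0" unfolding \<sigma>_def using \<gamma> M by simp
    \<comment> \<open>The 6 makes the exponent in \<open>small_ball\<close> equal to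
      \<open>L / 2\<close>, as \<open>union_bound_small\<close> expects.\<close>
    define \<tau> where "\<tau> = \<sigma>\<^sup>2 * real M / 6"
    have \<tau>: "\<tau> \<ge> 0" unfolding \<tau>_def by simp
    have exp_eq: "3 / (2 * \<sigma>\<^sup>2) * \<tau> = real L / 2" unfolding \<tau>_def M(2) using \<sigma> by simp
    obtain e B J w y where "sheet_system d r \<mu> M \<sigma> e B (J :: nat set) w y" using sys[OF M(1)] unfolding \<sigma>_def by blast
    then interpret sheet_system d r \<mu> M \<sigma> e B J w y .
    obtain E where E: "E \<in> sets \<mu>"
      and pE: "prob E \<le> real (Suc N0) * 2 ^ Suc k * (exp (3 / (2 * \<sigma>\<^sup>2) * \<tau>) * (1 / 2) ^ (M - (2 * k + 1)))"
      and near: "\<And>f ys v j. f \<in> F_space d r \<Longrightarrow> length ys \<le> N0 \<Longrightarrow> j \<le> k \<Longrightarrow> runs (L2 d) (prg (length ys)) ys [] v j \<Longrightarrow>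
        (hdist (L2 d) (L2_class d f) v)\<^sup>2 \<le> \<tau> \<Longrightarrow> f \<in> E"
      using accurate_outputs[of N0 k \<tau> prg] by blast
    have pE: "prob E \<le> 1 / 4"
      using pE union_bound_small[OF L_def] unfolding exp_eq M_def by (rule order_trans)
    have meas: "sq_error P U \<in> borel_measurable \<mu>" "total_cost P U \<in> borel_measurable \<mu>"
      using U unfolding Ueq by (auto simp: P)
    define X where "X = {f \<in> space \<mu>. ennreal T \<le> total_cost P U f}"
    have X: "X \<in> sets \<mu>" unfolding X_def using meas(2) by measurable
    have "ennreal T * emeasure \<mu> X \<le> ennreal A"
    proof -
      have "ennreal T * emeasure \<mu> X = (\<integral>\<^sup>+f. ennreal T * indicator X f \<partial>\<mu>)" using X by (simp add: nn_integral_cmult_indicator)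
      also have "\<dots> \<le> (\<integral>\<^sup>+f. total_cost P U f \<partial>\<mu>)" by (intro nn_integral_mono) (auto simp: X_def indicator_def)
      also have "\<dots> \<le> ennreal A" using cost unfolding avg_cost_def by (simp add: P)
      finally show ?thesis .
    qed
    then have "ennreal (T * prob X) \<le> ennreal A" using \<open>T \<ge> 0\<close> by (simp add: emeasure_eq_measure ennreal_mult)
    then have "T * prob X \<le> A" using A by (simp add: ennreal_le_iff)
    then have pX: "prob X \<le> 1 / 4" using A by (simp add: T_def)
    define Y where "Y = space \<mu> - (E \<union> X)"
    have Y: "Y \<in> sets \<mu>" unfolding Y_def using E X by auto
    have "prob (E \<union> X) \<le> 1 / 2" using measure_Un_le[OF E X] pE pX by linarith
    then have pY: "prob Y \<ge> 1 / 2" unfolding Y_def using prob_compl[of "E \<union> X"] E X by auto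
    have far: "ennreal \<tau> \<le> sq_error P U f" if f: "f \<in> Y" for f
    proof (rule ccontr)
      assume "\<not> ?thesis"
      then have "(hdist (L2 d) (L2_class d f) (\<phi> (info N f)))\<^sup>2 \<le> \<tau>"
        unfolding Ueq using \<tau> by (simp add: P ennreal_less_iff not_le)
      moreover have fF: "f \<in> F_space (dimension P) (smoothness P)" "f \<notin> X" "f \<notin> E" "f \<in> space \<mu>"
        using f by (auto simp: Y_def P space_sheet)
      then have "total_cost P (N, \<phi>, prg) f < ennreal T" unfolding X_def Ueq by (simp add: not_le)
      from cheap_output[OF U[unfolded Ueq] _ c fF(1) this]
      obtain j where "length (info N f) \<le> N0" "j \<le> k" "runs (L2 d) (prg (length (info N f))) (info N f) [] (\<phi> (info N f)) j"
        using \<kappa> unfolding N0_def k_def by (auto simp: P)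
      ultimately show False using near[of f "info N f" j "\<phi> (info N f)"] fF by (simp add: P)
    qed
    have "ennreal (\<tau> / 2) \<le> ennreal (\<tau> * prob Y)" using pY \<tau> mult_left_mono[OF pY \<tau>] by (intro ennreal_leI) simp
    also have "\<dots> = (\<integral>\<^sup>+f. ennreal \<tau> * indicator Y f \<partial>\<mu>)" using Y \<tau> by (simp add: nn_integral_cmult_indicator emeasure_eq_measure ennreal_mult)
    also have "\<dots> \<le> (\<integral>\<^sup>+f. sq_error P U f \<partial>\<mu>)" by (intro nn_integral_mono) (auto simp: indicator_def far)
    also have "\<dots> \<le> ennreal (\<epsilon>\<^sup>2)" using avg_error_square[OF err \<epsilon>] by (simp add: P)
    finally have \<tau>\<epsilon>: "\<tau> / 2 \<le> \<epsilon>\<^sup>2" by (simp add: ennreal_le_iff)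
    have "(1 / (C * A)) ^ (2 * m + 1) \<le> (1 / real M) ^ (2 * m + 1)"
      using MA M C A by (intro power_mono divide_left_mono) auto
    then have "\<gamma>\<^sup>2 / 12 * (1 / (C * A)) ^ (2 * m + 1) \<le> \<gamma>\<^sup>2 / 12 * (1 / real M) ^ (2 * m + 1)"
      by (rule mult_left_mono) simp
    also have "\<dots> = \<tau> / 2"
    proof -
      have "((1 / real M) ^ (m + 1))\<^sup>2 = (1 / real M) ^ (2 * m + 1) * (1 / real M)"
        unfolding power_mult[symmetric] power_Suc2[symmetric] by (rule arg_cong[where f="power (1 / real M)"]) simp
      then show ?thesis unfolding \<tau>_def \<sigma>_def power_mult_distrib using M by simp
    qed
    finally have "\<gamma>\<^sup>2 / 12 * (1 / (C * A)) ^ (2 * m + 1) \<le> \<tau> / 2" .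
    moreover have "K * (1 / A) ^ (2 * m + 1) = \<gamma>\<^sup>2 / 12 * (1 / (C * A)) ^ (2 * m + 1)"
      unfolding K_def mult.assoc power_mult_distrib[symmetric] by simp
    ultimately show ?thesis using \<tau>\<epsilon> by linarith
  qed
  then show ?thesis using K unfolding m_def by blast
qed

text \<open>With \<open>A\<close> of order \<open>\<epsilon> powr (- p)\<close> the lower bound
  bounds \<open>K\<close> by a multiple of \<open>\<epsilon> powr (2 - p * (2 * r j0 + 1))\<close>.
  A positive exponent would send this to 0.\<close>

lemma exponent_lower_bound:
  assumes sheet: "wiener_sheet d r \<mu>" and j0: "j0 \<in> {1..d}" and c: "c > 0"
    and \<kappa>: "information_cost (F_space d r) c \<kappa>"
    and P: "P = \<lparr>dimension = d, smoothness = r, meas = \<mu>, target = L2 d, solution = L2_class d, eval_cost = c, info_cost = \<kappa>\<rparr>"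
    and p: "p \<ge> 0" and comp: "\<forall>\<^sub>F \<epsilon> in at_right 0. comp_avg P \<Lambda> \<epsilon> \<le> ennreal (C * \<epsilon> powr (- p))"
  shows "2 \<le> p * real (2 * r j0 + 1)"
proof (rule ccontr)
  let ?n = "2 * r j0 + 1"
  assume "\<not> ?thesis"
  then have s: "0 < 2 - p * real ?n" by linarith
  obtain K where K: "K > 0" and lower: "\<And>U A \<epsilon>. is_algorithm P \<Lambda> U \<Longrightarrow> A \<ge> 1 \<Longrightarrow> \<epsilon> \<ge> 0 \<Longrightarrow> avg_cost P U \<le> ennreal A
      \<Longrightarrow> avg_error P U \<le> ennreal \<epsilon> \<Longrightarrow> K * (1 / A) ^ ?n \<le> \<epsilon>\<^sup>2"
    using approximation_lower_bound[OF sheet j0 c \<kappa> P] by blast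
  \<comment> \<open>The maximum makes the constant nonnegative whatever the sign of
    \<open>C\<close>. The added 1 gives \<open>A \<ge> 1\<close> and strict room above the infimum,
    so that some algorithm has cost below \<open>A\<close>.\<close>
  define C' where "C' = max C 0 + 1"
  have C': "C' \<ge> 1" "C \<le> C' - 1" by (auto simp: C'_def)
  have "\<forall>\<^sub>F \<epsilon> in at_right 0. \<epsilon> powr (2 - p * real ?n) < K / C' ^ ?n"
  proof (rule order_tendstoD(2))
    show "((\<lambda>\<epsilon>. \<epsilon> powr (2 - p * real ?n)) \<longlongrightarrow> 0) (at_right 0)"
      by (rule tendsto_zero_powrI[OF tendsto_ident_at tendsto_const eventually_mono[OF eventually_at_right_less] s]) simp
    show "0 < K / C' ^ ?n" using K C' by simp
  qed
  moreover have "\<forall>\<^sub>F \<epsilon>::real in at_right 0. \<epsilon> \<in> {0<..<1}" by (rule eventually_at_right_real) simp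
  ultimately have "\<forall>\<^sub>F \<epsilon>::real in at_right 0. False"
    using comp
  proof eventually_elim
    case (elim \<epsilon>)
    then have \<epsilon>: "0 < \<epsilon>" "\<epsilon> < 1" by auto
    define A where "A = C' * \<epsilon> powr (- p)"
    have "\<epsilon> powr p \<le> 1" using \<epsilon> p by (intro powr_le1) auto
    then have e1: "1 \<le> \<epsilon> powr (- p)" using \<epsilon> by (simp add: powr_minus one_le_inverse_iff)
    then have "C * \<epsilon> powr (- p) + \<epsilon> powr (- p) \<le> A"
      unfolding A_def using mult_right_mono[OF C'(2), of "\<epsilon> powr (- p)"] by (simp add: algebra_simps)
    then have lt: "C * \<epsilon> powr (- p) < A" using e1 by linarith
    have A1: "A \<ge> 1" unfolding A_def using mult_mono[OF C'(1) e1] C' by simp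
    have "comp_avg P \<Lambda> \<epsilon> < ennreal A"
      by (rule le_less_trans[OF elim(3) ennreal_lessI]) (use lt A1 in auto)
    then obtain U where U: "is_algorithm P \<Lambda> U" "avg_error P U \<le> ennreal \<epsilon>" "avg_cost P U < ennreal A"
      unfolding comp_avg_def INF_less_iff by auto
    have "K * (1 / A) ^ ?n \<le> \<epsilon>\<^sup>2" by (rule lower[OF U(1) A1 _ _ U(2)]) (use U(3) \<epsilon> in auto)
    then have "K \<le> \<epsilon>\<^sup>2 * A ^ ?n" using A1 by (simp add: power_divide divide_le_eq)
    also have "\<dots> = C' ^ ?n * \<epsilon> powr (2 - p * real ?n)"
    proof -
      have "(\<epsilon> powr (- p)) ^ ?n = \<epsilon> powr (- p * real ?n)" using \<epsilon> by (simp add: powr_powr powr_realpow[symmetric] del: power_Suc)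
      moreover have "\<epsilon>\<^sup>2 = \<epsilon> powr 2" using \<epsilon> by simp
      moreover have "\<epsilon> powr (2 - p * real ?n) = \<epsilon> powr 2 * \<epsilon> powr (- p * real ?n)"
        unfolding powr_add[symmetric] by simp
      ultimately show ?thesis unfolding A_def power_mult_distrib by (simp only: mult_ac)
    qed
    finally show False using elim(1) C' by (simp add: less_divide_eq mult.commute)
  qed
  then show False by simp
qed

section \<open>Upper bound and the two kinds of problems\<close>

lemma avg_error_leI:
  assumes "(\<integral>\<^sup>+f. sq_error P U f \<partial>meas P) \<le> ennreal (\<epsilon>\<^sup>2)" "0 \<le> \<epsilon>"
  shows "avg_error P U \<le> ennreal \<epsilon>"
proof -
  obtain x where x: "(\<integral>\<^sup>+f. sq_error P U f \<partial>meas P) = ennreal x" "x \<ge> 0"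
    using assms(1) by (metis ennreal_cases ennreal_neq_top top_unique)
  then have "x \<le> \<epsilon>\<^sup>2" using assms(1) by (simp add: ennreal_le_iff)
  then have "sqrt x \<le> \<epsilon>" using assms(2) real_le_lsqrt x(2) by blast
  then show ?thesis using x by (simp add: avg_error_def ennreal_leI)
qed

text \<open>Point values are continuous functionals, so one sampling algorithm serves both
  classes.\<close>

lemma Std_algorithm_All: "is_algorithm P Std U \<Longrightarrow> is_algorithm P \<Lambda> U"
proof (cases \<Lambda>; cases U)
  fix N \<phi> prg
  assume U: "is_algorithm P Std U" "\<Lambda> = All" "U = (N, \<phi>, prg)"
  have "next_fun N ys \<in> F_dual (dimension P) (smoothness P)" for ys
  proof -
    obtain x where "x \<in> cube (dimension P)" "next_fun N ys = (\<lambda>f. f x)" using U by auto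
    then show ?thesis using eval_in_F_dual by simp
  qed
  then show "is_algorithm P \<Lambda> U" using U by simp
qed simp

text \<open>The sparse grid of the level supplied by \<open>level_choice\<close>, with
  \<open>K * sqrt C\<close> as the constant of the error and \<open>(c + 2) * C\<close> as that of
  the cost: each value costs \<open>c\<close> and at most two operations.\<close>

lemma (in bounded_problem) complexity_upper_bound:
  fixes \<kappa> :: "information \<Rightarrow> func \<Rightarrow> real"
  assumes m: "\<And>j. j \<in> {1..d} \<Longrightarrow> m \<le> r j" and p: "p > inverse (1 / 2 + real m)"
    and c: "c > 0" and \<kappa>: "information_cost (F_space d r) c \<kappa>"
    and P: "P = \<lparr>dimension = d, smoothness = r, meas = \<mu>, target = H, solution = S,
      eval_cost = c, info_cost = \<kappa>\<rparr>"
  shows "\<exists>C. \<forall>\<^sub>F \<epsilon> in at_right 0. comp_avg P \<Lambda> \<epsilon> \<le> ennreal (C * c * \<epsilon> powr (- p))"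
proof -
  obtain C where C: "C > 0" and grid: "\<And>q::nat. \<exists>n t b. real n \<le> C * real (q + 2) ^ d * 2 ^ q \<and> (\<forall>i. t i \<in> cube d) \<and>
      (\<forall>i<n. b i \<in> F_space d r) \<and>
      sampling_error d r n t b \<le> ennreal (C * (real (q + 2) ^ d)\<^sup>2 * (1 / 2 ^ q) ^ (2 * m + 1))"
    using sparse_grid[where m=m and d=d and r=r] m by blast
  define \<alpha> where "\<alpha> = 1 / 2 + real m"
  define A where "A = K * sqrt C"
  have \<alpha>: "\<alpha> > 0" "p > 1 / \<alpha>" "A \<ge> 0" "(c + 2) * C \<ge> 0"
    using p c C K by (auto simp: \<alpha>_def A_def inverse_eq_divide)
  obtain D where D: "\<And>\<epsilon>. 0 < \<epsilon> \<Longrightarrow> \<epsilon> < 1 \<Longrightarrow> \<exists>q::nat. A * real (q + 2) ^ d * 2 powr (- \<alpha> * real q) \<le> \<epsilon> \<and>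
      (c + 2) * C * real (q + 2) ^ d * 2 ^ q \<le> D * \<epsilon> powr (- p)"
    by (rule level_choice[OF \<alpha>, of d]) (rule that)
  \<comment> \<open>Tractability asks for a multiple of the evaluation cost. The constant may depend
    on the dimension and hence on \<open>c\<close>, so dividing by \<open>c\<close> puts the bound
    into this form.\<close>
  have "comp_avg P \<Lambda> \<epsilon> \<le> ennreal (D / c * c * \<epsilon> powr (- p))" if \<epsilon>: "0 < \<epsilon>" "\<epsilon> < 1" for \<epsilon>
  proof -
    obtain q :: nat where q: "A * real (q + 2) ^ d * 2 powr (- \<alpha> * real q) \<le> \<epsilon>"
      "(c + 2) * C * real (q + 2) ^ d * 2 ^ q \<le> D * \<epsilon> powr (- p)" using D[OF \<epsilon>] by blast
    obtain n t b where n: "real n \<le> C * real (q + 2) ^ d * 2 ^ q" and t: "\<And>i. t i \<in> cube d"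
      and b: "\<And>i. i < n \<Longrightarrow> b i \<in> F_space d r"
      and s: "sampling_error d r n t b \<le> ennreal (C * (real (q + 2) ^ d)\<^sup>2 * (1 / 2 ^ q) ^ (2 * m + 1))"
      using grid[of q] by blast
    obtain U where U: "is_algorithm P Std U" "avg_cost P U \<le> ennreal ((c + 2) * real n)"
      "(\<integral>\<^sup>+f. sq_error P U f \<partial>\<mu>) \<le> ennreal (K\<^sup>2) * sampling_error d r n t b"
      by (rule linear_algorithm[OF t b c \<kappa> P])
    have two: "(2 powr (- \<alpha> * real q))\<^sup>2 = (1 / 2 ^ q) ^ (2 * m + 1)"
    proof -
      have "(2 powr (- \<alpha> * real q))\<^sup>2 = 2 powr (- \<alpha> * real q * 2)"
        by (simp add: powr_realpow[symmetric] powr_powr del: powr_numeral)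
      also have "- \<alpha> * real q * 2 = - real (q * (2 * m + 1))" by (simp add: \<alpha>_def algebra_simps)
      also have "2 powr (- real (q * (2 * m + 1))) = (1 / 2 ^ q) ^ (2 * m + 1)"
        unfolding powr_minus powr_realpow[OF zero_less_numeral] power_mult power_one_over by (simp add: inverse_eq_divide)
      finally show ?thesis .
    qed
    have "(\<integral>\<^sup>+f. sq_error P U f \<partial>meas P) \<le> ennreal (K\<^sup>2) * ennreal (C * (real (q + 2) ^ d)\<^sup>2 * (1 / 2 ^ q) ^ (2 * m + 1))"
      using U(3) mult_left_mono[OF s, of "ennreal (K\<^sup>2)"] by (simp add: P)
    also have "\<dots> = ennreal ((A * real (q + 2) ^ d * 2 powr (- \<alpha> * real q))\<^sup>2)"
      unfolding power_mult_distrib two A_def using C by (simp add: ennreal_mult[symmetric] mult.assoc)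
    also have "\<dots> \<le> ennreal (\<epsilon>\<^sup>2)"
      by (intro ennreal_leI power_mono q mult_nonneg_nonneg) (use \<alpha> in auto)
    finally have "avg_error P U \<le> ennreal \<epsilon>" by (rule avg_error_leI) (use \<epsilon> in simp)
    then have "comp_avg P \<Lambda> \<epsilon> \<le> avg_cost P U"
      unfolding comp_avg_def by (intro INF_lower) (use Std_algorithm_All[OF U(1)] in simp)
    also have "\<dots> \<le> ennreal ((c + 2) * real n)" by (rule U(2))
    also have "\<dots> \<le> ennreal (D / c * c * \<epsilon> powr (- p))"
    proof (rule ennreal_leI)
      have "(c + 2) * real n \<le> (c + 2) * (C * real (q + 2) ^ d * 2 ^ q)" by (rule mult_left_mono[OF n]) (use c in simp)
      also have "\<dots> \<le> D * \<epsilon> powr (- p)" using q(2) by (simp only: mult.assoc)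
      finally show "(c + 2) * real n \<le> D / c * c * \<epsilon> powr (- p)" using c by simp
    qed
    finally show ?thesis .
  qed
  moreover have "\<forall>\<^sub>F \<epsilon>::real in at_right 0. 0 < \<epsilon> \<and> \<epsilon> < 1"
    using eventually_at_right_real[of 0 "1::real"] by simp
  ultimately show ?thesis by (intro exI[of _ "D / c"]) (auto elim: eventually_mono)
qed

lemma L2_bounded_problem:
  assumes "wiener_sheet d r \<mu>"
  shows "bounded_problem d r \<mu> (L2 d) (L2_class d) 1"
  unfolding bounded_problem_def bounded_problem_axioms_def
proof (intro conjI allI impI assms)
  fix f g assume f: "f \<in> F_space d r" and g: "g \<in> F_space d r"
  note f' = F_space_L2[OF f] and g' = F_space_L2[OF g]
  have lin: "(\<lambda>x. f x + c * g x) \<in> L2_funs d" for c using L2_funs_linear[OF g' f'] by (simp add: add.commute)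
  have sq: "(\<integral>x. (f x + c * g x)\<^sup>2 \<partial>cube_measure d)
      = (\<integral>x. f x * f x \<partial>cube_measure d) + 2 * c * (\<integral>x. f x * g x \<partial>cube_measure d) + c\<^sup>2 * (\<integral>x. g x * g x \<partial>cube_measure d)" for c
  proof -
    have "(f x + c * g x)\<^sup>2 = f x * f x + 2 * c * (f x * g x) + c\<^sup>2 * (g x * g x)" for x
      by (simp add: power2_eq_square algebra_simps)
    then show ?thesis using L2_product_integrable[OF f' f'] L2_product_integrable[OF f' g'] L2_product_integrable[OF g' g'] by simp
  qed
  have "0 \<le> (\<integral>x. (f x + c * g x)\<^sup>2 \<partial>cube_measure d)" for c by simp
  then have "sqrt ((\<integral>x. f x * f x \<partial>cube_measure d) + 2 * (\<integral>x. f x * g x \<partial>cube_measure d) + (\<integral>x. g x * g x \<partial>cube_measure d))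
      \<le> sqrt (\<integral>x. f x * f x \<partial>cube_measure d) + sqrt (\<integral>x. g x * g x \<partial>cube_measure d)"
    unfolding sq by (intro semi_inner_triangle[where B="\<lambda>f g. \<integral>x. f x * g x \<partial>cube_measure d"]) auto
  then show "hnorm (L2 d) (L2_class d (\<lambda>x. f x + g x)) \<le> hnorm (L2 d) (L2_class d f) + hnorm (L2 d) (L2_class d g)"
    using lin[of 1] sq[of 1] by (simp add: L2_hnorm f' g' power2_eq_square)
qed (auto simp: L2_hnorm F_space_L2 L2_carrier L2_hadd L2_hscale)

lemma (in separable_hilbert_space) hnorm_triangle:
  assumes u: "u \<in> hcarrier H" and v: "v \<in> hcarrier H"
  shows "hnorm H (hadd H u v) \<le> hnorm H u + hnorm H v"
proof -
  have sq: "hinner H (hadd H u (hscale H a v)) (hadd H u (hscale H a v))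
      = hinner H u u + 2 * a * hinner H u v + a\<^sup>2 * hinner H v v" for a
  proof -
    let ?w = "hscale H a v" and ?s = "hadd H u (hscale H a v)"
    note w = scale_closed[OF v, of a]
    note s = add_closed[OF u w]
    have "hinner H u ?s = hinner H u u + a * hinner H u v"
      using inner_commute[OF u s] inner_add[OF u w u] inner_scale[OF v u, of a] inner_commute[OF v u] by simp
    moreover have "hinner H v ?s = hinner H u v + a * hinner H v v"
      using inner_commute[OF v s] inner_add[OF u w v] inner_scale[OF v v, of a] by simp
    ultimately show ?thesis
      using inner_add[OF u w s] inner_scale[OF v s, of a] by (simp add: power2_eq_square algebra_simps)
  qed
  have "0 \<le> hinner H u u + 2 * a * hinner H u v + a\<^sup>2 * hinner H v v" for a
    using inner_nonneg[OF add_closed[OF u scale_closed[OF v, of a]]] unfolding sq .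
  from semi_inner_triangle[OF this inner_nonneg[OF v]] show ?thesis
    using sq[of 1] unfolding hnorm_def scale_one[OF v] by simp
qed

text \<open>The given bound does not fix the sign of its constant; the absolute value provides the
  nonnegative one of the locale.\<close>

lemma hilbert_bounded_problem:
  assumes "wiener_sheet d r \<mu>" "separable_hilbert_space G" "continuous_linear_op d r G S"
    and K: "\<And>f. f \<in> F_space d r \<Longrightarrow> hnorm G (S f) \<le> K * hnorm (L2 d) (L2_class d f)"
  shows "bounded_problem d r \<mu> G S \<bar>K\<bar>"
proof -
  interpret G: separable_hilbert_space G by fact
  have S: "\<And>f. f \<in> F_space d r \<Longrightarrow> S f \<in> hcarrier G"
    "\<And>f g. f \<in> F_space d r \<Longrightarrow> g \<in> F_space d r \<Longrightarrow> S (\<lambda>x. f x + g x) = hadd G (S f) (S g)"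
    "\<And>f a. f \<in> F_space d r \<Longrightarrow> S (\<lambda>x. a * f x) = hscale G a (S f)"
    using assms(3) unfolding continuous_linear_op_def by auto
  show ?thesis unfolding bounded_problem_def bounded_problem_axioms_def
  proof (intro conjI allI impI assms)
    fix f assume f: "f \<in> F_space d r"
    show "0 \<le> hnorm G (S f)" unfolding hnorm_def using G.inner_nonneg[OF S(1)[OF f]] by simp
    have "hnorm G (S f) \<le> K * sqrt (\<integral>x. (f x)\<^sup>2 \<partial>cube_measure d)"
      using K[OF f] by (simp add: L2_hnorm F_space_L2[OF f])
    also have "\<dots> \<le> \<bar>K\<bar> * sqrt (\<integral>x. (f x)\<^sup>2 \<partial>cube_measure d)" by (intro mult_right_mono) auto
    finally show "hnorm G (S f) \<le> \<bar>K\<bar> * sqrt (\<integral>x. (f x)\<^sup>2 \<partial>cube_measure d)" .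
  qed (auto simp: S G.hnorm_triangle)
qed

theorem mainTheorem3:
  fixes r :: "nat \<Rightarrow> nat \<Rightarrow> nat" and \<mu> :: "nat \<Rightarrow> func measure" and c :: "nat \<Rightarrow> real"
    and \<kappa> :: "nat \<Rightarrow> information \<Rightarrow> func \<Rightarrow> real"
  assumes "\<And>d. d \<ge> 1 \<Longrightarrow> folded_wiener_sheet d (r d) (\<mu> d)"
    and "\<And>d. d \<ge> 1 \<Longrightarrow> c d > 0"
    and "\<And>d. d \<ge> 1 \<Longrightarrow> information_cost (F_space d (r d)) (c d) (\<kappa> d)"
  shows "tractable (APP r \<mu> c \<kappa>) Std \<and>
    exponent (APP r \<mu> c \<kappa>) All = exponent (APP r \<mu> c \<kappa>) Std \<and>
    exponent (APP r \<mu> c \<kappa>) Std = inverse (1/2 + real (LEAST m. \<exists>d\<ge>1. \<exists>j\<in>{1..d}. m = r d j)) \<and>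
    exponent (APP r \<mu> c \<kappa>) Std \<le> 2 \<and>
    (\<forall>(G :: nat \<Rightarrow> 'g hilbert) S.
       (\<forall>d\<ge>1. separable_hilbert_space (G d) \<and> continuous_linear_op d (r d) (G d) (S d) \<and>
          (\<exists>K1. \<forall>f\<in>F_space d (r d). hnorm (G d) (S d f) \<le> K1 * hnorm (L2 d) (L2_class d f))) \<longrightarrow>
       (\<forall>\<Lambda>. tractable (LMP r \<mu> c \<kappa> G S) \<Lambda> \<and>
          exponent (LMP r \<mu> c \<kappa> G S) \<Lambda> \<le> exponent (APP r \<mu> c \<kappa>) Std))"
proof -
  define m where "m = (LEAST m. \<exists>d\<ge>1. \<exists>j\<in>{1..d}. m = r d j)"
  define p0 where "p0 = inverse (1/2 + real m)"
  have sheet: "wiener_sheet d (r d) (\<mu> d)" if "d \<ge> 1" for d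
    using assms(1)[OF that] by (rule wiener_sheet.intro)
  have "\<exists>d\<ge>1. \<exists>j\<in>{1..d}. m = r d j" unfolding m_def
    by (rule LeastI[where k="r 1 1"]) (auto intro!: exI[of _ "1::nat"])
  \<comment> \<open>The minimum of the smoothness parameters is attained; the lower bound is taken
    in this dimension and coordinate.\<close>
  then obtain d0 j0 where d0: "d0 \<ge> 1" "j0 \<in> {1..d0}" "m = r d0 j0" by blast
  have m: "m \<le> r d j" if "d \<ge> 1" "j \<in> {1..d}" for d j
    unfolding m_def by (rule Least_le) (use that in blast)
  have p0: "0 < p0" "p0 \<le> 2" unfolding p0_def by (simp_all add: inverse_eq_divide divide_le_eq add_pos_nonneg)
  \<comment> \<open>The inequality \<open>p0 < p\<close> is strict because the powers of
    \<open>q\<close> consume part of the gap. The type \<open>'h\<close> is generalized, so the fact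
    applies to \<open>func set\<close> for approximation and to \<open>'g\<close> for a general
    problem.\<close>
  have upper: "tractable_with (LMP r \<mu> c \<kappa> G S) \<Lambda> p"
    if bp: "\<And>d. d \<ge> 1 \<Longrightarrow> \<exists>K. bounded_problem d (r d) (\<mu> d) (G d) (S d) K" and p: "p0 < p"
    for G :: "nat \<Rightarrow> 'h hilbert" and S \<Lambda> p
    unfolding tractable_with_def
  proof (intro conjI allI impI)
    show "0 \<le> p" using p p0 by simp
    fix d :: nat assume d: "d \<ge> 1"
    obtain K where "bounded_problem d (r d) (\<mu> d) (G d) (S d) K" using bp[OF d] by blast
    from bounded_problem.complexity_upper_bound[OF this m[OF d] p[unfolded p0_def] assms(2)[OF d] assms(3)[OF d] refl]
    show "\<exists>C. \<forall>\<^sub>F \<epsilon> in at_right 0. comp_avg (LMP r \<mu> c \<kappa> G S d) \<Lambda> \<epsilon>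
        \<le> ennreal (C * eval_cost (LMP r \<mu> c \<kappa> G S d) * \<epsilon> powr - p)"
      by (simp add: LMP_def)
  qed
  have exponent_le: "tractable (LMP r \<mu> c \<kappa> G S) \<Lambda> \<and> exponent (LMP r \<mu> c \<kappa> G S) \<Lambda> \<le> p0"
    if tr: "\<And>p. p0 < p \<Longrightarrow> tractable_with (LMP r \<mu> c \<kappa> G S) \<Lambda> p"
    for G :: "nat \<Rightarrow> 'h hilbert" and S \<Lambda>
  proof
    show "tractable (LMP r \<mu> c \<kappa> G S) \<Lambda>" unfolding tractable_def using tr[of "p0 + 1"] by auto
    have "bdd_below {p. tractable_with (LMP r \<mu> c \<kappa> G S) \<Lambda> p}"
      by (rule bdd_belowI[of _ 0]) (simp add: tractable_with_def)
    then have "exponent (LMP r \<mu> c \<kappa> G S) \<Lambda> \<le> p" if "p0 < p" for p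
      unfolding exponent_def using tr[OF that] by (intro cInf_lower) auto
    then show "exponent (LMP r \<mu> c \<kappa> G S) \<Lambda> \<le> p0" by (rule dense_ge)
  qed
  have app: "tractable_with (APP r \<mu> c \<kappa>) \<Lambda> p" if "p0 < p" for \<Lambda> p
    unfolding APP_def
  proof (rule upper[OF _ that])
    fix d :: nat assume "d \<ge> 1"
    from L2_bounded_problem[OF sheet[OF this]]
    show "\<exists>K. bounded_problem d (r d) (\<mu> d) (L2 d) (L2_class d) K" by blast
  qed
  \<comment> \<open>A single dimension decides, since tractability with \<open>p\<close> is demanded
    in all of them; \<open>\<Lambda>\<close> is arbitrary, so both classes obtain the same
    bound.\<close>
  have lower: "p0 \<le> p" if p: "tractable_with (APP r \<mu> c \<kappa>) \<Lambda> p" for \<Lambda> p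
  proof -
    obtain C where C: "\<forall>\<^sub>F \<epsilon> in at_right 0. comp_avg (APP r \<mu> c \<kappa> d0) \<Lambda> \<epsilon> \<le> ennreal (C * c d0 * \<epsilon> powr - p)"
      using p d0(1) unfolding tractable_with_def by (auto simp: APP_def LMP_def)
    have "2 \<le> p * real (2 * r d0 j0 + 1)"
      by (rule exponent_lower_bound[OF sheet[OF d0(1)] d0(2) assms(2)[OF d0(1)] assms(3)[OF d0(1)] _ _ C])
        (use p in \<open>simp_all add: APP_def LMP_def tractable_with_def\<close>)
    then have "1 \<le> p * (1/2 + real m)" unfolding d0(3) by (simp add: algebra_simps)
    then show "p0 \<le> p" unfolding p0_def by (simp add: inverse_eq_divide pos_divide_le_eq add_pos_nonneg)
  qed
  have exp_app: "exponent (APP r \<mu> c \<kappa>) \<Lambda> = p0" for \<Lambda>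
  proof (rule antisym)
    show "exponent (APP r \<mu> c \<kappa>) \<Lambda> \<le> p0" using exponent_le[of L2 L2_class \<Lambda>] app unfolding APP_def by blast
    show "p0 \<le> exponent (APP r \<mu> c \<kappa>) \<Lambda>"
      unfolding exponent_def using app[of "p0 + 1" \<Lambda>] lower by (intro cInf_greatest) auto
  qed
  show ?thesis
  proof (intro conjI allI impI)
    show "tractable (APP r \<mu> c \<kappa>) Std" using app[of "p0 + 1" Std] unfolding tractable_def by auto
    show "exponent (APP r \<mu> c \<kappa>) All = exponent (APP r \<mu> c \<kappa>) Std" by (simp add: exp_app)
    show "exponent (APP r \<mu> c \<kappa>) Std = inverse (1/2 + real (LEAST m. \<exists>d\<ge>1. \<exists>j\<in>{1..d}. m = r d j))"
      unfolding exp_app p0_def m_def ..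
    show "exponent (APP r \<mu> c \<kappa>) Std \<le> 2" using p0 by (simp add: exp_app)
    fix G :: "nat \<Rightarrow> 'g hilbert" and S \<Lambda>
    assume G: "\<forall>d\<ge>1. separable_hilbert_space (G d) \<and> continuous_linear_op d (r d) (G d) (S d) \<and>
      (\<exists>K1. \<forall>f\<in>F_space d (r d). hnorm (G d) (S d f) \<le> K1 * hnorm (L2 d) (L2_class d f))"
    have "\<exists>K. bounded_problem d (r d) (\<mu> d) (G d) (S d) K" if "d \<ge> 1" for d
      using hilbert_bounded_problem[OF sheet[OF that]] G that by blast
    from exponent_le[OF upper[OF this]]
    show "tractable (LMP r \<mu> c \<kappa> G S) \<Lambda>" "exponent (LMP r \<mu> c \<kappa> G S) \<Lambda> \<le> exponent (APP r \<mu> c \<kappa>) Std"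
      unfolding exp_app by blast+
  qed
qed

end
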